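(* Let $s\in(0,1)$, $\gamma\in(1,2)$, $T>0$, and assume that $g\in\mathbb{H}^s(\Omega)$, $h\in L^2(\Omega)$ and $f\in H^2(0,T;\mathbb{H}^{-s}(\Omega))$. Then the solution $\mathscr{U}$ to the extended problem $$\begin{cases}-\mathrm{div}(y^\alpha\mathbf{A}\nabla\mathscr{U})+y^\alpha c\,\mathscr{U}=0\ \text{ in }\mathcal{C}\times(0,T),\qquad \mathscr{U}=0\ \text{ on }\partial_L\mathcal{C}\times(0,T),\\ d_s\partial_t^\gamma\mathscr{U}+\partial_\nu^\alpha\mathscr{U}=d_sf\ \text{ on }(\Omega\times\{0\})\times(0,T),\\ \mathscr{U}=g,\quad\partial_t\mathscr{U}=h\ \text{ on }\Omega\times\{0\},\ t=0,\end{cases}$$ satisfies $$\|t^{\rho/2}\,\mathrm{tr}_\Omega\,\partial_t^3\mathscr{U}\|_{L^2(0,T;\mathbb{H}^{-s}(\Omega))}\le C\left(\|g\|_{\mathbb{H}^s(\Omega)}+\|h\|_{L^2(\Omega)}+\|f\|_{H^2(0,T;\mathbb{H}^{-s}(\Omega))}\right),$$ where $\rho>5-2\gamma$. The constant $C$ is independent of $t$ and of the problem data $f,g,h$, but blows up as $\gamma\downarrow1$.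
   Context: $\Omega\subset\mathbb{R}^n$ ($n\ge1$) is open, bounded and convex. $\mathcal{L}w=-\mathrm{div}(A\nabla w)+cw$ with homogeneous Dirichlet boundary conditions, where $0\le c\in L^\infty(\Omega)$ and $A$ is a Lipschitz ($C^{0,1}$), symmetric, uniformly positive definite matrix field on $\Omega$. $\{(\lambda_k,\varphi_k)\}_{k\ge1}\subset\mathbb{R}_+\times H_0^1(\Omega)$ are the eigenpairs of $\mathcal{L}$, with $\{\varphi_k\}$ an orthonormal basis of $L^2(\Omega)$. For $r\ge0$, $\mathbb{H}^r(\Omega)=\{w=\sum_kw_k\varphi_k:\|w\|_{\mathbb{H}^r(\Omega)}^2=\sum_k\lambda_k^r|w_k|^2<\infty\}$; $\mathbb{H}^{-r}(\Omega)$ is its dual, identified with formal series $\sum_kw_k\varphi_k$, $w_k=\langle w,\varphi_k\rangle$, with norm squared $\sum_k\lambda_k^{-r}|w_k|^2$. $\partial_t^\gamma$ is the left-sided Caputo derivative, $\partial_t^\gamma u(t)=\frac1{\Gamma(2-\gamma)}\int_0^t(t-r)^{1-\gamma}\frac{d^2u(r)}{dr^2}\,dr$. Extension notation: $\mathcal{C}=\Omega\times(0,\infty)$ with points $(x',y)$; $\partial_L\mathcal{C}=\partial\Omega\times[0,\infty)$; $\alpha=1-2s$; $d_s=2^\alpha\Gamma(1-s)/\Gamma(s)$; $\mathbf{A}=\mathrm{diag}\{A,1\}$; $\partial_\nu^\alpha\mathscr{U}=-\lim_{y\downarrow0}y^\alpha\mathscr{U}_y$; $\mathrm{tr}_\Omega$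 is the trace onto $\Omega\times\{0\}$. The solution is $\mathscr{U}(x',y,t)=\sum_{k\ge1}u_k(t)\varphi_k(x')\psi_k(y)$. Here, with $E_{\gamma,\mu}(z)=\sum_{j\ge0}\frac{z^j}{\Gamma(\gamma j+\mu)}$ and $g_k,h_k,f_k(t)$ the coefficients of $g,h,f(\cdot,t)$ with respect to $\varphi_k$, $$u_k(t)=E_{\gamma,1}(-\lambda_k^st^\gamma)g_k+tE_{\gamma,2}(-\lambda_k^st^\gamma)h_k+\int_0^t(t-r)^{\gamma-1}E_{\gamma,\gamma}(-\lambda_k^s(t-r)^\gamma)f_k(r)\,dr,$$ and $\psi_k$ solves $\psi_k''+\frac\alpha y\psi_k'=\lambda_k\psi_k$ on $(0,\infty)$, $\psi_k(0)=1$, $\lim_{y\to\infty}\psi_k(y)=0$. In particular $\mathrm{tr}_\Omega\mathscr{U}=\sum_ku_k\varphi_k$. *)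

theory Defs
  imports "HOL-Analysis.Analysis"
begin

section \<open>Test functions and function spaces on a set\<close>

text \<open>Continuous differentiability of order \<open>m\<close> on the whole space, by iterated partial
  derivatives; test functions are extended by zero outside the open set in question.\<close>

primrec Ck :: "nat \<Rightarrow> ('a::euclidean_space \<Rightarrow> real) \<Rightarrow> bool" where
  "Ck 0 f \<longleftrightarrow> continuous_on UNIV f"
| "Ck (Suc m) f \<longleftrightarrow> f differentiable_on UNIV \<and>
     (\<forall>b\<in>Basis. Ck m (\<lambda>x. frechet_derivative f (at x) b))"

definition test_functions :: "'a::euclidean_space set \<Rightarrow> ('a \<Rightarrow> real) set" where
  "test_functions S = {\<eta>. (\<forall>m. Ck m \<eta>) \<and>
     compact (closure {x. \<eta> x \<noteq> 0}) \<and> closure {x. \<eta> x \<noteq> 0} \<subseteq> S}"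

definition L2 :: "'a::euclidean_space set \<Rightarrow> ('a \<Rightarrow> 'b::euclidean_space) set" where
  "L2 S = {w. w \<in> borel_measurable (lebesgue_on S) \<and>
     integrable (lebesgue_on S) (\<lambda>x. (norm (w x))\<^sup>2)}"

definition L2_norm :: "'a::euclidean_space set \<Rightarrow> ('a \<Rightarrow> 'b::euclidean_space) \<Rightarrow> real" where
  "L2_norm S w = sqrt (\<integral>x. (norm (w x))\<^sup>2 \<partial>lebesgue_on S)"

definition L2_inner :: "'a::euclidean_space set \<Rightarrow> ('a \<Rightarrow> real) \<Rightarrow> ('a \<Rightarrow> real) \<Rightarrow> real" where
  "L2_inner S v w = (\<integral>x. v x * w x \<partial>lebesgue_on S)"

definition gradient :: "(real^'n \<Rightarrow> real) \<Rightarrow> real^'n \<Rightarrow> real^'n" where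
  "gradient \<eta> x = (\<chi> i. frechet_derivative \<eta> (at x) (axis i 1))"

text \<open>\<open>has_H1_gradient \<Omega> u G\<close>: the function \<open>u\<close> belongs to \<open>H\<^sup>1(\<Omega>)\<close> and has weak gradient \<open>G\<close>.\<close>

definition has_H1_gradient :: "(real^'n) set \<Rightarrow> (real^'n \<Rightarrow> real) \<Rightarrow> (real^'n \<Rightarrow> real^'n) \<Rightarrow> bool" where
  "has_H1_gradient \<Omega> u G \<longleftrightarrow> u \<in> L2 \<Omega> \<and> G \<in> L2 \<Omega> \<and>
     (\<forall>\<eta>\<in>test_functions \<Omega>. \<forall>i.
        (\<integral>x. u x * gradient \<eta> x $ i \<partial>lebesgue_on \<Omega>) = - (\<integral>x. G x $ i * \<eta> x \<partial>lebesgue_on \<Omega>))"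

text \<open>\<open>H\<^sub>0\<^sup>1(\<Omega>)\<close> is the closure of the test functions in \<open>H\<^sup>1(\<Omega>)\<close>.\<close>

definition has_H10_gradient :: "(real^'n) set \<Rightarrow> (real^'n \<Rightarrow> real) \<Rightarrow> (real^'n \<Rightarrow> real^'n) \<Rightarrow> bool" where
  "has_H10_gradient \<Omega> u G \<longleftrightarrow> has_H1_gradient \<Omega> u G \<and>
     (\<exists>\<eta>. (\<forall>j. \<eta> j \<in> test_functions \<Omega>) \<and>
        (\<lambda>j::nat. L2_norm \<Omega> (\<lambda>x. \<eta> j x - u x)) \<longlonglongrightarrow> 0 \<and>
        (\<lambda>j::nat. L2_norm \<Omega> (\<lambda>x. gradient (\<eta> j) x - G x)) \<longlonglongrightarrow> 0)"

section \<open>The elliptic operator and its eigenpairs\<close>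

definition admissible_coefficients ::
  "(real^'n) set \<Rightarrow> (real^'n \<Rightarrow> real^'n^'n) \<Rightarrow> (real^'n \<Rightarrow> real) \<Rightarrow> bool" where
  "admissible_coefficients \<Omega> A c \<longleftrightarrow>
     (\<exists>L. L-lipschitz_on \<Omega> A) \<and>
     (\<forall>x\<in>\<Omega>. transpose (A x) = A x) \<and>
     (\<exists>a>0. \<forall>x\<in>\<Omega>. \<forall>\<xi>. a * (norm \<xi>)\<^sup>2 \<le> \<xi> \<bullet> (A x *v \<xi>)) \<and>
     c \<in> borel_measurable (lebesgue_on \<Omega>) \<and>
     (\<exists>M. AE x in lebesgue_on \<Omega>. 0 \<le> c x \<and> c x \<le> M)"

text \<open>\<open>\<L> u = \<lambda> u\<close> with homogeneous Dirichlet conditions, for the divergence form operator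
  \<open>\<L> w = - div (A \<nabla> w) + c w\<close> in its usual weak sense on \<open>H\<^sub>0\<^sup>1(\<Omega>)\<close>.\<close>

definition dirichlet_eigenpair ::
  "(real^'n) set \<Rightarrow> (real^'n \<Rightarrow> real^'n^'n) \<Rightarrow> (real^'n \<Rightarrow> real) \<Rightarrow> real \<Rightarrow> (real^'n \<Rightarrow> real) \<Rightarrow> bool" where
  "dirichlet_eigenpair \<Omega> A c \<mu> u \<longleftrightarrow>
     (\<exists>G. has_H10_gradient \<Omega> u G \<and>
        (\<forall>v H. has_H10_gradient \<Omega> v H \<longrightarrow>
           (\<integral>x. (A x *v G x) \<bullet> H x + c x * u x * v x \<partial>lebesgue_on \<Omega>) = \<mu> * L2_inner \<Omega> u v))"

definition L2_orthonormal_basis :: "(real^'n) set \<Rightarrow> (nat \<Rightarrow> real^'n \<Rightarrow> real) \<Rightarrow> bool" where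
  "L2_orthonormal_basis \<Omega> \<phi> \<longleftrightarrow>
     (\<forall>k. \<phi> k \<in> L2 \<Omega>) \<and>
     (\<forall>j k. L2_inner \<Omega> (\<phi> j) (\<phi> k) = (if j = k then 1 else 0)) \<and>
     (\<forall>w\<in>L2 \<Omega>. (\<lambda>N. L2_norm \<Omega> (\<lambda>x. w x - (\<Sum>k<N. L2_inner \<Omega> w (\<phi> k) * \<phi> k x))) \<longlonglongrightarrow> 0)"

text \<open>The eigenpairs are indexed from \<open>0\<close> here.\<close>

definition dirichlet_eigenbasis ::
  "(real^'n) set \<Rightarrow> (real^'n \<Rightarrow> real^'n^'n) \<Rightarrow> (real^'n \<Rightarrow> real) \<Rightarrow>
    (nat \<Rightarrow> real) \<Rightarrow> (nat \<Rightarrow> real^'n \<Rightarrow> real) \<Rightarrow> bool" where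
  "dirichlet_eigenbasis \<Omega> A c lam \<phi> \<longleftrightarrow>
     (\<forall>k. 0 < lam k \<and> dirichlet_eigenpair \<Omega> A c (lam k) (\<phi> k)) \<and> L2_orthonormal_basis \<Omega> \<phi>"

section \<open>The spectral spaces and their time-dependent versions\<close>

text \<open>Elements of \<open>\<H>\<^sup>r(\<Omega>)\<close>, for \<open>r\<close> of either sign, are represented by the sequence of their
  coefficients with respect to the eigenbasis. For negative \<open>r\<close> this is the identification of the
  dual of \<open>\<H>\<^sup>-\<^sup>r(\<Omega>)\<close> with formal series.\<close>

definition Hspace :: "(nat \<Rightarrow> real) \<Rightarrow> real \<Rightarrow> (nat \<Rightarrow> real) set" where
  "Hspace lam r = {w. summable (\<lambda>k. lam k powr r * (w k)\<^sup>2)}"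

definition Hnorm :: "(nat \<Rightarrow> real) \<Rightarrow> real \<Rightarrow> (nat \<Rightarrow> real) \<Rightarrow> real" where
  "Hnorm lam r w = sqrt (\<Sum>k. lam k powr r * (w k)\<^sup>2)"

definition eig_coeffs :: "(real^'n) set \<Rightarrow> (nat \<Rightarrow> real^'n \<Rightarrow> real) \<Rightarrow> (real^'n \<Rightarrow> real) \<Rightarrow> nat \<Rightarrow> real" where
  "eig_coeffs \<Omega> \<phi> w = (\<lambda>k. L2_inner \<Omega> w (\<phi> k))"

text \<open>Strong (Bochner) measurability of an \<open>\<H>\<^sup>r\<close>-valued function on the time interval \<open>I\<close>.\<close>

definition bochner_measurable ::
  "real set \<Rightarrow> (nat \<Rightarrow> real) \<Rightarrow> real \<Rightarrow> (real \<Rightarrow> nat \<Rightarrow> real) \<Rightarrow> bool" where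
  "bochner_measurable I lam r u \<longleftrightarrow>
     (AE t in lebesgue_on I. u t \<in> Hspace lam r) \<and>
     (\<exists>S. (\<forall>m::nat. simple_function (lebesgue_on I) (S m) \<and> (\<forall>t\<in>I. S m t \<in> Hspace lam r)) \<and>
        (AE t in lebesgue_on I. (\<lambda>m. Hnorm lam r (\<lambda>k. S m t k - u t k)) \<longlonglongrightarrow> 0))"

definition L2_time :: "real \<Rightarrow> (nat \<Rightarrow> real) \<Rightarrow> real \<Rightarrow> (real \<Rightarrow> nat \<Rightarrow> real) set" where
  "L2_time T lam r = {u. bochner_measurable {0<..<T} lam r u \<and>
     integrable (lebesgue_on {0<..<T}) (\<lambda>t. (Hnorm lam r (u t))\<^sup>2)}"

definition L2_time_norm :: "real \<Rightarrow> (nat \<Rightarrow> real) \<Rightarrow> real \<Rightarrow> (real \<Rightarrow> nat \<Rightarrow> real) \<Rightarrow> real" where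
  "L2_time_norm T lam r u = sqrt (\<integral>t. (Hnorm lam r (u t))\<^sup>2 \<partial>lebesgue_on {0<..<T})"

definition L1loc_time :: "real \<Rightarrow> (nat \<Rightarrow> real) \<Rightarrow> real \<Rightarrow> (real \<Rightarrow> nat \<Rightarrow> real) set" where
  "L1loc_time T lam r = {u. bochner_measurable {0<..<T} lam r u \<and>
     (\<forall>a b. 0 < a \<and> a \<le> b \<and> b < T \<longrightarrow> integrable (lebesgue_on {a..b}) (\<lambda>t. Hnorm lam r (u t)))}"

text \<open>\<open>v\<close> is the distributional time derivative of order \<open>m\<close> of \<open>u\<close> on \<open>(0,T)\<close>, both
  with values in \<open>\<H>\<^sup>r\<close>. The Bochner integrals in the defining identity are compared coefficientwise,
  the coefficient maps being bounded linear functionals that separate points.\<close>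

definition has_time_derivative ::
  "real \<Rightarrow> (nat \<Rightarrow> real) \<Rightarrow> real \<Rightarrow> nat \<Rightarrow> (real \<Rightarrow> nat \<Rightarrow> real) \<Rightarrow> (real \<Rightarrow> nat \<Rightarrow> real) \<Rightarrow> bool" where
  "has_time_derivative T lam r m u v \<longleftrightarrow>
     u \<in> L1loc_time T lam r \<and> v \<in> L1loc_time T lam r \<and>
     (\<forall>\<eta>\<in>test_functions {0<..<T}. \<forall>k.
        (\<integral>t. (deriv ^^ m) \<eta> t * u t k \<partial>lebesgue_on {0<..<T})
          = (- 1) ^ m * (\<integral>t. \<eta> t * v t k \<partial>lebesgue_on {0<..<T}))"

text \<open>\<open>u \<in> H\<^sup>2(0,T;\<H>\<^sup>r)\<close> with first and second weak time derivatives \<open>u1\<close> and \<open>u2\<close>, which \<open>u\<close>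
  determines almost everywhere.\<close>

definition H2_time ::
  "real \<Rightarrow> (nat \<Rightarrow> real) \<Rightarrow> real \<Rightarrow> (real \<Rightarrow> nat \<Rightarrow> real) \<Rightarrow>
    (real \<Rightarrow> nat \<Rightarrow> real) \<Rightarrow> (real \<Rightarrow> nat \<Rightarrow> real) \<Rightarrow> bool" where
  "H2_time T lam r u u1 u2 \<longleftrightarrow>
     u \<in> L2_time T lam r \<and> u1 \<in> L2_time T lam r \<and> u2 \<in> L2_time T lam r \<and>
     has_time_derivative T lam r 1 u u1 \<and> has_time_derivative T lam r 2 u u2"

definition H2_time_norm ::
  "real \<Rightarrow> (nat \<Rightarrow> real) \<Rightarrow> real \<Rightarrow> (real \<Rightarrow> nat \<Rightarrow> real) \<Rightarrow>
    (real \<Rightarrow> nat \<Rightarrow> real) \<Rightarrow> (real \<Rightarrow> nat \<Rightarrow> real) \<Rightarrow> real" where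
  "H2_time_norm T lam r u u1 u2 =
     sqrt ((L2_time_norm T lam r u)\<^sup>2 + (L2_time_norm T lam r u1)\<^sup>2 + (L2_time_norm T lam r u2)\<^sup>2)"

section \<open>The solution of the extended problem\<close>

definition mittag_leffler :: "real \<Rightarrow> real \<Rightarrow> real \<Rightarrow> real" where
  "mittag_leffler \<gamma> \<mu> z = (\<Sum>j. z ^ j / Gamma (\<gamma> * real j + \<mu>))"

text \<open>The coefficient \<open>u\<^sub>k(t)\<close>, from \<open>l = \<lambda>\<^sub>k\<close>, the data \<open>gk = g\<^sub>k\<close>, \<open>hk = h\<^sub>k\<close> and the
  scalar forcing \<open>fk = f\<^sub>k\<close>.\<close>

definition mode_solution ::
  "real \<Rightarrow> real \<Rightarrow> real \<Rightarrow> real \<Rightarrow> real \<Rightarrow> (real \<Rightarrow> real) \<Rightarrow> real \<Rightarrow> real" where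
  "mode_solution s \<gamma> l gk hk fk t =
     mittag_leffler \<gamma> 1 (- (l powr s * t powr \<gamma>)) * gk
     + t * mittag_leffler \<gamma> 2 (- (l powr s * t powr \<gamma>)) * hk
     + (\<integral>r. (t - r) powr (\<gamma> - 1) * mittag_leffler \<gamma> \<gamma> (- (l powr s * (t - r) powr \<gamma>)) * fk r
          \<partial>lebesgue_on {0<..<t})"

text \<open>The profile \<open>\<psi>\<^sub>k\<close> in the extended variable, for \<open>\<alpha> = 1 - 2 s\<close> and \<open>l = \<lambda>\<^sub>k\<close>. The values
  of \<open>\<psi>\<close> at negative arguments are irrelevant.\<close>

definition extension_profile :: "real \<Rightarrow> real \<Rightarrow> (real \<Rightarrow> real) \<Rightarrow> bool" where
  "extension_profile \<alpha> l \<psi> \<longleftrightarrow>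
     (\<exists>\<psi>1 \<psi>2. \<forall>y>0. (\<psi> has_real_derivative \<psi>1 y) (at y) \<and>
        (\<psi>1 has_real_derivative \<psi>2 y) (at y) \<and> \<psi>2 y + \<alpha> / y * \<psi>1 y = l * \<psi> y) \<and>
     \<psi> 0 = 1 \<and> (\<psi> \<longlongrightarrow> \<psi> 0) (at_right 0) \<and> (\<psi> \<longlongrightarrow> 0) at_top"

text \<open>\<open>U(x,y,t) = \<Sum>\<^sub>k u\<^sub>k(t) \<phi>\<^sub>k(x) \<psi>\<^sub>k(y)\<close>, on the open cylinder and for times in \<open>(0,T)\<close>; the
  series is summed in \<open>L\<^sup>2(\<Omega>)\<close> for fixed \<open>y\<close> and \<open>t\<close>.\<close>

definition extended_solution ::
  "(real^'n) set \<Rightarrow> (nat \<Rightarrow> real) \<Rightarrow> (nat \<Rightarrow> real^'n \<Rightarrow> real) \<Rightarrow> (nat \<Rightarrow> real \<Rightarrow> real) \<Rightarrow>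
    real \<Rightarrow> real \<Rightarrow> real \<Rightarrow> (real^'n \<Rightarrow> real) \<Rightarrow> (real^'n \<Rightarrow> real) \<Rightarrow> (real \<Rightarrow> nat \<Rightarrow> real) \<Rightarrow>
    (real^'n \<Rightarrow> real \<Rightarrow> real \<Rightarrow> real) \<Rightarrow> bool" where
  "extended_solution \<Omega> lam \<phi> \<psi> s T \<gamma> g h f U \<longleftrightarrow>
     (\<forall>t\<in>{0<..<T}. \<forall>y>0. (\<lambda>x. U x y t) \<in> L2 \<Omega> \<and>
        (\<lambda>N. L2_norm \<Omega> (\<lambda>x. U x y t -
           (\<Sum>k<N. mode_solution s \<gamma> (lam k) (eig_coeffs \<Omega> \<phi> g k) (eig_coeffs \<Omega> \<phi> h k) (\<lambda>r. f r k) t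
                     * \<phi> k x * \<psi> k y))) \<longlonglongrightarrow> 0)"

text \<open>\<open>v\<close> is the trace on \<open>y = 0\<close> of the time derivative of order \<open>m\<close> of \<open>U\<close>: for every
  \<open>y > 0\<close> the slice \<open>U(\<cdot>,y,\<cdot>)\<close>, read as an \<open>\<H>\<^sup>r\<close>-valued function of time, has the weak
  derivative \<open>W y\<close>, and \<open>W y t\<close> tends to \<open>v t\<close> in \<open>\<H>\<^sup>r\<close> as \<open>y\<close> decreases to \<open>0\<close>.
  Almost everywhere in time, \<open>v\<close> does not depend on the representatives \<open>W y\<close>: compare along a
  sequence of heights.\<close>

definition trace_of_time_derivative ::
  "(real^'n) set \<Rightarrow> (nat \<Rightarrow> real) \<Rightarrow> (nat \<Rightarrow> real^'n \<Rightarrow> real) \<Rightarrow> real \<Rightarrow> real \<Rightarrow> nat \<Rightarrow>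
    (real^'n \<Rightarrow> real \<Rightarrow> real \<Rightarrow> real) \<Rightarrow> (real \<Rightarrow> nat \<Rightarrow> real) \<Rightarrow> bool" where
  "trace_of_time_derivative \<Omega> lam \<phi> T r m U v \<longleftrightarrow>
     (\<exists>W. (\<forall>y>0. has_time_derivative T lam r m (\<lambda>t. eig_coeffs \<Omega> \<phi> (\<lambda>x. U x y t)) (W y)) \<and>
        (AE t in lebesgue_on {0<..<T}. v t \<in> Hspace lam r \<and>
           (\<forall>\<^sub>F y in at_right 0. W y t \<in> Hspace lam r) \<and>
           ((\<lambda>y. Hnorm lam r (\<lambda>k. W y t k - v t k)) \<longlongrightarrow> 0) (at_right 0)))"

end

theory Submission
  imports Defs "HOL-Complex_Analysis.Complex_Analysis"
begin

text \<open>Everything happens mode by mode. Put \<open>\<mu> = lam k powr s\<close> and let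
  \<open>e(\<beta>)\<close> be the kernel \<open>t powr (\<beta> - 1) * E(\<gamma>, \<beta>; - \<mu> t powr \<gamma>)\<close>, with the two-parameter Mittag-Leffler function
  \<open>E\<close>. These kernels satisfy \<open>e(\<beta> + 1)' = e(\<beta>)\<close> and
  \<open>e(\<beta>) = t powr (\<beta> - 1) / \<Gamma>(\<beta>) - \<mu> e(\<beta> + \<gamma>)\<close>. The forcing of a mode is, almost everywhere,
  \<open>c0 + c1 t\<close> plus the twofold primitive of its second weak derivative \<open>F\<close>. Moving the primitives
  onto the kernel gives
  \<open>u = g e(1) + h e(2) + c0 e(\<gamma> + 1) + c1 e(\<gamma> + 2) + e(\<gamma> + 2) * F\<close>,
  the last star being convolution. Three derivatives lower every index by three, and since \<open>1 / \<Gamma>\<close> vanishes at \<open>-2\<close>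
  and \<open>-1\<close>, the third derivative of \<open>u\<close> is
  \<open>- \<mu> g e(\<gamma> - 2) - \<mu> h e(\<gamma> - 1) + c0 e(\<gamma> - 2) + c1 e(\<gamma> - 1) + e(\<gamma> - 1) * F\<close>.

  In the norm of \<open>\<H>(- s)\<close> a mode has the weight \<open>1 / \<mu>\<close>. Uniformly in \<open>\<mu>\<close>, the kernel
  \<open>e(\<gamma> - 2)\<close> is bounded by a multiple of \<open>t powr (\<gamma> - 3)\<close>, so the first term costs \<open>\<mu> g^2\<close> times the integral of
  \<open>t powr (\<rho> + 2 \<gamma> - 6)\<close>, which is finite precisely for \<open>\<rho> > 5 - 2 \<gamma>\<close>. For the second term half a power of \<open>\<mu>\<close> is
  traded for \<open>t powr (- \<gamma> / 2)\<close>, which needs only \<open>\<rho> > 3 - \<gamma>\<close>. The convolution is bounded by Young's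
  inequality, because \<open>e(\<gamma> - 1)\<close> is integrable. This is \<open>mode_deriv3_bound\<close>.

  The uniformity in \<open>\<mu>\<close> is the decay \<open>\<bar>E(\<gamma>, \<beta>; - x)\<bar> \<le> K / (1 + x)\<close> for \<open>\<beta> > 0\<close>, proved in \<open>mittag_leffler_bound\<close>
  from Hankel's contour integral for \<open>1 / \<Gamma>\<close>. Summed against the power series it represents the
  Mittag-Leffler function by a contour integral with denominator \<open>\<zeta> powr \<gamma> + x\<close>. For \<open>\<gamma> < 2\<close> the
  two poles of the integrand lie in the open left half-plane, so the contour can be kept away from them while the
  exponential still decays along it.

  Summation over the modes is monotone convergence. The bound passes from height \<open>y > 0\<close> to the trace because
  \<open>0 \<le> \<psi> k y \<le> 1\<close>, by the maximum principle, and \<open>\<psi> k y\<close> tends to \<open>1\<close>. That the solution itself takes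
  values in \<open>\<H>(- s)\<close> uses that the eigenvalues are bounded away from \<open>0\<close>, which is a Poincare inequality.\<close>

section \<open>Hankel's formula for the reciprocal Gamma function\<close>

text \<open>The integrand \<open>exp \<zeta> * \<zeta> powr (- z)\<close> of Hankel's formula in the logarithmic coordinate \<open>\<zeta> = exp w\<close>. Circular arcs
  about the origin become vertical segments, rays become horizontal lines, and the integrand is entire:
  no branch cut has to be chosen.\<close>

definition hankel_integrand :: "real \<Rightarrow> complex \<Rightarrow> complex" where
  "hankel_integrand z w = exp (exp w + of_real (1 - z) * w)"

text \<open>In the coordinate \<open>w\<close> this is the integral over the arc of radius \<open>exp N\<close> between the angles
  \<open>- \<theta>\<close> and \<open>\<theta>\<close>. By Cauchy's theorem a Hankel contour truncated at that radius has the same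
  integral.\<close>

definition vertical_integral :: "real \<Rightarrow> (complex \<Rightarrow> complex) \<Rightarrow> real \<Rightarrow> complex" where
  "vertical_integral \<theta> F N = contour_integral (linepath (Complex N (- \<theta>)) (Complex N \<theta>)) F"

lemma closed_segment_same_Re:
  assumes "w \<in> closed_segment (Complex N a) (Complex N b)" "a \<le> b"
  shows "Re w = N \<and> a \<le> Im w \<and> Im w \<le> b"
proof -
  obtain u where u: "0 \<le> u" "u \<le> 1" "w = (1 - u) *\<^sub>R Complex N a + u *\<^sub>R Complex N b"
    using assms(1) by (auto simp: closed_segment_def)
  have "Im w = a + u * (b - a)" "Re w = N"
    by (simp_all add: u(3) algebra_simps)
  moreover have "0 \<le> u * (b - a)" "u * (b - a) \<le> b - a"
    using u assms(2) mult_left_le_one_le[of "b - a" u] by auto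
  ultimately show ?thesis by auto
qed

text \<open>Contour integrals enter only as differences of a primitive. Deforming a contour is then a
  cancellation, and estimates along its pieces are mean value inequalities.\<close>

lemma vertical_integral_primitive:
  assumes "\<And>w. w \<in> S \<Longrightarrow> (G has_field_derivative F w) (at w)"
    and "closed_segment (Complex N (- \<theta>)) (Complex N \<theta>) \<subseteq> S"
  shows "vertical_integral \<theta> F N = G (Complex N \<theta>) - G (Complex N (- \<theta>))"
  unfolding vertical_integral_def
  using contour_integral_primitive[of S G F "linepath (Complex N (- \<theta>)) (Complex N \<theta>)"] assms
  by (intro contour_integral_unique) (auto intro: has_field_derivative_at_within)

lemma has_vector_derivative_Complex: "((\<lambda>u. Complex u y) has_vector_derivative 1) (at u)"
proof -
  have "((\<lambda>u. complex_of_real u + \<i> * of_real y) has_vector_derivative of_real 1) (at u)"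
    by (subst has_vector_derivative_add_const, rule has_vector_derivative_of_real) (auto intro: derivative_eq_intros)
  moreover have "(\<lambda>u. complex_of_real u + \<i> * of_real y) = (\<lambda>u. Complex u y)"
    by (simp add: fun_eq_iff complex_eq_iff)
  ultimately show ?thesis by simp
qed

text \<open>A primitive \<open>M\<close> of a majorant plays the role of the integral of the absolute value along a ray; it
  turns decay along the ray into an explicit bound.\<close>

lemma horizontal_mvt:
  fixes G F :: "complex \<Rightarrow> complex"
  assumes "a \<le> b"
    and "\<And>u. a \<le> u \<Longrightarrow> u \<le> b \<Longrightarrow> (G has_field_derivative F (Complex u y)) (at (Complex u y))"
    and "\<And>u. a \<le> u \<Longrightarrow> u \<le> b \<Longrightarrow> norm (F (Complex u y)) \<le> m u"
    and "\<And>u. a \<le> u \<Longrightarrow> u \<le> b \<Longrightarrow> (M has_real_derivative m u) (at u)"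
  shows "norm (G (Complex b y) - G (Complex a y)) \<le> M b - M a"
proof (cases "a = b")
  case False
  then have "a < b" using assms(1) by simp
  have D: "((\<lambda>u. G (Complex u y)) has_vector_derivative F (Complex u y)) (at u)" if "a \<le> u" "u \<le> b" for u
  proof -
    from field_vector_diff_chain_at[OF has_vector_derivative_Complex assms(2)[OF that]] show ?thesis by (simp add: o_def)
  qed
  show ?thesis
  proof (rule differentiable_bound_general[OF \<open>a < b\<close>])
    show "continuous_on {a..b} (\<lambda>u. G (Complex u y))"
      using D by (intro continuous_at_imp_continuous_on ballI) (meson atLeastAtMost_iff has_vector_derivative_continuous)
    show "continuous_on {a..b} M"
      using assms(4) by (intro continuous_at_imp_continuous_on ballI) (meson DERIV_isCont atLeastAtMost_iff)
    show "((\<lambda>u. G (Complex u y)) has_vector_derivative F (Complex x y)) (at x)" if "a < x" "x < b" for x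
      using D that by simp
    show "(M has_vector_derivative m x) (at x)" if "a < x" "x < b" for x
      using assms(4) that by (simp add: has_real_derivative_iff_has_vector_derivative)
  qed (use assms(3) in simp)
qed simp

lemma vertical_mvt:
  fixes G F :: "complex \<Rightarrow> complex"
  assumes "a \<le> b"
    and "\<And>v. a \<le> v \<Longrightarrow> v \<le> b \<Longrightarrow> (G has_field_derivative F (Complex x v)) (at (Complex x v))"
    and "\<And>v. a \<le> v \<Longrightarrow> v \<le> b \<Longrightarrow> norm (F (Complex x v)) \<le> B"
  shows "norm (G (Complex x b) - G (Complex x a)) \<le> B * (b - a)"
proof -
  have "norm (G (Complex x b) - G (Complex x a)) \<le> B * norm (Complex x b - Complex x a)"
  proof (rule field_differentiable_bound[where S = "closed_segment (Complex x a) (Complex x b)"])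
    fix w assume "w \<in> closed_segment (Complex x a) (Complex x b)"
    then have "Re w = x \<and> a \<le> Im w \<and> Im w \<le> b" using closed_segment_same_Re assms(1) by blast
    then have w: "w = Complex x (Im w)" "a \<le> Im w" "Im w \<le> b" by (auto simp: complex_eq_iff)
    show "(G has_field_derivative F w) (at w within closed_segment (Complex x a) (Complex x b))"
      using assms(2)[OF w(2,3)] w(1) by (metis has_field_derivative_at_within)
    show "norm (F w) \<le> B" using assms(3)[OF w(2,3)] w(1) by simp
  qed auto
  also have "Complex x b - Complex x a = \<i> * of_real (b - a)" by (simp add: complex_eq_iff)
  also have "norm \<dots> = b - a" using assms(1) by (simp add: norm_mult del: of_real_diff)
  finally show ?thesis .
qed

lemma hankel_primitive: "\<exists>G. \<forall>w. (G has_field_derivative hankel_integrand z w) (at w)"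
proof -
  have "(hankel_integrand z) holomorphic_on UNIV"
    unfolding hankel_integrand_def by (intro holomorphic_intros)
  then show ?thesis
    using holomorphic_convex_primitive'[of UNIV "hankel_integrand z"] by (metis UNIV_I convex_UNIV open_UNIV)
qed

lemma norm_hankel: "norm (hankel_integrand z (Complex u v)) = exp (exp u * cos v + (1 - z) * u)"
  unfolding hankel_integrand_def by (simp add: Re_exp)

text \<open>Along a ray of angle \<open>\<theta> > \<pi> / 2\<close> the integrands decay like \<open>exp (cos \<theta> * exp u)\<close>, which beats every
  exponential in \<open>u\<close>.\<close>

lemma exp_exp_decay:
  fixes c p :: real
  assumes "c > 0"
  shows "((\<lambda>u::real. exp (- c * exp u + p * u)) \<longlongrightarrow> 0) at_top"
proof -
  have "((\<lambda>y::real. y powr p * exp (- c * y)) \<longlongrightarrow> 0) at_top"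
    using assms by real_asymp
  from filterlim_compose[OF this exp_at_top]
  show ?thesis by (simp add: powr_def exp_add[symmetric] algebra_simps)
qed

definition lower_gamma :: "real \<Rightarrow> real \<Rightarrow> real" where
  "lower_gamma z T = integral {0..T} (\<lambda>t. t powr (z - 1) / exp t)"

lemma lower_gamma_integrable:
  fixes z :: real assumes "z > 0" shows "(\<lambda>t. t powr (z - 1) / exp t) integrable_on {0..b}"
proof -
  have "(\<lambda>t. t powr (z - 1) / exp t) absolutely_integrable_on {0..}"
    using Gamma_integral_real[OF assms] by (intro nonnegative_absolutely_integrable_1) auto
  then have "(\<lambda>t. t powr (z - 1) / exp t) absolutely_integrable_on {0..b}"
    by (rule set_integrable_subset) auto
  then show ?thesis using set_lebesgue_integral_eq_integral(1) by blast
qed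

lemma lower_gamma_deriv:
  assumes "z > 0" "t > 0"
  shows "(lower_gamma z has_real_derivative t powr (z - 1) / exp t) (at t)"
proof -
  have "continuous_on {0<..} (\<lambda>t::real. t powr (z - 1) / exp t)"
    by (intro continuous_intros) auto
  then have "isCont (\<lambda>t. t powr (z - 1) / exp t) t"
    using assms(2) by (simp add: continuous_on_eq_continuous_at)
  then have c: "continuous (at t within {0..t+1} - {}) (\<lambda>t. t powr (z - 1) / exp t)"
    by (rule continuous_at_imp_continuous_at_within)
  have "((\<lambda>u. integral {0..u} (\<lambda>t. t powr (z - 1) / exp t)) has_vector_derivative t powr (z - 1) / exp t)
     (at t within {0..t+1} - {})"
    using assms c by (intro integral_has_vector_derivative_continuous_at lower_gamma_integrable) auto
  then have "(lower_gamma z has_vector_derivative t powr (z - 1) / exp t) (at t within {0..t+1})"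
    by (simp add: lower_gamma_def[abs_def])
  moreover have "at t within {0..t+1} = at t"
    using assms by (intro at_within_interior) auto
  ultimately show ?thesis by (simp add: has_real_derivative_iff_has_vector_derivative)
qed

lemma lower_gamma_at_0:
  assumes "z > 0" shows "(lower_gamma z \<longlongrightarrow> 0) (at_right 0)"
proof -
  have "continuous_on {0..1} (lower_gamma z)"
    unfolding lower_gamma_def[abs_def] by (intro indefinite_integral_continuous_1 lower_gamma_integrable assms)
  then have "(lower_gamma z \<longlongrightarrow> lower_gamma z 0) (at 0 within {0..1})"
    by (auto simp: continuous_on_def)
  then show ?thesis by (simp add: lower_gamma_def at_within_Icc_at_right)
qed

lemma lower_gamma_at_top:
  fixes z :: real assumes "z > 0" shows "(lower_gamma z \<longlongrightarrow> Gamma z) at_top"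
proof (rule tendstoI)
  fix e :: real assume "e > 0"
  let ?f = "\<lambda>t::real. t powr (z - 1) / exp t"
  obtain B where B: "B > 0" "\<And>a b. ball 0 B \<subseteq> cbox a b \<Longrightarrow>
      norm (integral (cbox a b) (\<lambda>x. if x \<in> {0..} then ?f x else 0) - Gamma z) < e"
    using Gamma_integral_real[OF assms] \<open>e > 0\<close> unfolding has_integral_alt' by blast
  have "dist (lower_gamma z T) (Gamma z) < e" if "T \<ge> B" for T
  proof -
    have "ball 0 B \<subseteq> cbox (-T) T"
    proof
      fix x :: real assume "x \<in> ball 0 B"
      then have "\<bar>x\<bar> < B" by (simp add: dist_real_def)
      then show "x \<in> cbox (-T) T" using that by (auto simp: abs_if split: if_splits)
    qed
    from B(2)[OF this] have "norm (integral {-T..T} (\<lambda>x. if x \<in> {0..} then ?f x else 0) - Gamma z) < e"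
      by simp
    moreover have "integral {-T..T} (\<lambda>x. if x \<in> {0..} then ?f x else 0) = integral {-T..T} (\<lambda>x. if x \<in> {0..T} then ?f x else 0)"
      by (intro integral_cong) auto
    moreover have "\<dots> = integral {0..T} ?f"
      using that B(1) by (subst integral_restrict_Int) (simp add: Int_absorb1)
    ultimately show ?thesis by (simp add: lower_gamma_def dist_norm)
  qed
  then show "\<forall>\<^sub>F T in at_top. dist (lower_gamma z T) (Gamma z) < e"
    by (intro eventually_mono[OF eventually_ge_at_top[of B]])
qed

text \<open>At \<open>\<theta> = \<pi>\<close> the two rays run along both sides of the negative half-line, where \<open>exp \<zeta>\<close> agrees and
  \<open>\<zeta> powr (- z)\<close> jumps by a factor involving \<open>sin (\<pi> z)\<close>. This leaves the integrand of Euler's integral for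
  \<open>\<Gamma>(1 - z)\<close>.\<close>

lemma vertical_integral_pi_deriv:
  assumes G: "\<And>w. (G has_field_derivative hankel_integrand z w) (at w)"
  shows "((\<lambda>u. G (Complex u pi) - G (Complex u (- pi))) has_vector_derivative
     2 * \<i> * of_real (sin (pi * z) * exp (- exp u + (1 - z) * u))) (at u)"
proof -
  have D: "((\<lambda>u. G (Complex u y)) has_vector_derivative hankel_integrand z (Complex u y)) (at u)" for y
  proof -
    from field_vector_diff_chain_at[OF has_vector_derivative_Complex G] show ?thesis by (simp add: o_def)
  qed
  have E: "exp (Complex u pi) = - of_real (exp u)" "exp (Complex u (- pi)) = - of_real (exp u)"
    by (simp_all add: complex_eq_iff Re_exp Im_exp)
  have H: "hankel_integrand z (Complex u y) = Complex (exp (- exp u + (1 - z) * u) * cos ((1 - z) * y)) (exp (- exp u + (1 - z) * u) * sin ((1 - z) * y))"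
    if "exp (Complex u y) = - of_real (exp u)" for y
  proof -
    have "exp (Complex u y) + of_real (1 - z) * Complex u y = Complex (- exp u + (1 - z) * u) ((1 - z) * y)"
      unfolding that by (simp add: complex_eq_iff)
    then show ?thesis by (simp add: hankel_integrand_def complex_eq_iff Re_exp Im_exp)
  qed
  have "sin ((1 - z) * pi) = sin (pi - pi * z)" by (simp add: algebra_simps)
  then have S: "sin ((1 - z) * pi) = sin (pi * z)" by simp
  have "hankel_integrand z (Complex u pi) - hankel_integrand z (Complex u (- pi)) =
     2 * \<i> * of_real (sin (pi * z) * exp (- exp u + (1 - z) * u))"
    unfolding H[OF E(1)] H[OF E(2)] using S by (simp add: complex_eq_iff)
  with has_vector_derivative_diff[OF D[of pi] D[of "- pi"]] show ?thesis by simp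
qed

lemma vertical_integral_at_bot:
  assumes G: "\<And>w. (G has_field_derivative hankel_integrand z w) (at w)" and "z < 1"
  shows "((\<lambda>u. G (Complex u pi) - G (Complex u (- pi))) \<longlongrightarrow> 0) at_bot"
proof (rule Lim_null_comparison)
  have "norm (G (Complex u pi) - G (Complex u (- pi))) \<le> exp (1 + (1 - z) * u) * (pi - - pi)" if "u \<le> 0" for u
  proof (rule vertical_mvt[where F = "hankel_integrand z"])
    fix v
    have "exp u * cos v \<le> exp u * 1" by (intro mult_left_mono) auto
    also have "\<dots> \<le> 1" using that by simp
    finally have "exp u * cos v \<le> 1" .
    then show "norm (hankel_integrand z (Complex u v)) \<le> exp (1 + (1 - z) * u)" by (simp add: norm_hankel)
  qed (use G in auto)
  then show "\<forall>\<^sub>F u in at_bot. norm (G (Complex u pi) - G (Complex u (- pi))) \<le> exp (1 + (1 - z) * u) * (pi - - pi)"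
    by (intro eventually_mono[OF eventually_le_at_bot[of "0::real"]])
  show "((\<lambda>u. exp (1 + (1 - z) * u) * (pi - - pi)) \<longlongrightarrow> 0) at_bot"
    using assms(2)
    by (intro tendsto_mult_left_zero filterlim_compose[OF exp_at_bot]
      filterlim_tendsto_add_at_bot_iff[OF tendsto_const, THEN iffD2] filterlim_tendsto_pos_mult_at_bot[OF tendsto_const _ filterlim_ident]) simp_all
qed

text \<open>For \<open>z = 1\<close> the integrand tends to \<open>1\<close> at \<open>- \<infinity>\<close>, and the segment has length \<open>2 \<pi>\<close>.\<close>

lemma vertical_integral_at_bot_1:
  assumes G: "\<And>w. (G has_field_derivative hankel_integrand 1 w) (at w)"
  shows "((\<lambda>u. G (Complex u pi) - G (Complex u (- pi))) \<longlongrightarrow> 2 * pi * \<i>) at_bot"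
proof -
  define K where "K = (\<lambda>w. G w - w)"
  have K: "(K has_field_derivative exp (exp w) - 1) (at w)" for w
    unfolding K_def using G[of w] by (auto intro!: derivative_eq_intros simp: hankel_integrand_def)
  have "((\<lambda>u. K (Complex u pi) - K (Complex u (- pi))) \<longlongrightarrow> 0) at_bot"
  proof (rule Lim_null_comparison)
    have "norm (K (Complex u pi) - K (Complex u (- pi))) \<le> (exp 1 * exp u) * (pi - - pi)" if "u \<le> 0" for u
    proof (rule vertical_mvt[where F = "\<lambda>w. exp (exp w) - 1"])
      fix v
      have n: "norm (exp (Complex u v)) = exp u" by simp
      have "norm (exp (exp (Complex u v)) - exp 0) \<le> exp 1 * norm (exp (Complex u v) - 0)"
      proof (rule field_differentiable_bound[where S = "cball 0 1" and f' = exp])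
        show "exp (Complex u v) \<in> cball 0 1" using that by (simp add: n)
        show "norm (exp z) \<le> exp 1" if "z \<in> cball 0 1" for z :: complex
          using that by (auto intro: order_trans[OF complex_Re_le_cmod])
      qed (auto intro!: derivative_eq_intros)
      then show "norm (exp (exp (Complex u v)) - 1) \<le> exp 1 * exp u" by (simp add: n)
    qed (use K in auto)
    then show "\<forall>\<^sub>F u in at_bot. norm (K (Complex u pi) - K (Complex u (- pi))) \<le> (exp 1 * exp u) * (pi - - pi)"
      by (intro eventually_mono[OF eventually_le_at_bot[of "0::real"]])
    show "((\<lambda>u. (exp 1 * exp u) * (pi - - pi)) \<longlongrightarrow> 0) at_bot"
      by (intro tendsto_mult_left_zero tendsto_mult_right_zero exp_at_bot)
  qed
  from tendsto_add[OF this tendsto_const[of "2 * pi * \<i>"]]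
  have "((\<lambda>u. K (Complex u pi) - K (Complex u (- pi)) + 2 * pi * \<i>) \<longlongrightarrow> 2 * pi * \<i>) at_bot" by simp
  moreover have "(\<lambda>u. K (Complex u pi) - K (Complex u (- pi)) + 2 * pi * \<i>) = (\<lambda>u. G (Complex u pi) - G (Complex u (- pi)))"
  proof
    fix u
    have "Complex u pi = 2 * pi * \<i> + Complex u (- pi)" by (simp add: complex_eq_iff)
    then show "K (Complex u pi) - K (Complex u (- pi)) + 2 * pi * \<i> = G (Complex u pi) - G (Complex u (- pi))"
      by (simp add: K_def algebra_simps)
  qed
  ultimately show ?thesis by (simp only:)
qed

text \<open>Euler's integral for \<open>\<Gamma>(1 - z)\<close> combined with the reflection formula gives Hankel's formula for
  \<open>z < 1\<close>. The case \<open>z = 1\<close>, where \<open>\<Gamma>(1 - z)\<close> has a pole, is periodicity of \<open>exp (exp w)\<close>.\<close>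

lemma hankel_pi_limit:
  assumes G: "\<And>w. (G has_field_derivative hankel_integrand z w) (at w)" and z: "0 < z" "z \<le> 1"
  shows "((\<lambda>u. G (Complex u pi) - G (Complex u (- pi))) \<longlongrightarrow> 2 * pi * \<i> / of_real (Gamma z)) at_top"
proof (cases "z = 1")
  case True
  let ?V = "\<lambda>u. G (Complex u pi) - G (Complex u (- pi))"
  have V0: "(?V has_vector_derivative 0) (at u within UNIV)" for u
    using vertical_integral_pi_deriv[OF G, of u] True by simp
  obtain c where c0: "\<And>u. u \<in> UNIV \<Longrightarrow> ?V u = c"
    by (rule has_vector_derivative_zero_constant[OF convex_UNIV V0]) (rule that)
  have c: "?V u = c" for u by (rule c0[OF UNIV_I])
  have "((\<lambda>u. c) \<longlongrightarrow> 2 * pi * \<i>) (at_bot :: real filter)"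
    using vertical_integral_at_bot_1[of G] G True by (simp add: c)
  then have "c = 2 * pi * \<i>" by (simp add: tendsto_const_iff)
  then show ?thesis unfolding c using True by simp
next
  case False
  then have z1: "z < 1" using z by simp
  let ?V = "\<lambda>u. G (Complex u pi) - G (Complex u (- pi))"
  \<comment> \<open>Both terms have the same derivative in \<open>u\<close> and vanish at \<open>- \<infinity>\<close>, so their difference is zero.\<close>
  define P where "P = (\<lambda>u. ?V u - 2 * \<i> * of_real (sin (pi * z) * lower_gamma (1 - z) (exp u)))"
  have P0: "(P has_vector_derivative 0) (at u within UNIV)" for u
  proof -
    have "((\<lambda>u. lower_gamma (1 - z) (exp u)) has_real_derivative exp (- exp u + (1 - z) * u)) (at u)"
      using DERIV_chain2[OF lower_gamma_deriv[of "1 - z" "exp u"] DERIV_exp[of u]] z1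
      by (simp add: powr_def exp_add exp_minus exp_diff field_simps)
    from DERIV_cmult[OF this, of "sin (pi * z)"]
    have "((\<lambda>u. sin (pi * z) * lower_gamma (1 - z) (exp u)) has_real_derivative sin (pi * z) * exp (- exp u + (1 - z) * u)) (at u)" .
    then have "((\<lambda>u. 2 * \<i> * complex_of_real (sin (pi * z) * lower_gamma (1 - z) (exp u))) has_vector_derivative
        2 * \<i> * of_real (sin (pi * z) * exp (- exp u + (1 - z) * u))) (at u)"
      by (intro has_vector_derivative_mult_right has_vector_derivative_of_real)
    from has_vector_derivative_diff[OF vertical_integral_pi_deriv[OF G] this]
    show ?thesis unfolding P_def by simp
  qed
  obtain c where c0: "\<And>u. u \<in> UNIV \<Longrightarrow> P u = c"
    by (rule has_vector_derivative_zero_constant[OF convex_UNIV P0]) (rule that)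
  have c: "P u = c" for u by (rule c0[OF UNIV_I])
  have L0: "((\<lambda>u. lower_gamma (1 - z) (exp u)) \<longlongrightarrow> 0) at_bot"
    using z1 by (intro filterlim_compose[OF lower_gamma_at_0]) (auto simp: filterlim_at intro!: exp_at_bot)
  have "(P \<longlongrightarrow> 0 - 2 * \<i> * of_real (sin (pi * z) * 0)) at_bot"
    unfolding P_def by (intro tendsto_intros vertical_integral_at_bot[OF G z1] L0)
  moreover have "P = (\<lambda>_. c)" using c by auto
  ultimately have "c = 0" by (simp add: tendsto_const_iff)
  then have V: "?V u = 2 * \<i> * of_real (sin (pi * z) * lower_gamma (1 - z) (exp u))" for u
    using c[of u] by (simp add: P_def)
  have "((\<lambda>u. lower_gamma (1 - z) (exp u)) \<longlongrightarrow> Gamma (1 - z)) at_top"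
    using z1 by (intro filterlim_compose[OF lower_gamma_at_top exp_at_top]) auto
  then have "(?V \<longlongrightarrow> 2 * \<i> * of_real (sin (pi * z) * Gamma (1 - z))) at_top"
    unfolding V by (intro tendsto_intros)
  moreover have X: "sin (pi * z) * Gamma (1 - z) = pi / Gamma z"
  proof -
    have "complex_of_real (Gamma z * Gamma (1 - z)) = Gamma (of_real z) * Gamma (1 - of_real z)"
      using Gamma_complex_of_real[of "1 - z"] by (simp add: Gamma_complex_of_real)
    also have "\<dots> = of_real pi / sin (of_real pi * of_real z)" by (rule Gamma_reflection_complex)
    also have "\<dots> = of_real (pi / sin (pi * z))"
      by (simp only: of_real_mult[symmetric] sin_of_real of_real_divide[symmetric])
    finally have "complex_of_real (Gamma z * Gamma (1 - z)) = of_real (pi / sin (pi * z))" .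
    then have "Gamma z * Gamma (1 - z) = pi / sin (pi * z)" by (simp only: of_real_eq_iff)
    moreover have "sin (pi * z) > 0" using z z1 by (intro sin_gt_zero) auto
    moreover have "Gamma z > 0" using z by simp
    ultimately show ?thesis by (simp add: field_simps)
  qed
  moreover have "2 * \<i> * of_real (sin (pi * z) * Gamma (1 - z)) = 2 * pi * \<i> / complex_of_real (Gamma z)"
    unfolding X by simp
  ultimately show ?thesis by (simp only:)
qed

lemma cos_le_obtuse:
  assumes "pi / 2 < \<theta>" "\<theta> \<le> v" "v \<le> pi" shows "cos v \<le> cos \<theta>" "cos \<theta> < 0"
  using assms cos_monotone_0_pi_le[of \<theta> v] cos_gt_zero_pi[of "pi - \<theta>"] by auto

text \<open>Shortening the arc from \<open>\<pi>\<close> to \<open>\<theta>\<close> removes two pieces on which \<open>exp \<zeta>\<close> is tiny.\<close>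

lemma hankel_limit_base:
  assumes \<theta>: "pi / 2 < \<theta>" "\<theta> \<le> pi" and z: "0 < z" "z \<le> 1"
  shows "(vertical_integral \<theta> (hankel_integrand z) \<longlongrightarrow> 2 * pi * \<i> / of_real (Gamma z)) at_top"
proof -
  obtain G where G: "\<And>w. (G has_field_derivative hankel_integrand z w) (at w)" using hankel_primitive by metis
  define c where "c = - cos \<theta>"
  have c: "c > 0" using cos_le_obtuse[OF \<theta>(1) order_refl \<theta>(2)] by (simp add: c_def)
  let ?B = "\<lambda>u. exp (- c * exp u + (1 - z) * u)"
  have bd: "norm (hankel_integrand z (Complex u v)) \<le> ?B u" if "\<theta> \<le> \<bar>v\<bar>" "\<bar>v\<bar> \<le> pi" for u v
  proof -
    have "cos v \<le> - c" using cos_le_obtuse(1)[OF \<theta>(1) that] by (simp add: c_def abs_if split: if_splits)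
    then have "exp u * cos v \<le> exp u * - c" by (intro mult_left_mono) auto
    then show ?thesis by (simp add: norm_hankel mult.commute)
  qed
  have "((\<lambda>u. (G (Complex u pi) - G (Complex u (- pi))) - vertical_integral \<theta> (hankel_integrand z) u) \<longlongrightarrow> 0) at_top"
  proof (rule Lim_null_comparison)
    have "norm ((G (Complex u pi) - G (Complex u (- pi))) - vertical_integral \<theta> (hankel_integrand z) u) \<le> 2 * pi * ?B u" for u
    proof -
      have V: "vertical_integral \<theta> (hankel_integrand z) u = G (Complex u \<theta>) - G (Complex u (- \<theta>))"
        by (rule vertical_integral_primitive[of UNIV]) (use G in auto)
      have 1: "norm (G (Complex u pi) - G (Complex u \<theta>)) \<le> ?B u * (pi - \<theta>)"
        using \<theta> G bd pi_gt_zero by (intro vertical_mvt[where F = "hankel_integrand z"]) auto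
      have 2: "norm (G (Complex u (- \<theta>)) - G (Complex u (- pi))) \<le> ?B u * (- \<theta> - - pi)"
        using \<theta> G bd pi_gt_zero by (intro vertical_mvt[where F = "hankel_integrand z"]) auto
      have 3: "?B u * (pi - \<theta>) \<le> ?B u * pi"
        using \<theta> pi_gt_zero by (intro mult_left_mono) auto
      have "(G (Complex u pi) - G (Complex u (- pi))) - vertical_integral \<theta> (hankel_integrand z) u =
        (G (Complex u pi) - G (Complex u \<theta>)) + (G (Complex u (- \<theta>)) - G (Complex u (- pi)))"
        unfolding V by simp
      also have "norm \<dots> \<le> ?B u * (pi - \<theta>) + ?B u * (- \<theta> - - pi)"
        by (rule order_trans[OF norm_triangle_ineq add_mono[OF 1 2]])
      also have "\<dots> \<le> 2 * pi * ?B u" using 3 by (simp add: algebra_simps)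
      finally show ?thesis .
    qed
    then show "\<forall>\<^sub>F u in at_top. norm ((G (Complex u pi) - G (Complex u (- pi))) - vertical_integral \<theta> (hankel_integrand z) u) \<le> 2 * pi * ?B u"
      by simp
    show "((\<lambda>u. 2 * pi * ?B u) \<longlongrightarrow> 0) at_top"
      using tendsto_mult_right_zero[OF exp_exp_decay[OF c]] by simp
  qed
  from tendsto_diff[OF hankel_pi_limit[OF G z] this] show ?thesis by simp
qed

text \<open>Hankel's formula. Integration by parts, that is, the derivative of \<open>exp (exp w - z w)\<close>, reproduces the recurrence
  \<open>\<Gamma>(z + 1) = z \<Gamma>(z)\<close> and carries the formula from \<open>(0, 1]\<close> to all \<open>z > 0\<close>.\<close>

lemma hankel_limit:
  assumes \<theta>: "pi / 2 < \<theta>" "\<theta> \<le> pi" and z: "0 < z"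
  shows "(vertical_integral \<theta> (hankel_integrand z) \<longlongrightarrow> 2 * pi * \<i> / of_real (Gamma z)) at_top"
proof -
  define c where "c = - cos \<theta>"
  have c: "c > 0" using cos_le_obtuse[OF \<theta>(1) order_refl \<theta>(2)] by (simp add: c_def)
  have step: "(vertical_integral \<theta> (hankel_integrand (z + 1)) \<longlongrightarrow> 2 * pi * \<i> / of_real (Gamma (z + 1))) at_top"
    if z: "z > 0" and IH: "(vertical_integral \<theta> (hankel_integrand z) \<longlongrightarrow> 2 * pi * \<i> / of_real (Gamma z)) at_top" for z
  proof -
    obtain G where G: "\<And>w. (G has_field_derivative hankel_integrand z w) (at w)" using hankel_primitive by metis
    define G1 where "G1 = (\<lambda>w. (G w - exp (exp w - of_real z * w)) / of_real z)"
    have G1: "(G1 has_field_derivative hankel_integrand (z + 1) w) (at w)" for w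
    proof -
      have "hankel_integrand z w - exp (exp w - of_real z * w) * (exp w - of_real z) = of_real z * hankel_integrand (z + 1) w"
        by (simp add: hankel_integrand_def algebra_simps exp_add exp_diff diff_divide_distrib)
      moreover have "(G1 has_field_derivative (hankel_integrand z w - exp (exp w - of_real z * w) * (exp w - of_real z)) / of_real z) (at w)"
        unfolding G1_def using z by (auto intro!: derivative_eq_intros G)
      ultimately show ?thesis using z by simp
    qed
    have V: "vertical_integral \<theta> (hankel_integrand z) u = G (Complex u \<theta>) - G (Complex u (- \<theta>))" for u
        by (rule vertical_integral_primitive[of UNIV]) (use G in auto)
    have V1: "vertical_integral \<theta> (hankel_integrand (z + 1)) u = G1 (Complex u \<theta>) - G1 (Complex u (- \<theta>))" for u
        by (rule vertical_integral_primitive[of UNIV]) (use G1 in auto)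
    have small: "((\<lambda>u. exp (exp (Complex u y) - of_real z * Complex u y)) \<longlongrightarrow> 0) at_top" if "cos y = - c" for y
    proof (rule tendsto_norm_zero_cancel)
      show "((\<lambda>u. norm (exp (exp (Complex u y) - of_real z * Complex u y))) \<longlongrightarrow> 0) at_top"
        using exp_exp_decay[OF c, of "- z"] that by (simp add: Re_exp mult.commute)
    qed
    have "vertical_integral \<theta> (hankel_integrand (z + 1)) = (\<lambda>u. (vertical_integral \<theta> (hankel_integrand z) u - (exp (exp (Complex u \<theta>) - of_real z * Complex u \<theta>)
         - exp (exp (Complex u (- \<theta>)) - of_real z * Complex u (- \<theta>)))) / of_real z)"
      unfolding V V1 G1_def fun_eq_iff using z by (simp add: field_simps)
    moreover have "((\<lambda>u. (vertical_integral \<theta> (hankel_integrand z) u - (exp (exp (Complex u \<theta>) - of_real z * Complex u \<theta>)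
         - exp (exp (Complex u (- \<theta>)) - of_real z * Complex u (- \<theta>)))) / of_real z) \<longlongrightarrow>
        (2 * pi * \<i> / of_real (Gamma z) - (0 - 0)) / of_real z) at_top"
      using z by (intro tendsto_intros IH small) (auto simp: c_def)
    moreover have "(2 * pi * \<i> / of_real (Gamma z) - (0 - 0)) / of_real z = 2 * pi * \<i> / of_real (Gamma (z + 1))"
      using z Gamma_plus1[of z] by (simp add: nonpos_Ints_def field_simps)
    ultimately show ?thesis by simp
  qed
  have "\<forall>z. real n < z \<and> z \<le> real n + 1 \<longrightarrow> (vertical_integral \<theta> (hankel_integrand z) \<longlongrightarrow> 2 * pi * \<i> / of_real (Gamma z)) at_top" for n
  proof (induction n)
    case 0 then show ?case using hankel_limit_base[OF \<theta>] by simp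
  next
    case (Suc n)
    show ?case
    proof (intro allI impI)
      fix z assume "real (Suc n) < z \<and> z \<le> real (Suc n) + 1"
      then show "(vertical_integral \<theta> (hankel_integrand z) \<longlongrightarrow> 2 * pi * \<i> / of_real (Gamma z)) at_top"
        using step[of "z - 1"] Suc.IH[rule_format, of "z - 1"] by auto
    qed
  qed
  moreover have "real (nat (\<lceil>z\<rceil> - 1)) < z" "z \<le> real (nat (\<lceil>z\<rceil> - 1)) + 1"
    using z by linarith+
  ultimately show ?thesis by blast
qed

text \<open>The part of the contour beyond radius \<open>exp N\<close>. The factor \<open>exp (- z N)\<close> makes the error summable against the
  Mittag-Leffler series.\<close>

lemma hankel_tail:
  assumes \<theta>: "pi / 2 < \<theta>" "\<theta> \<le> pi" and z: "0 < z"
  shows "norm (2 * pi * \<i> / of_real (Gamma z) - vertical_integral \<theta> (hankel_integrand z) N)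
    \<le> 2 / (- cos \<theta>) * exp (- z * N) * exp (cos \<theta> * exp N)"
proof -
  define c where "c = - cos \<theta>"
  have c: "c > 0" using cos_le_obtuse[OF \<theta>(1) order_refl \<theta>(2)] by (simp add: c_def)
  obtain G where G: "\<And>w. (G has_field_derivative hankel_integrand z w) (at w)" using hankel_primitive by metis
  have V: "vertical_integral \<theta> (hankel_integrand z) u = G (Complex u \<theta>) - G (Complex u (- \<theta>))" for u
    by (rule vertical_integral_primitive[of UNIV]) (use G in auto)
  let ?R = "exp (- z * N) * exp (- c * exp N) / c"
  have ray: "norm (G (Complex M y) - G (Complex N y)) \<le> ?R" if "M \<ge> N" "cos y = - c" for M y
  proof -
    have "norm (G (Complex M y) - G (Complex N y))
      \<le> - (exp (- z * N) * exp (- c * exp M) / c) - - (exp (- z * N) * exp (- c * exp N) / c)"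
    proof (rule horizontal_mvt[where F = "hankel_integrand z" and m = "\<lambda>u. exp (- z * N) * (exp (- c * exp u) * exp u)"])
      fix u assume "N \<le> u"
      then have "z * N \<le> z * u" using z by simp
      then have "exp (- c * exp u + u - z * u) \<le> exp (- c * exp u + u - z * N)"  by simp
      then show "norm (hankel_integrand z (Complex u y)) \<le> exp (- z * N) * (exp (- c * exp u) * exp u)"
        by (simp add: norm_hankel that exp_add[symmetric] algebra_simps)
      show "((\<lambda>u. - (exp (- z * N) * exp (- c * exp u) / c)) has_real_derivative exp (- z * N) * (exp (- c * exp u) * exp u)) (at u)"
        using c by (auto intro!: derivative_eq_intros)
    qed (use that G in auto)
    also have "\<dots> \<le> ?R" using c by simp
    finally show ?thesis .
  qed
  have "norm (vertical_integral \<theta> (hankel_integrand z) M - vertical_integral \<theta> (hankel_integrand z) N) \<le> 2 * ?R" if "M \<ge> N" for M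
  proof -
    have "vertical_integral \<theta> (hankel_integrand z) M - vertical_integral \<theta> (hankel_integrand z) N =
      (G (Complex M \<theta>) - G (Complex N \<theta>)) - (G (Complex M (- \<theta>)) - G (Complex N (- \<theta>)))"
      unfolding V by simp
    also have "norm \<dots> \<le> ?R + ?R"
      by (rule order_trans[OF norm_triangle_ineq4 add_mono[OF ray[OF that] ray[OF that]]]) (auto simp: c_def)
    finally show ?thesis by simp
  qed
  then have "\<forall>\<^sub>F M in at_top. norm (vertical_integral \<theta> (hankel_integrand z) M - vertical_integral \<theta> (hankel_integrand z) N) \<le> 2 * ?R"
    by (intro eventually_mono[OF eventually_ge_at_top[of N]])
  moreover have "((\<lambda>M. norm (vertical_integral \<theta> (hankel_integrand z) M - vertical_integral \<theta> (hankel_integrand z) N)) \<longlongrightarrow>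
     norm (2 * pi * \<i> / of_real (Gamma z) - vertical_integral \<theta> (hankel_integrand z) N)) at_top"
    by (intro tendsto_intros hankel_limit assms)
  ultimately have "norm (2 * pi * \<i> / of_real (Gamma z) - vertical_integral \<theta> (hankel_integrand z) N) \<le> 2 * ?R"
    by (intro tendsto_upperbound) auto
  then show ?thesis by (simp add: c_def mult.assoc)
qed

text \<open>Hankel's formula at radius \<open>exp N\<close> bounds \<open>1 / \<Gamma>(z)\<close> by a multiple of \<open>exp (- z N)\<close> for every \<open>N\<close>, which
  gives the entire Mittag-Leffler series its infinite radius of convergence without Stirling's formula.\<close>

lemma rGamma_decay: "\<exists>K. \<forall>z::real. z > 0 \<longrightarrow> 1 / Gamma z \<le> K * exp (- z * N)"
proof (intro exI allI impI)
  fix z :: real assume z: "z > 0"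
  obtain G where G: "\<And>w. (G has_field_derivative hankel_integrand z w) (at w)" using hankel_primitive by metis
  have V: "vertical_integral pi (hankel_integrand z) u = G (Complex u pi) - G (Complex u (- pi))" for u
    by (rule vertical_integral_primitive[of UNIV]) (use G in auto)
  have 1: "norm (vertical_integral pi (hankel_integrand z) N) \<le> exp (exp N + (1 - z) * N) * (pi - - pi)"
    unfolding V by (rule vertical_mvt[where F = "hankel_integrand z"]) (use G in \<open>auto simp: norm_hankel\<close>)
  have 2: "norm (2 * pi * \<i> / of_real (Gamma z) - vertical_integral pi (hankel_integrand z) N) \<le> 2 * exp (- z * N) * exp (- exp N)"
    using hankel_tail[of pi z N] z by simp
  have "norm (2 * pi * \<i> / of_real (Gamma z)) \<le>
     norm (2 * pi * \<i> / of_real (Gamma z) - vertical_integral pi (hankel_integrand z) N) + norm (vertical_integral pi (hankel_integrand z) N)"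
    using norm_triangle_ineq[of "2 * pi * \<i> / of_real (Gamma z) - vertical_integral pi (hankel_integrand z) N" "vertical_integral pi (hankel_integrand z) N"] by simp
  also have "\<dots> \<le> 2 * exp (- z * N) * exp (- exp N) + exp (exp N + (1 - z) * N) * (pi - - pi)"
    using 1 2 by simp
  also have "exp (exp N + (1 - z) * N) = exp (exp N + N) * exp (- z * N)"
    by (simp add: exp_add[symmetric] algebra_simps)
  finally have "2 * pi * (1 / Gamma z) \<le> (2 * exp (- exp N) + 2 * pi * exp (exp N + N)) * exp (- z * N)"
    using z by (simp add: norm_mult norm_divide algebra_simps)
  then have "2 * pi * (1 / Gamma z) / (2 * pi) \<le> (2 * exp (- exp N) + 2 * pi * exp (exp N + N)) * exp (- z * N) / (2 * pi)"
    by (intro divide_right_mono) auto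
  then show "1 / Gamma z \<le> ((2 * exp (- exp N) + 2 * pi * exp (exp N + N)) / (2 * pi)) * exp (- z * N)"
    by simp
qed

lemma mittag_leffler_summable:
  fixes z :: real
  assumes "\<gamma> > 0"
  shows "summable (\<lambda>j. z ^ j / Gamma (\<gamma> * real j + \<beta>))"
proof -
  \<comment> \<open>This radius makes the majorant geometric with ratio at most one half.\<close>
  define N where "N = ln (2 * (\<bar>z\<bar> + 1)) / \<gamma>"
  obtain K where K: "\<And>z::real. z > 0 \<Longrightarrow> 1 / Gamma z \<le> K * exp (- z * N)" using rGamma_decay by blast
  have q: "\<bar>z\<bar> * exp (- \<gamma> * N) \<le> 1 / 2"
    using assms by (simp add: N_def exp_minus field_simps)
  have "K \<ge> 0" using K[of 1] by (smt (verit) Gamma_1 div_by_1 exp_gt_zero mult_nonpos_nonneg)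
  show ?thesis
  proof (rule summable_comparison_test_ev)
    have "\<forall>\<^sub>F j in sequentially. \<gamma> * real j + \<beta> > 0"
      using assms by real_asymp
    then show "\<forall>\<^sub>F j in sequentially. norm (z ^ j / Gamma (\<gamma> * real j + \<beta>)) \<le> K * exp (- \<beta> * N) * (1 / 2) ^ j"
    proof eventually_elim
      case (elim j)
      have "norm (z ^ j / Gamma (\<gamma> * real j + \<beta>)) = \<bar>z\<bar> ^ j * (1 / Gamma (\<gamma> * real j + \<beta>))"
        using elim by (simp add: power_abs)
      also have "\<dots> \<le> \<bar>z\<bar> ^ j * (K * exp (- (\<gamma> * real j + \<beta>) * N))"
        using K[OF elim] by (intro mult_left_mono) auto
      also have "exp (- (\<gamma> * real j + \<beta>) * N) = exp (- \<beta> * N) * exp (- \<gamma> * N) ^ j"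
        by (simp add: exp_of_nat_mult[symmetric] exp_add[symmetric] algebra_simps)
      also have "\<bar>z\<bar> ^ j * (K * (exp (- \<beta> * N) * exp (- \<gamma> * N) ^ j)) = K * exp (- \<beta> * N) * (\<bar>z\<bar> * exp (- \<gamma> * N)) ^ j"
        by (simp add: power_mult_distrib)
      also have "\<dots> \<le> K * exp (- \<beta> * N) * (1 / 2) ^ j"
        using q \<open>K \<ge> 0\<close> by (intro mult_left_mono power_mono) auto
      finally show ?case .
    qed
  qed (simp add: summable_geometric)
qed

section \<open>Decay of Mittag-Leffler functions on the negative half-line\<close>

text \<open>The integrand \<open>exp \<zeta> * \<zeta> powr (\<gamma> - \<beta>) / (\<zeta> powr \<gamma> + x)\<close> that represents \<open>E(\<gamma>, \<beta>; - x)\<close>, in the coordinate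
  \<open>\<zeta> = exp w\<close>.\<close>

definition ml_integrand :: "real \<Rightarrow> real \<Rightarrow> real \<Rightarrow> complex \<Rightarrow> complex" where
  "ml_integrand \<gamma> \<beta> x w = exp (exp w + of_real (\<gamma> - \<beta> + 1) * w) / (exp (of_real \<gamma> * w) + of_real x)"

text \<open>For an angle \<open>a\<close> with \<open>\<bar>a\<bar> < \<pi>\<close> one has \<open>\<bar>r cis a + x\<bar> \<ge> cos (a / 2) (r + x)\<close>; the difference of the squares is
  \<open>(1 - cos a) (r - x)^2 / 2\<close>.\<close>

lemma ml_integrand_denom_bound:
  assumes "\<gamma> > 0" "\<bar>Im w\<bar> \<le> \<theta>" "\<gamma> * \<theta> < pi" "x \<ge> 0"
  shows "cos (\<gamma> * \<theta> / 2) * (exp (\<gamma> * Re w) + x) \<le> norm (exp (of_real \<gamma> * w) + of_real x)"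
proof (rule power2_le_imp_le)
  define r a where "r = exp (\<gamma> * Re w)" and "a = \<gamma> * Im w"
  have r: "r > 0" by (simp add: r_def)
  have "\<bar>a\<bar> \<le> \<gamma> * \<theta>" using assms(1,2) by (simp add: a_def abs_mult)
  then have "cos (\<gamma> * \<theta> / 2) \<le> cos \<bar>a / 2\<bar>"
    using assms(3) by (intro cos_monotone_0_pi_le) auto
  moreover have "cos \<bar>a / 2\<bar> = cos (a / 2)" by (cases "a \<ge> 0") (auto simp: abs_if)
  ultimately have c: "cos (\<gamma> * \<theta> / 2) \<le> cos (a / 2)" by (simp only:)
  have "0 \<le> \<gamma> * \<theta> / 2" using assms(1,2) by (intro divide_nonneg_nonneg mult_nonneg_nonneg) auto
  then have c0: "0 \<le> cos (\<gamma> * \<theta> / 2)" using assms(3) by (intro cos_ge_zero) auto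
  have "(cos (\<gamma> * \<theta> / 2) * (r + x))\<^sup>2 = (cos (\<gamma> * \<theta> / 2))\<^sup>2 * (r + x)\<^sup>2" by (simp add: power_mult_distrib)
  also have "\<dots> \<le> (cos (a / 2))\<^sup>2 * (r + x)\<^sup>2"
    using c c0 by (intro mult_right_mono power_mono) auto
  also have "(cos (a / 2))\<^sup>2 = (1 + cos a) / 2" using cos_double_cos[of "a / 2"] by simp
  also have "(1 + cos a) / 2 * (r + x)\<^sup>2 = (r\<^sup>2 + x\<^sup>2 + 2 * r * x * cos a) - (1 - cos a) / 2 * (r - x)\<^sup>2"
    by (simp add: power2_eq_square field_simps)
  also have "\<dots> \<le> r\<^sup>2 + x\<^sup>2 + 2 * r * x * cos a" by simp
  also have "\<dots> = (r * cos a + x)\<^sup>2 + (r * sin a)\<^sup>2"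
  proof -
    have "(r * cos a + x)\<^sup>2 + (r * sin a)\<^sup>2 = r\<^sup>2 * ((sin a)\<^sup>2 + (cos a)\<^sup>2) + x\<^sup>2 + 2 * r * x * cos a"
      by algebra
    then show ?thesis by (simp only: sin_cos_squared_add mult_1_right)
  qed
  also have "\<dots> = (norm (exp (of_real \<gamma> * w) + of_real x))\<^sup>2"
    by (simp add: cmod_power2 Re_exp Im_exp r_def a_def)
  finally show "(cos (\<gamma> * \<theta> / 2) * (exp (\<gamma> * Re w) + x))\<^sup>2 \<le> (norm (exp (of_real \<gamma> * w) + of_real x))\<^sup>2"
    by (simp add: r_def)
qed simp

lemma norm_ml_integrand_le:
  assumes "\<gamma> > 0" "\<bar>v\<bar> \<le> \<theta>" "\<gamma> * \<theta> < pi" "x \<ge> 0"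
  shows "norm (ml_integrand \<gamma> \<beta> x (Complex u v)) \<le>
     exp (exp u * cos v + (\<gamma> - \<beta> + 1) * u) / (cos (\<gamma> * \<theta> / 2) * (exp (\<gamma> * u) + x))"
proof -
  have "0 \<le> \<gamma> * \<theta> / 2" using assms(1,2) by (intro divide_nonneg_nonneg mult_nonneg_nonneg) auto
  then have c0: "0 < cos (\<gamma> * \<theta> / 2)" using assms(3) by (intro cos_gt_zero_pi) auto
  have "0 < exp (\<gamma> * u) + x" using assms(4) by (simp add: add_pos_nonneg)
  then show ?thesis
    unfolding ml_integrand_def norm_divide
    using ml_integrand_denom_bound[of \<gamma> "Complex u v" \<theta> x] assms c0
    by (auto simp: Re_exp intro!: frac_le)
qed

lemma ml_integrand_denom_nonzero:
  assumes "\<gamma> > 0" "\<bar>Im w\<bar> < pi / \<gamma>" "x \<ge> 0"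
  shows "exp (of_real \<gamma> * w) + of_real x \<noteq> 0"
proof -
  have a: "\<gamma> * \<bar>Im w\<bar> < pi" using assms by (simp add: field_simps)
  moreover have "0 \<le> \<gamma> * \<bar>Im w\<bar>" using assms(1) by simp
  ultimately have "0 < cos (\<gamma> * \<bar>Im w\<bar> / 2)" by (intro cos_gt_zero_pi) auto
  moreover have "0 < exp (\<gamma> * Re w) + x" using assms(3) by (simp add: add_pos_nonneg)
  ultimately have "0 < cos (\<gamma> * \<bar>Im w\<bar> / 2) * (exp (\<gamma> * Re w) + x)" by simp
  also have "\<dots> \<le> norm (exp (of_real \<gamma> * w) + of_real x)"
    by (rule ml_integrand_denom_bound[OF assms(1) order_refl a assms(3)])
  finally show ?thesis by auto
qed

text \<open>One step of the geometric series for \<open>1 / (\<zeta> powr \<gamma> + x)\<close>.\<close>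

lemma ml_integrand_rec:
  assumes "exp (of_real \<gamma> * w) + of_real x \<noteq> 0"
  shows "ml_integrand \<gamma> \<beta> x w = hankel_integrand \<beta> w - of_real x * ml_integrand \<gamma> (\<beta> + \<gamma>) x w"
proof -
  have "exp (exp w + of_real (\<gamma> - \<beta> + 1) * w) = hankel_integrand \<beta> w * exp (of_real \<gamma> * w)"
    by (simp add: hankel_integrand_def exp_add[symmetric] algebra_simps)
  moreover have "exp (exp w + of_real (\<gamma> - (\<beta> + \<gamma>) + 1) * w) = hankel_integrand \<beta> w"
    by (simp add: hankel_integrand_def algebra_simps)
  ultimately show ?thesis using assms unfolding ml_integrand_def by (simp add: field_simps)
qed

lemma vertical_segment_in_strip:
  assumes "w \<in> closed_segment (Complex N (- \<theta>)) (Complex N \<theta>)" "0 \<le> \<theta>"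
  shows "\<bar>Im w\<bar> \<le> \<theta>" "w = Complex N (Im w)"
  using closed_segment_same_Re[OF assms(1)] assms(2) by (auto simp: complex_eq_iff)

lemma ml_integrand_continuous:
  assumes "\<gamma> > 0" "0 \<le> \<theta>" "\<gamma> * \<theta> < pi" "x \<ge> 0"
  shows "continuous_on (closed_segment (Complex N (- \<theta>)) (Complex N \<theta>)) (ml_integrand \<gamma> \<beta> x)"
  unfolding ml_integrand_def
proof (intro continuous_intros ballI)
  fix w assume "w \<in> closed_segment (Complex N (- \<theta>)) (Complex N \<theta>)"
  from vertical_segment_in_strip(1)[OF this assms(2)]
  show "exp (of_real \<gamma> * w) + of_real x \<noteq> 0"
    using assms by (intro ml_integrand_denom_nonzero) (auto simp: field_simps intro: le_less_trans[OF mult_left_mono])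
qed

lemma vertical_integral_bound:
  assumes "continuous_on (closed_segment (Complex N (- \<theta>)) (Complex N \<theta>)) F" "0 \<le> \<theta>"
    and "\<And>v. \<bar>v\<bar> \<le> \<theta> \<Longrightarrow> norm (F (Complex N v)) \<le> B"
  shows "norm (vertical_integral \<theta> F N) \<le> B * (2 * \<theta>)"
proof -
  have "B \<ge> 0" using assms(3)[of 0] assms(2) by (auto intro: order_trans[OF norm_ge_zero])
  have "norm (vertical_integral \<theta> F N) \<le> B * norm (Complex N \<theta> - Complex N (- \<theta>))"
    unfolding vertical_integral_def
  proof (rule contour_integral_bound_linepath[OF contour_integrable_continuous_linepath[OF assms(1)] \<open>B \<ge> 0\<close>])
    fix w assume w: "w \<in> closed_segment (Complex N (- \<theta>)) (Complex N \<theta>)"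
    show "norm (F w) \<le> B"
      using assms(3)[OF vertical_segment_in_strip(1)[OF w assms(2)]] vertical_segment_in_strip(2)[OF w assms(2)] by simp
  qed
  also have "Complex N \<theta> - Complex N (- \<theta>) = \<i> * of_real (2 * \<theta>)" by (simp add: complex_eq_iff)
  also have "norm \<dots> = 2 * \<theta>" using assms(2) by (simp add: norm_mult del: of_real_mult)
  finally show ?thesis .
qed

lemma ml_contour_partial_sum:
  assumes "\<gamma> > 0" "0 \<le> \<theta>" "\<gamma> * \<theta> < pi" "x \<ge> 0"
  shows "vertical_integral \<theta> (ml_integrand \<gamma> \<beta> x) N = (\<Sum>j<J. (- of_real x) ^ j * vertical_integral \<theta> (hankel_integrand (\<gamma> * real j + \<beta>)) N)
     + (- of_real x) ^ J * vertical_integral \<theta> (ml_integrand \<gamma> (\<gamma> * real J + \<beta>) x) N"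
proof (induction J)
  case (Suc J)
  let ?S = "closed_segment (Complex N (- \<theta>)) (Complex N \<theta>)"
  let ?b = "\<gamma> * real J + \<beta>"
  have "continuous_on ?S (hankel_integrand ?b)" unfolding hankel_integrand_def by (intro continuous_intros)
  then have i1: "hankel_integrand ?b contour_integrable_on linepath (Complex N (- \<theta>)) (Complex N \<theta>)"
    by (rule contour_integrable_continuous_linepath)
  have i2: "ml_integrand \<gamma> (?b + \<gamma>) x contour_integrable_on linepath (Complex N (- \<theta>)) (Complex N \<theta>)"
    by (intro contour_integrable_continuous_linepath ml_integrand_continuous assms)
  have "vertical_integral \<theta> (ml_integrand \<gamma> ?b x) N = contour_integral (linepath (Complex N (- \<theta>)) (Complex N \<theta>))
     (\<lambda>w. hankel_integrand ?b w - of_real x * ml_integrand \<gamma> (?b + \<gamma>) x w)"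
    unfolding vertical_integral_def
  proof (rule contour_integral_eq)
    fix w assume "w \<in> path_image (linepath (Complex N (- \<theta>)) (Complex N \<theta>))"
    then have "\<bar>Im w\<bar> \<le> \<theta>" using vertical_segment_in_strip(1) assms(2) by simp
    then have "\<gamma> * \<bar>Im w\<bar> < pi" using assms by (meson le_less_trans mult_left_mono less_imp_le)
    then show "ml_integrand \<gamma> ?b x w = hankel_integrand ?b w - of_real x * ml_integrand \<gamma> (?b + \<gamma>) x w"
      using assms by (intro ml_integrand_rec ml_integrand_denom_nonzero) (auto simp: field_simps)
  qed
  also have "\<dots> = vertical_integral \<theta> (hankel_integrand ?b) N - of_real x * vertical_integral \<theta> (ml_integrand \<gamma> (?b + \<gamma>) x) N"
    unfolding vertical_integral_def
    by (subst contour_integral_diff[OF i1 contour_integrable_lmul[OF i2]]) (simp add: contour_integral_lmul[OF i2])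
  finally have st: "vertical_integral \<theta> (ml_integrand \<gamma> ?b x) N = vertical_integral \<theta> (hankel_integrand ?b) N - of_real x * vertical_integral \<theta> (ml_integrand \<gamma> (?b + \<gamma>) x) N" .
  have e: "\<gamma> * real (Suc J) + \<beta> = ?b + \<gamma>" by (simp add: algebra_simps)
  show ?case unfolding Suc.IH st e by (simp add: algebra_simps)
qed simp

text \<open>On an arc with \<open>x \<le> \<bar>\<zeta>\<bar> powr \<gamma> / 2\<close> the geometric series converges, and the integral turns into the
  Mittag-Leffler series with every \<open>1 / \<Gamma>\<close> replaced by its truncated Hankel integral.\<close>

lemma ml_contour_sums:
  assumes "\<gamma> > 0" "0 \<le> \<theta>" "\<gamma> * \<theta> < pi" "x \<ge> 0" and N: "x * exp (- \<gamma> * N) \<le> 1 / 2"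
  shows "(\<lambda>j. (- of_real x) ^ j * vertical_integral \<theta> (hankel_integrand (\<gamma> * real j + \<beta>)) N) sums vertical_integral \<theta> (ml_integrand \<gamma> \<beta> x) N"
proof -
  let ?\<kappa> = "cos (\<gamma> * \<theta> / 2)"
  have "0 \<le> \<gamma> * \<theta>" using assms by simp
  then have \<kappa>: "0 < ?\<kappa>" using assms(3) by (intro cos_gt_zero_pi) auto
  let ?R = "\<lambda>J. (- of_real x) ^ J * vertical_integral \<theta> (ml_integrand \<gamma> (\<gamma> * real J + \<beta>) x) N"
  let ?C = "exp (exp N + (1 - \<beta>) * N) / ?\<kappa> * (2 * \<theta>)"
  have "norm (?R J) \<le> ?C * (1 / 2) ^ J" for J
  proof -
    let ?b = "\<gamma> * real J + \<beta>"
    have "norm (vertical_integral \<theta> (ml_integrand \<gamma> ?b x) N) \<le> (exp (exp N + (1 - ?b) * N) / ?\<kappa>) * (2 * \<theta>)"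
    proof (rule vertical_integral_bound[OF ml_integrand_continuous[OF assms(1-4)] assms(2)])
      fix v assume v: "\<bar>v\<bar> \<le> \<theta>"
      have "norm (ml_integrand \<gamma> ?b x (Complex N v)) \<le> exp (exp N * cos v + (\<gamma> - ?b + 1) * N) / (?\<kappa> * (exp (\<gamma> * N) + x))"
        by (rule norm_ml_integrand_le) (use assms v in auto)
      also have "\<dots> \<le> exp (exp N + (\<gamma> - ?b + 1) * N) / (?\<kappa> * exp (\<gamma> * N))"
        using \<kappa> assms(4) by (intro frac_le) auto
      also have "\<dots> = exp (exp N + (1 - ?b) * N) / ?\<kappa>"
        using \<kappa> by (simp add: field_simps exp_add[symmetric])
      finally show "norm (ml_integrand \<gamma> ?b x (Complex N v)) \<le> exp (exp N + (1 - ?b) * N) / ?\<kappa>" .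
    qed
    then have "norm (?R J) \<le> x ^ J * ((exp (exp N + (1 - ?b) * N) / ?\<kappa>) * (2 * \<theta>))"
      unfolding norm_mult norm_power using assms(4) by (intro mult_mono) auto
    also have "exp (exp N + (1 - ?b) * N) = exp (exp N + (1 - \<beta>) * N) * exp (- \<gamma> * N) ^ J"
      by (simp add: exp_of_nat_mult[symmetric] exp_add[symmetric] algebra_simps)
    also have "x ^ J * (exp (exp N + (1 - \<beta>) * N) * exp (- \<gamma> * N) ^ J / ?\<kappa> * (2 * \<theta>)) = ?C * (x * exp (- \<gamma> * N)) ^ J"
      by (simp add: power_mult_distrib)
    also have "\<dots> \<le> ?C * (1 / 2) ^ J"
      using assms \<kappa> by (intro mult_left_mono power_mono) auto
    finally show ?thesis .
  qed
  moreover have "(\<lambda>J. ?C * (1 / 2) ^ J) \<longlonglongrightarrow> 0"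
    by (intro tendsto_mult_right_zero LIMSEQ_power_zero) simp
  ultimately have "?R \<longlonglongrightarrow> 0" by (intro Lim_null_comparison[of ?R]) auto
  then have "(\<lambda>J. vertical_integral \<theta> (ml_integrand \<gamma> \<beta> x) N - ?R J) \<longlonglongrightarrow> vertical_integral \<theta> (ml_integrand \<gamma> \<beta> x) N - 0"
    by (intro tendsto_intros)
  moreover have "(\<lambda>J. vertical_integral \<theta> (ml_integrand \<gamma> \<beta> x) N - ?R J) = (\<lambda>J. \<Sum>j<J. (- of_real x) ^ j * vertical_integral \<theta> (hankel_integrand (\<gamma> * real j + \<beta>)) N)"
    using ml_contour_partial_sum[OF assms(1-4), of \<beta> N] by (auto simp: fun_eq_iff algebra_simps)
  ultimately show ?thesis by (simp add: sums_def)
qed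

lemma exp_exp_bound:
  fixes c p :: real
  assumes "c > 0" shows "\<exists>K>0. \<forall>u\<ge>0. exp (- c * exp u + p * u) \<le> K * exp (- u)"
proof -
  let ?f = "\<lambda>u::real. exp (- c * exp u + (p + 1) * u)"
  have "\<forall>\<^sub>F u in at_top. ?f u < 1"
    using order_tendstoD(2)[OF exp_exp_decay[OF assms], of 1 "p + 1"] by simp
  then obtain U where U: "\<And>u. u \<ge> U \<Longrightarrow> ?f u < 1" by (auto simp: eventually_at_top_linorder)
  have "bounded (?f ` {0..max 0 U})"
    by (intro compact_imp_bounded compact_continuous_image continuous_intros) auto
  then obtain B where B: "\<And>u. 0 \<le> u \<Longrightarrow> u \<le> max 0 U \<Longrightarrow> \<bar>?f u\<bar> \<le> B"
    unfolding bounded_iff real_norm_def by (meson atLeastAtMost_iff imageI)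
  have "exp (- c * exp u + p * u) \<le> max 1 B * exp (- u)" if "u \<ge> 0" for u
  proof -
    have "?f u \<le> max 1 B" using U[of u] B[OF that] by (cases "u \<ge> U") (auto simp: le_max_iff_disj less_imp_le)
    then have "?f u * exp (- u) \<le> max 1 B * exp (- u)" by (intro mult_right_mono) auto
    then show ?thesis by (simp add: exp_add[symmetric] algebra_simps)
  qed
  then show ?thesis by (intro exI[of _ "max 1 B"]) auto
qed

text \<open>Up to the angle \<open>\<theta> < \<pi> / \<gamma>\<close> the integrand has no poles, so the large arc may be replaced by the unit arc
  and two rays. There the exponential is bounded or decays, and the denominator is at least a
  multiple of \<open>1 + x\<close>.\<close>

lemma ml_contour_bound:
  assumes \<gamma>: "\<gamma> > 0" and \<theta>: "pi / 2 < \<theta>" "\<theta> \<le> pi" "\<gamma> * \<theta> < pi"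
  shows "\<exists>K. \<forall>x\<ge>0. \<forall>N\<ge>0. norm (vertical_integral \<theta> (ml_integrand \<gamma> \<beta> x) N) \<le> K / (1 + x)"
proof -
  define c where "c = - cos \<theta>"
  have c: "c > 0" using cos_le_obtuse[OF \<theta>(1) order_refl \<theta>(2)] by (simp add: c_def)
  have \<theta>0: "\<theta> > 0" using \<theta>(1) pi_gt_zero by linarith
  let ?\<kappa> = "cos (\<gamma> * \<theta> / 2)"
  have "0 \<le> \<gamma> * \<theta>" using \<gamma> \<theta>0 by simp
  then have \<kappa>: "0 < ?\<kappa>" using \<theta>(3) by (intro cos_gt_zero_pi) auto
  obtain K where K: "K > 0" "\<And>u. u \<ge> 0 \<Longrightarrow> exp (- c * exp u + (\<gamma> - \<beta> + 1) * u) \<le> K * exp (- u)"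
    using exp_exp_bound[OF c] by blast
  show ?thesis
  proof (intro exI allI impI)
    fix x N :: real assume x: "x \<ge> 0" and N: "N \<ge> 0"
    let ?S = "{w. Im w < pi / \<gamma>} \<inter> {w. Im w > - (pi / \<gamma>)}"
    have "open ?S" by (intro open_Int open_halfspace_Im_lt open_halfspace_Im_gt)
    moreover have "convex ?S" by (intro convex_Int convex_halfspace_Im_lt convex_halfspace_Im_gt)
    moreover have "ml_integrand \<gamma> \<beta> x holomorphic_on ?S"
      unfolding ml_integrand_def using ml_integrand_denom_nonzero[OF \<gamma> _ x] by (intro holomorphic_intros) auto
    ultimately obtain G where "\<And>w. w \<in> ?S \<Longrightarrow> (G has_field_derivative ml_integrand \<gamma> \<beta> x w) (at w within ?S)"
      using holomorphic_convex_primitive'[of ?S] by metis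
    then have G: "\<And>w. w \<in> ?S \<Longrightarrow> (G has_field_derivative ml_integrand \<gamma> \<beta> x w) (at w)"
      using at_within_open[OF _ \<open>open ?S\<close>] by metis
    have strip: "Complex u v \<in> ?S" if "\<bar>v\<bar> \<le> \<theta>" for u v
    proof -
      have "\<gamma> * \<bar>v\<bar> < pi" using \<theta>(3) \<gamma> that by (meson le_less_trans mult_left_mono less_imp_le)
      then have "\<bar>v\<bar> < pi / \<gamma>" using \<gamma> by (simp add: field_simps)
      then show ?thesis by auto
    qed
    have V: "vertical_integral \<theta> (ml_integrand \<gamma> \<beta> x) u = G (Complex u \<theta>) - G (Complex u (- \<theta>))" for u
    proof (rule vertical_integral_primitive[of ?S])
      show "closed_segment (Complex u (- \<theta>)) (Complex u \<theta>) \<subseteq> ?S"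
      proof
        fix w assume w: "w \<in> closed_segment (Complex u (- \<theta>)) (Complex u \<theta>)"
        show "w \<in> ?S" using vertical_segment_in_strip[OF w] strip[of "Im w" u] \<theta>0 by simp
      qed
    qed (use G in auto)
    have ray: "norm (G (Complex N y) - G (Complex 0 y)) \<le> K / (?\<kappa> * (1 + x))" if y: "\<bar>y\<bar> = \<theta>" for y
    proof -
      have cy: "cos y = - c" using y by (auto simp: c_def abs_if split: if_splits)
      have "norm (G (Complex N y) - G (Complex 0 y)) \<le>
         - (K * exp (- N) / (?\<kappa> * (1 + x))) - - (K * exp (- 0) / (?\<kappa> * (1 + x)))"
      proof (rule horizontal_mvt[where F = "ml_integrand \<gamma> \<beta> x" and m = "\<lambda>u. K * exp (- u) / (?\<kappa> * (1 + x))" and M = "\<lambda>u. - (K * exp (- u) / (?\<kappa> * (1 + x)))"])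
        fix u :: real assume u: "0 \<le> u"
        have "norm (ml_integrand \<gamma> \<beta> x (Complex u y)) \<le> exp (exp u * cos y + (\<gamma> - \<beta> + 1) * u) / (?\<kappa> * (exp (\<gamma> * u) + x))"
          by (rule norm_ml_integrand_le) (use \<gamma> \<theta> x y in auto)
        also have "\<dots> \<le> (K * exp (- u)) / (?\<kappa> * (1 + x))"
          using K u \<kappa> x \<gamma> cy by (intro frac_le) (auto simp: mult.commute)
        finally show "norm (ml_integrand \<gamma> \<beta> x (Complex u y)) \<le> (K * exp (- u)) / (?\<kappa> * (1 + x))" .
        show "((\<lambda>u. - (K * exp (- u) / (?\<kappa> * (1 + x)))) has_real_derivative K * exp (- u) / (?\<kappa> * (1 + x))) (at u)"
          using \<kappa> x by (auto intro!: derivative_eq_intros)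
      qed (use N G strip y in auto)
      also have "\<dots> \<le> K / (?\<kappa> * (1 + x))" using K(1) \<kappa> x by simp
      finally show ?thesis .
    qed
    have arc: "norm (vertical_integral \<theta> (ml_integrand \<gamma> \<beta> x) 0) \<le> (exp 1 / (?\<kappa> * (1 + x))) * (2 * \<theta>)"
    proof (rule vertical_integral_bound[OF ml_integrand_continuous])
      fix v assume v: "\<bar>v\<bar> \<le> \<theta>"
      have "norm (ml_integrand \<gamma> \<beta> x (Complex 0 v)) \<le> exp (exp 0 * cos v + (\<gamma> - \<beta> + 1) * 0) / (?\<kappa> * (exp (\<gamma> * 0) + x))"
        by (rule norm_ml_integrand_le) (use \<gamma> \<theta> x v in auto)
      also have "\<dots> \<le> exp 1 / (?\<kappa> * (1 + x))" using \<kappa> x by (intro frac_le) auto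
      finally show "norm (ml_integrand \<gamma> \<beta> x (Complex 0 v)) \<le> exp 1 / (?\<kappa> * (1 + x))" .
    qed (use \<gamma> \<theta> x \<theta>0 in auto)
    have "vertical_integral \<theta> (ml_integrand \<gamma> \<beta> x) N = vertical_integral \<theta> (ml_integrand \<gamma> \<beta> x) 0 +
       ((G (Complex N \<theta>) - G (Complex 0 \<theta>)) - (G (Complex N (- \<theta>)) - G (Complex 0 (- \<theta>))))"
      unfolding V by simp
    also have "norm \<dots> \<le> (exp 1 / (?\<kappa> * (1 + x))) * (2 * \<theta>) + (K / (?\<kappa> * (1 + x)) + K / (?\<kappa> * (1 + x)))"
      using \<theta>0 by (intro order_trans[OF norm_triangle_ineq] add_mono arc order_trans[OF norm_triangle_ineq4] ray) auto
    also have "\<dots> = ((exp 1 * (2 * \<theta>) + 2 * K) / ?\<kappa>) / (1 + x)"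
      using \<kappa> x by (simp add: add_divide_distrib)
    finally show "norm (vertical_integral \<theta> (ml_integrand \<gamma> \<beta> x) N) \<le> ((exp 1 * (2 * \<theta>) + 2 * K) / ?\<kappa>) / (1 + x)" .
  qed
qed

text \<open>The decay on which all estimates rest. It combines the bound on the contour integral with its
  convergence to the Mittag-Leffler function; the hypothesis \<open>\<gamma> < 2\<close> leaves room for an angle
  between \<open>\<pi> / 2\<close> and \<open>\<pi> / \<gamma>\<close>.\<close>

theorem mittag_leffler_bound:
  assumes "1 < \<gamma>" "\<gamma> < 2" "0 < \<beta>"
  shows "\<exists>K. \<forall>x\<ge>0. \<bar>mittag_leffler \<gamma> \<beta> (- x)\<bar> \<le> K / (1 + x)"
proof -
  \<comment> \<open>Beyond \<open>\<pi> / 2\<close> the exponential decays along the rays; below \<open>\<pi> / \<gamma>\<close> there are no poles.\<close>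
  define \<theta> where "\<theta> = (pi / 2 + pi / \<gamma>) / 2"
  have g: "pi / 2 < pi / \<gamma>" "pi / \<gamma> < pi" using assms by (auto simp: field_simps)
  have \<theta>: "pi / 2 < \<theta>" "\<theta> < pi / \<gamma>"
  proof -
    have mid: "p < (p + q) / 2 \<and> (p + q) / 2 < q" if "p < q" for p q :: real using that by simp
    show "pi / 2 < \<theta>" "\<theta> < pi / \<gamma>" unfolding \<theta>_def using mid[OF g(1)] by simp_all
  qed
  have \<theta>: "pi / 2 < \<theta>" "\<theta> \<le> pi" "\<theta> < pi / \<gamma>" using \<theta> g(2) by auto
  have \<theta>g: "\<gamma> * \<theta> < pi" using \<theta>(3) assms by (simp add: field_simps)
  have \<theta>0: "0 \<le> \<theta>" using \<theta>(1) pi_gt_zero by linarith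
  define c where "c = - cos \<theta>"
  have c: "c > 0" using cos_le_obtuse[OF \<theta>(1) order_refl \<theta>(2)] by (simp add: c_def)
  have \<gamma>0: "\<gamma> > 0" using assms by simp
  obtain K where K: "\<And>x N. x \<ge> 0 \<Longrightarrow> N \<ge> 0 \<Longrightarrow> norm (vertical_integral \<theta> (ml_integrand \<gamma> \<beta> x) N) \<le> K / (1 + x)"
    using ml_contour_bound[OF \<gamma>0 \<theta>(1,2) \<theta>g] by metis
  have "\<bar>mittag_leffler \<gamma> \<beta> (- x)\<bar> \<le> (K / (2 * pi)) / (1 + x)" if x: "x \<ge> 0" for x
  proof -
    let ?E = "2 * pi * \<i> * of_real (mittag_leffler \<gamma> \<beta> (- x))"
    have "(\<lambda>j. (- x) ^ j / Gamma (\<gamma> * real j + \<beta>)) sums mittag_leffler \<gamma> \<beta> (- x)"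
      unfolding mittag_leffler_def by (intro summable_sums mittag_leffler_summable \<gamma>0)
    then have Es: "(\<lambda>j. 2 * pi * \<i> * of_real ((- x) ^ j / Gamma (\<gamma> * real j + \<beta>))) sums ?E"
      by (intro sums_mult sums_of_real)
    \<comment> \<open>Term by term, the error is the tail of Hankel's formula.\<close>
    have close: "norm (?E - vertical_integral \<theta> (ml_integrand \<gamma> \<beta> x) N) \<le> 4 / c * exp (- c * exp N + (- \<beta>) * N)"
      if N: "x * exp (- \<gamma> * N) \<le> 1 / 2" for N
    proof -
      let ?d = "\<lambda>j. 2 * pi * \<i> * of_real ((- x) ^ j / Gamma (\<gamma> * real j + \<beta>)) - (- of_real x) ^ j * vertical_integral \<theta> (hankel_integrand (\<gamma> * real j + \<beta>)) N"
      let ?B = "2 / c * exp (- \<beta> * N) * exp (- c * exp N)"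
      have ds: "?d sums (?E - vertical_integral \<theta> (ml_integrand \<gamma> \<beta> x) N)"
        by (intro sums_diff Es ml_contour_sums \<gamma>0 \<theta>0 \<theta>g x N)
      have db: "norm (?d j) \<le> ?B * (1 / 2) ^ j" for j
      proof -
        let ?z = "\<gamma> * real j + \<beta>"
        have z: "?z > 0" using \<gamma>0 assms(3) by (simp add: add_nonneg_pos)
        have "?d j = (- of_real x) ^ j * (2 * pi * \<i> / of_real (Gamma ?z) - vertical_integral \<theta> (hankel_integrand ?z) N)"
          by (simp add: algebra_simps)
        then have "norm (?d j) = x ^ j * norm (2 * pi * \<i> / of_real (Gamma ?z) - vertical_integral \<theta> (hankel_integrand ?z) N)"
          using x by (simp add: norm_mult norm_power)
        also have "\<dots> \<le> x ^ j * (2 / c * exp (- ?z * N) * exp (- c * exp N))"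
          using hankel_tail[OF \<theta>(1,2) z, of N] x by (intro mult_left_mono) (auto simp: c_def)
        also have "exp (- ?z * N) = exp (- \<beta> * N) * exp (- \<gamma> * N) ^ j"
          by (simp add: exp_of_nat_mult[symmetric] exp_add[symmetric] algebra_simps)
        also have "x ^ j * (2 / c * (exp (- \<beta> * N) * exp (- \<gamma> * N) ^ j) * exp (- c * exp N)) = ?B * (x * exp (- \<gamma> * N)) ^ j"
          by (simp add: power_mult_distrib)
        also have "\<dots> \<le> ?B * (1 / 2) ^ j"
          using N x c by (intro mult_left_mono power_mono) auto
        finally show ?thesis .
      qed
      have gs: "(\<lambda>j. ?B * (1 / 2) ^ j) sums (?B * 2)"
        using geometric_sums[of "1 / 2 :: real"] by (intro sums_mult) simp
      have "norm (?E - vertical_integral \<theta> (ml_integrand \<gamma> \<beta> x) N) = norm (suminf ?d)" using ds by (simp add: sums_iff)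
      also have "\<dots> \<le> (\<Sum>j. ?B * (1 / 2) ^ j)"
        using db gs by (intro norm_suminf_le) (auto simp: sums_iff)
      also have "\<dots> = ?B * 2" using gs by (simp add: sums_iff)
      also have "\<dots> = 4 / c * exp (- c * exp N + (- \<beta>) * N)"
        by (simp add: exp_add[symmetric])
      finally show ?thesis .
    qed
    have "\<forall>\<^sub>F N in at_top. x * exp (- \<gamma> * N) \<le> 1 / 2"
    proof -
      have "((\<lambda>N. x * exp (- \<gamma> * N)) \<longlongrightarrow> 0) at_top"
        using \<gamma>0 by real_asymp
      then have "\<forall>\<^sub>F N in at_top. x * exp (- \<gamma> * N) < 1 / 2" by (rule order_tendstoD(2)) simp
      then show ?thesis by eventually_elim simp
    qed
    then have "\<forall>\<^sub>F N in at_top. norm ?E \<le> K / (1 + x) + 4 / c * exp (- c * exp N + (- \<beta>) * N)"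
      using eventually_ge_at_top[of "0::real"]
    proof eventually_elim
      case (elim N)
      have "norm ?E \<le> norm (vertical_integral \<theta> (ml_integrand \<gamma> \<beta> x) N) + norm (?E - vertical_integral \<theta> (ml_integrand \<gamma> \<beta> x) N)"
        using norm_triangle_ineq[of "vertical_integral \<theta> (ml_integrand \<gamma> \<beta> x) N" "?E - vertical_integral \<theta> (ml_integrand \<gamma> \<beta> x) N"] by simp
      then show ?case using close[OF elim(1)] K[OF x elim(2)] by simp
    qed
    moreover have "((\<lambda>N. K / (1 + x) + 4 / c * exp (- c * exp N + (- \<beta>) * N)) \<longlongrightarrow> K / (1 + x) + 4 / c * 0) at_top"
      by (intro tendsto_intros exp_exp_decay c)
    ultimately have "norm ?E \<le> K / (1 + x) + 4 / c * 0"
      by (intro tendsto_lowerbound) auto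
    then have "2 * pi * \<bar>mittag_leffler \<gamma> \<beta> (- x)\<bar> \<le> K / (1 + x)" by (simp add: norm_mult)
    then have "\<bar>mittag_leffler \<gamma> \<beta> (- x)\<bar> \<le> K / (1 + x) / (2 * pi)"
      by (subst pos_le_divide_eq) (simp_all add: mult_ac)
    then show ?thesis by (simp only: divide_divide_eq_left mult.commute)
  qed
  then show ?thesis by blast
qed

section \<open>The kernels built from Mittag-Leffler functions\<close>

text \<open>At the poles of \<open>\<Gamma>\<close> both sides are \<open>0\<close>, by the convention that \<open>Gamma\<close> and division by zero have the value
  \<open>0\<close>; this is the value of the entire function \<open>1 / \<Gamma>\<close> there, so indices below \<open>0\<close> need no separate treatment.\<close>

lemma rGamma_shift: "z / Gamma (z + 1) = 1 / Gamma (z::real)"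
  using rGamma_plus1[of z] by (simp add: rGamma_inverse_Gamma divide_inverse)

text \<open>The kernel \<open>e(\<beta>)\<close>. The index \<open>\<beta>\<close> counts derivatives: \<open>\<beta> = 1\<close> and \<open>\<beta> = 2\<close> propagate the initial data,
  \<open>\<beta> = \<gamma>\<close> the forcing.\<close>

definition ml_fun :: "real \<Rightarrow> real \<Rightarrow> real \<Rightarrow> real \<Rightarrow> real" where
  "ml_fun \<gamma> \<mu> \<beta> t = t powr (\<beta> - 1) * mittag_leffler \<gamma> \<beta> (- (\<mu> * t powr \<gamma>))"

lemma mittag_leffler_rec:
  assumes "\<gamma> > 0"
  shows "mittag_leffler \<gamma> \<beta> z = 1 / Gamma \<beta> + z * mittag_leffler \<gamma> (\<beta> + \<gamma>) z"
proof -
  let ?f = "\<lambda>j. z ^ j / Gamma (\<gamma> * real j + \<beta>)"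
  have "suminf ?f = ?f 0 + (\<Sum>j. ?f (Suc j))"
    using suminf_split_head[OF mittag_leffler_summable[OF assms]] by simp
  also have "(\<Sum>j. ?f (Suc j)) = (\<Sum>j. z * (z ^ j / Gamma (\<gamma> * real j + (\<beta> + \<gamma>))))"
    by (simp add: algebra_simps)
  also have "\<dots> = z * mittag_leffler \<gamma> (\<beta> + \<gamma>) z"
    unfolding mittag_leffler_def by (intro suminf_mult mittag_leffler_summable assms)
  finally show ?thesis by (simp add: mittag_leffler_def)
qed

lemma ml_fun_rec:
  assumes "\<gamma> > 0" "t > 0"
  shows "ml_fun \<gamma> \<mu> \<beta> t = t powr (\<beta> - 1) / Gamma \<beta> - \<mu> * ml_fun \<gamma> \<mu> (\<beta> + \<gamma>) t"
proof -
  have "t powr (\<beta> + \<gamma> - 1) = t powr (\<beta> - 1) * t powr \<gamma>" by (simp add: powr_add[symmetric] algebra_simps)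
  then show ?thesis unfolding ml_fun_def by (subst mittag_leffler_rec[OF assms(1)]) (simp add: algebra_simps)
qed

text \<open>Multiplying the \<open>j\<close>-th term of the series of index \<open>\<beta> + 1\<close> by \<open>\<gamma> j + \<beta>\<close> yields that of index \<open>\<beta>\<close>. The factor
  \<open>\<gamma> j\<close> is produced by \<open>\<gamma> z d/dz\<close>.\<close>

lemma mittag_leffler_deriv:
  assumes "\<gamma> > 0"
  shows "\<exists>D. (mittag_leffler \<gamma> (\<beta> + 1) has_real_derivative D) (at z) \<and>
     \<beta> * mittag_leffler \<gamma> (\<beta> + 1) z + \<gamma> * z * D = mittag_leffler \<gamma> \<beta> z"
proof -
  define a where "a = (\<lambda>j. 1 / Gamma (\<gamma> * real j + (\<beta> + 1)))"
  have sm: "summable (\<lambda>j. a j * y ^ j)" for y :: real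
    using mittag_leffler_summable[OF assms, of y "\<beta> + 1"] by (simp add: a_def)
  have ml: "mittag_leffler \<gamma> (\<beta> + 1) = (\<lambda>y. \<Sum>j. a j * y ^ j)"
    by (simp add: mittag_leffler_def a_def fun_eq_iff)
  let ?D = "\<Sum>j. diffs a j * z ^ j"
  have D: "(mittag_leffler \<gamma> (\<beta> + 1) has_real_derivative ?D) (at z)"
    unfolding ml by (rule termdiffs_strong_converges_everywhere[OF sm])
  have dsm: "(\<lambda>j. real j * a j * z ^ (j - Suc 0)) sums ?D"
    using diffs_equiv[of a z] termdiff_converges_all[OF sm, of z] by simp
  have "(\<lambda>j. \<beta> * (a j * z ^ j) + \<gamma> * z * (real j * a j * z ^ (j - Suc 0))) sums
     (\<beta> * mittag_leffler \<gamma> (\<beta> + 1) z + \<gamma> * z * ?D)"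
    unfolding ml by (intro sums_add sums_mult dsm summable_sums[OF sm])
  moreover have "\<beta> * (a j * z ^ j) + \<gamma> * z * (real j * a j * z ^ (j - Suc 0)) = z ^ j / Gamma (\<gamma> * real j + \<beta>)" for j
  proof -
    have "\<beta> * (a j * z ^ j) + \<gamma> * z * (real j * a j * z ^ (j - Suc 0)) = (\<gamma> * real j + \<beta>) * a j * z ^ j"
      by (cases j) (auto simp: algebra_simps)
    also have "(\<gamma> * real j + \<beta>) * a j = 1 / Gamma (\<gamma> * real j + \<beta>)"
      using rGamma_shift[of "\<gamma> * real j + \<beta>"] by (simp add: a_def add.assoc)
    finally show ?thesis by simp
  qed
  ultimately show ?thesis using D by (auto simp: mittag_leffler_def sums_iff)
qed

lemma ml_fun_deriv:
  assumes "\<gamma> > 0" "t > 0"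
  shows "(ml_fun \<gamma> \<mu> (\<beta> + 1) has_real_derivative ml_fun \<gamma> \<mu> \<beta> t) (at t)"
proof -
  let ?z = "- (\<mu> * t powr \<gamma>)"
  obtain D where D: "(mittag_leffler \<gamma> (\<beta> + 1) has_real_derivative D) (at ?z)"
     "\<beta> * mittag_leffler \<gamma> (\<beta> + 1) ?z + \<gamma> * ?z * D = mittag_leffler \<gamma> \<beta> ?z"
    using mittag_leffler_deriv[OF assms(1)] by blast
  have z: "((\<lambda>t. - (\<mu> * t powr \<gamma>)) has_real_derivative - (\<mu> * (\<gamma> * t powr (\<gamma> - 1)))) (at t)"
    using assms(2) by (auto intro!: derivative_eq_intros)
  have p: "((\<lambda>t. t powr \<beta>) has_real_derivative \<beta> * t powr (\<beta> - 1)) (at t)"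
    using assms(2) by (auto intro!: derivative_eq_intros)
  have "t powr \<beta> * t powr (\<gamma> - 1) = t powr (\<beta> - 1) * t powr \<gamma>"
    by (simp add: powr_add[symmetric] algebra_simps)
  then have e: "\<beta> * t powr (\<beta> - 1) * mittag_leffler \<gamma> (\<beta> + 1) ?z + D * - (\<mu> * (\<gamma> * t powr (\<gamma> - 1))) * t powr \<beta>
     = t powr (\<beta> - 1) * (\<beta> * mittag_leffler \<gamma> (\<beta> + 1) ?z + \<gamma> * ?z * D)"
    by (simp add: algebra_simps)
  from DERIV_mult[OF p DERIV_chain2[OF D(1) z]]
  show ?thesis unfolding ml_fun_def e D(2) by simp
qed

section \<open>Smooth test functions\<close>

lemma Ck_Suc_imp: "Ck (Suc m) f \<Longrightarrow> Ck m f"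
proof (induction m arbitrary: f)
  case 0 then show ?case using differentiable_imp_continuous_on by auto
qed auto

lemma frechet_derivative_mult_apply:
  fixes f g :: "'a::euclidean_space \<Rightarrow> real"
  assumes "f differentiable (at x)" "g differentiable (at x)"
  shows "frechet_derivative (\<lambda>x. f x * g x) (at x) b = f x * frechet_derivative g (at x) b + frechet_derivative f (at x) b * g x"
proof -
  have "((\<lambda>x. f x * g x) has_derivative (\<lambda>h. f x * frechet_derivative g (at x) h + frechet_derivative f (at x) h * g x)) (at x)"
    using assms by (intro has_derivative_mult) (simp_all add: frechet_derivative_works[symmetric])
  from frechet_derivative_at[OF this, symmetric] show ?thesis by simp
qed

lemma frechet_derivative_add_apply:
  fixes f g :: "'a::euclidean_space \<Rightarrow> real"
  assumes "f differentiable (at x)" "g differentiable (at x)"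
  shows "frechet_derivative (\<lambda>x. f x + g x) (at x) b = frechet_derivative f (at x) b + frechet_derivative g (at x) b"
proof -
  have "((\<lambda>x. f x + g x) has_derivative (\<lambda>h. frechet_derivative f (at x) h + frechet_derivative g (at x) h)) (at x)"
    using assms by (intro has_derivative_add) (simp_all add: frechet_derivative_works[symmetric])
  from frechet_derivative_at[OF this, symmetric] show ?thesis by simp
qed

lemma Ck_add: "Ck m f \<Longrightarrow> Ck m g \<Longrightarrow> Ck m (\<lambda>x. f x + g x)"
proof (induction m arbitrary: f g)
  case 0 then show ?case by (auto intro: continuous_intros)
next
  case (Suc m)
  then have d: "\<And>x. f differentiable (at x)" "\<And>x. g differentiable (at x)" by (auto simp: differentiable_on_def)
  show ?case
    using Suc by (auto simp: differentiable_on_def frechet_derivative_add_apply[OF d] intro!: derivative_intros)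
qed

lemma Ck_mult: "Ck m f \<Longrightarrow> Ck m g \<Longrightarrow> Ck m (\<lambda>x. f x * g x)"
proof (induction m arbitrary: f g)
  case 0 then show ?case by (auto intro: continuous_intros)
next
  case (Suc m)
  then have d: "\<And>x. f differentiable (at x)" "\<And>x. g differentiable (at x)" by (auto simp: differentiable_on_def)
  have fg: "Ck m f" "Ck m g" using Suc.prems Ck_Suc_imp by blast+
  have "Ck m (\<lambda>x. f x * frechet_derivative g (at x) b + frechet_derivative f (at x) b * g x)" if "b \<in> Basis" for b
    using Suc.prems that fg by (intro Ck_add Suc.IH) auto
  then show ?case
    using d by (auto simp: differentiable_on_def frechet_derivative_mult_apply[OF d] intro!: derivative_intros)
qed

lemma Ck_const: "Ck m (\<lambda>x. c)"
proof (induction m arbitrary: c)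
  case (Suc m)
  have "frechet_derivative (\<lambda>x::'a. c) (at x) b = 0" for x b by simp
  then show ?case using Suc by (auto simp: differentiable_on_def)
qed simp

text \<open>Multiplication by a coordinate keeps test functions smooth, which is how the Poincare inequality is
  obtained.\<close>

lemma Ck_bounded_linear:
  fixes L :: "'a::euclidean_space \<Rightarrow> real"
  assumes "bounded_linear L" shows "Ck m L"
proof (cases m)
  case 0 then show ?thesis using assms by (simp add: linear_continuous_on)
next
  case (Suc k)
  have "frechet_derivative L (at x) b = L b" for x b
    using frechet_derivative_at[OF bounded_linear_imp_has_derivative[OF assms, of "at x"], symmetric] by simp
  then show ?thesis using Suc bounded_linear_imp_differentiable[OF assms] by (auto simp: differentiable_on_def Ck_const)
qed

lemma Ck_real_Suc:
  assumes "\<And>x. (f has_real_derivative f' x) (at x)"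
  shows "Ck (Suc m) f \<longleftrightarrow> Ck m f'"
proof -
  have "frechet_derivative f (at x) 1 = f' x" for x
    using frechet_derivative_at[of f "\<lambda>h. f' x * h" x, symmetric] assms[of x] by (simp add: has_field_derivative_def)
  moreover have "f differentiable_on UNIV"
    using assms by (meson differentiable_on_def differentiable_at_withinI field_differentiable_imp_differentiable field_differentiable_def)
  ultimately show ?thesis by simp
qed

lemma Ck_real_deriv:
  fixes f :: "real \<Rightarrow> real"
  assumes "Ck (Suc m) f"
  shows "(f has_real_derivative deriv f x) (at x)" "Ck m (deriv f)"
proof -
  have D: "(f has_real_derivative deriv f x) (at x)" for x
    using assms by (metis Ck.simps(2) DERIV_deriv_iff_real_differentiable UNIV_I differentiable_on_def)
  show "(f has_real_derivative deriv f x) (at x)" by (rule D)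
  show "Ck m (deriv f)" using Ck_real_Suc[OF D] assms by simp
qed

lemma Ck_exp:
  fixes f :: "real \<Rightarrow> real"
  shows "Ck m f \<Longrightarrow> Ck m (\<lambda>x. exp (f x))"
proof (induction m)
  case 0 then show ?case by (auto intro: continuous_intros)
next
  case (Suc m)
  have "((\<lambda>x. exp (f x)) has_real_derivative (exp (f x) * deriv f x)) (at x)" for x
    using Ck_real_deriv(1)[OF Suc.prems] by (auto intro!: derivative_eq_intros)
  then show ?case
    using Ck_real_Suc[of "\<lambda>x. exp (f x)" "\<lambda>x. exp (f x) * deriv f x" m]
      Ck_mult[OF Suc.IH[OF Ck_Suc_imp[OF Suc.prems]] Ck_real_deriv(2)[OF Suc.prems]] by blast
qed

lemma Ck_affine:
  fixes f :: "real \<Rightarrow> real"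
  shows "Ck m f \<Longrightarrow> Ck m (\<lambda>x. f (a * x + d))"
proof (induction m arbitrary: f)
  case 0 then show ?case by (auto intro!: continuous_on_compose2[of UNIV f] continuous_intros)
next
  case (Suc m)
  have "((\<lambda>x. f (a * x + d)) has_real_derivative (a * deriv f (a * x + d))) (at x)" for x
    by (rule DERIV_chain2[of f _ "\<lambda>x. a * x + d", THEN DERIV_cong, OF Ck_real_deriv(1)[OF Suc.prems]])
      (auto intro!: derivative_eq_intros)
  then show ?case
    using Ck_real_Suc[of "\<lambda>x. f (a * x + d)" "\<lambda>x. a * deriv f (a * x + d)" m]
      Ck_mult[OF Ck_const Suc.IH[OF Ck_real_deriv(2)[OF Suc.prems]]] by blast
qed

text \<open>The functions \<open>p(1/x) exp (- 1/x)\<close> for \<open>x > 0\<close>, continued by zero. The family is closed under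
  differentiation, and this makes its members smooth.\<close>

definition flat :: "real poly \<Rightarrow> real \<Rightarrow> real" where
  "flat p x = (if x > 0 then poly p (1 / x) * exp (- (1 / x)) else 0)"

lemma poly_exp_decay: "((\<lambda>y::real. poly p y * exp (- y)) \<longlongrightarrow> 0) at_top"
proof -
  have "((\<lambda>y::real. \<Sum>i\<le>degree p. coeff p i * (y ^ i / exp y)) \<longlongrightarrow> (\<Sum>i\<le>degree p. coeff p i * 0)) at_top"
    by (intro tendsto_intros tendsto_power_div_exp_0)
  then show ?thesis by (simp add: poly_altdef sum_distrib_right exp_minus divide_inverse mult.assoc)
qed

lemma flat_deriv: "(flat p has_real_derivative flat ([:0, 0, 1:] * (p - pderiv p)) x) (at x)"
proof -
  let ?q = "[:0, 0, 1:] * (p - pderiv p)"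
  consider "x > 0" | "x < 0" | "x = 0" by linarith
  then show ?thesis
  proof cases
    case 1
    have "((\<lambda>x. poly p (1 / x) * exp (- (1 / x))) has_real_derivative flat ?q x) (at x)"
    proof -
      have "((\<lambda>x. poly p (1 / x)) has_real_derivative poly (pderiv p) (1 / x) * (- (1 / x\<^sup>2))) (at x)"
        using 1 by (intro DERIV_chain2[OF poly_DERIV]) (auto intro!: derivative_eq_intros simp: power2_eq_square)
      moreover have "((\<lambda>x. exp (- (1 / x))) has_real_derivative exp (- (1 / x)) * (1 / x\<^sup>2)) (at x)"
        using 1 by (auto intro!: derivative_eq_intros simp: power2_eq_square)
      ultimately have "((\<lambda>x. poly p (1 / x) * exp (- (1 / x))) has_real_derivative
         poly (pderiv p) (1 / x) * (- (1 / x\<^sup>2)) * exp (- (1 / x)) + exp (- (1 / x)) * (1 / x\<^sup>2) * poly p (1 / x)) (at x)"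
        by (rule DERIV_mult)
      moreover have "poly (pderiv p) (1 / x) * (- (1 / x\<^sup>2)) * exp (- (1 / x)) + exp (- (1 / x)) * (1 / x\<^sup>2) * poly p (1 / x) = flat ?q x"
        using 1 by (simp add: flat_def power2_eq_square algebra_simps diff_divide_distrib)
      ultimately show ?thesis by simp
    qed
    then show ?thesis
      using 1 by (subst DERIV_cong_ev[OF refl _ refl])
        (auto simp: flat_def intro!: eventually_mono[OF eventually_nhds_in_open[of "{0<..}" x]])
  next
    case 2
    then show ?thesis
      by (subst DERIV_cong_ev[OF refl _ refl, of _ "\<lambda>_. 0"])
        (auto simp: flat_def intro!: eventually_mono[OF eventually_nhds_in_open[of "{..<0}" x]])
  next
    case 3
    \<comment> \<open>From the right, \<open>x = 1 / h\<close> turns the difference quotient into a polynomial times \<open>exp (- x)\<close>.\<close>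
    have r: "((\<lambda>h. flat p h / h) \<longlongrightarrow> 0) (at_right 0)"
    proof -
      have "((\<lambda>h::real. poly (pCons 0 p) (inverse h) * exp (- inverse h)) \<longlongrightarrow> 0) (at_right 0)"
        by (rule filterlim_compose[OF poly_exp_decay filterlim_inverse_at_top_right])
      then show ?thesis
        by (rule Lim_transform_eventually)
          (auto simp: flat_def eventually_at_filter divide_inverse intro!: always_eventually)
    qed
    have l: "((\<lambda>h. flat p h / h) \<longlongrightarrow> 0) (at_left 0)"
      by (rule Lim_transform_eventually[OF tendsto_const]) (auto simp: flat_def eventually_at_filter)
    have "((\<lambda>h. flat p h / h) \<longlongrightarrow> 0) (at 0)"
      using filterlim_split_at[OF l r] by simp
    then show ?thesis using 3 by (simp add: DERIV_def flat_def)
  qed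
qed

lemma Ck_flat: "Ck m (flat p)"
proof (induction m arbitrary: p)
  case 0
  show ?case using flat_deriv by (simp, meson DERIV_isCont continuous_at_imp_continuous_on)
next
  case (Suc m)
  then show ?case using Ck_real_Suc[OF flat_deriv] by simp
qed

definition bump :: "real \<Rightarrow> real \<Rightarrow> real \<Rightarrow> real" where
  "bump a b x = flat 1 (x - a) * flat 1 (b - x)"

lemma Ck_bump: "Ck m (bump a b)"
  using Ck_mult[OF Ck_affine[OF Ck_flat[of m 1], of 1 "- a"] Ck_affine[OF Ck_flat[of m 1], of "- 1" b]]
  by (simp add: bump_def[abs_def])

lemma bump_pos: "a < x \<Longrightarrow> x < b \<Longrightarrow> bump a b x > 0"
  and bump_zero: "\<not> (a < x \<and> x < b) \<Longrightarrow> bump a b x = 0"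
  and bump_nonneg: "bump a b x \<ge> 0"
  by (auto simp: bump_def flat_def)

lemma test_functionI:
  assumes "\<And>m. Ck m \<eta>" "\<And>x. x \<notin> {a..b} \<Longrightarrow> \<eta> x = 0" "0 < a" "b < T"
  shows "\<eta> \<in> test_functions {0<..<T::real}"
proof -
  have "{x. \<eta> x \<noteq> 0} \<subseteq> {a..b}" using assms(2) by blast
  then have c: "closure {x. \<eta> x \<noteq> 0} \<subseteq> {a..b}" by (rule closure_minimal) simp
  then have "compact (closure {x. \<eta> x \<noteq> 0})" using compact_Icc[of a b] closed_Int_compact[of "closure {x. \<eta> x \<noteq> 0}" "{a..b}"]
    by (simp add: Int_absorb2)
  then show ?thesis using c assms by (auto simp: test_functions_def)
qed

text \<open>The support is compact in the open interval, so a slightly larger interval still has its closure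
  inside.\<close>

lemma test_functionE:
  assumes "\<eta> \<in> test_functions {0<..<T::real}" "0 < T"
  obtains a b where "0 < a" "a < b" "b < T" "\<And>x. x \<notin> {a<..<b} \<Longrightarrow> \<eta> x = 0"
proof -
  let ?S = "closure {x. \<eta> x \<noteq> 0}"
  have S: "compact ?S" "?S \<subseteq> {0<..<T}" using assms(1) by (auto simp: test_functions_def)
  show thesis
  proof (cases "?S = {}")
    case True
    then have "\<eta> x = 0" for x using closure_subset[of "{x. \<eta> x \<noteq> 0}"] by auto
    then show ?thesis using that[of "T / 3" "T / 2"] assms(2) by auto
  next
    case False
    obtain a where a: "a \<in> ?S" "\<And>x. x \<in> ?S \<Longrightarrow> a \<le> x" using compact_attains_inf[OF S(1) False] by auto
    obtain b where b: "b \<in> ?S" "\<And>x. x \<in> ?S \<Longrightarrow> x \<le> b" using compact_attains_sup[OF S(1) False] by auto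
    have "a \<le> b" using a b by auto
    moreover have "0 < a" "b < T" using a(1) b(1) S(2) by auto
    moreover have "\<eta> x = 0" if "x \<notin> {a/2<..<(b + T)/2}" for x
    proof (rule ccontr)
      assume "\<eta> x \<noteq> 0"
      then have "x \<in> ?S" using closure_subset[of "{x. \<eta> x \<noteq> 0}"] by auto
      then show False using a(2)[of x] b(2)[of x] that \<open>0 < a\<close> \<open>b < T\<close> by auto
    qed
    ultimately show ?thesis using that[of "a / 2" "(b + T) / 2"] by auto
  qed
qed

lemma test_function_deriv:
  assumes "\<eta> \<in> test_functions {0<..<T::real}" "0 < T"
  shows "deriv \<eta> \<in> test_functions {0<..<T}" "(\<eta> has_real_derivative deriv \<eta> x) (at x)"
    "continuous_on UNIV (deriv \<eta>)" "continuous_on UNIV \<eta>"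
proof -
  have C: "Ck m \<eta>" for m using assms(1) by (auto simp: test_functions_def)
  show D: "(\<eta> has_real_derivative deriv \<eta> x) (at x)" for x using Ck_real_deriv(1)[OF C] .
  obtain a b where ab: "0 < a" "a < b" "b < T" "\<And>x. x \<notin> {a<..<b} \<Longrightarrow> \<eta> x = 0"
    using test_functionE[OF assms] by blast
  have C': "Ck m (deriv \<eta>)" for m using Ck_real_deriv(2)[OF C] .
  show "deriv \<eta> \<in> test_functions {0<..<T}"
  proof (rule test_functionI[OF C' _ ab(1,3)])
    fix x assume x: "x \<notin> {a..b}"
    have "open (- {a..b})" by (simp add: open_Compl)
    then have "((\<lambda>_. 0) has_real_derivative deriv \<eta> x) (at x)"
      by (intro has_field_derivative_transform_within_open[OF D, of "- {a..b}"]) (use x ab(4) in auto)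
    then show "deriv \<eta> x = 0" using DERIV_unique DERIV_const by blast
  qed
  show "continuous_on UNIV (deriv \<eta>)" "continuous_on UNIV \<eta>" using C'[of 0] C[of 0] by auto
qed

section \<open>Convolution on the line\<close>

definition convolution :: "(real \<Rightarrow> real) \<Rightarrow> (real \<Rightarrow> real) \<Rightarrow> real \<Rightarrow> real" where
  "convolution K F t = (\<integral>r. K (t - r) * F r \<partial>lborel)"

lemma convolution_commute: "convolution K F t = convolution F K t"
  using lborel_integral_real_affine[of "-1" "\<lambda>r. K (t - r) * F r" t]
  by (simp add: convolution_def mult.commute)

lemma integrable_convolution_pair:
  fixes K F :: "real \<Rightarrow> real"
  assumes K: "integrable lborel K" and F: "integrable lborel F"
  shows "integrable (lborel \<Otimes>\<^sub>M lborel) (\<lambda>(t, r). K (t - r) * F r)"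
proof -
  have [measurable]: "K \<in> borel_measurable borel" "F \<in> borel_measurable borel"
    using K F by (auto dest: borel_measurable_integrable)
  have aff: "integrable lborel (\<lambda>t. K (t - r))" for r
    using lborel_integrable_real_affine[OF K, of 1 "- r"] by (simp add: add.commute)
  have nrm: "(\<integral>t. \<bar>K (t - r)\<bar> \<partial>lborel) = (\<integral>t. \<bar>K t\<bar> \<partial>lborel)" for r
    using lborel_integral_real_affine[of 1 "\<lambda>t. \<bar>K (t - r)\<bar>" r] by simp
  have "integrable (lborel \<Otimes>\<^sub>M lborel) (\<lambda>(r, t). K (t - r) * F r)"
  proof (rule lborel_pair.Fubini_integrable)
    show "(\<lambda>(r, t). K (t - r) * F r) \<in> borel_measurable (lborel \<Otimes>\<^sub>M lborel)" by measurable
    have "(\<integral>t. norm (case (r, t) of (r, t) \<Rightarrow> K (t - r) * F r) \<partial>lborel) = (\<integral>t. \<bar>K t\<bar> \<partial>lborel) * \<bar>F r\<bar>" for r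
      using nrm[of r] by (simp add: abs_mult)
    then show "integrable lborel (\<lambda>r. \<integral>t. norm (case (r, t) of (r, t) \<Rightarrow> K (t - r) * F r) \<partial>lborel)"
      using F by simp
    show "AE r in lborel. integrable lborel (\<lambda>t. case (r, t) of (r, t) \<Rightarrow> K (t - r) * F r)"
      using aff by simp
  qed
  from lborel_pair.integrable_product_swap[OF this] show ?thesis by (simp add: case_prod_unfold)
qed

lemma integrable_convolution:
  assumes "integrable lborel K" "integrable lborel F"
  shows "integrable lborel (convolution K F)"
  using lborel_pair.integrable_fst'[OF integrable_convolution_pair[OF assms]] by (simp add: convolution_def[abs_def])

text \<open>Taking the primitive of a convolution amounts to taking the primitive of the kernel. Exchanging
  primitives between kernel and forcing is the mechanism behind the formulas for the modes.\<close>

lemma integral_convolution: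
  assumes K: "integrable lborel K" and F: "integrable lborel F"
  shows "(\<integral>x. indicator {..t} x * convolution K F x \<partial>lborel) = convolution (\<lambda>t. \<integral>x. indicator {..t} x * K x \<partial>lborel) F t"
proof -
  have [measurable]: "K \<in> borel_measurable borel" "F \<in> borel_measurable borel"
    using K F by (auto dest: borel_measurable_integrable)
  have I: "integrable (lborel \<Otimes>\<^sub>M lborel) (\<lambda>(x, r). indicator {..t} x * (K (x - r) * F r))"
    using integrable_convolution_pair[OF K F] by (rule Bochner_Integration.integrable_bound) (auto simp: indicator_def)
  have "(\<integral>x. indicator {..t} x * convolution K F x \<partial>lborel) = (\<integral>x. \<integral>r. indicator {..t} x * (K (x - r) * F r) \<partial>lborel \<partial>lborel)"
    by (simp add: convolution_def)
  also have "\<dots> = (\<integral>r. \<integral>x. indicator {..t} x * (K (x - r) * F r) \<partial>lborel \<partial>lborel)"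
    by (rule lborel_pair.Fubini_integral[OF I, symmetric])
  also have "\<dots> = (\<integral>r. (\<integral>x. indicator {..t - r} x * K x \<partial>lborel) * F r \<partial>lborel)"
  proof (rule Bochner_Integration.integral_cong[OF refl])
    fix r
    have "(\<integral>x. indicator {..t} x * (K (x - r) * F r) \<partial>lborel) = (\<integral>x. indicator {..t} x * K (x - r) \<partial>lborel) * F r"
      by (simp add: mult.assoc[symmetric])
    also have "(\<integral>x. indicator {..t} x * K (x - r) \<partial>lborel) = (\<integral>x. indicator {..t} (r + x) * K x \<partial>lborel)"
      using lborel_integral_real_affine[of 1 "\<lambda>x. indicator {..t} x * K (x - r)" r] by simp
    also have "\<dots> = (\<integral>x. indicator {..t - r} x * K x \<partial>lborel)"
      by (intro Bochner_Integration.integral_cong) (auto simp: indicator_def)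
    finally show "(\<integral>x. indicator {..t} x * (K (x - r) * F r) \<partial>lborel) = (\<integral>x. indicator {..t - r} x * K x \<partial>lborel) * F r" .
  qed
  finally show ?thesis by (simp add: convolution_def)
qed

text \<open>Young's inequality for an integrable kernel and a square-integrable function: split \<open>\<bar>k\<bar>\<close> into two square roots,
  apply Cauchy-Schwarz, and integrate.\<close>

lemma young_L1_L2:
  fixes k f :: "real \<Rightarrow> real"
  assumes [measurable]: "k \<in> borel_measurable borel" "f \<in> borel_measurable borel"
  shows "(\<integral>\<^sup>+t. ennreal ((convolution k f t)\<^sup>2) \<partial>lborel) \<le> (\<integral>\<^sup>+t. ennreal \<bar>k t\<bar> \<partial>lborel)\<^sup>2 * (\<integral>\<^sup>+t. ennreal ((f t)\<^sup>2) \<partial>lborel)"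
proof -
  let ?K = "\<integral>\<^sup>+t. ennreal \<bar>k t\<bar> \<partial>lborel"
  have sh: "(\<integral>\<^sup>+r. ennreal \<bar>k (t - r)\<bar> \<partial>lborel) = ?K" for t
    using nn_integral_real_affine[of "\<lambda>r. ennreal \<bar>k (t - r)\<bar>" "-1" t] by simp
  have sh2: "(\<integral>\<^sup>+t. ennreal \<bar>k (t - r)\<bar> \<partial>lborel) = ?K" for r
    using nn_integral_real_affine[of "\<lambda>t. ennreal \<bar>k (t - r)\<bar>" 1 r] by simp
  have pw: "ennreal ((convolution k f t)\<^sup>2) \<le> ?K * (\<integral>\<^sup>+r. ennreal \<bar>k (t - r)\<bar> * ennreal ((f r)\<^sup>2) \<partial>lborel)" for t
  proof -
    have "ennreal ((convolution k f t)\<^sup>2) = (ennreal \<bar>convolution k f t\<bar>)\<^sup>2" by (simp add: ennreal_power)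
    also have "ennreal \<bar>convolution k f t\<bar> \<le> (\<integral>\<^sup>+r. ennreal \<bar>k (t - r) * f r\<bar> \<partial>lborel)"
      unfolding convolution_def by (cases "integrable lborel (\<lambda>r. k (t - r) * f r)")
        (auto intro: integral_norm_bound_ennreal[of lborel "\<lambda>r. k (t - r) * f r", simplified] simp: not_integrable_integral_eq)
    also have "\<dots> = (\<integral>\<^sup>+r. ennreal (sqrt \<bar>k (t - r)\<bar>) * ennreal (sqrt \<bar>k (t - r)\<bar> * \<bar>f r\<bar>) \<partial>lborel)"
      by (intro nn_integral_cong) (simp add: ennreal_mult[symmetric] abs_mult mult.assoc[symmetric])
    also have "\<dots>\<^sup>2 \<le> (\<integral>\<^sup>+r. (ennreal (sqrt \<bar>k (t - r)\<bar>))\<^sup>2 \<partial>lborel) * (\<integral>\<^sup>+r. (ennreal (sqrt \<bar>k (t - r)\<bar> * \<bar>f r\<bar>))\<^sup>2 \<partial>lborel)"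
      by (rule Cauchy_Schwarz_nn_integral) measurable
    also have "(\<integral>\<^sup>+r. (ennreal (sqrt \<bar>k (t - r)\<bar>))\<^sup>2 \<partial>lborel) = ?K"
      by (simp add: ennreal_power sh)
    also have "(\<integral>\<^sup>+r. (ennreal (sqrt \<bar>k (t - r)\<bar> * \<bar>f r\<bar>))\<^sup>2 \<partial>lborel) = (\<integral>\<^sup>+r. ennreal \<bar>k (t - r)\<bar> * ennreal ((f r)\<^sup>2) \<partial>lborel)"
      by (intro nn_integral_cong) (simp add: ennreal_power ennreal_mult[symmetric] power_mult_distrib)
    finally show ?thesis by (simp add: power_mono)
  qed
  have "(\<integral>\<^sup>+t. ennreal ((convolution k f t)\<^sup>2) \<partial>lborel) \<le> (\<integral>\<^sup>+t. ?K * (\<integral>\<^sup>+r. ennreal \<bar>k (t - r)\<bar> * ennreal ((f r)\<^sup>2) \<partial>lborel) \<partial>lborel)"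
    by (intro nn_integral_mono pw)
  also have "\<dots> = ?K * (\<integral>\<^sup>+t. \<integral>\<^sup>+r. ennreal \<bar>k (t - r)\<bar> * ennreal ((f r)\<^sup>2) \<partial>lborel \<partial>lborel)"
    by (intro nn_integral_cmult) measurable
  also have "(\<integral>\<^sup>+t. \<integral>\<^sup>+r. ennreal \<bar>k (t - r)\<bar> * ennreal ((f r)\<^sup>2) \<partial>lborel \<partial>lborel) =
      (\<integral>\<^sup>+r. \<integral>\<^sup>+t. ennreal \<bar>k (t - r)\<bar> * ennreal ((f r)\<^sup>2) \<partial>lborel \<partial>lborel)"
    by (rule lborel_pair.Fubini') measurable
  also have "\<dots> = (\<integral>\<^sup>+r. ?K * ennreal ((f r)\<^sup>2) \<partial>lborel)"
    by (intro nn_integral_cong) (simp add: nn_integral_multc sh2)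
  also have "\<dots> = ?K * (\<integral>\<^sup>+r. ennreal ((f r)\<^sup>2) \<partial>lborel)"
    by (intro nn_integral_cmult) measurable
  finally show ?thesis by (simp add: power2_eq_square mult.assoc)
qed

section \<open>Weak derivatives on an interval\<close>

text \<open>An absolutely continuous function has its almost everywhere derivative as weak derivative. The
  derivative \<open>v\<close> need not be continuous, so this is Fubini's theorem rather than the product rule.\<close>

lemma weak_by_parts:
  fixes u v \<eta> \<eta>' :: "real \<Rightarrow> real"
  assumes "a < b" and D: "\<And>x. (\<eta> has_real_derivative \<eta>' x) (at x)" and c: "continuous_on UNIV \<eta>'"
    and z: "\<And>x. x \<notin> {a<..<b} \<Longrightarrow> \<eta> x = 0" and z': "\<And>x. x \<notin> {a<..<b} \<Longrightarrow> \<eta>' x = 0"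
    and v: "integrable lborel (\<lambda>x. indicator {a..b} x * v x)"
    and u: "\<And>t. a \<le> t \<Longrightarrow> t \<le> b \<Longrightarrow> u t = u a + (\<integral>x. indicator {a..t} x * v x \<partial>lborel)"
  shows "integrable lborel (\<lambda>x. \<eta>' x * u x)" "integrable lborel (\<lambda>x. \<eta> x * v x)"
    "(\<integral>x. \<eta>' x * u x \<partial>lborel) = - (\<integral>x. \<eta> x * v x \<partial>lborel)"
proof -
  define w where "w = (\<lambda>x. indicator {a..b} x * v x)"
  have w: "integrable lborel w" using v by (simp add: w_def)
  then have [measurable]: "w \<in> borel_measurable borel" by (auto dest: borel_measurable_integrable)
  have c\<eta>: "continuous_on UNIV \<eta>" using D by (meson DERIV_isCont continuous_at_imp_continuous_on)
  have [measurable]: "\<eta> \<in> borel_measurable borel" "\<eta>' \<in> borel_measurable borel"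
    using c c\<eta> by (auto intro: borel_measurable_continuous_onI)
  have ib: "\<exists>B. \<forall>x. \<bar>f x\<bar> \<le> B" if "continuous_on UNIV f" "\<And>x. x \<notin> {a<..<b} \<Longrightarrow> f x = 0" for f :: "real \<Rightarrow> real"
  proof -
    have "bounded (f ` {a..b})"
      using that(1) by (intro compact_imp_bounded compact_continuous_image) (auto intro: continuous_on_subset)
    then obtain B where B: "\<And>x. x \<in> {a..b} \<Longrightarrow> \<bar>f x\<bar> \<le> B" unfolding bounded_iff real_norm_def by (meson imageI)
    have "\<bar>f x\<bar> \<le> max B 0" for x using B[of x] that(2)[of x] by (cases "x \<in> {a..b}") auto
    then show ?thesis by blast
  qed
  obtain B where B: "\<And>x. \<bar>\<eta> x\<bar> \<le> B" using ib[OF c\<eta> z] by blast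
  obtain B' where B': "\<And>x. \<bar>\<eta>' x\<bar> \<le> B'" using ib[OF c z'] by blast
  have \<eta>w: "\<eta> x * v x = \<eta> x * w x" for x using z[of x] by (cases "x \<in> {a<..<b}") (auto simp: w_def)
  have "integrable lborel (\<lambda>x. B * w x)" using w by simp
  then show i2: "integrable lborel (\<lambda>x. \<eta> x * v x)"
    unfolding \<eta>w by (rule Bochner_Integration.integrable_bound) (use B in \<open>auto simp: abs_mult intro!: mult_right_mono order_trans[OF B]\<close>)
  have FTC: "(\<integral>x. indicator {p..b} x * \<eta>' x \<partial>lborel) = - \<eta> p" "integrable lborel (\<lambda>x. indicator {p..b} x * \<eta>' x)" if "p \<le> b" for p
  proof -
    have h: "has_bochner_integral lborel (\<lambda>x. indicator {p..b} x * \<eta>' x) (\<eta> b - \<eta> p)"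
      using has_bochner_integral_FTC_Icc_real[OF that D] c by (simp add: mult.commute continuous_on_eq_continuous_at)
    show "(\<integral>x. indicator {p..b} x * \<eta>' x \<partial>lborel) = - \<eta> p"
      using has_bochner_integral_integral_eq[OF h] z[of b] by simp
    show "integrable lborel (\<lambda>x. indicator {p..b} x * \<eta>' x)" using h by (auto simp: has_bochner_integral_iff)
  qed
  have \<eta>'i: "integrable lborel \<eta>'"
  proof -
    have "\<eta>' = (\<lambda>x. indicator {a..b} x * \<eta>' x)"
    proof
      fix x show "\<eta>' x = indicator {a..b} x * \<eta>' x"
        using z'[of x] by (cases "x \<in> {a<..<b}") auto
    qed
    then show ?thesis using FTC(2)[of a] \<open>a < b\<close> by simp
  qed
  have \<eta>'0: "(\<integral>x. \<eta>' x \<partial>lborel) = 0"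
  proof -
    have "\<eta>' = (\<lambda>x. indicator {a..b} x * \<eta>' x)"
    proof
      fix x show "\<eta>' x = indicator {a..b} x * \<eta>' x"
        using z'[of x] by (cases "x \<in> {a<..<b}") auto
    qed
    then show ?thesis using FTC(1)[of a] \<open>a < b\<close> z[of a] by simp
  qed
  have I: "integrable (lborel \<Otimes>\<^sub>M lborel) (\<lambda>(x, r). \<eta>' x * (indicator {a..x} r * w r))"
  proof (rule Bochner_Integration.integrable_bound[where f = "\<lambda>(x, r). \<eta>' x * w r"])
    show "integrable (lborel \<Otimes>\<^sub>M lborel) (\<lambda>(x, r). \<eta>' x * w r)"
    proof (rule lborel_pair.Fubini_integrable)
      show "integrable lborel (\<lambda>x. \<integral>y. norm (case (x, y) of (x, r) \<Rightarrow> \<eta>' x * w r) \<partial>lborel)"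
        using \<eta>'i by (simp add: abs_mult)
    qed (use w in \<open>auto\<close>)
    show "(\<lambda>(x, r). \<eta>' x * (indicator {a..x} r * w r)) \<in> borel_measurable (lborel \<Otimes>\<^sub>M lborel)"
    proof -
      have "(\<lambda>(x, r). \<eta>' x * (indicator {a..x} r * w r)) = (\<lambda>(x, r). \<eta>' x * ((if a \<le> r \<and> r \<le> x then 1 else 0) * w r))"
        by (auto simp: fun_eq_iff indicator_def)
      then show ?thesis by simp
    qed
  qed (auto simp: indicator_def)
  have \<eta>'u: "\<eta>' x * u x = \<eta>' x * u a + (\<integral>r. \<eta>' x * (indicator {a..x} r * w r) \<partial>lborel)" for x
  proof (cases "x \<in> {a<..<b}")
    case True
    have "(\<integral>r. indicator {a..x} r * w r \<partial>lborel) = (\<integral>r. indicator {a..x} r * v r \<partial>lborel)"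
      using True by (intro Bochner_Integration.integral_cong) (auto simp: w_def indicator_def)
    then show ?thesis using u[of x] True by (simp add: algebra_simps)
  qed (use z'[of x] in auto)
  have J: "integrable lborel (\<lambda>x. \<integral>r. \<eta>' x * (indicator {a..x} r * w r) \<partial>lborel)"
    using lborel_pair.integrable_fst'[OF I] by simp
  show i1: "integrable lborel (\<lambda>x. \<eta>' x * u x)"
    unfolding \<eta>'u using \<eta>'i J by simp
  have "(\<integral>x. \<eta>' x * u x \<partial>lborel) = (\<integral>x. \<integral>r. \<eta>' x * (indicator {a..x} r * w r) \<partial>lborel \<partial>lborel)"
    unfolding \<eta>'u using \<eta>'i J \<eta>'0 by simp
  also have "\<dots> = (\<integral>r. \<integral>x. \<eta>' x * (indicator {a..x} r * w r) \<partial>lborel \<partial>lborel)"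
    by (rule lborel_pair.Fubini_integral[OF I, symmetric])
  also have "\<dots> = (\<integral>r. - (\<eta> r * v r) \<partial>lborel)"
  proof (rule Bochner_Integration.integral_cong[OF refl])
    fix r
    show "(\<integral>x. \<eta>' x * (indicator {a..x} r * w r) \<partial>lborel) = - (\<eta> r * v r)"
    proof (cases "r \<in> {a..b}")
      case True
      have "(\<integral>x. \<eta>' x * (indicator {a..x} r * w r) \<partial>lborel) = (\<integral>x. (indicator {r..b} x * \<eta>' x) * w r \<partial>lborel)"
        using True z' by (intro Bochner_Integration.integral_cong) (auto simp: indicator_def not_less)
      also have "\<dots> = - \<eta> r * w r" using True FTC[of r] by simp
      finally show ?thesis by (simp add: \<eta>w)
    next
      case False
      then have "r \<notin> {a<..<b}" by auto
      then show ?thesis using False z[of r] by (simp add: w_def)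
    qed
  qed
  finally show "(\<integral>x. \<eta>' x * u x \<partial>lborel) = - (\<integral>x. \<eta> x * v x \<partial>lborel)" by simp
qed

lemma flat_continuous: "isCont (flat p) x"
  using flat_deriv by (rule DERIV_isCont)

text \<open>Integration starts at \<open>a - 1\<close>, where the integrand already vanishes, so that no one-sided derivative
  occurs.\<close>

lemma smooth_antiderivative:
  fixes \<zeta> :: "real \<Rightarrow> real"
  assumes c: "continuous_on UNIV \<zeta>" and z: "\<And>x. x < a \<Longrightarrow> \<zeta> x = 0"
  shows "\<exists>\<eta>. (\<forall>x. (\<eta> has_real_derivative \<zeta> x) (at x)) \<and> (\<forall>x<a. \<eta> x = 0)"
proof -
  define \<eta> where "\<eta> = (\<lambda>x. integral {a - 1..x} \<zeta>)"
  have z0: "\<eta> x = 0" if "x < a" for x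
  proof -
    have "integral {a - 1..x} \<zeta> = integral {a - 1..x} (\<lambda>_. 0)" using z that by (intro integral_cong) auto
    then show ?thesis by (simp add: \<eta>_def)
  qed
  have "(\<eta> has_real_derivative \<zeta> x) (at x)" for x
  proof (cases "x < a")
    case True
    have "((\<lambda>_. 0) has_real_derivative 0) (at x)" by simp
    then have "(\<eta> has_real_derivative 0) (at x)"
      by (rule has_field_derivative_transform_within_open[of _ _ _ "{..<a}"]) (use True z0 in auto)
    then show ?thesis using z[OF True] by simp
  next
    case False
    have "(\<eta> has_real_derivative \<zeta> x) (at x within {a - 1..x + 1})"
      unfolding \<eta>_def using False by (intro integral_has_real_derivative continuous_on_subset[OF c]) auto
    moreover have "at x within {a - 1..x + 1} = at x"
      using False by (intro at_within_interior) auto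
    ultimately show ?thesis by simp
  qed
  then show ?thesis using z0 by blast
qed

lemma test_function_integrable:
  assumes "\<eta> \<in> test_functions {0<..<T::real}" "0 < T"
  shows "integrable lborel \<eta>" "\<exists>B. \<forall>x. \<bar>\<eta> x\<bar> \<le> B" "\<eta> \<in> borel_measurable borel"
proof -
  obtain a b where ab: "0 < a" "a < b" "b < T" "\<And>x. x \<notin> {a<..<b} \<Longrightarrow> \<eta> x = 0"
    using test_functionE[OF assms] by blast
  have c: "continuous_on UNIV \<eta>" by (rule test_function_deriv(4)[OF assms])
  then show m: "\<eta> \<in> borel_measurable borel" by (rule borel_measurable_continuous_onI)
  have e: "\<eta> = (\<lambda>x. indicator {a..b} x *\<^sub>R \<eta> x)"
  proof
    fix x show "\<eta> x = indicator {a..b} x *\<^sub>R \<eta> x" using ab(4)[of x] by (cases "x \<in> {a<..<b}") auto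
  qed
  have "integrable lborel (\<lambda>x. indicator {a..b} x *\<^sub>R \<eta> x)"
    by (rule borel_integrable_compact) (use continuous_on_subset[OF c] in auto)
  then show "integrable lborel \<eta>" using e by simp
  have "bounded (\<eta> ` {a..b})"
    by (intro compact_imp_bounded compact_continuous_image continuous_on_subset[OF c]) auto
  then obtain B where B: "\<And>x. x \<in> {a..b} \<Longrightarrow> \<bar>\<eta> x\<bar> \<le> B" unfolding bounded_iff real_norm_def by (meson imageI)
  have "\<bar>\<eta> x\<bar> \<le> max B 0" for x using B[of x] ab(4)[of x] by (cases "x \<in> {a..b}") (auto simp: le_max_iff_disj)
  then show "\<exists>B. \<forall>x. \<bar>\<eta> x\<bar> \<le> B" by blast
qed

lemma test_function_mult_integrable:
  assumes "\<eta> \<in> test_functions {0<..<T::real}" "0 < T" "integrable lborel F"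
  shows "integrable lborel (\<lambda>x. \<eta> x * F x)"
proof -
  obtain B where B: "\<And>x. \<bar>\<eta> x\<bar> \<le> B" using test_function_integrable(2)[OF assms(1,2)] by blast
  have [measurable]: "F \<in> borel_measurable borel" "\<eta> \<in> borel_measurable borel"
    using assms(3) test_function_integrable(3)[OF assms(1,2)] by (auto dest: borel_measurable_integrable)
  have B0: "B \<ge> 0" using B[of 0] by simp
  show ?thesis
  proof (rule Bochner_Integration.integrable_bound[where f = "\<lambda>x. B * F x"])
    show "AE x in lborel. norm (\<eta> x * F x) \<le> norm (B * F x)"
      using B B0 by (auto simp: abs_mult intro!: mult_right_mono)
  qed (use assms(3) in auto)
qed

text \<open>The half-lines generate the Borel sets and are closed under intersection, so the integral over every
  Borel set vanishes.\<close>

lemma borel_zero_if_initial_integrals_zero: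
  fixes H :: "real \<Rightarrow> real"
  assumes H: "integrable lborel H" and z: "\<And>t. (\<integral>x. indicator {..t} x * H x \<partial>lborel) = 0"
    and z1: "(\<integral>x. H x \<partial>lborel) = 0"
  shows "AE x in lborel. H x = 0"
proof -
  have S: "set_lebesgue_integral lborel A H = 0" if "A \<in> sets borel" for A
  proof -
    have "Int_stable (range (\<lambda>a::real. {..a}))"
      by (auto simp: Int_stable_def intro: image_eqI[of _ _ "min _ _"])
    moreover have "range (\<lambda>a::real. {..a}) \<subseteq> Pow UNIV" by auto
    moreover have "A \<in> sigma_sets UNIV (range (\<lambda>a::real. {..a}))" using that by (simp add: borel_eq_atMost)
    ultimately show ?thesis
    proof (induction rule: sigma_sets_induct_disjoint)
      case (basic A)
      then show ?case using z by (auto simp: set_lebesgue_integral_def)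
    next
      case empty then show ?case by (simp add: set_lebesgue_integral_def)
    next
      case (compl A)
      then have A: "A \<in> sets borel" by (simp add: borel_eq_atMost)
      have "set_lebesgue_integral lborel (UNIV - A) H = (\<integral>x. H x - indicator A x *\<^sub>R H x \<partial>lborel)"
        unfolding set_lebesgue_integral_def by (intro Bochner_Integration.integral_cong) (auto simp: indicator_def)
      also have "\<dots> = (\<integral>x. H x \<partial>lborel) - set_lebesgue_integral lborel A H"
        unfolding set_lebesgue_integral_def using A H integrable_mult_indicator[of A lborel H]
        by (intro Bochner_Integration.integral_diff) auto
      finally show ?case using compl z1 by simp
    next
      case (union A)
      then have A: "\<And>i. A i \<in> sets lborel" by (auto simp: borel_eq_atMost)
      have "set_lebesgue_integral lborel (\<Union>i. A i) H = (\<Sum>i. set_lebesgue_integral lborel (A i) H)"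
      proof (rule lebesgue_integral_countable_add)
        show "set_integrable lborel (\<Union>i. A i) H"
          unfolding set_integrable_def using A H by (intro integrable_mult_indicator) auto
        show "A i \<inter> A j = {}" if "i \<noteq> j" for i j using union(1) that by (auto simp: disjoint_family_on_def)
      qed (use A in auto)
      then show ?case using union by simp
    qed
  qed
  have "AE x in lborel. H x = (\<lambda>_. 0) x"
    by (rule density_unique_real[OF H]) (use S in auto)
  then show ?thesis by simp
qed

text \<open>A function with vanishing weak derivative is constant. A test function of integral zero is the
  derivative of a test function; hence \<open>F - c\<close> annihilates all test functions once \<open>c\<close> is chosen to
  annihilate one with integral different from zero. Smooth approximations of indicator functions finish the argument.\<close>

lemma du_bois_reymond:
  fixes F :: "real \<Rightarrow> real"
  assumes T: "0 < T" and F: "integrable lborel F"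
    and w: "\<And>\<eta>. \<eta> \<in> test_functions {0<..<T} \<Longrightarrow> (\<integral>x. deriv \<eta> x * F x \<partial>lborel) = 0"
  shows "\<exists>c. AE x in lborel. x \<in> {0<..<T} \<longrightarrow> F x = c"
proof -
  define \<theta> where "\<theta> = bump (T / 3) (2 * T / 3)"
  have \<theta>: "\<theta> \<in> test_functions {0<..<T}"
    by (rule test_functionI[of _ "T / 3" "2 * T / 3"]) (use T Ck_bump bump_zero in \<open>auto simp: \<theta>_def\<close>)
  have \<theta>c: "continuous_on UNIV \<theta>" by (rule test_function_deriv(4)[OF \<theta> T])
  have m: "(\<integral>x. \<theta> x \<partial>lborel) > 0"
  proof -
    have "(\<integral>x. \<theta> x \<partial>lborel) \<noteq> 0"
    proof
      assume "(\<integral>x. \<theta> x \<partial>lborel) = 0"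
      then have "AE x in lborel. \<theta> x = 0"
        using integral_nonneg_eq_0_iff_AE[OF test_function_integrable(1)[OF \<theta> T]] bump_nonneg by (auto simp: \<theta>_def)
      then have "AE x in lborel. x \<notin> {T/3<..<2*T/3}"
      proof eventually_elim
        case (elim x)
        then show ?case using bump_pos[of "T / 3" x "2 * T / 3"] by (auto simp: \<theta>_def)
      qed
      then have "emeasure lborel {T/3<..<2*T/3} = 0"
        by (intro null_setsD1 AE_iff_null_sets[THEN iffD2]) auto
      then show False using T by simp
    qed
    moreover have "(\<integral>x. \<theta> x \<partial>lborel) \<ge> 0" by (intro Bochner_Integration.integral_nonneg) (simp add: \<theta>_def bump_nonneg)
    ultimately show ?thesis by simp
  qed
  define c where "c = (\<integral>x. \<theta> x * F x \<partial>lborel) / (\<integral>x. \<theta> x \<partial>lborel)"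
  have key: "(\<integral>x. \<xi> x * F x \<partial>lborel) = c * (\<integral>x. \<xi> x \<partial>lborel)" if \<xi>: "\<xi> \<in> test_functions {0<..<T}" for \<xi>
  proof -
    define q where "q = (\<integral>x. \<xi> x \<partial>lborel) / (\<integral>x. \<theta> x \<partial>lborel)"
    \<comment> \<open>Subtracting a multiple of \<open>\<theta>\<close> gives integral zero.\<close>
    define \<zeta> where "\<zeta> = (\<lambda>x. \<xi> x + - q * \<theta> x)"
    obtain a0 b0 where ab: "0 < a0" "a0 < b0" "b0 < T" "\<And>x. x \<notin> {a0<..<b0} \<Longrightarrow> \<xi> x = 0"
      using test_functionE[OF \<xi> T] by blast
    define a where "a = min a0 (T / 3)"
    define b where "b = max b0 (2 * T / 3)"
    have a: "0 < a" "a < b" "b < T" using ab T by (auto simp: a_def b_def)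
    have \<zeta>0: "\<zeta> x = 0" if "x \<notin> {a<..<b}" for x
    proof -
      have "x \<notin> {a0<..<b0}" "\<not> (T / 3 < x \<and> x < 2 * T / 3)" using that by (auto simp: a_def b_def)
      then show ?thesis using ab(4)[of x] bump_zero[of "T / 3" x "2 * T / 3"] by (simp add: \<zeta>_def \<theta>_def)
    qed
    have C\<zeta>: "Ck n \<zeta>" for n
      unfolding \<zeta>_def using \<xi> \<theta> by (intro Ck_add Ck_mult Ck_const) (auto simp: test_functions_def)
    have \<zeta>c: "continuous_on UNIV \<zeta>" using C\<zeta>[of 0] by simp
    have i0: "(\<integral>x. \<zeta> x \<partial>lborel) = 0"
      unfolding \<zeta>_def using test_function_integrable(1)[OF \<xi> T] test_function_integrable(1)[OF \<theta> T] m
      by (simp add: q_def)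
    obtain \<eta> where \<eta>: "\<And>x. (\<eta> has_real_derivative \<zeta> x) (at x)" "\<And>x. x < a \<Longrightarrow> \<eta> x = 0"
      using smooth_antiderivative[OF \<zeta>c, of a] \<zeta>0 by force
    have d\<eta>: "deriv \<eta> = \<zeta>" using \<eta>(1) by (auto simp: DERIV_imp_deriv)
    have \<eta>b: "\<eta> x = 0" if "x > b" for x
    proof -
      have "(\<integral>y. \<zeta> y * indicator {a/2..x} y \<partial>lborel) = \<eta> x - \<eta> (a/2)"
        using a that \<eta>(1) \<zeta>c by (intro integral_FTC_Icc_real) (auto simp: continuous_on_eq_continuous_at)
      also have "(\<lambda>y. \<zeta> y * indicator {a/2..x} y) = \<zeta>"
      proof
        fix y show "\<zeta> y * indicator {a/2..x} y = \<zeta> y" using \<zeta>0[of y] a that by (cases "y \<in> {a<..<b}") auto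
      qed
      finally show ?thesis using i0 \<eta>(2)[of "a/2"] a by simp
    qed
    have "\<eta> \<in> test_functions {0<..<T}"
    proof (rule test_functionI)
      show "Ck n \<eta>" for n using Ck_real_Suc[of \<eta> \<zeta> n] \<eta>(1) C\<zeta> Ck_Suc_imp by blast
      show "\<eta> x = 0" if "x \<notin> {a..b}" for x using that \<eta>(2)[of x] \<eta>b[of x] by auto
    qed (use a in auto)
    from w[OF this] have "(\<integral>x. \<zeta> x * F x \<partial>lborel) = 0" by (simp add: d\<eta>)
    also have "(\<integral>x. \<zeta> x * F x \<partial>lborel) = (\<integral>x. \<xi> x * F x - q * (\<theta> x * F x) \<partial>lborel)"
      by (simp add: \<zeta>_def algebra_simps)
    also have "\<dots> = (\<integral>x. \<xi> x * F x \<partial>lborel) - q * (\<integral>x. \<theta> x * F x \<partial>lborel)"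
      using test_function_mult_integrable[OF \<xi> T F] test_function_mult_integrable[OF \<theta> T F] by simp
    finally show ?thesis by (simp add: q_def c_def mult.commute)
  qed
  define H where "H = (\<lambda>x. indicator {0<..<T} x * (F x - c))"
  have [measurable]: "F \<in> borel_measurable borel" using F by (auto dest: borel_measurable_integrable)
  have indI: "integrable lborel (indicator {0<..<s} :: real \<Rightarrow> real)" if "0 \<le> s" for s :: real
    by (rule integrable_real_indicator) (use that in auto)
  have Hi: "integrable lborel H"
  proof -
    have "H = (\<lambda>x. indicator {0<..<T} x *\<^sub>R F x - c * indicator {0<..<T} x)" by (auto simp: H_def fun_eq_iff algebra_simps)
    moreover have "integrable lborel (\<lambda>x. indicator {0<..<T} x *\<^sub>R F x)" by (intro integrable_mult_indicator F) auto
    ultimately show ?thesis using indI[of T] T by simp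
  qed
  have init: "(\<integral>x. indicator {0<..<t} x * H x \<partial>lborel) = 0" if t: "0 < t" "t \<le> T" for t
  proof -
    define a where "a = (\<lambda>n::nat. t / (real n + 3))"
    \<comment> \<open>These test functions tend to the indicator function of \<open>(0, t)\<close>: the bump is positive exactly
      inside a slightly smaller interval, and \<open>n\<close> times the bump tends to infinity.\<close>
    define \<xi> where "\<xi> = (\<lambda>n::nat. \<lambda>x. 1 + - exp (- real n * bump (a n) (t - a n) x))"
    have a: "0 < a n" "a n < t" "a n \<le> t / 3" for n
    proof -
      show "0 < a n" using t by (simp add: a_def)
      show *: "a n \<le> t / 3" unfolding a_def using t by (intro divide_left_mono) auto
      show "a n < t" using * t by simp
    qed
    have \<xi>t: "\<xi> n \<in> test_functions {0<..<T}" for n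
    proof (rule test_functionI[of _ "a n" "t - a n"])
      have "Ck m (\<lambda>x. 1 + (- 1) * exp (- real n * bump (a n) (t - a n) x))" for m
        by (intro Ck_add Ck_mult Ck_const Ck_exp Ck_bump)
      then show "Ck m (\<xi> n)" for m by (simp add: \<xi>_def)
      show "\<xi> n x = 0" if "x \<notin> {a n..t - a n}" for x using that bump_zero[of "a n" x "t - a n"] by (auto simp: \<xi>_def)
    qed (use a[of n] t in auto)
    have \<xi>b: "\<bar>\<xi> n x\<bar> \<le> indicator {0<..<t} x" for n x
    proof (cases "x \<in> {0<..<t}")
      case True
      have "exp (- real n * bump (a n) (t - a n) x) \<le> exp 0"
        using bump_nonneg[of "a n" "t - a n" x] by (subst exp_le_cancel_iff) simp
      moreover have "0 < exp (- real n * bump (a n) (t - a n) x)" by simp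
      ultimately show ?thesis using True by (simp add: \<xi>_def abs_le_iff)
    next
      case False
      then have "\<not> (a n < x \<and> x < t - a n)" using a(1)[of n] by auto
      then show ?thesis using False bump_zero by (auto simp: \<xi>_def)
    qed
    have \<xi>l: "(\<lambda>n. \<xi> n x) \<longlonglongrightarrow> indicator {0<..<t} x" for x
    proof (cases "x \<in> {0<..<t}")
      case True
      have a0: "a \<longlonglongrightarrow> 0" unfolding a_def by real_asymp
      have "(\<lambda>n. bump (a n) (t - a n) x) \<longlonglongrightarrow> bump 0 t x"
        unfolding bump_def using a0
        by (intro tendsto_mult isCont_tendsto_compose[OF flat_continuous]) (auto intro!: tendsto_eq_intros)
      moreover have "bump 0 t x > 0" using True by (intro bump_pos) auto
      ultimately have "filterlim (\<lambda>n. bump (a n) (t - a n) x * real n) at_top sequentially"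
        by (intro filterlim_tendsto_pos_mult_at_top[OF _ _ filterlim_real_sequentially])
      then have "filterlim (\<lambda>n. - (bump (a n) (t - a n) x * real n)) at_bot sequentially"
        by (simp add: filterlim_uminus_at_top)
      then have "(\<lambda>n. exp (- (bump (a n) (t - a n) x * real n))) \<longlonglongrightarrow> 0"
        by (rule filterlim_compose[OF exp_at_bot])
      then have "(\<lambda>n. 1 - exp (- (bump (a n) (t - a n) x * real n))) \<longlonglongrightarrow> 1 - 0" by (intro tendsto_intros)
      then show ?thesis using True by (simp add: \<xi>_def mult.commute)
    next
      case False
      then have "\<bar>\<xi> n x\<bar> \<le> 0" for n using \<xi>b[of n x] by simp
      then show ?thesis using False by simp
    qed
    have [measurable]: "\<xi> n \<in> borel_measurable borel" for n by (rule test_function_integrable(3)[OF \<xi>t T])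
    have "(\<integral>x. \<xi> n x * (F x - c) \<partial>lborel) = 0" for n
      using key[OF \<xi>t[of n]] test_function_mult_integrable[OF \<xi>t[of n] T F] test_function_integrable(1)[OF \<xi>t[of n] T]
      by (simp add: right_diff_distrib mult.commute[of _ c])
    moreover have "\<xi> n x * (F x - c) = \<xi> n x * H x" for n x
      using \<xi>b[of n x] t by (cases "x \<in> {0<..<t}") (auto simp: H_def)
    ultimately have z: "(\<integral>x. \<xi> n x * H x \<partial>lborel) = 0" for n by simp
    have Hm[measurable]: "H \<in> borel_measurable borel" using Hi by (auto dest: borel_measurable_integrable)
    have "(\<lambda>n. \<integral>x. \<xi> n x * H x \<partial>lborel) \<longlonglongrightarrow> (\<integral>x. indicator {0<..<t} x * H x \<partial>lborel)"
    proof (rule integral_dominated_convergence[where w = "\<lambda>x. \<bar>H x\<bar>"])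
      show "AE x in lborel. (\<lambda>n. \<xi> n x * H x) \<longlonglongrightarrow> indicator {0<..<t} x * H x"
        by (intro always_eventually allI tendsto_mult \<xi>l tendsto_const)
      have "\<bar>\<xi> n x\<bar> \<le> 1" for n x by (rule order_trans[OF \<xi>b]) (simp add: indicator_def)
      then show "AE x in lborel. norm (\<xi> n x * H x) \<le> \<bar>H x\<bar>" for n by (auto simp: abs_mult intro!: mult_left_le_one_le)
    qed (use Hi in auto)
    then show ?thesis unfolding z by (simp add: LIMSEQ_const_iff)
  qed
  have "AE x in lborel. H x = 0"
  proof (rule borel_zero_if_initial_integrals_zero[OF Hi])
    have HT: "(\<lambda>x. indicator {0<..<T} x * H x) = H" by (simp add: H_def indicator_def fun_eq_iff)
    then show "(\<integral>x. H x \<partial>lborel) = 0" using init[of T] T by simp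
    fix t
    show "(\<integral>x. indicator {..t} x * H x \<partial>lborel) = 0"
    proof (cases "t \<le> 0")
      case True
      then have "(\<lambda>x. indicator {..t} x * H x) = (\<lambda>_. 0)" by (auto simp: H_def indicator_def fun_eq_iff)
      then show ?thesis by simp
    next
      case False
      then have "min t T > 0" using T by simp
      have "AE x in lborel. x \<noteq> t" by (rule AE_lborel_singleton)
      then have "(\<integral>x. indicator {..t} x * H x \<partial>lborel) = (\<integral>x. indicator {0<..<min t T} x * H x \<partial>lborel)"
        using Hi by (intro integral_cong_AE) (auto simp: H_def indicator_def elim!: eventually_mono)
      then show ?thesis using init[of "min t T"] \<open>min t T > 0\<close> by simp
    qed
  qed
  then show ?thesis by (intro exI[of _ c]) (auto simp: H_def elim!: eventually_mono)
qed

text \<open>For integrands vanishing on the negative half-line this is the integral from \<open>0\<close>; integrating from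
  \<open>- \<infinity>\<close> makes it compatible with convolution on the line.\<close>

definition primitive :: "(real \<Rightarrow> real) \<Rightarrow> real \<Rightarrow> real" where
  "primitive F t = (\<integral>x. indicator {..t} x * F x \<partial>lborel)"

lemma primitive_diff:
  assumes F: "integrable lborel F" and "a \<le> t"
  shows "primitive F t = primitive F a + (\<integral>x. indicator {a..t} x * F x \<partial>lborel)"
proof -
  have i: "integrable lborel (\<lambda>x. indicator A x * F x)" if "A \<in> sets borel" for A
    using integrable_mult_indicator[of A lborel F] that F by simp
  have "primitive F a + (\<integral>x. indicator {a..t} x * F x \<partial>lborel) = (\<integral>x. indicator {..a} x * F x + indicator {a..t} x * F x \<partial>lborel)"
    unfolding primitive_def by (intro Bochner_Integration.integral_add[symmetric] i) auto
  also have "\<dots> = primitive F t"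
    unfolding primitive_def
  proof (rule integral_cong_AE)
    show "AE x in lborel. indicator {..a} x * F x + indicator {a..t} x * F x = indicator {..t} x * F x"
      using AE_lborel_singleton[of a] by eventually_elim (use \<open>a \<le> t\<close> in \<open>auto simp: indicator_def\<close>)
  qed (use F in \<open>auto dest: borel_measurable_integrable\<close>)
  finally show ?thesis by simp
qed

lemma primitive_bound:
  assumes "integrable lborel F" shows "\<bar>primitive F t\<bar> \<le> (\<integral>x. \<bar>F x\<bar> \<partial>lborel)"
proof -
  have "\<bar>primitive F t\<bar> \<le> (\<integral>x. \<bar>indicator {..t} x * F x\<bar> \<partial>lborel)"
    unfolding primitive_def using integral_norm_bound[of lborel "\<lambda>x. indicator {..t} x * F x"] by simp
  also have "\<dots> \<le> (\<integral>x. \<bar>F x\<bar> \<partial>lborel)"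
    using assms integrable_mult_indicator[of "{..t}" lborel F] by (intro integral_mono) (auto simp: indicator_def)
  finally show ?thesis .
qed

lemma primitive_continuous:
  assumes F: "integrable lborel F" shows "continuous_on UNIV (primitive F)"
proof -
  have [measurable]: "F \<in> borel_measurable borel" using F by (auto dest: borel_measurable_integrable)
  have "isCont (primitive F) t" for t
    unfolding continuous_at_sequentially o_def
  proof (intro allI impI)
    fix X :: "nat \<Rightarrow> real" assume X: "X \<longlonglongrightarrow> t"
    show "(\<lambda>n. primitive F (X n)) \<longlonglongrightarrow> primitive F t"
      unfolding primitive_def
    proof (rule integral_dominated_convergence[where w = "\<lambda>x. \<bar>F x\<bar>"])
      show "AE x in lborel. (\<lambda>n. indicator {..X n} x * F x) \<longlonglongrightarrow> indicator {..t} x * F x"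
        using AE_lborel_singleton[of t]
      proof eventually_elim
        case (elim x)
        have "\<forall>\<^sub>F n in sequentially. indicator {..X n} x = (indicator {..t} x :: real)"
        proof (cases "x < t")
          case True
          then show ?thesis using order_tendstoD(1)[OF X True] by (auto elim!: eventually_mono simp: indicator_def)
        next
          case False
          then have "t < x" using elim by simp
          then show ?thesis using order_tendstoD(2)[OF X \<open>t < x\<close>] by (auto elim!: eventually_mono simp: indicator_def)
        qed
        then have "(\<lambda>n. indicator {..X n} x :: real) \<longlonglongrightarrow> indicator {..t} x" by (rule tendsto_eventually)
        then show ?case by (intro tendsto_intros)
      qed
    qed (use F in \<open>auto simp: indicator_def\<close>)
  qed
  then show ?thesis by (intro continuous_at_imp_continuous_on) auto
qed

text \<open>The absolutely continuous representative of a function with an integrable weak derivative.\<close>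

lemma weak_derivative_representation:
  fixes F F1 :: "real \<Rightarrow> real"
  assumes T: "0 < T" and F: "integrable lborel F" and F1: "integrable lborel F1"
    and w: "\<And>\<eta>. \<eta> \<in> test_functions {0<..<T} \<Longrightarrow> (\<integral>x. deriv \<eta> x * F x \<partial>lborel) = - (\<integral>x. \<eta> x * F1 x \<partial>lborel)"
  shows "\<exists>c. AE x in lborel. x \<in> {0<..<T} \<longrightarrow> F x = c + primitive F1 x"
proof -
  have [measurable]: "primitive F1 \<in> borel_measurable borel" by (rule borel_measurable_continuous_onI[OF primitive_continuous[OF F1]])
  define P where "P = (\<lambda>x. indicator {0<..<T} x * primitive F1 x)"
  have Pi: "integrable lborel P"
  proof (rule Bochner_Integration.integrable_bound[where f = "\<lambda>x. (\<integral>x. \<bar>F1 x\<bar> \<partial>lborel) * indicator {0<..<T} x"])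
    show "integrable lborel (\<lambda>x. (\<integral>x. \<bar>F1 x\<bar> \<partial>lborel) * indicator {0<..<T} x)"
      using T by (intro integrable_mult_right integrable_real_indicator) auto
    show "AE x in lborel. norm (P x) \<le> norm ((\<integral>x. \<bar>F1 x\<bar> \<partial>lborel) * indicator {0<..<T} x)"
      using primitive_bound[OF F1] by (intro AE_I2) (auto simp: P_def indicator_def intro: order_trans[OF _ abs_ge_self])
  qed (simp add: P_def)
  have "\<exists>c. AE x in lborel. x \<in> {0<..<T} \<longrightarrow> F x - P x = c"
  proof (rule du_bois_reymond[OF T])
    show "integrable lborel (\<lambda>x. F x - P x)" using F Pi by simp
    fix \<eta> assume \<eta>: "\<eta> \<in> test_functions {0<..<T}"
    obtain a b where ab: "0 < a" "a < b" "b < T" "\<And>x. x \<notin> {a<..<b} \<Longrightarrow> \<eta> x = 0"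
      using test_functionE[OF \<eta> T] by blast
    have z': "deriv \<eta> x = 0" if "x \<notin> {0<..<T}" for x
      using test_function_deriv(1)[OF \<eta> T] test_functionE[OF _ T] that by (metis greaterThanLessThan_iff less_trans)
    have \<eta>0: "\<eta> x = 0" if "x \<notin> {0<..<T}" for x using ab(1-3) ab(4)[of x] that by auto
    \<comment> \<open>The primitive has weak derivative \<open>F1\<close> as well, so \<open>F\<close> minus the primitive has weak derivative zero.\<close>
    have "(\<integral>x. deriv \<eta> x * primitive F1 x \<partial>lborel) = - (\<integral>x. \<eta> x * F1 x \<partial>lborel)"
    proof (rule weak_by_parts(3)[OF T test_function_deriv(2)[OF \<eta> T] test_function_deriv(3)[OF \<eta> T] \<eta>0 z'])
      show "integrable lborel (\<lambda>x. indicator {0..T} x * F1 x)" using integrable_mult_indicator[of "{0..T}" lborel F1] F1 by simp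
      show "primitive F1 t = primitive F1 0 + (\<integral>x. indicator {0..t} x * F1 x \<partial>lborel)" if "0 \<le> t" for t
        by (rule primitive_diff[OF F1 that])
    qed auto
    moreover have "deriv \<eta> x * primitive F1 x = deriv \<eta> x * P x" for x
      using z'[of x] by (cases "x \<in> {0<..<T}") (auto simp: P_def)
    ultimately have "(\<integral>x. deriv \<eta> x * P x \<partial>lborel) = - (\<integral>x. \<eta> x * F1 x \<partial>lborel)" by simp
    then show "(\<integral>x. deriv \<eta> x * (F x - P x) \<partial>lborel) = 0"
      using w[OF \<eta>] test_function_mult_integrable[OF test_function_deriv(1)[OF \<eta> T] T F]
        test_function_mult_integrable[OF test_function_deriv(1)[OF \<eta> T] T Pi]
      by (simp add: right_diff_distrib)
  qed
  then obtain c where "AE x in lborel. x \<in> {0<..<T} \<longrightarrow> F x - P x = c" by blast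
  then have "AE x in lborel. x \<in> {0<..<T} \<longrightarrow> F x = c + primitive F1 x"
    by eventually_elim (auto simp: P_def)
  then show ?thesis by blast
qed

text \<open>The trace at time zero of an \<open>H1\<close> function: express the constant by the function and its derivative at
  each time, square, and average over the interval.\<close>

lemma initial_value_bound:
  fixes F F1 :: "real \<Rightarrow> real"
  assumes T: "0 < T" and F1: "integrable lborel F1" and Fm[measurable]: "F \<in> borel_measurable borel" and z: "\<And>x. x \<notin> {0<..<T} \<Longrightarrow> F1 x = 0"
    and r: "AE x in lborel. x \<in> {0<..<T} \<longrightarrow> F x = c + primitive F1 x"
  shows "ennreal (T * c\<^sup>2) \<le> 2 * (\<integral>\<^sup>+x. ennreal ((F x)\<^sup>2) \<partial>lborel) + ennreal (2 * T\<^sup>2) * (\<integral>\<^sup>+x. ennreal ((F1 x)\<^sup>2) \<partial>lborel)"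
proof -
  have [measurable]: "F1 \<in> borel_measurable borel" using F1 by (auto dest: borel_measurable_integrable)
  let ?N1 = "\<integral>\<^sup>+x. ennreal ((F1 x)\<^sup>2) \<partial>lborel"
  have em: "(\<integral>\<^sup>+x. indicator {0<..<T} x \<partial>lborel) = ennreal T" using T by simp
  have pb: "ennreal ((primitive F1 x)\<^sup>2) \<le> ennreal T * ?N1" for x
  proof -
    have "ennreal \<bar>primitive F1 x\<bar> \<le> (\<integral>\<^sup>+x. ennreal \<bar>F1 x\<bar> \<partial>lborel)"
      using primitive_bound[OF F1, of x] nn_integral_eq_integral[of lborel "\<lambda>x. \<bar>F1 x\<bar>"] F1 by (simp add: ennreal_leI)
    also have "\<dots> = (\<integral>\<^sup>+x. indicator {0<..<T} x * ennreal \<bar>F1 x\<bar> \<partial>lborel)"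
      using z by (intro nn_integral_cong) (auto simp: indicator_def)
    finally have "(ennreal \<bar>primitive F1 x\<bar>)\<^sup>2 \<le> (\<integral>\<^sup>+x. indicator {0<..<T} x * ennreal \<bar>F1 x\<bar> \<partial>lborel)\<^sup>2"
      by (rule power_mono) simp
    also have "\<dots> \<le> (\<integral>\<^sup>+x. (indicator {0<..<T} x)\<^sup>2 \<partial>lborel) * (\<integral>\<^sup>+x. (ennreal \<bar>F1 x\<bar>)\<^sup>2 \<partial>lborel)"
      by (rule Cauchy_Schwarz_nn_integral) measurable
    also have "(\<lambda>x. (indicator {0<..<T} x :: ennreal)\<^sup>2) = indicator {0<..<T}" by (auto simp: indicator_def fun_eq_iff)
    finally show ?thesis by (simp add: ennreal_power em)
  qed
  have pw: "AE x in lborel. indicator {0<..<T} x * ennreal (c\<^sup>2) \<le> 2 * ennreal ((F x)\<^sup>2) + indicator {0<..<T} x * (2 * (ennreal T * ?N1))"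
    using r
  proof eventually_elim
    case (elim x)
    show ?case
    proof (cases "x \<in> {0<..<T}")
      case True
      then have c: "c = F x - primitive F1 x" using elim by simp
      have "c\<^sup>2 \<le> 2 * (F x)\<^sup>2 + 2 * (primitive F1 x)\<^sup>2"
        unfolding c using zero_le_power2[of "F x + primitive F1 x"] by (simp add: power2_eq_square algebra_simps)
      then have "ennreal (c\<^sup>2) \<le> ennreal (2 * (F x)\<^sup>2 + 2 * (primitive F1 x)\<^sup>2)" by (rule ennreal_leI)
      also have "\<dots> = 2 * ennreal ((F x)\<^sup>2) + 2 * ennreal ((primitive F1 x)\<^sup>2)" by (simp add: ennreal_plus ennreal_mult')
      also have "\<dots> \<le> 2 * ennreal ((F x)\<^sup>2) + 2 * (ennreal T * ?N1)"
        using pb[of x] by (intro add_left_mono mult_left_mono) auto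
      finally show ?thesis using True by simp
    qed simp
  qed
  have "ennreal (T * c\<^sup>2) = (\<integral>\<^sup>+x. indicator {0<..<T} x * ennreal (c\<^sup>2) \<partial>lborel)"
    using T by (simp add: nn_integral_multc em ennreal_mult)
  also have "\<dots> \<le> (\<integral>\<^sup>+x. 2 * ennreal ((F x)\<^sup>2) + indicator {0<..<T} x * (2 * (ennreal T * ?N1)) \<partial>lborel)"
    by (rule nn_integral_mono_AE[OF pw])
  also have "\<dots> = 2 * (\<integral>\<^sup>+x. ennreal ((F x)\<^sup>2) \<partial>lborel) + ennreal T * (2 * (ennreal T * ?N1))"
    by (subst nn_integral_add) (auto simp: nn_integral_cmult nn_integral_multc em)
  also have "ennreal T * (2 * (ennreal T * ?N1)) = ennreal (2 * T\<^sup>2) * ?N1"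
    using T by (simp add: ennreal_mult power2_eq_square mult_ac)
  finally show ?thesis .
qed

section \<open>The modes and their time derivatives\<close>

lemma mittag_leffler_continuous: "\<gamma> > 0 \<Longrightarrow> continuous_on UNIV (mittag_leffler \<gamma> \<beta>)"
  using mittag_leffler_deriv[of \<gamma> "\<beta> - 1"]
  by (intro continuous_at_imp_continuous_on ballI) (metis DERIV_isCont diff_add_cancel)

lemma ml_fun_measurable:
  assumes "\<gamma> > 0" shows "ml_fun \<gamma> \<mu> \<beta> \<in> borel_measurable borel"
proof -
  have [measurable]: "mittag_leffler \<gamma> \<beta> \<in> borel_measurable borel"
    by (rule borel_measurable_continuous_onI[OF mittag_leffler_continuous[OF assms]])
  show ?thesis unfolding ml_fun_def[abs_def] by measurable
qed

lemma ml_fun_isCont: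
  assumes "\<gamma> > 0" "t > 0" shows "isCont (ml_fun \<gamma> \<mu> \<beta>) t"
  using ml_fun_deriv[OF assms, of \<mu> "\<beta> - 1"] by (simp add: DERIV_isCont)

lemma ml_fun_FTC:
  assumes "\<gamma> > 0" "0 < a" "a \<le> t"
  shows "integrable lborel (\<lambda>x. indicator {a..t} x * ml_fun \<gamma> \<mu> \<beta> x)"
    "(\<integral>x. indicator {a..t} x * ml_fun \<gamma> \<mu> \<beta> x \<partial>lborel) = ml_fun \<gamma> \<mu> (\<beta> + 1) t - ml_fun \<gamma> \<mu> (\<beta> + 1) a"
proof -
  have h: "has_bochner_integral lborel (\<lambda>x. ml_fun \<gamma> \<mu> \<beta> x * indicator {a..t} x) (ml_fun \<gamma> \<mu> (\<beta> + 1) t - ml_fun \<gamma> \<mu> (\<beta> + 1) a)"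
    using assms by (intro has_bochner_integral_FTC_Icc_real ml_fun_deriv ml_fun_isCont) auto
  show "integrable lborel (\<lambda>x. indicator {a..t} x * ml_fun \<gamma> \<mu> \<beta> x)"
    "(\<integral>x. indicator {a..t} x * ml_fun \<gamma> \<mu> \<beta> x \<partial>lborel) = ml_fun \<gamma> \<mu> (\<beta> + 1) t - ml_fun \<gamma> \<mu> (\<beta> + 1) a"
    using h by (simp_all add: has_bochner_integral_iff mult.commute)
qed

text \<open>The decay of the Mittag-Leffler function, interpolated: gaining a factor \<open>sqrt \<mu>\<close> or \<open>\<mu>\<close> costs a factor
  \<open>t powr (- \<gamma> / 2)\<close> or \<open>t powr (- \<gamma>)\<close>.\<close>

lemma ml_fun_bound:
  assumes "1 < \<gamma>" "\<gamma> < 2" "0 < \<beta>"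
  shows "\<exists>K\<ge>0. \<forall>\<mu>\<ge>0. \<forall>t>0. \<bar>ml_fun \<gamma> \<mu> \<beta> t\<bar> \<le> K * t powr (\<beta> - 1)
    \<and> sqrt \<mu> * \<bar>ml_fun \<gamma> \<mu> \<beta> t\<bar> \<le> K * t powr (\<beta> - 1 - \<gamma> / 2) \<and> \<mu> * \<bar>ml_fun \<gamma> \<mu> \<beta> t\<bar> \<le> K * t powr (\<beta> - 1 - \<gamma>)"
proof -
  obtain K where K: "\<And>x. x \<ge> 0 \<Longrightarrow> \<bar>mittag_leffler \<gamma> \<beta> (- x)\<bar> \<le> K / (1 + x)"
    using mittag_leffler_bound[OF assms] by blast
  have K0: "K \<ge> 0" using K[of 0] by (simp add: order_trans[OF abs_ge_zero])
  show ?thesis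
  proof (intro exI[of _ K] conjI allI impI K0)
    fix \<mu> t :: real assume \<mu>: "\<mu> \<ge> 0" and t: "t > 0"
    define x where "x = \<mu> * t powr \<gamma>"
    define E where "E = \<bar>mittag_leffler \<gamma> \<beta> (- x)\<bar>"
    have x: "x \<ge> 0" using \<mu> by (simp add: x_def)
    have E: "E * (1 + x) \<le> K" "E \<ge> 0" using K[OF x] x by (auto simp: E_def field_simps)
    have Ex: "0 \<le> E * x" using E x by simp
    have E1: "E \<le> K" "E * x \<le> K" using E Ex by (auto simp: algebra_simps)
    have "sqrt x \<le> 1 + x"
    proof -
      have "x \<le> (1 + x)\<^sup>2" using x by (simp add: power2_eq_square algebra_simps)
      then have "sqrt x \<le> sqrt ((1 + x)\<^sup>2)" by (rule real_sqrt_le_mono)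
      then show ?thesis using x by simp
    qed
    then have "E * sqrt x \<le> E * (1 + x)" using E by (intro mult_left_mono) auto
    then have E2: "E * sqrt x \<le> K" using E by simp
    have m: "\<bar>ml_fun \<gamma> \<mu> \<beta> t\<bar> = t powr (\<beta> - 1) * E" by (simp add: ml_fun_def abs_mult E_def x_def)
    show "\<bar>ml_fun \<gamma> \<mu> \<beta> t\<bar> \<le> K * t powr (\<beta> - 1)"
      unfolding m by (subst mult.commute) (intro mult_right_mono E1(1), simp)
    have sx: "sqrt x = sqrt \<mu> * t powr (\<gamma> / 2)"
      unfolding x_def using t by (simp add: real_sqrt_mult powr_half_sqrt[symmetric] powr_powr)
    have "sqrt \<mu> * \<bar>ml_fun \<gamma> \<mu> \<beta> t\<bar> = (E * sqrt x) * t powr (\<beta> - 1 - \<gamma> / 2)"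
      unfolding m sx using t by (simp add: powr_diff)
    also have "\<dots> \<le> K * t powr (\<beta> - 1 - \<gamma> / 2)" using E2 by (intro mult_right_mono) auto
    finally show "sqrt \<mu> * \<bar>ml_fun \<gamma> \<mu> \<beta> t\<bar> \<le> K * t powr (\<beta> - 1 - \<gamma> / 2)" .
    have "\<mu> * \<bar>ml_fun \<gamma> \<mu> \<beta> t\<bar> = (E * x) * t powr (\<beta> - 1 - \<gamma>)"
      unfolding m x_def using t by (simp add: powr_diff)
    also have "\<dots> \<le> K * t powr (\<beta> - 1 - \<gamma>)" using E1(2) by (intro mult_right_mono) auto
    finally show "\<mu> * \<bar>ml_fun \<gamma> \<mu> \<beta> t\<bar> \<le> K * t powr (\<beta> - 1 - \<gamma>)" .
  qed
qed

text \<open>The index \<open>\<gamma> - 2\<close> is negative; one step of the recurrence moves it to \<open>2 \<gamma> - 2 > 0\<close>.\<close>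

lemma ml_fun_bound_singular:
  assumes "1 < \<gamma>" "\<gamma> < 2"
  shows "\<exists>K\<ge>0. \<forall>\<mu>\<ge>0. \<forall>t>0. \<bar>ml_fun \<gamma> \<mu> (\<gamma> - 2) t\<bar> \<le> K * t powr (\<gamma> - 3)"
proof -
  obtain K where K: "K \<ge> 0" "\<And>\<mu> t. \<mu> \<ge> 0 \<Longrightarrow> t > 0 \<Longrightarrow> \<mu> * \<bar>ml_fun \<gamma> \<mu> (2 * \<gamma> - 2) t\<bar> \<le> K * t powr (2 * \<gamma> - 2 - 1 - \<gamma>)"
    using ml_fun_bound[OF assms, of "2 * \<gamma> - 2"] assms by auto
  show ?thesis
  proof (intro exI[of _ "1 / \<bar>Gamma (\<gamma> - 2)\<bar> + K"] conjI allI impI)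
    fix \<mu> t :: real assume \<mu>: "\<mu> \<ge> 0" and t: "t > 0"
    have "ml_fun \<gamma> \<mu> (\<gamma> - 2) t = t powr (\<gamma> - 3) / Gamma (\<gamma> - 2) - \<mu> * ml_fun \<gamma> \<mu> (2 * \<gamma> - 2) t"
      using ml_fun_rec[of \<gamma> t \<mu> "\<gamma> - 2"] assms t by simp
    also have "\<bar>\<dots>\<bar> \<le> \<bar>t powr (\<gamma> - 3) / Gamma (\<gamma> - 2)\<bar> + \<bar>\<mu> * ml_fun \<gamma> \<mu> (2 * \<gamma> - 2) t\<bar>" by (rule abs_triangle_ineq4)
    also have "\<dots> \<le> t powr (\<gamma> - 3) / \<bar>Gamma (\<gamma> - 2)\<bar> + K * t powr (\<gamma> - 3)"
      using K(2)[OF \<mu> t] \<mu> by (simp add: abs_mult)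
    finally show "\<bar>ml_fun \<gamma> \<mu> (\<gamma> - 2) t\<bar> \<le> (1 / \<bar>Gamma (\<gamma> - 2)\<bar> + K) * t powr (\<gamma> - 3)" by (simp add: algebra_simps)
  qed (use K in auto)
qed

lemma nn_integral_powr:
  assumes "p > -1" "T > 0"
  shows "(\<integral>\<^sup>+t. ennreal (indicator {0<..<T} t * t powr p) \<partial>lborel) \<le> ennreal (T powr (p + 1) / (p + 1))"
proof -
  have "((\<lambda>x. x powr p) has_integral (T powr (p + 1) / (p + 1))) {0..T}"
    using has_integral_powr_from_0[of p T] assms by simp
  then have "(\<integral>\<^sup>+t. ennreal (indicator {0..T} t * t powr p) \<partial>lborel) = ennreal (T powr (p + 1) / (p + 1))"
    by (intro nn_integral_has_integral_lebesgue) auto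
  moreover have "(\<integral>\<^sup>+t. ennreal (indicator {0<..<T} t * t powr p) \<partial>lborel) \<le> (\<integral>\<^sup>+t. ennreal (indicator {0..T} t * t powr p) \<partial>lborel)"
    by (intro nn_integral_mono) (auto simp: indicator_def)
  ultimately show ?thesis by simp
qed

text \<open>The kernel cut off to the time interval, integrable on the whole line for \<open>\<beta> > 0\<close>. For times before \<open>T\<close> a causal
  convolution does not see the cut-off.\<close>

definition cut_ml :: "real \<Rightarrow> real \<Rightarrow> real \<Rightarrow> real \<Rightarrow> real \<Rightarrow> real" where
  "cut_ml \<gamma> \<mu> T \<beta> t = indicator {0<..<T} t * ml_fun \<gamma> \<mu> \<beta> t"

lemma cut_ml_measurable: "\<gamma> > 0 \<Longrightarrow> cut_ml \<gamma> \<mu> T \<beta> \<in> borel_measurable borel"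
  unfolding cut_ml_def[abs_def] using ml_fun_measurable[of \<gamma> \<mu> \<beta>] by measurable

lemma cut_ml_L1_bound:
  assumes "1 < \<gamma>" "\<gamma> < 2" "0 < \<beta>" "0 < T"
  shows "\<exists>K\<ge>0. \<forall>\<mu>\<ge>0. (\<integral>\<^sup>+t. ennreal \<bar>cut_ml \<gamma> \<mu> T \<beta> t\<bar> \<partial>lborel) \<le> ennreal K"
proof -
  obtain K where K: "K \<ge> 0" "\<And>\<mu> t. \<mu> \<ge> 0 \<Longrightarrow> t > 0 \<Longrightarrow> \<bar>ml_fun \<gamma> \<mu> \<beta> t\<bar> \<le> K * t powr (\<beta> - 1)"
    using ml_fun_bound[OF assms(1-3)] by blast
  show ?thesis
  proof (intro exI[of _ "K * (T powr (\<beta> - 1 + 1) / (\<beta> - 1 + 1))"] conjI allI impI)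
    fix \<mu> :: real assume \<mu>: "\<mu> \<ge> 0"
    have "(\<integral>\<^sup>+t. ennreal \<bar>cut_ml \<gamma> \<mu> T \<beta> t\<bar> \<partial>lborel) \<le> (\<integral>\<^sup>+t. ennreal K * ennreal (indicator {0<..<T} t * t powr (\<beta> - 1)) \<partial>lborel)"
      using K \<mu> by (intro nn_integral_mono) (auto simp: cut_ml_def indicator_def ennreal_mult[symmetric])
    also have "\<dots> = ennreal K * (\<integral>\<^sup>+t. ennreal (indicator {0<..<T} t * t powr (\<beta> - 1)) \<partial>lborel)"
      by (intro nn_integral_cmult) measurable
    also have "\<dots> \<le> ennreal K * ennreal (T powr (\<beta> - 1 + 1) / (\<beta> - 1 + 1))"
      using assms by (intro mult_left_mono nn_integral_powr) auto
    also have "\<dots> = ennreal (K * (T powr (\<beta> - 1 + 1) / (\<beta> - 1 + 1)))"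
      using K assms by (intro ennreal_mult[symmetric]) auto
    finally show "(\<integral>\<^sup>+t. ennreal \<bar>cut_ml \<gamma> \<mu> T \<beta> t\<bar> \<partial>lborel) \<le> ennreal (K * (T powr (\<beta> - 1 + 1) / (\<beta> - 1 + 1)))" .
  qed (use K assms in auto)
qed

lemma cut_ml_integrable:
  assumes "1 < \<gamma>" "\<gamma> < 2" "0 < \<beta>" "0 < T" "0 \<le> \<mu>"
  shows "integrable lborel (cut_ml \<gamma> \<mu> T \<beta>)"
proof (rule integrableI_bounded)
  obtain K where "(\<integral>\<^sup>+t. ennreal \<bar>cut_ml \<gamma> \<mu> T \<beta> t\<bar> \<partial>lborel) \<le> ennreal K" using cut_ml_L1_bound[OF assms(1-4)] assms(5) by blast
  then show "(\<integral>\<^sup>+t. ennreal (norm (cut_ml \<gamma> \<mu> T \<beta> t)) \<partial>lborel) < \<infinity>" by (simp add: order_le_less_trans)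
qed (use cut_ml_measurable[of \<gamma> \<mu> T \<beta>] assms in simp)

lemma primitive_zero: "(\<And>x. x \<le> 0 \<Longrightarrow> F x = 0) \<Longrightarrow> t \<le> 0 \<Longrightarrow> primitive F t = 0"
proof -
  assume "\<And>x. x \<le> 0 \<Longrightarrow> F x = 0" "t \<le> 0"
  then have "(\<lambda>x. indicator {..t} x * F x) = (\<lambda>_. 0)" by (auto simp: indicator_def fun_eq_iff)
  then show ?thesis by (simp add: primitive_def)
qed

text \<open>Away from \<open>0\<close> this is the fundamental theorem of calculus. Both sides vanish at \<open>0\<close>, the kernel because its index
  exceeds \<open>1\<close>.\<close>

lemma primitive_cut_ml:
  assumes g: "1 < \<gamma>" "\<gamma> < 2" "0 < \<beta>" "0 < T" "0 \<le> \<mu>" and t: "t < T"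
  shows "primitive (cut_ml \<gamma> \<mu> T \<beta>) t = cut_ml \<gamma> \<mu> T (\<beta> + 1) t"
proof (cases "t \<le> 0")
  case True
  then show ?thesis using primitive_zero[of "cut_ml \<gamma> \<mu> T \<beta>" t] by (simp add: cut_ml_def)
next
  case False
  let ?P = "primitive (cut_ml \<gamma> \<mu> T \<beta>)"
  let ?m = "ml_fun \<gamma> \<mu> (\<beta> + 1)"
  have I: "integrable lborel (cut_ml \<gamma> \<mu> T \<beta>)" by (rule cut_ml_integrable[OF g])
  have eq: "?P a - ?m a = ?P t - ?m t" if "0 < a" "a < t" for a
  proof -
    have "?P t = ?P a + (\<integral>x. indicator {a..t} x * cut_ml \<gamma> \<mu> T \<beta> x \<partial>lborel)" using that by (intro primitive_diff I) auto
    also have "(\<integral>x. indicator {a..t} x * cut_ml \<gamma> \<mu> T \<beta> x \<partial>lborel) = (\<integral>x. indicator {a..t} x * ml_fun \<gamma> \<mu> \<beta> x \<partial>lborel)"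
      using that t by (intro Bochner_Integration.integral_cong) (auto simp: cut_ml_def indicator_def)
    also have "\<dots> = ?m t - ?m a" using that g by (intro ml_fun_FTC) auto
    finally show ?thesis by simp
  qed
  obtain K where K: "\<And>t. t > 0 \<Longrightarrow> \<bar>?m t\<bar> \<le> K * t powr (\<beta> + 1 - 1)"
    using ml_fun_bound[OF g(1,2), of "\<beta> + 1"] g by auto
  have "(?m \<longlongrightarrow> 0) (at_right 0)"
  proof (rule Lim_null_comparison)
    show "\<forall>\<^sub>F a in at_right 0. norm (?m a) \<le> K * a powr \<beta>"
      using K by (auto simp: eventually_at_filter intro!: always_eventually)
    have "((\<lambda>a. a powr \<beta>) \<longlongrightarrow> 0) (at_right 0)" using g(3) by real_asymp
    then show "((\<lambda>a. K * a powr \<beta>) \<longlongrightarrow> 0) (at_right 0)" by (rule tendsto_mult_right_zero)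
  qed
  moreover have "(?P \<longlongrightarrow> ?P 0) (at_right 0)"
    using primitive_continuous[OF I] by (simp add: continuous_on_eq_continuous_at continuous_at filterlim_at_split)
  moreover have "?P 0 = 0" by (rule primitive_zero) (auto simp: cut_ml_def)
  ultimately have "((\<lambda>a. ?P a - ?m a) \<longlongrightarrow> 0 - 0) (at_right 0)" by (intro tendsto_diff) auto
  moreover have "\<forall>\<^sub>F a in at_right 0. ?P a - ?m a = ?P t - ?m t"
    using eq False by (auto simp: eventually_at_right_field intro!: exI[of _ t])
  ultimately have "((\<lambda>a::real. ?P t - ?m t) \<longlongrightarrow> 0) (at_right 0)"
    using tendsto_cong by fastforce
  then have "?P t = ?m t" by (simp add: tendsto_const_iff)
  then show ?thesis using False t by (simp add: cut_ml_def)
qed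

lemma primitive_convolution_cut_ml:
  assumes g: "1 < \<gamma>" "\<gamma> < 2" "0 < \<beta>" "0 < T" "0 \<le> \<mu>" and t: "t < T"
    and F: "integrable lborel F" "\<And>r. r \<le> 0 \<Longrightarrow> F r = 0"
  shows "primitive (convolution (cut_ml \<gamma> \<mu> T \<beta>) F) t = convolution (cut_ml \<gamma> \<mu> T (\<beta> + 1)) F t"
proof -
  have "primitive (convolution (cut_ml \<gamma> \<mu> T \<beta>) F) t = convolution (primitive (cut_ml \<gamma> \<mu> T \<beta>)) F t"
    using integral_convolution[OF cut_ml_integrable[OF g] F(1)] by (simp add: primitive_def[abs_def])
  also have "\<dots> = convolution (cut_ml \<gamma> \<mu> T (\<beta> + 1)) F t"
    unfolding convolution_def
  proof (rule Bochner_Integration.integral_cong[OF refl])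
    fix r show "primitive (cut_ml \<gamma> \<mu> T \<beta>) (t - r) * F r = cut_ml \<gamma> \<mu> T (\<beta> + 1) (t - r) * F r"
      using primitive_cut_ml[OF g, of "t - r"] F(2)[of r] t by (cases "r \<le> 0") auto
  qed
  finally show ?thesis .
qed

text \<open>A primitive moves from the forcing to the kernel, by commuting the convolution and applying the preceding rule twice.\<close>

lemma convolution_cut_ml_primitive:
  assumes g: "1 < \<gamma>" "\<gamma> < 2" "0 < \<beta>" "0 < T" "0 \<le> \<mu>" and t: "t < T"
    and F: "integrable lborel F" "\<And>r. r \<le> 0 \<Longrightarrow> F r = 0"
  shows "convolution (cut_ml \<gamma> \<mu> T \<beta>) (primitive F) t = convolution (cut_ml \<gamma> \<mu> T (\<beta> + 1)) F t"
proof -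
  have "convolution (cut_ml \<gamma> \<mu> T \<beta>) (primitive F) t = convolution (primitive F) (cut_ml \<gamma> \<mu> T \<beta>) t" by (rule convolution_commute)
  also have "\<dots> = primitive (convolution F (cut_ml \<gamma> \<mu> T \<beta>)) t"
    using integral_convolution[OF F(1) cut_ml_integrable[OF g]] by (simp add: primitive_def[abs_def])
  also have "convolution F (cut_ml \<gamma> \<mu> T \<beta>) = convolution (cut_ml \<gamma> \<mu> T \<beta>) F" by (rule ext) (rule convolution_commute)
  finally show ?thesis using primitive_convolution_cut_ml[OF g t F] by simp
qed

lemma convolution_cut_ml_const:
  assumes g: "1 < \<gamma>" "\<gamma> < 2" "0 < \<beta>" "0 < T" "0 \<le> \<mu>" and t: "t < T"
  shows "convolution (cut_ml \<gamma> \<mu> T \<beta>) (indicator {0<..<T}) t = cut_ml \<gamma> \<mu> T (\<beta> + 1) t"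
proof -
  have [measurable]: "cut_ml \<gamma> \<mu> T \<beta> \<in> borel_measurable borel" using cut_ml_measurable g by simp
  have "convolution (cut_ml \<gamma> \<mu> T \<beta>) (indicator {0<..<T}) t = convolution (indicator {0<..<T}) (cut_ml \<gamma> \<mu> T \<beta>) t" by (rule convolution_commute)
  also have "\<dots> = primitive (cut_ml \<gamma> \<mu> T \<beta>) t"
    unfolding convolution_def primitive_def
  proof (rule integral_cong_AE)
    show "AE r in lborel. indicator {0<..<T} (t - r) * cut_ml \<gamma> \<mu> T \<beta> r = indicator {..t} r * cut_ml \<gamma> \<mu> T \<beta> r"
      using AE_lborel_singleton[of t] by eventually_elim (use t in \<open>auto simp: indicator_def cut_ml_def\<close>)
  qed measurable
  also have "\<dots> = cut_ml \<gamma> \<mu> T (\<beta> + 1) t" by (rule primitive_cut_ml[OF g t])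
  finally show ?thesis .
qed

text \<open>Duhamel's integral absorbs one derivative of the forcing: the kernel index goes up by one and the
  initial value of the forcing appears as a boundary term.\<close>

lemma duhamel_step:
  assumes g: "1 < \<gamma>" "\<gamma> < 2" "0 < \<beta>" "0 < T" "0 \<le> \<mu>" and t: "t < T"
    and F[measurable]: "F \<in> borel_measurable borel" and Fz: "\<And>r. r \<notin> {0<..<T} \<Longrightarrow> F r = 0"
    and F1: "integrable lborel F1" "\<And>r. r \<le> 0 \<Longrightarrow> F1 r = 0"
    and r: "AE x in lborel. x \<in> {0<..<T} \<longrightarrow> F x = c + primitive F1 x"
  shows "convolution (cut_ml \<gamma> \<mu> T \<beta>) F t = c * cut_ml \<gamma> \<mu> T (\<beta> + 1) t + convolution (cut_ml \<gamma> \<mu> T (\<beta> + 1)) F1 t"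
proof -
  let ?k = "cut_ml \<gamma> \<mu> T \<beta>"
  have I: "integrable lborel ?k" by (rule cut_ml_integrable[OF g])
  have [measurable]: "?k \<in> borel_measurable borel" using cut_ml_measurable g by simp
  have [measurable]: "primitive F1 \<in> borel_measurable borel" by (rule borel_measurable_continuous_onI[OF primitive_continuous[OF F1(1)]])
  have Ik: "integrable lborel (\<lambda>r. ?k (t - r))"
    using lborel_integrable_real_affine[OF I, of "-1" t] by simp
  have i1: "integrable lborel (\<lambda>r. ?k (t - r) * indicator {0<..<T} r)"
    using integrable_mult_indicator[OF _ Ik, of "{0<..<T}"] by (simp add: mult.commute)
  have i2: "integrable lborel (\<lambda>r. ?k (t - r) * primitive F1 r)"
  proof (rule Bochner_Integration.integrable_bound[where f = "\<lambda>r. (\<integral>x. \<bar>F1 x\<bar> \<partial>lborel) * ?k (t - r)"])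
    show "AE r in lborel. norm (?k (t - r) * primitive F1 r) \<le> norm ((\<integral>x. \<bar>F1 x\<bar> \<partial>lborel) * ?k (t - r))"
    proof (rule AE_I2)
      fix r
      have "\<bar>primitive F1 r\<bar> \<le> \<bar>\<integral>x. \<bar>F1 x\<bar> \<partial>lborel\<bar>" using primitive_bound[OF F1(1), of r] by (rule order_trans) simp
      from mult_right_mono[OF this abs_ge_zero, of "?k (t - r)"]
      show "norm (?k (t - r) * primitive F1 r) \<le> norm ((\<integral>x. \<bar>F1 x\<bar> \<partial>lborel) * ?k (t - r))"
        unfolding real_norm_def abs_mult by (simp only: mult.commute)
    qed
  qed (use Ik in auto)
  have "convolution ?k F t = (\<integral>r. c * (?k (t - r) * indicator {0<..<T} r) + ?k (t - r) * primitive F1 r \<partial>lborel)"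
    unfolding convolution_def
  proof (rule integral_cong_AE)
    show "AE x in lborel. ?k (t - x) * F x = c * (?k (t - x) * indicator {0<..<T} x) + ?k (t - x) * primitive F1 x"
      using r
    proof eventually_elim
      case (elim x)
      consider "x \<le> 0" | "x \<in> {0<..<T}" | "x \<ge> T" by fastforce
      then show ?case
      proof cases
        case 1 then show ?thesis using Fz[of x] primitive_zero[OF F1(2)] by simp
      next
        case 2 then show ?thesis using elim by (simp add: algebra_simps)
      next
        case 3 then show ?thesis using t by (simp add: cut_ml_def)
      qed
    qed
  qed measurable
  also have "\<dots> = c * convolution ?k (indicator {0<..<T}) t + convolution ?k (primitive F1) t"
    using i1 i2 by (simp add: convolution_def)
  finally show ?thesis using convolution_cut_ml_const[OF g t] convolution_cut_ml_primitive[OF g t F1] by simp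
qed

text \<open>The time derivative of order \<open>n\<close> of a mode; \<open>F2\<close> is the second derivative of the forcing, and \<open>c0\<close>,
  \<open>c1\<close> are the initial values of the forcing and of its first derivative. A real order \<open>n\<close> avoids conversions in the
  indices.\<close>

definition mode_deriv :: "real \<Rightarrow> real \<Rightarrow> real \<Rightarrow> real \<Rightarrow> real \<Rightarrow> real \<Rightarrow> real \<Rightarrow> (real \<Rightarrow> real) \<Rightarrow> real \<Rightarrow> real \<Rightarrow> real" where
  "mode_deriv \<gamma> \<mu> T g h c0 c1 F2 n t = g * ml_fun \<gamma> \<mu> (1 - n) t + h * ml_fun \<gamma> \<mu> (2 - n) t
     + c0 * ml_fun \<gamma> \<mu> (\<gamma> + 1 - n) t + c1 * ml_fun \<gamma> \<mu> (\<gamma> + 2 - n) t + convolution (cut_ml \<gamma> \<mu> T (\<gamma> + 2 - n)) F2 t"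

text \<open>The bound on \<open>n\<close> keeps the index of the convolution kernel positive after the step: that kernel must be
  integrable up to \<open>t = 0\<close>. The other kernels are used away from \<open>0\<close>.\<close>

lemma mode_deriv_step:
  assumes g: "1 < \<gamma>" "\<gamma> < 2" "0 < T" "0 \<le> \<mu>" and n: "\<gamma> + 1 - n > 0" and F: "integrable lborel F2" "\<And>r. r \<le> 0 \<Longrightarrow> F2 r = 0"
    and t: "0 < a" "a \<le> t" "t < T"
  shows "integrable lborel (\<lambda>x. indicator {a..t} x * mode_deriv \<gamma> \<mu> T g h c0 c1 F2 (n + 1) x)"
    "mode_deriv \<gamma> \<mu> T g h c0 c1 F2 n t = mode_deriv \<gamma> \<mu> T g h c0 c1 F2 n a + (\<integral>x. indicator {a..t} x * mode_deriv \<gamma> \<mu> T g h c0 c1 F2 (n + 1) x \<partial>lborel)"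
proof -
  let ?k = "cut_ml \<gamma> \<mu> T (\<gamma> + 1 - n)"
  have \<gamma>0: "\<gamma> > 0" using g by simp
  have ki: "integrable lborel ?k" by (rule cut_ml_integrable[OF g(1,2) n g(3,4)])
  have ci: "integrable lborel (convolution ?k F2)" by (rule integrable_convolution[OF ki F(1)])
  have ci': "integrable lborel (\<lambda>x. indicator {a..t} x * convolution ?k F2 x)"
    using integrable_mult_indicator[of "{a..t}" lborel, OF _ ci] by simp
  have e: "\<gamma> + 2 - n = \<gamma> + 1 - n + 1" by simp
  have cc: "convolution (cut_ml \<gamma> \<mu> T (\<gamma> + 2 - n)) F2 t = convolution (cut_ml \<gamma> \<mu> T (\<gamma> + 2 - n)) F2 a + (\<integral>x. indicator {a..t} x * convolution ?k F2 x \<partial>lborel)"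
    unfolding e using primitive_convolution_cut_ml[OF g(1,2) n g(3,4) t(3) F] primitive_convolution_cut_ml[OF g(1,2) n g(3,4) _ F, of a] primitive_diff[OF ci t(2)] t by simp
  note fi = ml_fun_FTC(1)[OF \<gamma>0 t(1,2)] and fe = ml_fun_FTC(2)[OF \<gamma>0 t(1,2)]
  let ?M = "\<lambda>\<beta> x. indicator {a..t} x * ml_fun \<gamma> \<mu> \<beta> x"
  have s: "(\<lambda>x. indicator {a..t} x * mode_deriv \<gamma> \<mu> T g h c0 c1 F2 (n + 1) x) =
     (\<lambda>x. g * ?M (- n) x + h * ?M (1 - n) x + c0 * ?M (\<gamma> - n) x + c1 * ?M (\<gamma> + 1 - n) x + indicator {a..t} x * convolution ?k F2 x)"
    by (simp add: mode_deriv_def fun_eq_iff algebra_simps)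
  show "integrable lborel (\<lambda>x. indicator {a..t} x * mode_deriv \<gamma> \<mu> T g h c0 c1 F2 (n + 1) x)"
    unfolding s by (intro Bochner_Integration.integrable_add integrable_mult_right fi ci')
  have "(\<integral>x. indicator {a..t} x * mode_deriv \<gamma> \<mu> T g h c0 c1 F2 (n + 1) x \<partial>lborel) =
    g * (\<integral>x. ?M (- n) x \<partial>lborel) + h * (\<integral>x. ?M (1 - n) x \<partial>lborel) + c0 * (\<integral>x. ?M (\<gamma> - n) x \<partial>lborel) + c1 * (\<integral>x. ?M (\<gamma> + 1 - n) x \<partial>lborel)
     + (\<integral>x. indicator {a..t} x * convolution ?k F2 x \<partial>lborel)"
    unfolding s using fi ci' by simp
  then show "mode_deriv \<gamma> \<mu> T g h c0 c1 F2 n t = mode_deriv \<gamma> \<mu> T g h c0 c1 F2 n a + (\<integral>x. indicator {a..t} x * mode_deriv \<gamma> \<mu> T g h c0 c1 F2 (n + 1) x \<partial>lborel)"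
    unfolding fe mode_deriv_def[of \<gamma> \<mu> T g h c0 c1 F2 n] cc by (simp add: algebra_simps)
qed

text \<open>Three integrations by parts. The test function vanishes near \<open>t = 0\<close>, where the derivatives of the mode may blow
  up.\<close>

lemma mode_deriv_weak_derivative:
  assumes g: "1 < \<gamma>" "\<gamma> < 2" "0 < T" "0 \<le> \<mu>" and F: "integrable lborel F2" "\<And>r. r \<le> 0 \<Longrightarrow> F2 r = 0"
    and \<eta>: "\<eta> \<in> test_functions {0<..<T}"
  shows "(\<integral>x. (deriv ^^ 3) \<eta> x * mode_deriv \<gamma> \<mu> T g h c0 c1 F2 0 x \<partial>lborel) = - (\<integral>x. \<eta> x * mode_deriv \<gamma> \<mu> T g h c0 c1 F2 3 x \<partial>lborel)"
proof -
  obtain a b where ab: "0 < a" "a < b" "b < T" "\<And>x. x \<notin> {a<..<b} \<Longrightarrow> \<eta> x = 0"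
    using test_functionE[OF \<eta> g(3)] by blast
  have step: "deriv \<zeta> \<in> test_functions {0<..<T} \<and> (\<forall>x. x \<notin> {a..b} \<longrightarrow> deriv \<zeta> x = 0) \<and>
     (\<integral>x. deriv \<zeta> x * mode_deriv \<gamma> \<mu> T g h c0 c1 F2 n x \<partial>lborel) = - (\<integral>x. \<zeta> x * mode_deriv \<gamma> \<mu> T g h c0 c1 F2 (n + 1) x \<partial>lborel)"
    if \<zeta>: "\<zeta> \<in> test_functions {0<..<T}" and z: "\<And>x. x \<notin> {a..b} \<Longrightarrow> \<zeta> x = 0" and n: "\<gamma> + 1 - n > 0" for \<zeta> n
  proof (intro conjI allI impI)
    show "deriv \<zeta> \<in> test_functions {0<..<T}" by (rule test_function_deriv(1)[OF \<zeta> g(3)])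
    have z': "deriv \<zeta> x = 0" if x: "x \<notin> {a..b}" for x
    proof -
      have "((\<lambda>_. 0) has_real_derivative deriv \<zeta> x) (at x)"
        by (rule has_field_derivative_transform_within_open[OF test_function_deriv(2)[OF \<zeta> g(3)], of "- {a..b}"])
          (use x z in auto)
      then show ?thesis using DERIV_unique DERIV_const by blast
    qed
    then show "deriv \<zeta> x = 0" if "x \<notin> {a..b}" for x using that .
    define a' where "a' = a / 2" define b' where "b' = (b + T) / 2"
    have ab': "0 < a'" "a' < b'" "b' < T" "a' < a" "b < b'" using ab by (auto simp: a'_def b'_def)
    show "(\<integral>x. deriv \<zeta> x * mode_deriv \<gamma> \<mu> T g h c0 c1 F2 n x \<partial>lborel) = - (\<integral>x. \<zeta> x * mode_deriv \<gamma> \<mu> T g h c0 c1 F2 (n + 1) x \<partial>lborel)"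
    proof (rule weak_by_parts(3)[OF ab'(2) test_function_deriv(2)[OF \<zeta> g(3)] test_function_deriv(3)[OF \<zeta> g(3)]])
      show "\<zeta> x = 0" if "x \<notin> {a'<..<b'}" for x using z[of x] that ab' by auto
      show "deriv \<zeta> x = 0" if "x \<notin> {a'<..<b'}" for x using z'[of x] that ab' by auto
      show "integrable lborel (\<lambda>x. indicator {a'..b'} x * mode_deriv \<gamma> \<mu> T g h c0 c1 F2 (n + 1) x)"
        by (rule mode_deriv_step(1)[OF g n F]) (use ab' in auto)
      show "mode_deriv \<gamma> \<mu> T g h c0 c1 F2 n t = mode_deriv \<gamma> \<mu> T g h c0 c1 F2 n a' + (\<integral>x. indicator {a'..t} x * mode_deriv \<gamma> \<mu> T g h c0 c1 F2 (n + 1) x \<partial>lborel)"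
        if "a' \<le> t" "t \<le> b'" for t
        by (rule mode_deriv_step(2)[OF g n F]) (use ab' that in auto)
    qed
  qed
  have z0: "\<eta> x = 0" if "x \<notin> {a..b}" for x using ab(4)[of x] that by auto
  have s1: "\<gamma> + 1 - 2 > 0" "\<gamma> + 1 - 1 > 0" "\<gamma> + 1 - 0 > 0" using g by auto
  note A = step[OF \<eta> z0 s1(1)]
  have B: "deriv (deriv \<eta>) \<in> test_functions {0<..<T} \<and> (\<forall>x. x \<notin> {a..b} \<longrightarrow> deriv (deriv \<eta>) x = 0) \<and>
     (\<integral>x. deriv (deriv \<eta>) x * mode_deriv \<gamma> \<mu> T g h c0 c1 F2 1 x \<partial>lborel) = - (\<integral>x. deriv \<eta> x * mode_deriv \<gamma> \<mu> T g h c0 c1 F2 (1 + 1) x \<partial>lborel)"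
    by (rule step) (use A s1 in auto)
  have C: "(\<integral>x. deriv (deriv (deriv \<eta>)) x * mode_deriv \<gamma> \<mu> T g h c0 c1 F2 0 x \<partial>lborel) = - (\<integral>x. deriv (deriv \<eta>) x * mode_deriv \<gamma> \<mu> T g h c0 c1 F2 (0 + 1) x \<partial>lborel)"
    using step[of "deriv (deriv \<eta>)" 0] B s1 by blast
  show ?thesis using A B C by (simp add: numeral_3_eq_3)
qed

lemma convolution_measurable:
  assumes [measurable]: "k \<in> borel_measurable borel" "F \<in> borel_measurable borel"
  shows "convolution k F \<in> borel_measurable borel"
  unfolding convolution_def[abs_def] by measurable

lemma mode_deriv_measurable:
  assumes "\<gamma> > 0" "F2 \<in> borel_measurable borel"
  shows "mode_deriv \<gamma> \<mu> T g h c0 c1 F2 n \<in> borel_measurable borel"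
  unfolding mode_deriv_def[abs_def]
  using ml_fun_measurable[OF assms(1)] convolution_measurable[OF cut_ml_measurable[OF assms(1)] assms(2)] by measurable

lemma square_sum5_le: "(a + b + c + d + e)\<^sup>2 \<le> 5 * (a\<^sup>2 + b\<^sup>2 + c\<^sup>2 + d\<^sup>2 + (e::real)\<^sup>2)"
proof -
  have "5 * (a\<^sup>2 + b\<^sup>2 + c\<^sup>2 + d\<^sup>2 + e\<^sup>2) - (a + b + c + d + e)\<^sup>2 =
    (a-b)\<^sup>2 + (a-c)\<^sup>2 + (a-d)\<^sup>2 + (a-e)\<^sup>2 + (b-c)\<^sup>2 + (b-d)\<^sup>2 + (b-e)\<^sup>2 + (c-d)\<^sup>2 + (c-e)\<^sup>2 + (d-e)\<^sup>2"
    by (simp add: power2_eq_square algebra_simps)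
  also have "\<dots> \<ge> 0" by (intro add_nonneg_nonneg) auto
  finally show ?thesis by simp
qed

lemma cut_ml_young:
  assumes g: "1 < \<gamma>" "\<gamma> < 2" "0 < \<beta>" "0 < T"
  shows "\<exists>K\<ge>0. \<forall>\<mu>\<ge>0. \<forall>F\<in>borel_measurable borel.
    (\<integral>\<^sup>+t. ennreal ((convolution (cut_ml \<gamma> \<mu> T \<beta>) F t)\<^sup>2) \<partial>lborel) \<le> ennreal K * (\<integral>\<^sup>+t. ennreal ((F t)\<^sup>2) \<partial>lborel)"
proof -
  obtain K where K: "K \<ge> 0" "\<And>\<mu>. \<mu> \<ge> 0 \<Longrightarrow> (\<integral>\<^sup>+t. ennreal \<bar>cut_ml \<gamma> \<mu> T \<beta> t\<bar> \<partial>lborel) \<le> ennreal K"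
    using cut_ml_L1_bound[OF g] by blast
  show ?thesis
  proof (intro exI[of _ "K\<^sup>2"] conjI allI impI ballI)
    fix \<mu> :: real and F :: "real \<Rightarrow> real" assume \<mu>: "\<mu> \<ge> 0" and F: "F \<in> borel_measurable borel"
    have "(\<integral>\<^sup>+t. ennreal ((convolution (cut_ml \<gamma> \<mu> T \<beta>) F t)\<^sup>2) \<partial>lborel) \<le> (\<integral>\<^sup>+t. ennreal \<bar>cut_ml \<gamma> \<mu> T \<beta> t\<bar> \<partial>lborel)\<^sup>2 * (\<integral>\<^sup>+t. ennreal ((F t)\<^sup>2) \<partial>lborel)"
      using g by (intro young_L1_L2 cut_ml_measurable F) auto
    also have "\<dots> \<le> (ennreal K)\<^sup>2 * (\<integral>\<^sup>+t. ennreal ((F t)\<^sup>2) \<partial>lborel)"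
      by (intro mult_right_mono power_mono K \<mu>) auto
    finally show "(\<integral>\<^sup>+t. ennreal ((convolution (cut_ml \<gamma> \<mu> T \<beta>) F t)\<^sup>2) \<partial>lborel) \<le> ennreal (K\<^sup>2) * (\<integral>\<^sup>+t. ennreal ((F t)\<^sup>2) \<partial>lborel)"
      using K by (simp add: ennreal_power)
  qed simp
qed

text \<open>The heart of the estimate. After division by \<open>\<mu>\<close> the right-hand side is what the norms of the data
  control.\<close>

lemma mode_deriv3_bound:
  assumes g: "1 < \<gamma>" "\<gamma> < 2" "0 < T" and \<rho>: "5 - 2 * \<gamma> < \<rho>"
  shows "\<exists>C\<ge>0. \<forall>\<mu>\<ge>0. \<forall>g h c0 c1. \<forall>F2\<in>borel_measurable borel.
    (\<integral>\<^sup>+t. ennreal (indicator {0<..<T} t * (t powr \<rho> * (mode_deriv \<gamma> \<mu> T g h c0 c1 F2 3 t)\<^sup>2)) \<partial>lborel) \<le>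
      ennreal C * (ennreal (\<mu>\<^sup>2 * g\<^sup>2 + \<mu> * h\<^sup>2 + c0\<^sup>2 + c1\<^sup>2) + (\<integral>\<^sup>+t. ennreal ((F2 t)\<^sup>2) \<partial>lborel))"
proof -
  obtain Ka where Ka: "Ka \<ge> 0" "\<And>\<mu> t. \<mu> \<ge> 0 \<Longrightarrow> t > 0 \<Longrightarrow> \<bar>ml_fun \<gamma> \<mu> (\<gamma> - 2) t\<bar> \<le> Ka * t powr (\<gamma> - 3)"
    using ml_fun_bound_singular[OF g(1,2)] by blast
  have b1: "0 < \<gamma> - 1" using g by simp
  obtain Kb where Kb: "Kb \<ge> 0" "\<And>\<mu> t. \<mu> \<ge> 0 \<Longrightarrow> t > 0 \<Longrightarrow> \<bar>ml_fun \<gamma> \<mu> (\<gamma> - 1) t\<bar> \<le> Kb * t powr (\<gamma> - 1 - 1)"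
     "\<And>\<mu> t. \<mu> \<ge> 0 \<Longrightarrow> t > 0 \<Longrightarrow> sqrt \<mu> * \<bar>ml_fun \<gamma> \<mu> (\<gamma> - 1) t\<bar> \<le> Kb * t powr (\<gamma> - 1 - 1 - \<gamma> / 2)"
    using ml_fun_bound[OF g(1,2) b1] by blast
  obtain Kc where Kc: "Kc \<ge> 0" "\<And>\<mu> F. \<mu> \<ge> 0 \<Longrightarrow> F \<in> borel_measurable borel \<Longrightarrow>
     (\<integral>\<^sup>+t. ennreal ((convolution (cut_ml \<gamma> \<mu> T (\<gamma> - 1)) F t)\<^sup>2) \<partial>lborel) \<le> ennreal Kc * (\<integral>\<^sup>+t. ennreal ((F t)\<^sup>2) \<partial>lborel)"
    using cut_ml_young[OF g(1,2) b1 g(3)] by blast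
  \<comment> \<open>The exponents of \<open>t\<close> left by the kernels \<open>e(\<gamma> - 2)\<close> and \<open>e(\<gamma> - 1)\<close>; that \<open>p1\<close> exceeds \<open>-1\<close> is the hypothesis on
    \<open>\<rho>\<close>.\<close>
  define p1 p2 p3 where "p1 = \<rho> + 2 * \<gamma> - 6" and "p2 = \<rho> + \<gamma> - 4" and "p3 = \<rho> + 2 * \<gamma> - 4"
  have p: "p1 > -1" "p2 > -1" "p3 > -1" "\<rho> > 0" using g \<rho> by (auto simp: p1_def p2_def p3_def)
  define P where "P = (\<lambda>p. T powr (p + 1) / (p + 1))"
  have P0: "P p1 \<ge> 0" "P p2 \<ge> 0" "P p3 \<ge> 0" using p by (auto simp: P_def)
  define C where "C = 5 * (Ka\<^sup>2 * P p1 + Kb\<^sup>2 * P p2 + Kb\<^sup>2 * P p3 + T powr \<rho> * Kc)"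
  have C0: "C \<ge> 0" using P0 Kc by (simp add: C_def)
  show ?thesis
  proof (intro exI[of _ C] conjI allI impI ballI C0)
    fix \<mu> gg h c0 c1 :: real and F2 :: "real \<Rightarrow> real" assume \<mu>: "\<mu> \<ge> 0" and F2[measurable]: "F2 \<in> borel_measurable borel"
    let ?L = "mode_deriv \<gamma> \<mu> T gg h c0 c1 F2 3"
    let ?c = "convolution (cut_ml \<gamma> \<mu> T (\<gamma> - 1)) F2"
    have [measurable]: "?c \<in> borel_measurable borel" using convolution_measurable[OF cut_ml_measurable F2] g by simp
    define R1 where "R1 = 5 * Ka\<^sup>2 * (\<mu>\<^sup>2 * gg\<^sup>2 + c0\<^sup>2)"
    define R2 where "R2 = 5 * Kb\<^sup>2 * (\<mu> * h\<^sup>2)"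
    define R3 where "R3 = 5 * Kb\<^sup>2 * c1\<^sup>2"
    have R0: "R1 \<ge> 0" "R2 \<ge> 0" "R3 \<ge> 0" using \<mu> by (auto simp: R1_def R2_def R3_def)
    have pw: "t powr \<rho> * (?L t)\<^sup>2 \<le> R1 * t powr p1 + R2 * t powr p2 + R3 * t powr p3 + 5 * T powr \<rho> * (?c t)\<^sup>2"
      if t: "0 < t" "t < T" for t
    proof -
      have \<gamma>0: "\<gamma> > 0" using g by simp
      \<comment> \<open>The initial data enter through the indices \<open>-2\<close> and \<open>-1\<close>, where \<open>1 / \<Gamma>\<close> vanishes; the recurrence
        then exposes a factor \<open>\<mu>\<close>.\<close>
      have G2: "Gamma (- 2 :: real) = 0" "Gamma (- 1 :: real) = 0" by (simp_all add: Gamma_eq_zero_iff nonpos_Ints_def)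
      have m2: "ml_fun \<gamma> \<mu> (- 2) t = - \<mu> * ml_fun \<gamma> \<mu> (\<gamma> - 2) t" using ml_fun_rec[OF \<gamma>0 t(1), of \<mu> "- 2"] G2 by simp
      have m1: "ml_fun \<gamma> \<mu> (- 1) t = - \<mu> * ml_fun \<gamma> \<mu> (\<gamma> - 1) t" using ml_fun_rec[OF \<gamma>0 t(1), of \<mu> "- 1"] G2 by simp
      have L: "?L t = gg * ml_fun \<gamma> \<mu> (- 2) t + h * ml_fun \<gamma> \<mu> (- 1) t + c0 * ml_fun \<gamma> \<mu> (\<gamma> - 2) t + c1 * ml_fun \<gamma> \<mu> (\<gamma> - 1) t + ?c t"
        by (simp add: mode_deriv_def)
      define e where "e = ml_fun \<gamma> \<mu> (\<gamma> - 2) t"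
      define d where "d = ml_fun \<gamma> \<mu> (\<gamma> - 1) t"
      have e2: "e\<^sup>2 \<le> (Ka * t powr (\<gamma> - 3))\<^sup>2" using Ka(2)[OF \<mu> t(1)] by (simp add: e_def abs_le_square_iff[symmetric] abs_mult Ka(1))
      have d2: "d\<^sup>2 \<le> (Kb * t powr (\<gamma> - 1 - 1))\<^sup>2" using Kb(2)[OF \<mu> t(1)] by (simp add: d_def abs_le_square_iff[symmetric] abs_mult Kb(1))
      have "(sqrt \<mu> * \<bar>d\<bar>)\<^sup>2 \<le> (Kb * t powr (\<gamma> - 1 - 1 - \<gamma> / 2))\<^sup>2"
        using Kb(3)[OF \<mu> t(1)] \<mu> by (intro power_mono) (auto simp: d_def)
      then have d3: "\<mu> * d\<^sup>2 \<le> (Kb * t powr (\<gamma> - 1 - 1 - \<gamma> / 2))\<^sup>2" using \<mu> by (simp add: power_mult_distrib)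
      have pr: "t powr \<rho> * (t powr q)\<^sup>2 = t powr (\<rho> + 2 * q)" for q
      proof -
        have "\<rho> + 2 * q = \<rho> + (q + q)" by simp
        then show ?thesis by (simp only: powr_add power2_eq_square)
      qed
      have E: "t powr \<rho> * e\<^sup>2 \<le> Ka\<^sup>2 * t powr p1"
      proof -
        have "t powr \<rho> * e\<^sup>2 \<le> t powr \<rho> * (Ka * t powr (\<gamma> - 3))\<^sup>2" using e2 by (intro mult_left_mono) auto
        also have "\<dots> = Ka\<^sup>2 * t powr p1" using pr[of "\<gamma> - 3"] by (simp add: power_mult_distrib p1_def mult.left_commute algebra_simps)
        finally show ?thesis .
      qed
      have Dd: "t powr \<rho> * d\<^sup>2 \<le> Kb\<^sup>2 * t powr p3"
      proof -
        have "t powr \<rho> * d\<^sup>2 \<le> t powr \<rho> * (Kb * t powr (\<gamma> - 1 - 1))\<^sup>2" using d2 by (intro mult_left_mono) auto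
        also have "\<dots> = Kb\<^sup>2 * t powr p3" using pr[of "\<gamma> - 1 - 1"] by (simp add: power_mult_distrib p3_def mult.left_commute algebra_simps)
        finally show ?thesis .
      qed
      have Dm: "t powr \<rho> * (\<mu> * d\<^sup>2) \<le> Kb\<^sup>2 * t powr p2"
      proof -
        have "t powr \<rho> * (\<mu> * d\<^sup>2) \<le> t powr \<rho> * (Kb * t powr (\<gamma> - 1 - 1 - \<gamma> / 2))\<^sup>2" using d3 by (intro mult_left_mono) auto
        also have "\<dots> = Kb\<^sup>2 * t powr p2" using pr[of "\<gamma> - 1 - 1 - \<gamma> / 2"] by (simp add: power_mult_distrib p2_def mult.left_commute algebra_simps)
        finally show ?thesis .
      qed
      have tT: "t powr \<rho> \<le> T powr \<rho>" using t p(4) by (intro powr_mono2) auto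
      have "(?L t)\<^sup>2 \<le> 5 * ((gg * (- \<mu> * e))\<^sup>2 + (h * (- \<mu> * d))\<^sup>2 + (c0 * e)\<^sup>2 + (c1 * d)\<^sup>2 + (?c t)\<^sup>2)"
        unfolding L m1 m2 e_def d_def by (rule square_sum5_le)
      then have "t powr \<rho> * (?L t)\<^sup>2 \<le> t powr \<rho> * (5 * ((gg * (- \<mu> * e))\<^sup>2 + (h * (- \<mu> * d))\<^sup>2 + (c0 * e)\<^sup>2 + (c1 * d)\<^sup>2 + (?c t)\<^sup>2))"
        by (intro mult_left_mono) auto
      also have "\<dots> = 5 * (\<mu>\<^sup>2 * gg\<^sup>2 + c0\<^sup>2) * (t powr \<rho> * e\<^sup>2) + 5 * (\<mu> * h\<^sup>2) * (t powr \<rho> * (\<mu> * d\<^sup>2)) + 5 * c1\<^sup>2 * (t powr \<rho> * d\<^sup>2) + 5 * t powr \<rho> * (?c t)\<^sup>2"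
        by (simp add: power_mult_distrib power2_eq_square algebra_simps)
      also have "\<dots> \<le> 5 * (\<mu>\<^sup>2 * gg\<^sup>2 + c0\<^sup>2) * (Ka\<^sup>2 * t powr p1) + 5 * (\<mu> * h\<^sup>2) * (Kb\<^sup>2 * t powr p2) + 5 * c1\<^sup>2 * (Kb\<^sup>2 * t powr p3) + 5 * T powr \<rho> * (?c t)\<^sup>2"
        using E Dm Dd tT \<mu> by (intro add_mono mult_left_mono mult_right_mono) auto
      also have "\<dots> = R1 * t powr p1 + R2 * t powr p2 + R3 * t powr p3 + 5 * T powr \<rho> * (?c t)\<^sup>2"
        by (simp add: R1_def R2_def R3_def algebra_simps)
      finally show ?thesis .
    qed
    let ?i = "\<lambda>p t. ennreal (indicator {0<..<T} t * t powr p)"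
    have "(\<integral>\<^sup>+t. ennreal (indicator {0<..<T} t * (t powr \<rho> * (?L t)\<^sup>2)) \<partial>lborel) \<le>
       (\<integral>\<^sup>+t. ennreal R1 * ?i p1 t + ennreal R2 * ?i p2 t + ennreal R3 * ?i p3 t + ennreal (5 * T powr \<rho>) * ennreal ((?c t)\<^sup>2) \<partial>lborel)"
    proof (intro nn_integral_mono)
      fix t
      show "ennreal (indicator {0<..<T} t * (t powr \<rho> * (?L t)\<^sup>2)) \<le> ennreal R1 * ?i p1 t + ennreal R2 * ?i p2 t + ennreal R3 * ?i p3 t + ennreal (5 * T powr \<rho>) * ennreal ((?c t)\<^sup>2)"
      proof (cases "t \<in> {0<..<T}")
        case True
        then have "ennreal (t powr \<rho> * (?L t)\<^sup>2) \<le> ennreal (R1 * t powr p1 + R2 * t powr p2 + R3 * t powr p3 + 5 * T powr \<rho> * (?c t)\<^sup>2)"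
          by (intro ennreal_leI pw) auto
        then show ?thesis using True R0 by (simp add: ennreal_plus ennreal_mult)
      qed simp
    qed
    also have "\<dots> = ennreal R1 * (\<integral>\<^sup>+t. ?i p1 t \<partial>lborel) + ennreal R2 * (\<integral>\<^sup>+t. ?i p2 t \<partial>lborel) + ennreal R3 * (\<integral>\<^sup>+t. ?i p3 t \<partial>lborel) + ennreal (5 * T powr \<rho>) * (\<integral>\<^sup>+t. ennreal ((?c t)\<^sup>2) \<partial>lborel)"
      by (simp add: nn_integral_add nn_integral_cmult)
    also have "\<dots> \<le> ennreal R1 * ennreal (P p1) + ennreal R2 * ennreal (P p2) + ennreal R3 * ennreal (P p3) + ennreal (5 * T powr \<rho>) * (ennreal Kc * (\<integral>\<^sup>+t. ennreal ((F2 t)\<^sup>2) \<partial>lborel))"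
      unfolding P_def by (intro add_mono mult_left_mono nn_integral_powr p g Kc \<mu> F2) auto
    also have "\<dots> = ennreal (R1 * P p1 + R2 * P p2 + R3 * P p3) + ennreal (5 * T powr \<rho> * Kc) * (\<integral>\<^sup>+t. ennreal ((F2 t)\<^sup>2) \<partial>lborel)"
      using R0 P0 Kc(1) by (simp add: ennreal_plus ennreal_mult mult.assoc)
    also have "\<dots> \<le> ennreal (C * (\<mu>\<^sup>2 * gg\<^sup>2 + \<mu> * h\<^sup>2 + c0\<^sup>2 + c1\<^sup>2)) + ennreal C * (\<integral>\<^sup>+t. ennreal ((F2 t)\<^sup>2) \<partial>lborel)"
    proof (intro add_mono mult_right_mono ennreal_leI)
      define Q where "Q = \<mu>\<^sup>2 * gg\<^sup>2 + \<mu> * h\<^sup>2 + c0\<^sup>2 + c1\<^sup>2"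
      have q: "\<mu>\<^sup>2 * gg\<^sup>2 + c0\<^sup>2 \<le> Q" "\<mu> * h\<^sup>2 \<le> Q" "c1\<^sup>2 \<le> Q" "0 \<le> Q" using \<mu> by (auto simp: Q_def)
      have "R1 * P p1 + R2 * P p2 + R3 * P p3 \<le> (5 * Ka\<^sup>2 * Q) * P p1 + (5 * Kb\<^sup>2 * Q) * P p2 + (5 * Kb\<^sup>2 * Q) * P p3"
        unfolding R1_def R2_def R3_def using q P0 by (intro add_mono mult_right_mono mult_left_mono) auto
      also have "\<dots> \<le> C * Q" using q(4) Kc(1) by (simp add: C_def algebra_simps)
      finally show "R1 * P p1 + R2 * P p2 + R3 * P p3 \<le> C * (\<mu>\<^sup>2 * gg\<^sup>2 + \<mu> * h\<^sup>2 + c0\<^sup>2 + c1\<^sup>2)" by (simp add: Q_def)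
      show "5 * T powr \<rho> * Kc \<le> C" using P0 by (simp add: C_def)
    qed simp
    also have "\<dots> = ennreal C * (ennreal (\<mu>\<^sup>2 * gg\<^sup>2 + \<mu> * h\<^sup>2 + c0\<^sup>2 + c1\<^sup>2) + (\<integral>\<^sup>+t. ennreal ((F2 t)\<^sup>2) \<partial>lborel))"
      using C0 \<mu> by (simp add: ennreal_mult distrib_left)
    finally show "(\<integral>\<^sup>+t. ennreal (indicator {0<..<T} t * (t powr \<rho> * (?L t)\<^sup>2)) \<partial>lborel) \<le>
      ennreal C * (ennreal (\<mu>\<^sup>2 * gg\<^sup>2 + \<mu> * h\<^sup>2 + c0\<^sup>2 + c1\<^sup>2) + (\<integral>\<^sup>+t. ennreal ((F2 t)\<^sup>2) \<partial>lborel))" .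
  qed
qed

text \<open>A crude bound, which only serves to place the solution itself in \<open>L2(0, T; \<H>(- s))\<close>.\<close>

lemma mode_deriv0_bound:
  assumes g: "1 < \<gamma>" "\<gamma> < 2" "0 < T"
  shows "\<exists>C\<ge>0. \<forall>\<mu>\<ge>0. \<forall>g h c0 c1. \<forall>F2\<in>borel_measurable borel.
    (\<integral>\<^sup>+t. ennreal (indicator {0<..<T} t * (mode_deriv \<gamma> \<mu> T g h c0 c1 F2 0 t)\<^sup>2) \<partial>lborel) \<le>
      ennreal C * (ennreal (g\<^sup>2 + h\<^sup>2 + c0\<^sup>2 + c1\<^sup>2) + (\<integral>\<^sup>+t. ennreal ((F2 t)\<^sup>2) \<partial>lborel))"
proof -
  have bnd: "\<exists>K\<ge>0. \<forall>\<mu>\<ge>0. \<forall>t. 0 < t \<and> t < T \<longrightarrow> (ml_fun \<gamma> \<mu> \<beta> t)\<^sup>2 \<le> K" if \<beta>: "\<beta> \<ge> 1" for \<beta>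
  proof -
    obtain K where K: "K \<ge> 0" "\<And>\<mu> t. \<mu> \<ge> 0 \<Longrightarrow> t > 0 \<Longrightarrow> \<bar>ml_fun \<gamma> \<mu> \<beta> t\<bar> \<le> K * t powr (\<beta> - 1)"
      using ml_fun_bound[OF g(1,2), of \<beta>] \<beta> by auto
    have "(ml_fun \<gamma> \<mu> \<beta> t)\<^sup>2 \<le> (K * T powr (\<beta> - 1))\<^sup>2" if "\<mu> \<ge> 0" "0 < t" "t < T" for \<mu> t
    proof -
      have "\<bar>ml_fun \<gamma> \<mu> \<beta> t\<bar> \<le> K * t powr (\<beta> - 1)" by (rule K(2)[OF that(1,2)])
      also have "\<dots> \<le> K * T powr (\<beta> - 1)" using that \<beta> K(1) by (intro mult_left_mono powr_mono2) auto
      finally have "\<bar>ml_fun \<gamma> \<mu> \<beta> t\<bar>\<^sup>2 \<le> (K * T powr (\<beta> - 1))\<^sup>2" by (intro power_mono) auto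
      then show ?thesis by simp
    qed
    then show ?thesis by (intro exI[of _ "(K * T powr (\<beta> - 1))\<^sup>2"]) auto
  qed
  obtain K1 where K1: "K1 \<ge> 0" "\<And>\<mu> t. \<mu> \<ge> 0 \<Longrightarrow> 0 < t \<Longrightarrow> t < T \<Longrightarrow> (ml_fun \<gamma> \<mu> 1 t)\<^sup>2 \<le> K1" using bnd[of 1] by auto
  obtain K2 where K2: "K2 \<ge> 0" "\<And>\<mu> t. \<mu> \<ge> 0 \<Longrightarrow> 0 < t \<Longrightarrow> t < T \<Longrightarrow> (ml_fun \<gamma> \<mu> 2 t)\<^sup>2 \<le> K2" using bnd[of 2] by auto
  obtain K3 where K3: "K3 \<ge> 0" "\<And>\<mu> t. \<mu> \<ge> 0 \<Longrightarrow> 0 < t \<Longrightarrow> t < T \<Longrightarrow> (ml_fun \<gamma> \<mu> (\<gamma> + 1) t)\<^sup>2 \<le> K3" using bnd[of "\<gamma> + 1"] g by auto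
  obtain K4 where K4: "K4 \<ge> 0" "\<And>\<mu> t. \<mu> \<ge> 0 \<Longrightarrow> 0 < t \<Longrightarrow> t < T \<Longrightarrow> (ml_fun \<gamma> \<mu> (\<gamma> + 2) t)\<^sup>2 \<le> K4" using bnd[of "\<gamma> + 2"] g by auto
  have b2: "0 < \<gamma> + 2" using g by simp
  obtain Kc where Kc: "Kc \<ge> 0" "\<And>\<mu> F. \<mu> \<ge> 0 \<Longrightarrow> F \<in> borel_measurable borel \<Longrightarrow>
     (\<integral>\<^sup>+t. ennreal ((convolution (cut_ml \<gamma> \<mu> T (\<gamma> + 2)) F t)\<^sup>2) \<partial>lborel) \<le> ennreal Kc * (\<integral>\<^sup>+t. ennreal ((F t)\<^sup>2) \<partial>lborel)"
    using cut_ml_young[OF g(1,2) b2 g(3)] by blast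
  define K where "K = max (max K1 K2) (max K3 K4)"
  have K: "K1 \<le> K" "K2 \<le> K" "K3 \<le> K" "K4 \<le> K" "0 \<le> K" using K1(1) by (auto simp: K_def)
  define C where "C = 5 * (T * K + Kc)"
  have C0: "C \<ge> 0" using K Kc g by (simp add: C_def)
  show ?thesis
  proof (intro exI[of _ C] conjI allI impI ballI C0)
    fix \<mu> gg h c0 c1 :: real and F2 :: "real \<Rightarrow> real" assume \<mu>: "\<mu> \<ge> 0" and F2[measurable]: "F2 \<in> borel_measurable borel"
    let ?L = "mode_deriv \<gamma> \<mu> T gg h c0 c1 F2 0"
    let ?c = "convolution (cut_ml \<gamma> \<mu> T (\<gamma> + 2)) F2"
    have [measurable]: "?c \<in> borel_measurable borel" using convolution_measurable[OF cut_ml_measurable F2] g by simp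
    define Q where "Q = gg\<^sup>2 + h\<^sup>2 + c0\<^sup>2 + c1\<^sup>2"
    have Q0: "Q \<ge> 0" by (simp add: Q_def)
    have pw: "(?L t)\<^sup>2 \<le> 5 * K * Q + 5 * (?c t)\<^sup>2" if t: "0 < t" "t < T" for t
    proof -
      have "(?L t)\<^sup>2 \<le> 5 * ((gg * ml_fun \<gamma> \<mu> 1 t)\<^sup>2 + (h * ml_fun \<gamma> \<mu> 2 t)\<^sup>2 + (c0 * ml_fun \<gamma> \<mu> (\<gamma> + 1) t)\<^sup>2 + (c1 * ml_fun \<gamma> \<mu> (\<gamma> + 2) t)\<^sup>2 + (?c t)\<^sup>2)"
        using square_sum5_le[of "gg * ml_fun \<gamma> \<mu> 1 t" "h * ml_fun \<gamma> \<mu> 2 t" "c0 * ml_fun \<gamma> \<mu> (\<gamma> + 1) t" "c1 * ml_fun \<gamma> \<mu> (\<gamma> + 2) t" "?c t"]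
        by (simp add: mode_deriv_def)
      also have "\<dots> \<le> 5 * (gg\<^sup>2 * K + h\<^sup>2 * K + c0\<^sup>2 * K + c1\<^sup>2 * K + (?c t)\<^sup>2)"
        unfolding power_mult_distrib
        using K1(2)[OF \<mu> t] K2(2)[OF \<mu> t] K3(2)[OF \<mu> t] K4(2)[OF \<mu> t] K
        by (intro mult_left_mono add_mono) auto
      also have "\<dots> = 5 * K * Q + 5 * (?c t)\<^sup>2" by (simp add: Q_def algebra_simps)
      finally show ?thesis .
    qed
    have "(\<integral>\<^sup>+t. ennreal (indicator {0<..<T} t * (?L t)\<^sup>2) \<partial>lborel) \<le>
       (\<integral>\<^sup>+t. ennreal (5 * K * Q) * indicator {0<..<T} t + ennreal 5 * ennreal ((?c t)\<^sup>2) \<partial>lborel)"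
    proof (intro nn_integral_mono)
      fix t
      show "ennreal (indicator {0<..<T} t * (?L t)\<^sup>2) \<le> ennreal (5 * K * Q) * indicator {0<..<T} t + ennreal 5 * ennreal ((?c t)\<^sup>2)"
      proof (cases "t \<in> {0<..<T}")
        case True
        then have "ennreal ((?L t)\<^sup>2) \<le> ennreal (5 * K * Q + 5 * (?c t)\<^sup>2)"
          by (intro ennreal_leI pw) auto
        also have "\<dots> = ennreal (5 * K * Q) + ennreal 5 * ennreal ((?c t)\<^sup>2)"
          using K Q0 by (subst ennreal_plus) (auto simp: ennreal_mult[symmetric] mult_nonneg_nonneg simp del: ennreal_numeral)
        finally show ?thesis using True by simp
      qed simp
    qed
    also have "\<dots> = ennreal (5 * K * Q) * ennreal T + ennreal 5 * (\<integral>\<^sup>+t. ennreal ((?c t)\<^sup>2) \<partial>lborel)"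
      using g by (subst nn_integral_add) (auto simp: nn_integral_cmult)
    also have "\<dots> \<le> ennreal (5 * K * Q) * ennreal T + ennreal 5 * (ennreal Kc * (\<integral>\<^sup>+t. ennreal ((F2 t)\<^sup>2) \<partial>lborel))"
      by (intro add_mono mult_left_mono Kc \<mu> F2) auto
    also have "\<dots> = ennreal (5 * K * Q * T) + ennreal (5 * Kc) * (\<integral>\<^sup>+t. ennreal ((F2 t)\<^sup>2) \<partial>lborel)"
      using K Q0 g Kc(1) by (simp add: ennreal_mult mult.assoc)
    also have "\<dots> \<le> ennreal (C * Q) + ennreal C * (\<integral>\<^sup>+t. ennreal ((F2 t)\<^sup>2) \<partial>lborel)"
    proof (intro add_mono mult_right_mono ennreal_leI)
      show "5 * K * Q * T \<le> C * Q" using Kc(1) Q0 by (simp add: C_def algebra_simps)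
      show "5 * Kc \<le> C" using K(5) g by (simp add: C_def)
    qed simp
    also have "\<dots> = ennreal C * (ennreal Q + (\<integral>\<^sup>+t. ennreal ((F2 t)\<^sup>2) \<partial>lborel))"
      using C0 Q0 by (simp add: ennreal_mult distrib_left)
    finally show "(\<integral>\<^sup>+t. ennreal (indicator {0<..<T} t * (?L t)\<^sup>2) \<partial>lborel) \<le>
      ennreal C * (ennreal (gg\<^sup>2 + h\<^sup>2 + c0\<^sup>2 + c1\<^sup>2) + (\<integral>\<^sup>+t. ennreal ((F2 t)\<^sup>2) \<partial>lborel))" by (simp add: Q_def)
  qed
qed

section \<open>Square-integrable functions\<close>

lemma L2_mult_integrable:
  fixes u v :: "'a::euclidean_space \<Rightarrow> real"
  assumes "u \<in> L2 S" "v \<in> L2 S"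
  shows "integrable (lebesgue_on S) (\<lambda>x. u x * v x)"
proof (rule Bochner_Integration.integrable_bound[where f = "\<lambda>x. (u x)\<^sup>2 + (v x)\<^sup>2"])
  show "integrable (lebesgue_on S) (\<lambda>x. (u x)\<^sup>2 + (v x)\<^sup>2)" using assms by (auto simp: L2_def)
  show "(\<lambda>x. u x * v x) \<in> borel_measurable (lebesgue_on S)" using assms by (auto simp: L2_def)
  have "\<bar>a * b\<bar> \<le> a\<^sup>2 + b\<^sup>2" for a b :: real
  proof -
    have "2 * \<bar>a\<bar> * \<bar>b\<bar> \<le> a\<^sup>2 + b\<^sup>2" using sum_squares_bound[of "\<bar>a\<bar>" "\<bar>b\<bar>"] by simp
    moreover have "0 \<le> \<bar>a\<bar> * \<bar>b\<bar>" by simp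
    ultimately show ?thesis unfolding abs_mult by linarith
  qed
  then show "AE x in lebesgue_on S. norm (u x * v x) \<le> norm ((u x)\<^sup>2 + (v x)\<^sup>2)" by simp
qed

lemma L2_cauchy_schwarz:
  fixes u v :: "'a::euclidean_space \<Rightarrow> real"
  assumes u: "u \<in> L2 S" and v: "v \<in> L2 S"
  shows "\<bar>\<integral>x. u x * v x \<partial>lebesgue_on S\<bar> \<le> L2_norm S u * L2_norm S v"
proof (rule power2_le_imp_le)
  let ?M = "lebesgue_on S"
  have [measurable]: "u \<in> borel_measurable ?M" "v \<in> borel_measurable ?M" using u v by (auto simp: L2_def)
  have iu: "integrable ?M (\<lambda>x. (u x)\<^sup>2)" and iv: "integrable ?M (\<lambda>x. (v x)\<^sup>2)" using u v by (auto simp: L2_def)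
  have "ennreal \<bar>\<integral>x. u x * v x \<partial>?M\<bar> \<le> (\<integral>\<^sup>+x. ennreal \<bar>u x * v x\<bar> \<partial>?M)"
    using integral_norm_bound_ennreal[OF L2_mult_integrable[OF u v]] by simp
  then have "(ennreal \<bar>\<integral>x. u x * v x \<partial>?M\<bar>)\<^sup>2 \<le> (\<integral>\<^sup>+x. ennreal \<bar>u x\<bar> * ennreal \<bar>v x\<bar> \<partial>?M)\<^sup>2"
    by (intro power_mono) (auto simp: ennreal_mult[symmetric] abs_mult)
  also have "\<dots> \<le> (\<integral>\<^sup>+x. (ennreal \<bar>u x\<bar>)\<^sup>2 \<partial>?M) * (\<integral>\<^sup>+x. (ennreal \<bar>v x\<bar>)\<^sup>2 \<partial>?M)"
    by (rule Cauchy_Schwarz_nn_integral) measurable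
  also have "\<dots> = ennreal (\<integral>x. (u x)\<^sup>2 \<partial>?M) * ennreal (\<integral>x. (v x)\<^sup>2 \<partial>?M)"
    using nn_integral_eq_integral[OF iu] nn_integral_eq_integral[OF iv] by (simp add: ennreal_power)
  also have "\<dots> = ennreal ((\<integral>x. (u x)\<^sup>2 \<partial>?M) * (\<integral>x. (v x)\<^sup>2 \<partial>?M))"
    by (rule ennreal_mult[symmetric]) auto
  finally have "\<bar>\<integral>x. u x * v x \<partial>?M\<bar>\<^sup>2 \<le> (\<integral>x. (u x)\<^sup>2 \<partial>?M) * (\<integral>x. (v x)\<^sup>2 \<partial>?M)"
    by (simp add: ennreal_power mult_nonneg_nonneg)
  then show "\<bar>\<integral>x. u x * v x \<partial>?M\<bar>\<^sup>2 \<le> (L2_norm S u * L2_norm S v)\<^sup>2"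
    by (simp add: L2_norm_def power_mult_distrib)
qed (simp add: L2_norm_def)

lemma L2_add:
  fixes u v :: "'a::euclidean_space \<Rightarrow> real"
  assumes "u \<in> L2 S" "v \<in> L2 S" shows "(\<lambda>x. u x + v x) \<in> L2 S"
  using assms L2_mult_integrable[OF assms] by (auto simp: L2_def power2_sum mult.assoc)

lemma L2_scale:
  fixes u :: "'a::euclidean_space \<Rightarrow> real"
  assumes "u \<in> L2 S" shows "(\<lambda>x. c * u x) \<in> L2 S"
  using assms by (auto simp: L2_def power_mult_distrib)

lemma L2_diff:
  fixes u v :: "'a::euclidean_space \<Rightarrow> real"
  assumes "u \<in> L2 S" "v \<in> L2 S" shows "(\<lambda>x. u x - v x) \<in> L2 S"
  using L2_add[OF assms(1) L2_scale[OF assms(2), of "-1"]] by simp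

lemma L2_sum:
  fixes u :: "'i \<Rightarrow> 'a::euclidean_space \<Rightarrow> real"
  assumes "finite I" "\<And>i. i \<in> I \<Longrightarrow> u i \<in> L2 S" shows "(\<lambda>x. \<Sum>i\<in>I. u i x) \<in> L2 S"
  using assms
proof (induction I rule: finite_induct)
  case empty then show ?case by (simp add: L2_def)
next
  case (insert i I)
  then show ?case using L2_add[of "u i" S "\<lambda>x. \<Sum>i\<in>I. u i x"] by simp
qed

lemma L2_bounded_mult:
  fixes u m :: "'a::euclidean_space \<Rightarrow> real"
  assumes u: "u \<in> L2 S" and "m \<in> borel_measurable (lebesgue_on S)" "\<And>x. x \<in> S \<Longrightarrow> \<bar>m x\<bar> \<le> B"
  shows "(\<lambda>x. m x * u x) \<in> L2 S"
proof -
  have "integrable (lebesgue_on S) (\<lambda>x. (m x * u x)\<^sup>2)"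
  proof (rule Bochner_Integration.integrable_bound[where f = "\<lambda>x. B\<^sup>2 * (u x)\<^sup>2"])
    have "\<bar>m x\<bar>\<^sup>2 \<le> B\<^sup>2" if "x \<in> S" for x using assms(3)[OF that] by (intro power_mono) auto
    then show "AE x in lebesgue_on S. norm ((m x * u x)\<^sup>2) \<le> norm (B\<^sup>2 * (u x)\<^sup>2)"
      by (auto simp: power_mult_distrib intro!: AE_I2 mult_right_mono)
  qed (use assms in \<open>auto simp: L2_def\<close>)
  then show ?thesis using assms by (auto simp: L2_def)
qed

lemma L2_norm_bounded_mult:
  fixes u m :: "'a::euclidean_space \<Rightarrow> real"
  assumes u: "u \<in> L2 S" and "m \<in> borel_measurable (lebesgue_on S)" "\<And>x. x \<in> S \<Longrightarrow> \<bar>m x\<bar> \<le> B" "0 \<le> B"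
  shows "L2_norm S (\<lambda>x. m x * u x) \<le> B * L2_norm S u"
proof -
  have "(\<integral>x. (m x * u x)\<^sup>2 \<partial>lebesgue_on S) \<le> (\<integral>x. B\<^sup>2 * (u x)\<^sup>2 \<partial>lebesgue_on S)"
  proof (rule integral_mono)
    fix x assume "x \<in> space (lebesgue_on S)"
    then have "\<bar>m x\<bar>\<^sup>2 \<le> B\<^sup>2" using assms(3)[of x] by (intro power_mono) auto
    then show "(m x * u x)\<^sup>2 \<le> B\<^sup>2 * (u x)\<^sup>2" by (auto simp: power_mult_distrib intro!: mult_right_mono)
  qed (use L2_bounded_mult[OF assms(1-3)] u in \<open>auto simp: L2_def\<close>)
  also have "\<dots> = B\<^sup>2 * (\<integral>x. (u x)\<^sup>2 \<partial>lebesgue_on S)" by simp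
  finally have "sqrt (\<integral>x. (m x * u x)\<^sup>2 \<partial>lebesgue_on S) \<le> sqrt (B\<^sup>2 * (\<integral>x. (u x)\<^sup>2 \<partial>lebesgue_on S))"
    by (rule real_sqrt_le_mono)
  also have "\<dots> = B * sqrt (\<integral>x. (u x)\<^sup>2 \<partial>lebesgue_on S)" using assms(4) by (simp add: real_sqrt_mult)
  finally show ?thesis by (simp add: L2_norm_def)
qed

lemma L2_inner_limit:
  fixes p q :: "'a::euclidean_space \<Rightarrow> real" and q' :: "nat \<Rightarrow> 'a \<Rightarrow> real"
  assumes p: "p \<in> L2 S" and q: "q \<in> L2 S" "\<And>j. q' j \<in> L2 S" and lim: "(\<lambda>j. L2_norm S (\<lambda>x. q' j x - q x)) \<longlonglongrightarrow> 0"
  shows "(\<lambda>j. \<integral>x. p x * q' j x \<partial>lebesgue_on S) \<longlonglongrightarrow> (\<integral>x. p x * q x \<partial>lebesgue_on S)"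
proof -
  have "(\<lambda>j. (\<integral>x. p x * q' j x \<partial>lebesgue_on S) - (\<integral>x. p x * q x \<partial>lebesgue_on S)) \<longlonglongrightarrow> 0"
  proof (rule Lim_null_comparison)
    show "(\<lambda>j. L2_norm S p * L2_norm S (\<lambda>x. q' j x - q x)) \<longlonglongrightarrow> 0" using tendsto_mult_right_zero[OF lim] .
    have "(\<integral>x. p x * q' j x \<partial>lebesgue_on S) - (\<integral>x. p x * q x \<partial>lebesgue_on S) = (\<integral>x. p x * (q' j x - q x) \<partial>lebesgue_on S)" for j
      using L2_mult_integrable[OF p q(2)] L2_mult_integrable[OF p q(1)] by (simp add: right_diff_distrib)
    then show "\<forall>\<^sub>F j in sequentially. norm ((\<integral>x. p x * q' j x \<partial>lebesgue_on S) - (\<integral>x. p x * q x \<partial>lebesgue_on S))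
        \<le> L2_norm S p * L2_norm S (\<lambda>x. q' j x - q x)"
      using L2_cauchy_schwarz[OF p L2_diff[OF q(2) q(1)]] by simp
  qed
  then show ?thesis by (simp add: LIM_zero_iff)
qed

lemma L2_continuous:
  fixes f :: "'a::euclidean_space \<Rightarrow> real"
  assumes "continuous_on UNIV f" "open S" "bounded S"
  shows "f \<in> L2 S"
proof -
  have m: "f \<in> borel_measurable (lebesgue_on S)"
    by (intro measurable_restrict_space1 measurable_completion) (use borel_measurable_continuous_onI[OF assms(1)] in simp)
  have "bounded (f ` closure S)"
    using assms by (intro compact_imp_bounded compact_continuous_image) (auto intro: continuous_on_subset simp: compact_closure)
  then obtain B where B: "\<And>x. x \<in> S \<Longrightarrow> \<bar>f x\<bar> \<le> B"
    unfolding bounded_iff real_norm_def by (meson closure_subset imageI subsetD)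
  have "S \<in> lmeasurable" using assms by (simp add: bounded_set_imp_lmeasurable borel_open)
  then interpret finite_measure "lebesgue_on S" by (rule finite_measure_lebesgue_on)
  have "integrable (lebesgue_on S) (\<lambda>x. (norm (f x))\<^sup>2)"
  proof (rule integrable_const_bound[where B = "B\<^sup>2"])
    have "norm ((norm (f x))\<^sup>2) \<le> B\<^sup>2" if "x \<in> S" for x
      using power_mono[OF B[OF that] abs_ge_zero, of 2] by simp
    then show "AE x in lebesgue_on S. norm ((norm (f x))\<^sup>2) \<le> B\<^sup>2" by (intro AE_I2) simp
  qed (use m in auto)
  then show ?thesis using m by (simp add: L2_def)
qed

section \<open>A positive lower bound for the eigenvalues\<close>

lemma frechet_derivative_Ck:
  fixes f :: "'a::euclidean_space \<Rightarrow> real"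
  assumes "Ck (Suc 0) f" "b \<in> Basis" shows "continuous_on UNIV (\<lambda>x. frechet_derivative f (at x) b)"
  using assms by simp

lemma gradient_component: "gradient \<eta> x $ i = frechet_derivative \<eta> (at x) (axis i 1)"
  by (simp add: gradient_def)

lemma coordinate_measurable: "(\<lambda>x::real^'n. x $ i) \<in> borel_measurable (lebesgue_on S)"
  by (intro measurable_restrict_space1 measurable_completion)
    (use borel_measurable_continuous_onI[of "\<lambda>x::real^'n. x $ i"] in \<open>simp add: continuous_on_component\<close>)

text \<open>Weak gradients are compared component by component, while \<open>H10\<close> is defined by the norm of the
  whole vector.\<close>

lemma L2_component:
  fixes G :: "real^'n \<Rightarrow> real^'n"
  assumes G: "G \<in> L2 S"
  shows "(\<lambda>x. G x $ i) \<in> L2 S" "L2_norm S (\<lambda>x. G x $ i) \<le> L2_norm S G"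
proof -
  have Gm: "G \<in> borel_measurable (lebesgue_on S)" using G by (auto simp: L2_def)
  have Gim: "(\<lambda>x. G x $ i) \<in> borel_measurable (lebesgue_on S)"
    by (rule measurable_compose[OF Gm borel_measurable_continuous_onI]) (intro continuous_on_component continuous_on_id)
  have cmp: "(G x $ i)\<^sup>2 \<le> (norm (G x))\<^sup>2" for x
    using component_le_norm_cart[of "G x" i] by (metis abs_ge_zero power2_abs power_mono)
  have gi: "integrable (lebesgue_on S) (\<lambda>x. (G x $ i)\<^sup>2)"
    by (rule Bochner_Integration.integrable_bound[where f = "\<lambda>x. (norm (G x))\<^sup>2"]) (use G Gim cmp in \<open>auto simp: L2_def\<close>)
  then show "(\<lambda>x. G x $ i) \<in> L2 S" using Gim by (simp add: L2_def)
  show "L2_norm S (\<lambda>x. G x $ i) \<le> L2_norm S G"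
    unfolding L2_norm_def real_sqrt_le_iff real_norm_def power2_abs
    using G gi cmp by (intro integral_mono) (auto simp: L2_def)
qed

text \<open>In the weak form of \<open>\<partial>\<^sub>i u = G $ i\<close> take the test functions \<open>x $ i * \<eta> j x\<close> with \<open>\<eta> j\<close> tending to \<open>u\<close> in \<open>H1\<close>. Formally the
  integral of \<open>\<partial>\<^sub>i (x $ i * u^2)\<close> vanishes, and Cauchy-Schwarz makes it a Poincare inequality on a bounded domain.\<close>

lemma H10_moment_identity:
  fixes \<Omega> :: "(real^'n) set"
  assumes "open \<Omega>" "bounded \<Omega>" and H: "has_H10_gradient \<Omega> u G"
  shows "(\<integral>x. u x * u x \<partial>lebesgue_on \<Omega>) = - 2 * (\<integral>x. (x $ i * u x) * G x $ i \<partial>lebesgue_on \<Omega>)"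
proof -
  obtain \<eta> where \<eta>: "\<And>j::nat. \<eta> j \<in> test_functions \<Omega>" and l1: "(\<lambda>j. L2_norm \<Omega> (\<lambda>x. \<eta> j x - u x)) \<longlonglongrightarrow> 0"
    and l2: "(\<lambda>j. L2_norm \<Omega> (\<lambda>x. gradient (\<eta> j) x - G x)) \<longlonglongrightarrow> 0"
    using H by (auto simp: has_H10_gradient_def)
  have u: "u \<in> L2 \<Omega>" and G: "G \<in> L2 \<Omega>" and wk: "\<And>\<xi>. \<xi> \<in> test_functions \<Omega> \<Longrightarrow>
      (\<integral>x. u x * gradient \<xi> x $ i \<partial>lebesgue_on \<Omega>) = - (\<integral>x. G x $ i * \<xi> x \<partial>lebesgue_on \<Omega>)"
    using H by (auto simp: has_H10_gradient_def has_H1_gradient_def)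
  obtain R where R: "\<And>x. x \<in> \<Omega> \<Longrightarrow> norm x \<le> R" using assms(2) by (auto simp: bounded_iff)
  note xm = coordinate_measurable[of i \<Omega>]
  have xb: "\<bar>x $ i\<bar> \<le> R" if "x \<in> \<Omega>" for x using R[OF that] component_le_norm_cart[of x i] by simp
  have C\<eta>: "Ck m (\<eta> j)" for m j using \<eta>[of j] by (auto simp: test_functions_def)
  have \<eta>2: "\<eta> j \<in> L2 \<Omega>" for j using C\<eta>[of 0 j] by (intro L2_continuous assms) auto
  have d\<eta>2: "(\<lambda>x. gradient (\<eta> j) x $ i) \<in> L2 \<Omega>" for j
    unfolding gradient_component
    by (intro L2_continuous assms frechet_derivative_Ck C\<eta>) (simp add: axis_in_Basis_iff)
  have Gm: "G \<in> borel_measurable (lebesgue_on \<Omega>)" using G by (auto simp: L2_def)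
  have Gi: "(\<lambda>x. G x $ i) \<in> L2 \<Omega>" by (rule L2_component(1)[OF G])
  have l2': "(\<lambda>j. L2_norm \<Omega> (\<lambda>x. gradient (\<eta> j) x $ i - G x $ i)) \<longlonglongrightarrow> 0"
  proof (rule Lim_null_comparison[OF _ l2], intro always_eventually allI)
    fix j
    have gm: "(\<lambda>x. gradient (\<eta> j) x) \<in> borel_measurable (lebesgue_on \<Omega>)"
    proof -
      have "continuous_on UNIV (\<lambda>x. gradient (\<eta> j) x)"
        unfolding gradient_def continuous_on_vec_lambda
        by (intro continuous_on_vec_lambda frechet_derivative_Ck C\<eta>) (simp add: axis_in_Basis_iff)
      then show ?thesis
        by (intro measurable_restrict_space1 measurable_completion) (use borel_measurable_continuous_onI in auto)
    qed
    have gi: "integrable (lebesgue_on \<Omega>) (\<lambda>x. (norm (gradient (\<eta> j) x - G x))\<^sup>2)"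
    proof (rule Bochner_Integration.integrable_bound[where f = "\<lambda>x. 2 * (norm (gradient (\<eta> j) x))\<^sup>2 + 2 * (norm (G x))\<^sup>2"])
      have "integrable (lebesgue_on \<Omega>) (\<lambda>x. (norm (gradient (\<eta> j) x))\<^sup>2)"
      proof -
        have "(\<lambda>x. gradient (\<eta> j) x $ k) \<in> L2 \<Omega>" for k
          unfolding gradient_component
          by (intro L2_continuous assms frechet_derivative_Ck C\<eta>) (simp add: axis_in_Basis_iff)
        then have "integrable (lebesgue_on \<Omega>) (\<lambda>x. \<Sum>k\<in>UNIV. (gradient (\<eta> j) x $ k)\<^sup>2)"
          by (intro Bochner_Integration.integrable_sum) (auto simp: L2_def)
        then show ?thesis by (simp add: norm_vec_def L2_set_def sum_nonneg)
      qed
      then show "integrable (lebesgue_on \<Omega>) (\<lambda>x. 2 * (norm (gradient (\<eta> j) x))\<^sup>2 + 2 * (norm (G x))\<^sup>2)"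
        using G by (auto simp: L2_def)
      have "(norm (a - b))\<^sup>2 \<le> 2 * (norm a)\<^sup>2 + 2 * (norm b)\<^sup>2" for a b :: "real^'n"
      proof -
        have "(norm (a - b))\<^sup>2 + (norm (a + b))\<^sup>2 = 2 * (norm a)\<^sup>2 + 2 * (norm b)\<^sup>2"
          by (simp add: power2_norm_eq_inner algebra_simps inner_commute)
        then show ?thesis using zero_le_power2[of "norm (a + b)"] by linarith
      qed
      then show "AE x in lebesgue_on \<Omega>. norm ((norm (gradient (\<eta> j) x - G x))\<^sup>2) \<le> norm (2 * (norm (gradient (\<eta> j) x))\<^sup>2 + 2 * (norm (G x))\<^sup>2)"
        by simp
    qed (use gm Gm in measurable)
    have "(\<lambda>x. gradient (\<eta> j) x - G x) \<in> L2 \<Omega>" using gm Gm gi by (simp add: L2_def)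
    from L2_component(2)[OF this, of i]
    show "norm (L2_norm \<Omega> (\<lambda>x. gradient (\<eta> j) x $ i - G x $ i)) \<le> L2_norm \<Omega> (\<lambda>x. gradient (\<eta> j) x - G x)"
      by (simp add: L2_norm_def)
  qed
  have xi: "(\<lambda>x. x $ i * \<eta> j x) \<in> test_functions \<Omega>" for j
  proof -
    have C: "Ck m (\<lambda>x. x $ i * \<eta> j x)" for m
      by (intro Ck_mult Ck_bounded_linear C\<eta> bounded_linear_vec_nth)
    have sub: "closure {x. x $ i * \<eta> j x \<noteq> 0} \<subseteq> closure {x. \<eta> j x \<noteq> 0}" by (intro closure_mono) auto
    have "compact (closure {x. \<eta> j x \<noteq> 0})" "closure {x. \<eta> j x \<noteq> 0} \<subseteq> \<Omega>" using \<eta>[of j] by (auto simp: test_functions_def)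
    then show ?thesis using C sub closed_Int_compact[OF closed_closure, of "closure {x. \<eta> j x \<noteq> 0}" "{x. x $ i * \<eta> j x \<noteq> 0}"]
      by (auto simp: test_functions_def Int_absorb2)
  qed
  have gxi: "gradient (\<lambda>x. x $ i * \<eta> j x) x $ i = x $ i * gradient (\<eta> j) x $ i + \<eta> j x" for j x
  proof -
    have bl: "bounded_linear (\<lambda>x::real^'n. x $ i)" by (rule bounded_linear_vec_nth)
    have "frechet_derivative (\<lambda>x::real^'n. x $ i) (at x) (axis i 1) = 1"
      using frechet_derivative_at[OF bounded_linear_imp_has_derivative[OF bl, of "at x"], symmetric] by simp
    moreover have "\<eta> j differentiable (at x)" using C\<eta>[of 1 j] by (auto simp: differentiable_on_def)
    ultimately show ?thesis
      using frechet_derivative_mult_apply[OF bounded_linear_imp_differentiable[OF bl], of "\<eta> j" x "axis i 1"]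
      by (simp add: gradient_component)
  qed
  have xu: "(\<lambda>x. x $ i * u x) \<in> L2 \<Omega>" by (rule L2_bounded_mult[OF u xm xb])
  have xG: "(\<lambda>x. x $ i * G x $ i) \<in> L2 \<Omega>" by (rule L2_bounded_mult[OF Gi xm xb])
  have eq: "(\<integral>x. (x $ i * u x) * gradient (\<eta> j) x $ i \<partial>lebesgue_on \<Omega>) + (\<integral>x. u x * \<eta> j x \<partial>lebesgue_on \<Omega>) =
     - (\<integral>x. (x $ i * G x $ i) * \<eta> j x \<partial>lebesgue_on \<Omega>)" for j
  proof -
    have "(\<integral>x. (x $ i * u x) * gradient (\<eta> j) x $ i \<partial>lebesgue_on \<Omega>) + (\<integral>x. u x * \<eta> j x \<partial>lebesgue_on \<Omega>) =
       (\<integral>x. u x * gradient (\<lambda>x. x $ i * \<eta> j x) x $ i \<partial>lebesgue_on \<Omega>)"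
      unfolding gxi using L2_mult_integrable[OF xu d\<eta>2[of j]] L2_mult_integrable[OF u \<eta>2[of j]]
      by (subst Bochner_Integration.integral_add[symmetric]) (auto simp: algebra_simps)
    also have "\<dots> = - (\<integral>x. G x $ i * (x $ i * \<eta> j x) \<partial>lebesgue_on \<Omega>)" by (rule wk[OF xi])
    finally show ?thesis by (simp add: mult_ac)
  qed
  have "(\<lambda>j. (\<integral>x. (x $ i * u x) * gradient (\<eta> j) x $ i \<partial>lebesgue_on \<Omega>) + (\<integral>x. u x * \<eta> j x \<partial>lebesgue_on \<Omega>))
     \<longlonglongrightarrow> (\<integral>x. (x $ i * u x) * G x $ i \<partial>lebesgue_on \<Omega>) + (\<integral>x. u x * u x \<partial>lebesgue_on \<Omega>)"
    by (intro tendsto_add L2_inner_limit xu Gi d\<eta>2 l2' u \<eta>2 l1)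
  moreover have "(\<lambda>j. - (\<integral>x. (x $ i * G x $ i) * \<eta> j x \<partial>lebesgue_on \<Omega>)) \<longlonglongrightarrow> - (\<integral>x. (x $ i * G x $ i) * u x \<partial>lebesgue_on \<Omega>)"
    by (intro tendsto_minus L2_inner_limit xG u \<eta>2 l1)
  ultimately have "(\<integral>x. (x $ i * u x) * G x $ i \<partial>lebesgue_on \<Omega>) + (\<integral>x. u x * u x \<partial>lebesgue_on \<Omega>) = - (\<integral>x. (x $ i * G x $ i) * u x \<partial>lebesgue_on \<Omega>)"
    unfolding eq by (rule LIMSEQ_unique)
  then show ?thesis by (simp add: mult_ac)
qed

text \<open>Test the eigenvalue equation with the eigenfunction itself: ellipticity bounds the eigenvalue below by
  the gradient, and the Poincare inequality bounds the gradient below by the function.\<close>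

lemma eigenvalue_lower_bound:
  fixes \<Omega> :: "(real^'n) set"
  assumes "open \<Omega>" "bounded \<Omega>" and ad: "admissible_coefficients \<Omega> A c"
  shows "\<exists>l0>0. \<forall>\<mu> u. 0 < \<mu> \<longrightarrow> dirichlet_eigenpair \<Omega> A c \<mu> u \<longrightarrow> L2_inner \<Omega> u u = 1 \<longrightarrow> l0 \<le> \<mu>"
proof -
  obtain a where a: "a > 0" "\<And>x \<xi>. x \<in> \<Omega> \<Longrightarrow> a * (norm \<xi>)\<^sup>2 \<le> \<xi> \<bullet> (A x *v \<xi>)"
    using ad by (auto simp: admissible_coefficients_def)
  have cpos: "AE x in lebesgue_on \<Omega>. 0 \<le> c x"
    using ad by (auto simp: admissible_coefficients_def elim: AE_mp)
  obtain R0 where R0: "\<And>x. x \<in> \<Omega> \<Longrightarrow> norm x \<le> R0" using assms(2) by (auto simp: bounded_iff)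
  define R where "R = max 1 R0"
  have R: "R > 0" "\<And>x. x \<in> \<Omega> \<Longrightarrow> norm x \<le> R" using R0 by (auto simp: R_def le_max_iff_disj)
  fix i0 :: 'n
  show ?thesis
  proof (intro exI[of _ "a / (4 * R\<^sup>2)"] conjI allI impI)
    show "a / (4 * R\<^sup>2) > 0" using a R by simp
    fix \<mu> u assume mu: "0 < \<mu>" and ep: "dirichlet_eigenpair \<Omega> A c \<mu> u" and n1: "L2_inner \<Omega> u u = 1"
    obtain G where H: "has_H10_gradient \<Omega> u G" and
      E: "\<And>v H. has_H10_gradient \<Omega> v H \<Longrightarrow> (\<integral>x. (A x *v G x) \<bullet> H x + c x * u x * v x \<partial>lebesgue_on \<Omega>) = \<mu> * L2_inner \<Omega> u v"
      using ep by (auto simp: dirichlet_eigenpair_def)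
    have u: "u \<in> L2 \<Omega>" and G: "G \<in> L2 \<Omega>" using H by (auto simp: has_H10_gradient_def has_H1_gradient_def)
    have e: "(\<integral>x. (A x *v G x) \<bullet> G x + c x * u x * u x \<partial>lebesgue_on \<Omega>) = \<mu>" using E[OF H] n1 by simp
    \<comment> \<open>A Bochner integral that does not exist is \<open>0\<close>, but this one equals \<open>\<mu> > 0\<close>.\<close>
    then have int: "integrable (lebesgue_on \<Omega>) (\<lambda>x. (A x *v G x) \<bullet> G x + c x * u x * u x)"
      using mu not_integrable_integral_eq by fastforce
    have "(\<integral>x. a * (norm (G x))\<^sup>2 \<partial>lebesgue_on \<Omega>) \<le> (\<integral>x. (A x *v G x) \<bullet> G x + c x * u x * u x \<partial>lebesgue_on \<Omega>)"
    proof (rule integral_mono_AE[OF _ int])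
      show "integrable (lebesgue_on \<Omega>) (\<lambda>x. a * (norm (G x))\<^sup>2)" using G by (auto simp: L2_def)
      show "AE x in lebesgue_on \<Omega>. a * (norm (G x))\<^sup>2 \<le> (A x *v G x) \<bullet> G x + c x * u x * u x"
        using cpos AE_space
      proof eventually_elim
        case (elim x)
        then have "a * (norm (G x))\<^sup>2 \<le> (A x *v G x) \<bullet> G x" using a(2)[of x "G x"] by (simp add: inner_commute)
        moreover have "0 \<le> c x * (u x * u x)" using mult_nonneg_nonneg[OF elim(1) zero_le_square] .
        ultimately show ?case by (simp add: mult.assoc)
      qed
    qed
    then have G\<mu>: "a * (L2_norm \<Omega> G)\<^sup>2 \<le> \<mu>" unfolding e by (simp add: L2_norm_def)
    note Gi = L2_component(1)[OF G, of i0] and Gile = L2_component(2)[OF G, of i0]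
    note xm = coordinate_measurable[of i0 \<Omega>]
    have xb: "\<bar>x $ i0\<bar> \<le> R" if "x \<in> \<Omega>" for x using R(2)[OF that] component_le_norm_cart[of x i0] by simp
    have nu: "L2_norm \<Omega> u = 1" using n1 by (simp add: L2_norm_def L2_inner_def power2_eq_square)
    have "1 = \<bar>- 2 * (\<integral>x. (x $ i0 * u x) * G x $ i0 \<partial>lebesgue_on \<Omega>)\<bar>"
      using H10_moment_identity[OF assms(1,2) H, of i0] n1 by (simp add: L2_inner_def)
    also have "\<dots> \<le> 2 * (L2_norm \<Omega> (\<lambda>x. x $ i0 * u x) * L2_norm \<Omega> (\<lambda>x. G x $ i0))"
      using L2_cauchy_schwarz[OF L2_bounded_mult[OF u xm xb] Gi] by simp
    also have "\<dots> \<le> 2 * ((R * L2_norm \<Omega> u) * L2_norm \<Omega> G)"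
      using L2_norm_bounded_mult[OF u xm xb] R(1) Gile by (intro mult_left_mono mult_mono) (auto simp: L2_norm_def)
    finally have "1 \<le> 2 * R * L2_norm \<Omega> G" using nu by simp
    then have "1\<^sup>2 \<le> (2 * R * L2_norm \<Omega> G)\<^sup>2" by (intro power_mono) auto
    then have "1 \<le> 4 * R\<^sup>2 * (L2_norm \<Omega> G)\<^sup>2" by (simp add: power_mult_distrib)
    then have "a * 1 \<le> a * (4 * R\<^sup>2 * (L2_norm \<Omega> G)\<^sup>2)" using a(1) by (intro mult_left_mono) auto
    also have "\<dots> = 4 * R\<^sup>2 * (a * (L2_norm \<Omega> G)\<^sup>2)" by simp
    also have "\<dots> \<le> 4 * R\<^sup>2 * \<mu>" using G\<mu> by (intro mult_left_mono) auto
    finally show "a / (4 * R\<^sup>2) \<le> \<mu>" using R(1) by (simp add: field_simps)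
  qed
qed

section \<open>Expansion in an orthonormal basis\<close>

text \<open>The inner product with a basis function is continuous, and on the partial sums it is eventually constant.\<close>

lemma expansion_coefficient:
  assumes B: "L2_orthonormal_basis \<Omega> \<phi>" and w: "w \<in> L2 \<Omega>"
    and lim: "(\<lambda>N. L2_norm \<Omega> (\<lambda>x. w x - (\<Sum>k<N. a k * \<phi> k x))) \<longlonglongrightarrow> 0"
  shows "L2_inner \<Omega> w (\<phi> k) = a k"
proof -
  have \<phi>: "\<phi> k \<in> L2 \<Omega>" and on: "L2_inner \<Omega> (\<phi> j) (\<phi> k) = (if j = k then 1 else 0)" for j k
    using B by (auto simp: L2_orthonormal_basis_def)
  have s2: "(\<lambda>x. \<Sum>k<N. a k * \<phi> k x) \<in> L2 \<Omega>" for N by (intro L2_sum L2_scale \<phi>) auto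
  have "L2_norm \<Omega> (\<lambda>x. (\<Sum>k<N. a k * \<phi> k x) - w x) = L2_norm \<Omega> (\<lambda>x. w x - (\<Sum>k<N. a k * \<phi> k x))" for N
    by (simp add: L2_norm_def abs_minus_commute power2_commute)
  then have "(\<lambda>N. \<integral>x. \<phi> k x * (\<Sum>j<N. a j * \<phi> j x) \<partial>lebesgue_on \<Omega>) \<longlonglongrightarrow> (\<integral>x. \<phi> k x * w x \<partial>lebesgue_on \<Omega>)"
    using lim by (intro L2_inner_limit \<phi> w s2) simp
  moreover have "(\<integral>x. \<phi> k x * (\<Sum>j<N. a j * \<phi> j x) \<partial>lebesgue_on \<Omega>) = a k" if "N > k" for N
  proof -
    have "(\<integral>x. \<phi> k x * (\<Sum>j<N. a j * \<phi> j x) \<partial>lebesgue_on \<Omega>) = (\<integral>x. (\<Sum>j<N. a j * (\<phi> j x * \<phi> k x)) \<partial>lebesgue_on \<Omega>)"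
      by (simp add: sum_distrib_left mult_ac)
    also have "\<dots> = (\<Sum>j<N. a j * L2_inner \<Omega> (\<phi> j) (\<phi> k))"
      unfolding L2_inner_def using L2_mult_integrable[OF \<phi> \<phi>] by (subst Bochner_Integration.integral_sum) auto
    also have "\<dots> = a k" using that by (simp add: on if_distrib[of "\<lambda>z. a _ * z"] cong: if_cong)
    finally show ?thesis .
  qed
  then have "(\<lambda>N. \<integral>x. \<phi> k x * (\<Sum>j<N. a j * \<phi> j x) \<partial>lebesgue_on \<Omega>) \<longlonglongrightarrow> a k"
    by (intro tendsto_eventually) (auto intro: eventually_mono[OF eventually_gt_at_top[of k]])
  ultimately have "(\<integral>x. \<phi> k x * w x \<partial>lebesgue_on \<Omega>) = a k" by (rule LIMSEQ_unique)
  then show ?thesis by (simp add: L2_inner_def mult.commute)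
qed

text \<open>Bessel's inequality: the projection \<open>S\<close> satisfies \<open>(w, S) = (S, S)\<close>, and Cauchy-Schwarz applies.\<close>

lemma bessel:
  assumes B: "L2_orthonormal_basis \<Omega> \<phi>" and w: "w \<in> L2 \<Omega>"
  shows "(\<Sum>k<N. (L2_inner \<Omega> w (\<phi> k))\<^sup>2) \<le> (L2_norm \<Omega> w)\<^sup>2"
proof -
  have \<phi>: "\<phi> k \<in> L2 \<Omega>" and on: "L2_inner \<Omega> (\<phi> j) (\<phi> k) = (if j = k then 1 else 0)" for j k
    using B by (auto simp: L2_orthonormal_basis_def)
  let ?a = "\<lambda>k. L2_inner \<Omega> w (\<phi> k)"
  let ?s = "\<Sum>k<N. (?a k)\<^sup>2"
  define S where "S = (\<lambda>x. \<Sum>k<N. ?a k * \<phi> k x)"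
  have S: "S \<in> L2 \<Omega>" unfolding S_def by (intro L2_sum L2_scale \<phi>) auto
  have lin: "(\<integral>x. v x * S x \<partial>lebesgue_on \<Omega>) = (\<Sum>k<N. ?a k * L2_inner \<Omega> v (\<phi> k))" if "v \<in> L2 \<Omega>" for v
  proof -
    have "(\<integral>x. v x * S x \<partial>lebesgue_on \<Omega>) = (\<integral>x. (\<Sum>k<N. ?a k * (v x * \<phi> k x)) \<partial>lebesgue_on \<Omega>)"
      by (simp add: S_def sum_distrib_left mult_ac)
    also have "\<dots> = (\<Sum>k<N. ?a k * L2_inner \<Omega> v (\<phi> k))"
      using L2_mult_integrable[OF that \<phi>] by (subst Bochner_Integration.integral_sum) (auto simp: L2_inner_def)
    finally show ?thesis .
  qed
  have wS: "(\<integral>x. w x * S x \<partial>lebesgue_on \<Omega>) = ?s" by (simp add: lin[OF w] power2_eq_square)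
  have "L2_inner \<Omega> S (\<phi> k) = ?a k" if "k < N" for k
  proof -
    have "L2_inner \<Omega> S (\<phi> k) = (\<integral>x. \<phi> k x * S x \<partial>lebesgue_on \<Omega>)" by (simp add: L2_inner_def mult.commute)
    also have "\<dots> = ?a k" using that by (simp add: lin[OF \<phi>] on if_distrib[of "\<lambda>z. ?a _ * z"] cong: if_cong)
    finally show ?thesis .
  qed
  then have "(\<integral>x. S x * S x \<partial>lebesgue_on \<Omega>) = ?s" by (simp add: lin[OF S] power2_eq_square)
  then have SS: "(L2_norm \<Omega> S)\<^sup>2 = ?s" by (simp add: L2_norm_def power2_eq_square sum_nonneg)
  have s0: "0 \<le> ?s" by (simp add: sum_nonneg)
  have "?s \<le> L2_norm \<Omega> w * L2_norm \<Omega> S" using L2_cauchy_schwarz[OF w S] by (simp add: wS)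
  then have "?s\<^sup>2 \<le> (L2_norm \<Omega> w * L2_norm \<Omega> S)\<^sup>2" using s0 by (intro power_mono)
  then have "?s * ?s \<le> (L2_norm \<Omega> w)\<^sup>2 * ?s" by (simp add: power_mult_distrib SS power2_eq_square[of ?s])
  then show ?thesis using s0 by (cases "?s = 0") auto
qed

section \<open>The extension profile\<close>

text \<open>At an interior maximum above \<open>B \<ge> 0\<close> the first derivative vanishes and the equation makes the second
  derivative positive, a contradiction.\<close>

lemma max_principle:
  fixes f :: "real \<Rightarrow> real"
  assumes D1: "\<And>y. y > 0 \<Longrightarrow> (f has_real_derivative f1 y) (at y)"
    and D2: "\<And>y. y > 0 \<Longrightarrow> (f1 has_real_derivative f2 y) (at y)"
    and eq: "\<And>y. y > 0 \<Longrightarrow> f2 y + \<alpha> / y * f1 y = l * f y"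
    and l: "l > 0" and B: "B \<ge> 0"
    and l0: "(f \<longlongrightarrow> b0) (at_right 0)" "b0 \<le> B" and l1: "(f \<longlongrightarrow> b1) at_top" "b1 \<le> B"
    and y0: "y0 > 0"
  shows "f y0 \<le> B"
proof (rule ccontr)
  assume "\<not> f y0 \<le> B"
  then have fy: "f y0 > B" by simp
  have "\<forall>\<^sub>F y in at_right 0. f y < f y0" using order_tendstoD(2)[OF l0(1), of "f y0"] l0(2) fy by simp
  then obtain d where d: "d > 0" "\<And>y. 0 < y \<Longrightarrow> y < d \<Longrightarrow> f y < f y0"
    unfolding eventually_at_right_field by auto
  have "\<forall>\<^sub>F y in at_top. f y < f y0" using order_tendstoD(2)[OF l1(1), of "f y0"] l1(2) fy by simp
  then obtain Y where Y: "\<And>y. y \<ge> Y \<Longrightarrow> f y < f y0" by (auto simp: eventually_at_top_linorder)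
  define p where "p = min (d / 2) (y0 / 2)"
  define q where "q = max Y (y0 + 1)"
  have pq: "0 < p" "p < y0" "y0 < q" "f p < f y0" "f q < f y0"
    using d y0 Y[of q] d(2)[of p] by (auto simp: p_def q_def min_def)
  have cont: "continuous_on {p..q} f"
    using D1 pq(1) by (intro continuous_at_imp_continuous_on ballI) (meson DERIV_isCont atLeastAtMost_iff less_le_trans)
  then obtain m where m: "m \<in> {p..q}" "\<And>y. y \<in> {p..q} \<Longrightarrow> f y \<le> f m"
    using continuous_attains_sup[of "{p..q}" f] pq by auto
  have fm: "f m \<ge> f y0" using m(2)[of y0] pq by auto
  then have mi: "p < m" "m < q" using m(1) pq by (auto simp: less_le)
  have m0: "m > 0" using mi pq by simp
  have f1m: "f1 m = 0"
    by (rule DERIV_local_max[OF D1[OF m0], of "min (m - p) (q - m)"]) (use mi m(2) in \<open>auto simp: abs_less_iff\<close>)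
  have "f2 m = l * f m" using eq[OF m0] f1m by simp
  then have "f2 m > 0" using l fm fy B by simp
  from DERIV_pos_inc_right[OF D2[OF m0] this] obtain e where e: "e > 0" "\<And>h. 0 < h \<Longrightarrow> h < e \<Longrightarrow> f1 m < f1 (m + h)" by auto
  define h where "h = min (e / 2) (q - m)"
  have h: "0 < h" "h < e" "m + h \<le> q" using e mi by (auto simp: h_def)
  have "\<exists>z. m < z \<and> z < m + h \<and> f (m + h) - f m = (m + h - m) * f1 z"
    using h m0 D1 by (intro MVT2) auto
  then obtain z where z: "m < z" "z < m + h" "f (m + h) - f m = h * f1 z" by auto
  have "f1 z > 0" using e(2)[of "z - m"] z h f1m by simp
  have "f (m + h) > f m"
  proof -
    have "0 < h * f1 z" using h(1) \<open>f1 z > 0\<close> by simp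
    then show ?thesis using z(3) by simp
  qed
  moreover have "f (m + h) \<le> f m" using m(2)[of "m + h"] h mi by auto
  ultimately show False by simp
qed

text \<open>The maximum principle for \<open>\<psi>\<close> with bound \<open>1\<close> and for \<open>- \<psi>\<close> with bound \<open>0\<close>.\<close>

lemma extension_profile_range:
  assumes "extension_profile \<alpha> l \<psi>" "l > 0" "y > 0"
  shows "0 \<le> \<psi> y" "\<psi> y \<le> 1"
proof -
  obtain \<psi>1 \<psi>2 where D: "\<And>y. y > 0 \<Longrightarrow> (\<psi> has_real_derivative \<psi>1 y) (at y)"
     "\<And>y. y > 0 \<Longrightarrow> (\<psi>1 has_real_derivative \<psi>2 y) (at y)" "\<And>y. y > 0 \<Longrightarrow> \<psi>2 y + \<alpha> / y * \<psi>1 y = l * \<psi> y"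
    and lims: "\<psi> 0 = 1" "(\<psi> \<longlongrightarrow> \<psi> 0) (at_right 0)" "(\<psi> \<longlongrightarrow> 0) at_top"
    using assms(1) unfolding extension_profile_def by blast
  have l0: "(\<psi> \<longlongrightarrow> 1) (at_right 0)" using lims by simp
  show "\<psi> y \<le> 1"
    by (rule max_principle[OF D assms(2) _ l0 _ lims(3) _ assms(3)]) auto
  have D3: "- \<psi>2 y + \<alpha> / y * - \<psi>1 y = l * - \<psi> y" if "y > 0" for y
    using D(3)[OF that] by simp
  have "- \<psi> y \<le> 0"
    by (rule max_principle[of "\<lambda>y. - \<psi> y" "\<lambda>y. - \<psi>1 y" "\<lambda>y. - \<psi>2 y" \<alpha> l 0 "- 1" "- 0"])
      (rule DERIV_minus[OF D(1)] DERIV_minus[OF D(2)] D3 assms tendsto_minus[OF l0] tendsto_minus[OF lims(3)] | simp)+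
  then show "0 \<le> \<psi> y" by simp
qed

section \<open>Borel representatives on an interval\<close>

lemma AE_lebesgue_on_iff:
  assumes "S \<in> sets borel"
  shows "(AE x in lebesgue_on S. P x) \<longleftrightarrow> (AE x in lborel. x \<in> S \<longrightarrow> P x)"
  using assms by (subst AE_restrict_space_iff) (auto simp: AE_completion_iff)

text \<open>Convolutions and Fubini's theorem are used for Borel functions on the whole line. This lemma returns
  to Lebesgue integrals over a set.\<close>

lemma lebesgue_on_integral_eq:
  fixes h H :: "real \<Rightarrow> real"
  assumes S: "S \<in> sets borel" and H: "H \<in> borel_measurable borel"
    and ae: "AE x in lborel. indicator S x * h x = H x"
  shows "(\<integral>x. h x \<partial>lebesgue_on S) = (\<integral>x. H x \<partial>lborel)"
    "h \<in> borel_measurable (lebesgue_on S)"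
    "(\<And>x. x \<in> S \<Longrightarrow> h x \<ge> 0) \<Longrightarrow> (\<integral>\<^sup>+x. ennreal (h x) \<partial>lebesgue_on S) = (\<integral>\<^sup>+x. ennreal (H x) \<partial>lborel)"
proof -
  have ae': "AE x in lebesgue. indicator S x * h x = H x" using ae by (simp add: AE_completion_iff)
  have Hm: "H \<in> borel_measurable lebesgue" using H by (simp add: measurable_completion)
  have m: "(\<lambda>x. indicator S x * h x) \<in> borel_measurable lebesgue"
    by (rule borel_measurable_AE[OF Hm]) (use ae' in \<open>auto elim: eventually_mono\<close>)
  have Sl: "S \<in> sets lebesgue" using S by simp
  have "(\<lambda>x. if x \<in> S then h x else 0) = (\<lambda>x. indicator S x * h x)" by (auto simp: fun_eq_iff)
  then show "h \<in> borel_measurable (lebesgue_on S)" using m borel_measurable_if[OF Sl, of h] by simp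
  have "(\<integral>x. h x \<partial>lebesgue_on S) = (\<integral>x. indicator S x * h x \<partial>lebesgue)"
    using Sl by (subst integral_restrict_space) auto
  also have "\<dots> = (\<integral>x. H x \<partial>lebesgue)" by (rule integral_cong_AE[OF m Hm ae'])
  also have "\<dots> = (\<integral>x. H x \<partial>lborel)" using H by (intro integral_completion) simp
  finally show "(\<integral>x. h x \<partial>lebesgue_on S) = (\<integral>x. H x \<partial>lborel)" .
  assume "\<And>x. x \<in> S \<Longrightarrow> h x \<ge> 0"
  have "(\<integral>\<^sup>+x. ennreal (h x) \<partial>lebesgue_on S) = (\<integral>\<^sup>+x. ennreal (h x) * indicator S x \<partial>lebesgue)"
    using Sl by (subst nn_integral_restrict_space) auto
  also have "\<dots> = (\<integral>\<^sup>+x. ennreal (H x) \<partial>lebesgue)"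
    using ae' by (intro nn_integral_cong_AE) (auto elim!: eventually_mono simp: indicator_def split: if_splits)
  also have "\<dots> = (\<integral>\<^sup>+x. ennreal (H x) \<partial>lborel)" by (rule nn_integral_completion)
  finally show "(\<integral>\<^sup>+x. ennreal (h x) \<partial>lebesgue_on S) = (\<integral>\<^sup>+x. ennreal (H x) \<partial>lborel)" .
qed

lemma borel_representative:
  fixes h :: "real \<Rightarrow> real"
  assumes S: "S \<in> sets borel" and h: "h \<in> borel_measurable (lebesgue_on S)"
  shows "\<exists>H\<in>borel_measurable borel. (\<forall>x. x \<notin> S \<longrightarrow> H x = 0) \<and> (AE x in lborel. x \<in> S \<longrightarrow> H x = h x)"
proof -
  have Sl: "S \<in> sets lebesgue" using S by simp
  have "(\<lambda>x. if x \<in> S then h x else 0) \<in> borel_measurable lebesgue" using borel_measurable_if[OF Sl] h by blast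
  from completion_ex_borel_measurable_real[OF this]
  obtain g where g: "g \<in> borel_measurable lborel" "AE x in lborel. (if x \<in> S then h x else 0) = g x" by blast
  show ?thesis
  proof (intro bexI[of _ "\<lambda>x. indicator S x * g x"] conjI)
    show "AE x in lborel. x \<in> S \<longrightarrow> indicator S x * g x = h x" using g(2) by eventually_elim auto
    show "(\<lambda>x. indicator S x * g x) \<in> borel_measurable borel" using g(1) S by simp
  qed auto
qed

lemma borel_measurable_lebesgue_on_AE:
  fixes u v :: "real \<Rightarrow> real"
  assumes S: "S \<in> sets borel" and v: "v \<in> borel_measurable (lebesgue_on S)" and ae: "AE x in lebesgue_on S. v x = u x"
  shows "u \<in> borel_measurable (lebesgue_on S)"
proof -
  have Sl: "S \<in> sets lebesgue" using S by simp
  have "(\<lambda>x. if x \<in> S then v x else 0) \<in> borel_measurable lebesgue" using borel_measurable_if[OF Sl] v by blast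
  moreover have "AE x in lebesgue. (if x \<in> S then v x else 0) = (if x \<in> S then u x else 0)"
    using ae unfolding AE_lebesgue_on_iff[OF S] AE_completion_iff by eventually_elim auto
  ultimately have "(\<lambda>x. if x \<in> S then u x else 0) \<in> borel_measurable lebesgue" by (rule borel_measurable_AE)
  then show ?thesis using borel_measurable_if[OF Sl] by blast
qed

section \<open>Weighted sequence spaces\<close>

lemma Hspace_diff:
  assumes "x \<in> Hspace lam r" "y \<in> Hspace lam r"
  shows "(\<lambda>k. x k - y k) \<in> Hspace lam r"
proof -
  have "summable (\<lambda>k. 2 * (lam k powr r * (x k)\<^sup>2) + 2 * (lam k powr r * (y k)\<^sup>2))"
    using assms by (intro summable_add summable_mult) (auto simp: Hspace_def)
  moreover have "norm (lam k powr r * (x k - y k)\<^sup>2) \<le> 2 * (lam k powr r * (x k)\<^sup>2) + 2 * (lam k powr r * (y k)\<^sup>2)" for k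
  proof -
    have "(x k - y k)\<^sup>2 \<le> 2 * (x k)\<^sup>2 + 2 * (y k)\<^sup>2"
      using zero_le_power2[of "x k + y k"] by (simp add: power2_eq_square algebra_simps)
    then have "lam k powr r * (x k - y k)\<^sup>2 \<le> lam k powr r * (2 * (x k)\<^sup>2 + 2 * (y k)\<^sup>2)" by (intro mult_left_mono) auto
    then show ?thesis by (simp add: algebra_simps)
  qed
  ultimately show ?thesis unfolding Hspace_def by (auto intro: summable_comparison_test'[where N = 0])
qed

lemma Hspace_dominated:
  assumes "x \<in> Hspace lam r" "\<And>k. \<bar>y k\<bar> \<le> \<bar>x k\<bar>"
  shows "y \<in> Hspace lam r"
proof -
  have "norm (lam k powr r * (y k)\<^sup>2) \<le> lam k powr r * (x k)\<^sup>2" for k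
    using assms(2)[of k] by (auto intro!: mult_left_mono simp: abs_le_square_iff[symmetric])
  then show ?thesis using assms(1) unfolding Hspace_def by (auto intro: summable_comparison_test'[where N = 0])
qed

lemma weighted_square_scale:
  fixes lam :: "nat \<Rightarrow> real"
  shows "(\<lambda>k. lam k powr r * (c * x k)\<^sup>2) = (\<lambda>k. c\<^sup>2 * (lam k powr r * (x k)\<^sup>2))"
  by (rule ext) (simp only: power_mult_distrib mult_ac)

lemma Hspace_scale: "x \<in> Hspace lam r \<Longrightarrow> (\<lambda>k. c * x k) \<in> Hspace lam r"
  unfolding Hspace_def mem_Collect_eq weighted_square_scale by (rule summable_mult)

lemma Hnorm_scale: "x \<in> Hspace lam r \<Longrightarrow> Hnorm lam r (\<lambda>k. c * x k) = \<bar>c\<bar> * Hnorm lam r x"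
  unfolding Hspace_def mem_Collect_eq Hnorm_def weighted_square_scale by (simp add: suminf_mult real_sqrt_mult)

lemma Hnorm_nonneg: "x \<in> Hspace lam r \<Longrightarrow> 0 \<le> Hnorm lam r x"
  unfolding Hspace_def Hnorm_def by (auto intro!: suminf_nonneg)

lemma Hnorm_sq: "x \<in> Hspace lam r \<Longrightarrow> (Hnorm lam r x)\<^sup>2 = (\<Sum>k. lam k powr r * (x k)\<^sup>2)"
  unfolding Hspace_def Hnorm_def by (auto intro!: suminf_nonneg)

lemma Hnorm_coord:
  assumes "x \<in> Hspace lam r" shows "lam k powr r * (x k)\<^sup>2 \<le> (Hnorm lam r x)\<^sup>2"
proof -
  have "lam k powr r * (x k)\<^sup>2 = (\<Sum>j\<in>{k}. lam j powr r * (x j)\<^sup>2)" by simp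
  also have "\<dots> \<le> (\<Sum>j. lam j powr r * (x j)\<^sup>2)" using assms by (intro sum_le_suminf) (auto simp: Hspace_def)
  finally show ?thesis using Hnorm_sq[OF assms] by simp
qed

text \<open>Dominated convergence for series. It gives both the approximation by simple functions and the
  convergence to the trace.\<close>

lemma Hnorm_null:
  assumes dom: "M \<in> Hspace lam r" and b: "\<And>n k. \<bar>x n k\<bar> \<le> \<bar>M k\<bar>" and l: "\<And>k. ((\<lambda>n. x n k) \<longlongrightarrow> 0) F" and F: "F \<noteq> bot"
  shows "((\<lambda>n. Hnorm lam r (x n)) \<longlongrightarrow> 0) F"
proof -
  have "((\<lambda>n. \<Sum>k. lam k powr r * (x n k)\<^sup>2) \<longlongrightarrow> (\<Sum>k. (0::real))) F"
  proof (rule tannerys_theorem[where M = "\<lambda>k. lam k powr r * (M k)\<^sup>2", THEN conjunct2, THEN conjunct2])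
    show "((\<lambda>n. lam k powr r * (x n k)\<^sup>2) \<longlongrightarrow> 0) F" for k
      using tendsto_mult[OF tendsto_const tendsto_power[OF l[of k], of 2], of "lam k powr r"] by simp
    have "norm (lam k powr r * (x n k)\<^sup>2) \<le> lam k powr r * (M k)\<^sup>2" for k n
      using b[of n k] by (auto intro!: mult_left_mono simp: abs_le_square_iff[symmetric])
    then show "\<forall>\<^sub>F (k, n) in at_top \<times>\<^sub>F F. norm (lam k powr r * (x n k)\<^sup>2) \<le> lam k powr r * (M k)\<^sup>2"
      by (intro always_eventually) auto
    show "summable (\<lambda>k. lam k powr r * (M k)\<^sup>2)" using dom by (simp add: Hspace_def)
  qed (rule F)
  from tendsto_real_sqrt[OF this] show ?thesis by (simp add: Hnorm_def)
qed

section \<open>Bochner measurability\<close>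

text \<open>Rounding towards zero on a grid of mesh \<open>1 / (m + 1)\<close>, cut off at size \<open>m\<close>: finitely many values, and an
  error never larger than the argument.\<close>

definition round_to_grid :: "nat \<Rightarrow> real \<Rightarrow> real" where
  "round_to_grid m z = (if \<bar>z\<bar> \<le> real m then sgn z * real_of_int \<lfloor>\<bar>z\<bar> * real (Suc m)\<rfloor> / real (Suc m) else 0)"

lemma round_to_grid_measurable: "round_to_grid m \<in> borel_measurable borel"
  unfolding round_to_grid_def[abs_def] by measurable

lemma round_to_grid_finite: "finite (range (round_to_grid m))"
proof -
  have "range (round_to_grid m) \<subseteq> (\<lambda>(s, j). s * real_of_int j / real (Suc m)) ` ({-1, 0, 1} \<times> {0..int (m * Suc m)})"
  proof (rule image_subsetI)
    fix z :: real
    show "round_to_grid m z \<in> (\<lambda>(s, j). s * real_of_int j / real (Suc m)) ` ({-1, 0, 1} \<times> {0..int (m * Suc m)})"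
    proof (cases "\<bar>z\<bar> \<le> real m")
      case True
      have "\<bar>z\<bar> * real (Suc m) \<le> real m * real (Suc m)" using True by (intro mult_right_mono) auto
      then have "\<lfloor>\<bar>z\<bar> * real (Suc m)\<rfloor> \<le> int (m * Suc m)" by (simp add: floor_le_iff algebra_simps)
      moreover have "0 \<le> \<lfloor>\<bar>z\<bar> * real (Suc m)\<rfloor>" by simp
      ultimately show ?thesis using True
        by (intro image_eqI[of _ _ "(sgn z, \<lfloor>\<bar>z\<bar> * real (Suc m)\<rfloor>)"]) (auto simp: round_to_grid_def sgn_if)
    next
      case False
      then show ?thesis by (intro image_eqI[of _ _ "(0, 0)"]) (auto simp: round_to_grid_def)
    qed
  qed
  then show ?thesis by (rule finite_subset) simp
qed

lemma round_to_grid_error: "\<bar>round_to_grid m z - z\<bar> \<le> \<bar>z\<bar>" "\<bar>z\<bar> \<le> real m \<Longrightarrow> \<bar>round_to_grid m z - z\<bar> \<le> 1 / real (Suc m)"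
proof -
  define q where "q = real_of_int \<lfloor>\<bar>z\<bar> * real (Suc m)\<rfloor> / real (Suc m)"
  have q: "0 \<le> q" "q \<le> \<bar>z\<bar>" "\<bar>z\<bar> - q \<le> 1 / real (Suc m)"
  proof -
    show "0 \<le> q" by (simp add: q_def)
    have f: "real_of_int \<lfloor>\<bar>z\<bar> * real (Suc m)\<rfloor> \<le> \<bar>z\<bar> * real (Suc m)" "\<bar>z\<bar> * real (Suc m) \<le> real_of_int \<lfloor>\<bar>z\<bar> * real (Suc m)\<rfloor> + 1"
      by linarith+
    have "q \<le> (\<bar>z\<bar> * real (Suc m)) / real (Suc m)" unfolding q_def by (rule divide_right_mono[OF f(1)]) simp
    then show "q \<le> \<bar>z\<bar>" by simp
    have "(\<bar>z\<bar> * real (Suc m)) / real (Suc m) \<le> (real_of_int \<lfloor>\<bar>z\<bar> * real (Suc m)\<rfloor> + 1) / real (Suc m)"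
      by (rule divide_right_mono[OF f(2)]) simp
    then show "\<bar>z\<bar> - q \<le> 1 / real (Suc m)" by (simp add: q_def add_divide_distrib)
  qed
  have e: "\<bar>sgn z * q - z\<bar> = \<bar>z\<bar> - q" using q by (auto simp: sgn_if abs_if split: if_splits)
  show "\<bar>round_to_grid m z - z\<bar> \<le> \<bar>z\<bar>"
    using q e by (auto simp: round_to_grid_def q_def)
  show "\<bar>round_to_grid m z - z\<bar> \<le> 1 / real (Suc m)" if "\<bar>z\<bar> \<le> real m"
    using q e that by (auto simp: round_to_grid_def q_def)
qed

lemma round_to_grid_tendsto: "(\<lambda>m. round_to_grid m z) \<longlonglongrightarrow> z"
proof -
  have "(\<lambda>m. round_to_grid m z - z) \<longlonglongrightarrow> 0"
  proof (rule Lim_null_comparison)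
    obtain m0 :: nat where "\<bar>z\<bar> \<le> real m0" using real_arch_simple by blast
    then have "norm (round_to_grid m z - z) \<le> 1 / real (Suc m)" if "m0 \<le> m" for m
      using round_to_grid_error(2)[of z m] that by simp
    then show "\<forall>\<^sub>F m in sequentially. norm (round_to_grid m z - z) \<le> 1 / real (Suc m)"
      by (rule eventually_mono[OF eventually_ge_at_top[of m0]])
    show "(\<lambda>m. 1 / real (Suc m)) \<longlonglongrightarrow> 0" by (rule LIMSEQ_Suc[OF lim_1_over_n])
  qed
  then show ?thesis by (simp add: LIM_zero_iff)
qed

text \<open>Round the first \<open>n\<close> weighted coefficients. Since the error is dominated by the sequence itself, the
  simple functions converge in norm.\<close>

lemma bochner_measurableI:
  assumes lam: "\<And>k. 0 < lam k" and sp: "AE t in lebesgue_on I. u t \<in> Hspace lam r"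
    and m: "\<And>k. (\<lambda>t. u t k) \<in> borel_measurable (lebesgue_on I)"
  shows "bochner_measurable I lam r u"
proof -
  define w where "w = (\<lambda>k. sqrt (lam k powr r))"
  have w: "w k > 0" "(w k)\<^sup>2 = lam k powr r" for k using lam[of k] by (auto simp: w_def)
  define S where "S = (\<lambda>m t k. if k < m then round_to_grid m (w k * u t k) / w k else 0)"
  have Sm: "(\<lambda>t. S n t k) \<in> borel_measurable (lebesgue_on I)" for n k
  proof -
    have "(\<lambda>t. round_to_grid n (w k * u t k)) \<in> borel_measurable (lebesgue_on I)"
      by (rule measurable_compose[OF _ round_to_grid_measurable]) (use m[of k] in measurable)
    then show ?thesis by (simp add: S_def)
  qed
  have "simple_function (lebesgue_on I) (S n)" for n
    unfolding simple_function_def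
  proof (intro conjI ballI)
    have "S n t k \<in> (\<Union>k<n. (\<lambda>z. z / w k) ` range (round_to_grid n))" if "k < n" for t k
      using that by (intro UN_I[of k]) (auto simp: S_def)
    moreover have "S n t k = 0" if "\<not> k < n" for t k using that by (simp add: S_def)
    ultimately have "S n ` space (lebesgue_on I) \<subseteq> {f. \<forall>k. (k \<in> {..<n} \<longrightarrow> f k \<in> (\<Union>k<n. (\<lambda>z. z / w k) ` range (round_to_grid n))) \<and> (k \<notin> {..<n} \<longrightarrow> f k = 0)}"
      by auto
    then show "finite (S n ` space (lebesgue_on I))"
      by (rule finite_subset) (intro finite_set_of_finite_funs finite_UN_I finite_imageI round_to_grid_finite finite_lessThan)
    fix x assume "x \<in> S n ` space (lebesgue_on I)"
    have "S n -` {x} \<inter> space (lebesgue_on I) = {t \<in> space (lebesgue_on I). \<forall>k. S n t k = x k}" by (auto simp: fun_eq_iff)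
    also have "\<dots> \<in> sets (lebesgue_on I)" using Sm by measurable
    finally show "S n -` {x} \<inter> space (lebesgue_on I) \<in> sets (lebesgue_on I)" .
  qed
  moreover have "S n t \<in> Hspace lam r" for n t
    unfolding Hspace_def mem_Collect_eq
    by (rule summable_finite[of "{..<n}"]) (auto simp: S_def)
  moreover have "(\<lambda>n. Hnorm lam r (\<lambda>k. S n t k - u t k)) \<longlonglongrightarrow> 0" if t: "u t \<in> Hspace lam r" for t
  proof (rule Hnorm_null[OF t])
    fix n k
    show "\<bar>S n t k - u t k\<bar> \<le> \<bar>u t k\<bar>"
    proof (cases "k < n")
      case True
      have "S n t k - u t k = (round_to_grid n (w k * u t k) - w k * u t k) / w k"
        using True w(1)[of k] by (simp add: S_def diff_divide_distrib)
      also have "\<bar>\<dots>\<bar> \<le> \<bar>w k * u t k\<bar> / w k"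
        unfolding abs_divide using w(1)[of k] round_to_grid_error(1)[of n "w k * u t k"] by (simp add: divide_right_mono)
      also have "\<dots> = \<bar>u t k\<bar>" using w(1)[of k] by (simp add: abs_mult)
      finally show ?thesis .
    qed (simp add: S_def)
  next
    fix k
    have "(\<lambda>n. round_to_grid n (w k * u t k) / w k - u t k) \<longlonglongrightarrow> (w k * u t k) / w k - u t k"
      using w(1)[of k] by (intro tendsto_intros round_to_grid_tendsto) auto
    then have "(\<lambda>n. round_to_grid n (w k * u t k) / w k - u t k) \<longlonglongrightarrow> 0" using w(1)[of k] by simp
    then show "(\<lambda>n. S n t k - u t k) \<longlonglongrightarrow> 0"
      by (rule Lim_transform_eventually) (auto simp: S_def intro: eventually_mono[OF eventually_gt_at_top[of k]])
  qed simp
  ultimately show ?thesis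
    unfolding bochner_measurable_def using sp by (auto intro!: exI[of _ S] elim: eventually_mono)
qed

text \<open>Coefficients are continuous on \<open>\<H>(r)\<close>, so they inherit measurability from the simple functions as limits almost
  everywhere; completeness of Lebesgue measure removes the exceptional set.\<close>

lemma bochner_measurable_coord:
  fixes I :: "real set"
  assumes I: "I \<in> sets borel" and lam: "\<And>k. 0 < lam k" and b: "bochner_measurable I lam r u"
  shows "(\<lambda>t. u t k) \<in> borel_measurable (lebesgue_on I)"
proof -
  obtain S where S: "\<And>m::nat. simple_function (lebesgue_on I) (S m)" "\<And>m t. t \<in> I \<Longrightarrow> S m t \<in> Hspace lam r"
    and l: "AE t in lebesgue_on I. (\<lambda>m. Hnorm lam r (\<lambda>k. S m t k - u t k)) \<longlonglongrightarrow> 0"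
    and sp: "AE t in lebesgue_on I. u t \<in> Hspace lam r"
    using b unfolding bochner_measurable_def by blast
  have m: "(\<lambda>t. S m t k) \<in> borel_measurable (lebesgue_on I)" for m
    by (rule borel_measurable_simple_function[OF simple_function_compose1[OF S(1)]])
  define w where "w = sqrt (lam k powr r)"
  have w: "w > 0" using lam[of k] by (simp add: w_def)
  have "AE t in lebesgue_on I. lim (\<lambda>m. S m t k) = u t k"
    using l sp AE_space
  proof eventually_elim
    case (elim t)
    have "(\<lambda>m. S m t k - u t k) \<longlonglongrightarrow> 0"
    proof (rule Lim_null_comparison)
      show "(\<lambda>m. Hnorm lam r (\<lambda>k. S m t k - u t k) / w) \<longlonglongrightarrow> 0" using tendsto_divide[OF elim(1) tendsto_const, of w] w by simp
      have "norm (S m t k - u t k) \<le> Hnorm lam r (\<lambda>k. S m t k - u t k) / w" for m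
      proof -
        have "t \<in> I" using elim(3) by simp
        then have d: "(\<lambda>k. S m t k - u t k) \<in> Hspace lam r" using S(2) elim(2) by (intro Hspace_diff) auto
        have "(w * \<bar>S m t k - u t k\<bar>)\<^sup>2 \<le> (Hnorm lam r (\<lambda>k. S m t k - u t k))\<^sup>2"
          using Hnorm_coord[OF d, of k] by (simp add: w_def power_mult_distrib)
        then have "w * \<bar>S m t k - u t k\<bar> \<le> Hnorm lam r (\<lambda>k. S m t k - u t k)"
          by (rule power2_le_imp_le) (rule Hnorm_nonneg[OF d])
        then show ?thesis using w by (simp add: pos_le_divide_eq mult.commute)
      qed
      then show "\<forall>\<^sub>F m in sequentially. norm (S m t k - u t k) \<le> Hnorm lam r (\<lambda>k. S m t k - u t k) / w" by simp
    qed
    then have "(\<lambda>m. S m t k) \<longlonglongrightarrow> u t k" by (simp add: LIM_zero_iff)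
    then show ?case by (rule limI)
  qed
  then show ?thesis
    by (rule borel_measurable_lebesgue_on_AE[OF I borel_measurable_lim_metric[OF m]])
qed

section \<open>Time-dependent norms as sums over the modes\<close>

text \<open>Monotone convergence reduces every norm in time to integrals of single coefficients.\<close>

lemma L2_time_sum:
  assumes lam: "\<And>k. 0 < lam k" and u: "u \<in> L2_time T lam r"
  shows "(\<Sum>k. \<integral>\<^sup>+t. ennreal (lam k powr r * (u t k)\<^sup>2) \<partial>lebesgue_on {0<..<T}) = ennreal ((L2_time_norm T lam r u)\<^sup>2)"
proof -
  let ?M = "lebesgue_on {0<..<T}"
  have b: "bochner_measurable {0<..<T} lam r u" and i: "integrable ?M (\<lambda>t. (Hnorm lam r (u t))\<^sup>2)"
    using u by (auto simp: L2_time_def)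
  have m[measurable]: "(\<lambda>t. u t k) \<in> borel_measurable ?M" for k
    by (rule bochner_measurable_coord[OF _ lam b]) simp
  have sp: "AE t in ?M. u t \<in> Hspace lam r" using b by (simp add: bochner_measurable_def)
  have "(\<Sum>k. \<integral>\<^sup>+t. ennreal (lam k powr r * (u t k)\<^sup>2) \<partial>?M) = (\<integral>\<^sup>+t. (\<Sum>k. ennreal (lam k powr r * (u t k)\<^sup>2)) \<partial>?M)"
    by (rule nn_integral_suminf[symmetric]) measurable
  also have "\<dots> = (\<integral>\<^sup>+t. ennreal ((Hnorm lam r (u t))\<^sup>2) \<partial>?M)"
  proof (rule nn_integral_cong_AE)
    show "AE t in ?M. (\<Sum>k. ennreal (lam k powr r * (u t k)\<^sup>2)) = ennreal ((Hnorm lam r (u t))\<^sup>2)"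
      using sp
    proof eventually_elim
      case (elim t)
      then show ?case unfolding Hnorm_sq[OF elim] by (intro suminf_ennreal2) (auto simp: Hspace_def)
    qed
  qed
  also have "\<dots> = ennreal (\<integral>t. (Hnorm lam r (u t))\<^sup>2 \<partial>?M)" by (rule nn_integral_eq_integral[OF i]) simp
  also have "(\<integral>t. (Hnorm lam r (u t))\<^sup>2 \<partial>?M) = (L2_time_norm T lam r u)\<^sup>2"
    by (simp add: L2_time_norm_def)
  finally show ?thesis .
qed

text \<open>Membership in the space is part of the conclusion: a finite sum of integrals forces the weighted
  series to converge for almost every time.\<close>

lemma L2_timeI:
  assumes lam: "\<And>k. 0 < lam k" and m: "\<And>k. (\<lambda>t. u t k) \<in> borel_measurable (lebesgue_on {0<..<T})"
    and B: "(\<Sum>k. \<integral>\<^sup>+t. ennreal (lam k powr r * (u t k)\<^sup>2) \<partial>lebesgue_on {0<..<T}) \<le> ennreal B" and B0: "0 \<le> B"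
  shows "u \<in> L2_time T lam r" "(L2_time_norm T lam r u)\<^sup>2 \<le> B"
proof -
  let ?M = "lebesgue_on {0<..<T}"
  note [measurable] = m
  have "(\<integral>\<^sup>+t. (\<Sum>k. ennreal (lam k powr r * (u t k)\<^sup>2)) \<partial>?M) = (\<Sum>k. \<integral>\<^sup>+t. ennreal (lam k powr r * (u t k)\<^sup>2) \<partial>?M)"
    by (rule nn_integral_suminf) measurable
  then have le: "(\<integral>\<^sup>+t. (\<Sum>k. ennreal (lam k powr r * (u t k)\<^sup>2)) \<partial>?M) \<le> ennreal B" using B by simp
  have "AE t in ?M. (\<Sum>k. ennreal (lam k powr r * (u t k)\<^sup>2)) \<noteq> \<infinity>"
    by (rule nn_integral_PInf_AE) (use le in \<open>auto simp: top_unique\<close>)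
  then have sp: "AE t in ?M. u t \<in> Hspace lam r"
    by eventually_elim (auto simp: Hspace_def intro!: summable_suminf_not_top)
  have b: "bochner_measurable {0<..<T} lam r u" by (rule bochner_measurableI[OF lam sp m])
  have hm: "(\<lambda>t. (Hnorm lam r (u t))\<^sup>2) \<in> borel_measurable ?M" unfolding Hnorm_def by measurable
  have "(\<integral>\<^sup>+t. ennreal ((Hnorm lam r (u t))\<^sup>2) \<partial>?M) = (\<integral>\<^sup>+t. (\<Sum>k. ennreal (lam k powr r * (u t k)\<^sup>2)) \<partial>?M)"
  proof (rule nn_integral_cong_AE)
    show "AE t in ?M. ennreal ((Hnorm lam r (u t))\<^sup>2) = (\<Sum>k. ennreal (lam k powr r * (u t k)\<^sup>2))"
      using sp
    proof eventually_elim
      case (elim t)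
      then show ?case unfolding Hnorm_sq[OF elim] by (intro suminf_ennreal2[symmetric]) (auto simp: Hspace_def)
    qed
  qed
  then have le2: "(\<integral>\<^sup>+t. ennreal ((Hnorm lam r (u t))\<^sup>2) \<partial>?M) \<le> ennreal B" using le by simp
  have i: "integrable ?M (\<lambda>t. (Hnorm lam r (u t))\<^sup>2)"
    by (rule integrableI_bounded[OF hm]) (use le2 in \<open>auto simp: less_top[symmetric] top_unique\<close>)
  show "u \<in> L2_time T lam r" using b i by (simp add: L2_time_def)
  have "ennreal (\<integral>t. (Hnorm lam r (u t))\<^sup>2 \<partial>?M) \<le> ennreal B" using le2 nn_integral_eq_integral[OF i] by simp
  then show "(L2_time_norm T lam r u)\<^sup>2 \<le> B" using B0 by (simp add: L2_time_norm_def)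
qed

text \<open>A weight \<open>t powr \<rho>\<close> is harmless on compact subintervals, which stay away from \<open>0\<close>.\<close>

lemma L1loc_timeI:
  assumes lam: "\<And>k. 0 < lam k" and m: "\<And>k. (\<lambda>t. u t k) \<in> borel_measurable (lebesgue_on {0<..<T})" and \<rho>: "0 \<le> \<rho>"
    and B: "(\<Sum>k. \<integral>\<^sup>+t. ennreal (lam k powr r * (t powr (\<rho> / 2) * u t k)\<^sup>2) \<partial>lebesgue_on {0<..<T}) \<le> ennreal B" and B0: "0 \<le> B"
  shows "u \<in> L1loc_time T lam r"
proof -
  let ?M = "lebesgue_on {0<..<T}"
  define w where "w = (\<lambda>t k. t powr (\<rho> / 2) * u t k)"
  note [measurable] = m
  have pm: "(\<lambda>t. t powr (\<rho> / 2)) \<in> borel_measurable ?M"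
    by (intro measurable_restrict_space1 measurable_completion) measurable
  have wm: "(\<lambda>t. w t k) \<in> borel_measurable ?M" for k unfolding w_def using pm by measurable
  have wL: "w \<in> L2_time T lam r" by (rule L2_timeI[OF lam wm _ B0]) (use B in \<open>simp add: w_def\<close>)
  then have "AE t in ?M. w t \<in> Hspace lam r" by (simp add: L2_time_def bochner_measurable_def)
  then have sp: "AE t in ?M. u t \<in> Hspace lam r \<and> Hnorm lam r (u t) = t powr (- (\<rho> / 2)) * Hnorm lam r (w t) \<and> w t \<in> Hspace lam r"
    using AE_space
  proof eventually_elim
    case (elim t)
    then have "t > 0" by simp
    then have "u t = (\<lambda>k. t powr (- (\<rho> / 2)) * w t k)" by (simp add: w_def powr_minus fun_eq_iff)
    then show ?case using Hspace_scale[OF elim(1), of "t powr (- (\<rho> / 2))"] Hnorm_scale[OF elim(1), of "t powr (- (\<rho> / 2))"] elim(1) by simp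
  qed
  have b: "bochner_measurable {0<..<T} lam r u"
    by (rule bochner_measurableI[OF lam _ m]) (use sp in \<open>auto elim: eventually_mono\<close>)
  have "integrable (lebesgue_on {a..b}) (\<lambda>t. Hnorm lam r (u t))" if ab: "0 < a \<and> a \<le> b \<and> b < T" for a b
  proof -
    have sub: "{a..b} \<subseteq> {0<..<T}" using ab by auto
    have iw: "integrable ?M (\<lambda>t. (Hnorm lam r (w t))\<^sup>2)" using wL by (simp add: L2_time_def)
    have "integrable lebesgue (\<lambda>t. indicator {0<..<T} t *\<^sub>R (Hnorm lam r (w t))\<^sup>2)"
      by (rule integrable_restrict_space[THEN iffD1, OF _ iw]) simp
    from integrable_mult_indicator[OF _ this, of "{a..b}"]
    have "integrable lebesgue (\<lambda>t. indicator {a..b} t *\<^sub>R (indicator {0<..<T} t *\<^sub>R (Hnorm lam r (w t))\<^sup>2))"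
      by simp
    also have "(\<lambda>t. indicator {a..b} t *\<^sub>R (indicator {0<..<T} t *\<^sub>R (Hnorm lam r (w t))\<^sup>2)) = (\<lambda>t. indicator {a..b} t *\<^sub>R (Hnorm lam r (w t))\<^sup>2)"
      using sub by (auto simp: fun_eq_iff indicator_def)
    finally have X: "integrable lebesgue (\<lambda>t. indicator {a..b} t *\<^sub>R (Hnorm lam r (w t))\<^sup>2)" .
    have iwab: "integrable (lebesgue_on {a..b}) (\<lambda>t. (Hnorm lam r (w t))\<^sup>2)"
      by (rule integrable_restrict_space[THEN iffD2, OF _ X]) simp
    interpret finite_measure "lebesgue_on {a..b}" by (rule finite_measure_lebesgue_on) simp
    have dom: "integrable (lebesgue_on {a..b}) (\<lambda>t. a powr (- (\<rho> / 2)) * (1 + (Hnorm lam r (w t))\<^sup>2))"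
      using iwab by simp
    show ?thesis
    proof (rule Bochner_Integration.integrable_bound[OF dom])
      have "(\<lambda>t. Hnorm lam r (u t)) \<in> borel_measurable ?M" unfolding Hnorm_def by measurable
      then show "(\<lambda>t. Hnorm lam r (u t)) \<in> borel_measurable (lebesgue_on {a..b})" by (rule measurable_restrict_mono[OF _ sub])
      have "AE t in lborel. t \<in> {0<..<T} \<longrightarrow> (u t \<in> Hspace lam r \<and> Hnorm lam r (u t) = t powr (- (\<rho> / 2)) * Hnorm lam r (w t) \<and> w t \<in> Hspace lam r)"
        using sp by (subst (asm) AE_lebesgue_on_iff) auto
      then have "AE t in lborel. t \<in> {a..b} \<longrightarrow> norm (Hnorm lam r (u t)) \<le> norm (a powr (- (\<rho> / 2)) * (1 + (Hnorm lam r (w t))\<^sup>2))"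
      proof eventually_elim
        case (elim t)
        show ?case
        proof
          assume t: "t \<in> {a..b}"
          then have e: "Hnorm lam r (u t) = t powr (- (\<rho> / 2)) * Hnorm lam r (w t)" and wt: "w t \<in> Hspace lam r" using elim sub by auto
          have "t powr (- (\<rho> / 2)) \<le> a powr (- (\<rho> / 2))" using t ab \<rho> by (intro powr_mono2') auto
          moreover have "Hnorm lam r (w t) \<le> 1 + (Hnorm lam r (w t))\<^sup>2"
            using zero_le_power2[of "Hnorm lam r (w t) - 1"] Hnorm_nonneg[OF wt] by (simp add: power2_eq_square algebra_simps)
          ultimately have "t powr (- (\<rho> / 2)) * Hnorm lam r (w t) \<le> a powr (- (\<rho> / 2)) * (1 + (Hnorm lam r (w t))\<^sup>2)"
            using Hnorm_nonneg[OF wt] by (intro mult_mono) auto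
          then show "norm (Hnorm lam r (u t)) \<le> norm (a powr (- (\<rho> / 2)) * (1 + (Hnorm lam r (w t))\<^sup>2))"
            unfolding e using Hnorm_nonneg[OF wt] by simp
        qed
      qed
      then show "AE t in lebesgue_on {a..b}. norm (Hnorm lam r (u t)) \<le> norm (a powr (- (\<rho> / 2)) * (1 + (Hnorm lam r (w t))\<^sup>2))"
        by (subst AE_lebesgue_on_iff) auto
    qed
  qed
  then show ?thesis using b by (simp add: L1loc_time_def)
qed

text \<open>The squared \<open>L2(0, T)\<close> norm of one coefficient.\<close>

definition energy :: "real \<Rightarrow> (real \<Rightarrow> nat \<Rightarrow> real) \<Rightarrow> nat \<Rightarrow> real" where
  "energy T u k = enn2real (\<integral>\<^sup>+t. ennreal ((u t k)\<^sup>2) \<partial>lebesgue_on {0<..<T})"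

lemma energy_nonneg: "0 \<le> energy T u k"
  by (simp add: energy_def)

lemma L2_time_energy:
  assumes lam: "\<And>k. 0 < lam k" and u: "u \<in> L2_time T lam r"
  shows "(\<integral>\<^sup>+t. ennreal ((u t k)\<^sup>2) \<partial>lebesgue_on {0<..<T}) = ennreal (energy T u k)"
    "(\<lambda>k. lam k powr r * energy T u k) sums (L2_time_norm T lam r u)\<^sup>2"
proof -
  let ?M = "lebesgue_on {0<..<T}"
  have [measurable]: "(\<lambda>t. u t k) \<in> borel_measurable ?M" for k
    using u by (intro bochner_measurable_coord[OF _ lam]) (auto simp: L2_time_def)
  let ?E = "\<lambda>k. \<integral>\<^sup>+t. ennreal ((u t k)\<^sup>2) \<partial>?M"
  have e: "(\<integral>\<^sup>+t. ennreal (lam k powr r * (u t k)\<^sup>2) \<partial>?M) = ennreal (lam k powr r) * ?E k" for k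
    by (subst nn_integral_cmult[symmetric]) (auto simp: ennreal_mult)
  have S: "(\<Sum>k. ennreal (lam k powr r) * ?E k) = ennreal ((L2_time_norm T lam r u)\<^sup>2)"
    using L2_time_sum[OF lam u] unfolding e .
  have fin: "?E k \<noteq> top" for k
  proof
    assume t: "?E k = top"
    have "ennreal (lam k powr r) * ?E k = (\<Sum>j\<in>{k}. ennreal (lam j powr r) * ?E j)" by simp
    also have "\<dots> \<le> (\<Sum>k. ennreal (lam k powr r) * ?E k)" by (rule sum_le_suminf) auto
    finally have "ennreal (lam k powr r) * ?E k \<le> ennreal ((L2_time_norm T lam r u)\<^sup>2)" unfolding S .
    moreover have "lam k powr r > 0" using lam[of k] by simp
    ultimately show False unfolding t by (simp add: ennreal_mult_top top_unique)
  qed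
  show E: "?E k = ennreal (energy T u k)" for k
    unfolding energy_def using fin[of k] by (simp add: less_top)
  have X: "(\<Sum>k. ennreal (lam k powr r * energy T u k)) = ennreal ((L2_time_norm T lam r u)\<^sup>2)"
    using S unfolding E by (simp add: ennreal_mult energy_nonneg)
  have nn: "0 \<le> lam k powr r * energy T u k" for k by (simp add: energy_nonneg)
  have sm: "summable (\<lambda>k. lam k powr r * energy T u k)"
    by (rule summable_suminf_not_top[OF nn]) (simp add: X)
  have eq: "ennreal (\<Sum>k. lam k powr r * energy T u k) = ennreal ((L2_time_norm T lam r u)\<^sup>2)"
    using suminf_ennreal2[OF nn sm] X by simp
  have "0 \<le> (\<Sum>k. lam k powr r * energy T u k)" by (intro suminf_nonneg sm nn)
  then show "(\<lambda>k. lam k powr r * energy T u k) sums (L2_time_norm T lam r u)\<^sup>2"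
    using eq sm by (simp add: sums_iff)
qed

lemma L2_time_representative:
  assumes T: "0 < T" and lam: "\<And>k. 0 < lam k" and u: "u \<in> L2_time T lam r"
  shows "\<exists>F\<in>borel_measurable borel. integrable lborel F \<and> (\<forall>x. x \<notin> {0<..<T} \<longrightarrow> F x = 0) \<and>
    (AE x in lborel. x \<in> {0<..<T} \<longrightarrow> F x = u x k) \<and> (\<integral>\<^sup>+x. ennreal ((F x)\<^sup>2) \<partial>lborel) = ennreal (energy T u k)"
proof -
  have m: "(\<lambda>t. u t k) \<in> borel_measurable (lebesgue_on {0<..<T})"
    using u by (intro bochner_measurable_coord[OF _ lam]) (auto simp: L2_time_def)
  obtain F where F[measurable]: "F \<in> borel_measurable borel" and z: "\<And>x. x \<notin> {0<..<T} \<Longrightarrow> F x = 0"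
    and ae: "AE x in lborel. x \<in> {0<..<T} \<longrightarrow> F x = u x k"
    using borel_representative[OF _ m] by auto
  have N: "(\<integral>\<^sup>+x. ennreal ((F x)\<^sup>2) \<partial>lborel) = ennreal (energy T u k)"
  proof -
    have "(\<integral>\<^sup>+t. ennreal ((u t k)\<^sup>2) \<partial>lebesgue_on {0<..<T}) = (\<integral>\<^sup>+x. ennreal ((F x)\<^sup>2) \<partial>lborel)"
    proof (rule lebesgue_on_integral_eq(3))
      show "AE x in lborel. indicator {0<..<T} x * (u x k)\<^sup>2 = (F x)\<^sup>2"
        using ae
      proof eventually_elim
        case (elim x)
        then show ?case using z[of x] by (cases "x \<in> {0<..<T}") auto
      qed
    qed auto
    then show ?thesis using L2_time_energy(1)[OF lam u] by simp
  qed
  have "integrable lborel F"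
  proof (rule integrableI_bounded)
    have "\<bar>y\<bar> \<le> 1 + y\<^sup>2" for y :: real
      using zero_le_power2[of "\<bar>y\<bar> - 1"] by (simp add: power2_eq_square algebra_simps abs_mult_self_eq)
    then have "norm (F x) \<le> indicator {0<..<T} x + (F x)\<^sup>2" for x
      using z[of x] by (cases "x \<in> {0<..<T}") auto
    then have "(\<integral>\<^sup>+x. ennreal (norm (F x)) \<partial>lborel) \<le> (\<integral>\<^sup>+x. ennreal (indicator {0<..<T} x + (F x)\<^sup>2) \<partial>lborel)"
      by (intro nn_integral_mono ennreal_leI)
    also have "\<dots> = (\<integral>\<^sup>+x. indicator {0<..<T} x + ennreal ((F x)\<^sup>2) \<partial>lborel)"
      by (intro nn_integral_cong) (simp add: ennreal_plus ennreal_indicator)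
    also have "\<dots> = ennreal T + ennreal (energy T u k)"
      using T by (subst nn_integral_add) (auto simp: N)
    also have "\<dots> < \<infinity>" by (simp add: ennreal_add_less_top)
    finally show "(\<integral>\<^sup>+x. ennreal (norm (F x)) \<partial>lborel) < \<infinity>" .
  qed simp
  then show ?thesis using F z ae N by blast
qed

lemma test_function_outside:
  assumes "\<eta> \<in> test_functions {0<..<T::real}" "0 < T" "x \<notin> {0<..<T}" shows "\<eta> x = 0"
  by (rule test_functionE[OF assms(1,2)]) (use assms(3) in force)

lemma test_integral_transfer:
  fixes h F \<eta> :: "real \<Rightarrow> real"
  assumes T: "0 < T" and \<eta>: "\<eta> \<in> test_functions {0<..<T}" and F: "F \<in> borel_measurable borel"
    and ae: "AE x in lborel. x \<in> {0<..<T} \<longrightarrow> F x = h x"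
  shows "(\<integral>t. \<eta> t * h t \<partial>lebesgue_on {0<..<T}) = (\<integral>t. \<eta> t * F t \<partial>lborel)"
proof (rule lebesgue_on_integral_eq(1))
  show "(\<lambda>x. \<eta> x * F x) \<in> borel_measurable borel" using F test_function_integrable(3)[OF \<eta> T] by simp
  show "AE x in lborel. indicator {0<..<T} x * (\<eta> x * h x) = \<eta> x * F x"
    using ae
  proof eventually_elim
    case (elim x)
    then show ?case using test_function_outside[OF \<eta> T, of x] by (cases "x \<in> {0<..<T}") auto
  qed
qed simp

lemma initial_value_bound_real:
  assumes T: "0 < T" and F1: "integrable lborel F1" and Fm: "F \<in> borel_measurable borel" and z: "\<And>x. x \<notin> {0<..<T} \<Longrightarrow> F1 x = 0"
    and r: "AE x in lborel. x \<in> {0<..<T} \<longrightarrow> F x = c + primitive F1 x"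
    and n: "(\<integral>\<^sup>+x. ennreal ((F x)\<^sup>2) \<partial>lborel) = ennreal n0" "(\<integral>\<^sup>+x. ennreal ((F1 x)\<^sup>2) \<partial>lborel) = ennreal n1" "0 \<le> n0" "0 \<le> n1"
  shows "c\<^sup>2 \<le> 2 / T * n0 + 2 * T * n1"
proof -
  have "ennreal (T * c\<^sup>2) \<le> 2 * ennreal n0 + ennreal (2 * T\<^sup>2) * ennreal n1"
    using initial_value_bound[OF T F1 Fm z r] n by simp
  also have "\<dots> = ennreal (2 * n0 + 2 * T\<^sup>2 * n1)"
    using n(3,4) by (simp add: ennreal_mult ennreal_plus)
  finally have "T * c\<^sup>2 \<le> 2 * n0 + 2 * T\<^sup>2 * n1" using n(3,4) by (subst (asm) ennreal_le_iff) auto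
  then have "c\<^sup>2 \<le> (2 * n0 + 2 * T\<^sup>2 * n1) / T" using T by (simp add: field_simps)
  also have "\<dots> = 2 / T * n0 + 2 * T * n1" using T by (simp add: field_simps power2_eq_square)
  finally show ?thesis .
qed

section \<open>The forcing term of a mode\<close>

text \<open>The second derivative \<open>F2\<close> and the two initial values \<open>c0\<close>, \<open>c1\<close> of the forcing in mode \<open>k\<close>, with
  their bounds and with the resulting form of Duhamel's integral. The parameters \<open>\<gamma>\<close> and \<open>\<mu>\<close> of the kernel are
  universal because the data depend on \<open>f\<close> alone.\<close>

definition forcing_data ::
  "real \<Rightarrow> (real \<Rightarrow> nat \<Rightarrow> real) \<Rightarrow> (real \<Rightarrow> nat \<Rightarrow> real) \<Rightarrow> (real \<Rightarrow> nat \<Rightarrow> real) \<Rightarrow> nat \<Rightarrow>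
    real \<Rightarrow> real \<Rightarrow> (real \<Rightarrow> real) \<Rightarrow> bool" where
  "forcing_data T f f1 f2 k c0 c1 F2 \<longleftrightarrow>
    F2 \<in> borel_measurable borel \<and> integrable lborel F2 \<and> (\<forall>x\<le>0. F2 x = 0) \<and>
    (\<integral>\<^sup>+x. ennreal ((F2 x)\<^sup>2) \<partial>lborel) = ennreal (energy T f2 k) \<and>
    c0\<^sup>2 \<le> 2 / T * energy T f k + 2 * T * energy T f1 k \<and> c1\<^sup>2 \<le> 2 / T * energy T f1 k + 2 * T * energy T f2 k \<and>
    (\<forall>\<gamma> \<mu> t. 1 < \<gamma> \<and> \<gamma> < 2 \<and> 0 \<le> \<mu> \<and> 0 < t \<and> t < T \<longrightarrow>
      (\<integral>r. (t - r) powr (\<gamma> - 1) * mittag_leffler \<gamma> \<gamma> (- (\<mu> * (t - r) powr \<gamma>)) * f r k \<partial>lebesgue_on {0<..<t})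
       = c0 * ml_fun \<gamma> \<mu> (\<gamma> + 1) t + c1 * ml_fun \<gamma> \<mu> (\<gamma> + 2) t + convolution (cut_ml \<gamma> \<mu> T (\<gamma> + 2)) F2 t)"

text \<open>The hypotheses give the first and second weak derivatives of \<open>f\<close> separately. Testing with the
  derivative of a test function shows that the second is also the weak derivative of the first, and two
  steps of Duhamel's integral apply.\<close>

lemma mode_forcing:
  assumes T: "0 < T" and lam: "\<And>k. 0 < lam k" and f: "H2_time T lam r f f1 f2"
  shows "\<exists>c0 c1 F2. forcing_data T f f1 f2 k c0 c1 F2"
proof -
  have fL: "f \<in> L2_time T lam r" "f1 \<in> L2_time T lam r" "f2 \<in> L2_time T lam r"
    and d1: "has_time_derivative T lam r 1 f f1" and d2: "has_time_derivative T lam r 2 f f2"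
    using f by (auto simp: H2_time_def)
  obtain F where F: "F \<in> borel_measurable borel" "integrable lborel F" "\<And>x. x \<notin> {0<..<T} \<Longrightarrow> F x = 0"
    "AE x in lborel. x \<in> {0<..<T} \<longrightarrow> F x = f x k" "(\<integral>\<^sup>+x. ennreal ((F x)\<^sup>2) \<partial>lborel) = ennreal (energy T f k)"
    using L2_time_representative[OF T lam fL(1), of k] by blast
  obtain F1 where F1: "F1 \<in> borel_measurable borel" "integrable lborel F1" "\<And>x. x \<notin> {0<..<T} \<Longrightarrow> F1 x = 0"
    "AE x in lborel. x \<in> {0<..<T} \<longrightarrow> F1 x = f1 x k" "(\<integral>\<^sup>+x. ennreal ((F1 x)\<^sup>2) \<partial>lborel) = ennreal (energy T f1 k)"
    using L2_time_representative[OF T lam fL(2), of k] by blast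
  obtain F2 where F2: "F2 \<in> borel_measurable borel" "integrable lborel F2" "\<And>x. x \<notin> {0<..<T} \<Longrightarrow> F2 x = 0"
    "AE x in lborel. x \<in> {0<..<T} \<longrightarrow> F2 x = f2 x k" "(\<integral>\<^sup>+x. ennreal ((F2 x)\<^sup>2) \<partial>lborel) = ennreal (energy T f2 k)"
    using L2_time_representative[OF T lam fL(3), of k] by blast
  have w1: "(\<integral>x. deriv \<eta> x * F x \<partial>lborel) = - (\<integral>x. \<eta> x * F1 x \<partial>lborel)" if \<eta>: "\<eta> \<in> test_functions {0<..<T}" for \<eta>
  proof -
    have d: "deriv \<eta> \<in> test_functions {0<..<T}" by (rule test_function_deriv(1)[OF \<eta> T])
    have "(\<integral>t. (deriv ^^ 1) \<eta> t * f t k \<partial>lebesgue_on {0<..<T}) = (- 1) ^ 1 * (\<integral>t. \<eta> t * f1 t k \<partial>lebesgue_on {0<..<T})"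
      using d1 \<eta> unfolding has_time_derivative_def by blast
    then show ?thesis
      using test_integral_transfer[OF T d F(1,4)] test_integral_transfer[OF T \<eta> F1(1,4)] by simp
  qed
  have w2: "(\<integral>x. deriv \<eta> x * F1 x \<partial>lborel) = - (\<integral>x. \<eta> x * F2 x \<partial>lborel)" if \<eta>: "\<eta> \<in> test_functions {0<..<T}" for \<eta>
  proof -
    have d: "deriv \<eta> \<in> test_functions {0<..<T}" by (rule test_function_deriv(1)[OF \<eta> T])
    have dd: "deriv (deriv \<eta>) \<in> test_functions {0<..<T}" by (rule test_function_deriv(1)[OF d T])
    have "(\<integral>t. (deriv ^^ 2) \<eta> t * f t k \<partial>lebesgue_on {0<..<T}) = (- 1) ^ 2 * (\<integral>t. \<eta> t * f2 t k \<partial>lebesgue_on {0<..<T})"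
      using d2 \<eta> unfolding has_time_derivative_def by blast
    then have "(\<integral>x. deriv (deriv \<eta>) x * F x \<partial>lborel) = (\<integral>x. \<eta> x * F2 x \<partial>lborel)"
      using test_integral_transfer[OF T dd F(1,4)] test_integral_transfer[OF T \<eta> F2(1,4)] by (simp add: numeral_2_eq_2)
    then show ?thesis using w1[OF d] by simp
  qed
  obtain c0 where c0: "AE x in lborel. x \<in> {0<..<T} \<longrightarrow> F x = c0 + primitive F1 x"
    using weak_derivative_representation[OF T F(2) F1(2) w1] by blast
  obtain c1 where c1: "AE x in lborel. x \<in> {0<..<T} \<longrightarrow> F1 x = c1 + primitive F2 x"
    using weak_derivative_representation[OF T F1(2) F2(2) w2] by blast
  show ?thesis
    unfolding forcing_data_def
  proof (rule exI[of _ c0], rule exI[of _ c1], rule exI[of _ F2], intro conjI allI impI)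
    show "F2 x = 0" if "x \<le> 0" for x using F2(3)[of x] that by simp
    show "c0\<^sup>2 \<le> 2 / T * energy T f k + 2 * T * energy T f1 k"
      by (rule initial_value_bound_real[OF T F1(2) F(1) F1(3) c0 F(5) F1(5)]) (auto simp: energy_nonneg)
    show "c1\<^sup>2 \<le> 2 / T * energy T f1 k + 2 * T * energy T f2 k"
      by (rule initial_value_bound_real[OF T F2(2) F1(1) F2(3) c1 F1(5) F2(5)]) (auto simp: energy_nonneg)
    fix \<gamma> \<mu> t :: real assume a: "1 < \<gamma> \<and> \<gamma> < 2 \<and> 0 \<le> \<mu> \<and> 0 < t \<and> t < T"
    then have g: "1 < \<gamma>" "\<gamma> < 2" "0 \<le> \<mu>" "0 < t" "t < T" "\<gamma> > 0" "\<gamma> + 1 > 0" by auto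
    have kt: "cut_ml \<gamma> \<mu> T \<beta> t = ml_fun \<gamma> \<mu> \<beta> t" for \<beta> using g by (simp add: cut_ml_def)
    have [measurable]: "cut_ml \<gamma> \<mu> T \<gamma> \<in> borel_measurable borel" "F \<in> borel_measurable borel" using cut_ml_measurable g F by auto
    have "(\<integral>r. (t - r) powr (\<gamma> - 1) * mittag_leffler \<gamma> \<gamma> (- (\<mu> * (t - r) powr \<gamma>)) * f r k \<partial>lebesgue_on {0<..<t})
      = (\<integral>r. cut_ml \<gamma> \<mu> T \<gamma> (t - r) * F r \<partial>lborel)"
    proof (rule lebesgue_on_integral_eq(1))
      show "AE r in lborel. indicator {0<..<t} r * ((t - r) powr (\<gamma> - 1) * mittag_leffler \<gamma> \<gamma> (- (\<mu> * (t - r) powr \<gamma>)) * f r k)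
         = cut_ml \<gamma> \<mu> T \<gamma> (t - r) * F r"
        using F(4)
      proof eventually_elim
        case (elim r)
        show ?case
        proof (cases "r \<in> {0<..<t}")
          case True
          then show ?thesis using elim g by (simp add: cut_ml_def ml_fun_def)
        next
          case False
          then show ?thesis using F(3)[of r] g by (cases "r \<le> 0") (auto simp: cut_ml_def)
        qed
      qed
    qed measurable
    also have "\<dots> = convolution (cut_ml \<gamma> \<mu> T \<gamma>) F t" by (simp add: convolution_def)
    also have "\<dots> = c0 * cut_ml \<gamma> \<mu> T (\<gamma> + 1) t + convolution (cut_ml \<gamma> \<mu> T (\<gamma> + 1)) F1 t"
      by (rule duhamel_step[OF g(1,2,6) T g(3,5) F(1,3) F1(2) _ c0]) (use F1(3) in auto)
    also have "convolution (cut_ml \<gamma> \<mu> T (\<gamma> + 1)) F1 t = c1 * cut_ml \<gamma> \<mu> T (\<gamma> + 1 + 1) t + convolution (cut_ml \<gamma> \<mu> T (\<gamma> + 1 + 1)) F2 t"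
      by (rule duhamel_step[OF g(1,2,7) T g(3,5) F1(1,3) F2(2) _ c1]) (use F2(3) in auto)
    also have "\<gamma> + 1 + 1 = \<gamma> + 2" by simp
    finally show "(\<integral>r. (t - r) powr (\<gamma> - 1) * mittag_leffler \<gamma> \<gamma> (- (\<mu> * (t - r) powr \<gamma>)) * f r k \<partial>lebesgue_on {0<..<t})
       = c0 * ml_fun \<gamma> \<mu> (\<gamma> + 1) t + c1 * ml_fun \<gamma> \<mu> (\<gamma> + 2) t + convolution (cut_ml \<gamma> \<mu> T (\<gamma> + 2)) F2 t"
      by (simp add: kt)
  qed (use F2 in auto)
qed

section \<open>Summation over the modes\<close>

lemma weighted_mode_bound:
  fixes L :: "real \<Rightarrow> real"
  assumes L: "L \<in> borel_measurable borel" and w: "0 \<le> w" and p: "p = 2 * q"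
    and B: "(\<integral>\<^sup>+t. ennreal (indicator {0<..<T} t * (t powr p * (L t)\<^sup>2)) \<partial>lborel) \<le> ennreal X" and X: "0 \<le> X"
  shows "(\<integral>\<^sup>+t. ennreal (w * (t powr q * L t)\<^sup>2) \<partial>lebesgue_on {0<..<T}) \<le> ennreal (w * X)"
proof -
  note [measurable] = L
  have "(\<integral>\<^sup>+t. ennreal (w * (t powr q * L t)\<^sup>2) \<partial>lebesgue_on {0<..<T}) =
    (\<integral>\<^sup>+t. ennreal (w * (indicator {0<..<T} t * (t powr p * (L t)\<^sup>2))) \<partial>lborel)"
  proof (rule lebesgue_on_integral_eq(3))
    have "(t powr q * L t)\<^sup>2 = t powr p * (L t)\<^sup>2" for t
    proof -
      have "p = q + q" using p by simp
      then have "t powr p = t powr q * t powr q" by (simp only: powr_add)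
      then show ?thesis by (simp add: power2_eq_square)
    qed
    then show "AE t in lborel. indicator {0<..<T} t * (w * (t powr q * L t)\<^sup>2) = w * (indicator {0<..<T} t * (t powr p * (L t)\<^sup>2))"
      by simp
  qed (use w in auto)
  also have "\<dots> = ennreal w * (\<integral>\<^sup>+t. ennreal (indicator {0<..<T} t * (t powr p * (L t)\<^sup>2)) \<partial>lborel)"
    using w by (subst nn_integral_cmult[symmetric]) (auto simp: ennreal_mult)
  also have "\<dots> \<le> ennreal w * ennreal X" by (intro mult_left_mono B) simp
  also have "\<dots> = ennreal (w * X)" using w X by (simp add: ennreal_mult)
  finally show ?thesis .
qed

text \<open>The estimate for fixed \<open>\<gamma>\<close> and \<open>\<rho>\<close>, from a positive lower bound of the eigenvalues. The derivative at
  height \<open>y\<close> is the derivative at the bottom with the coefficients multiplied by \<open>\<psi> k y\<close>.\<close>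

lemma third_derivative_estimate:
  fixes \<Omega> :: "(real^'n) set"
  assumes basis: "L2_orthonormal_basis \<Omega> \<phi>" and lam: "\<And>k. l0 \<le> lam k" and l0: "0 < l0"
    and s: "0 < s" and T: "0 < T" and prof: "\<And>k. extension_profile (1 - 2 * s) (lam k) (\<psi> k)"
    and g: "1 < \<gamma>" "\<gamma> < 2" and \<rho>: "5 - 2 * \<gamma> < \<rho>"
  shows "\<exists>C\<ge>0. \<forall>g h f f1 f2 U. g \<in> L2 \<Omega> \<and> eig_coeffs \<Omega> \<phi> g \<in> Hspace lam s \<and> h \<in> L2 \<Omega> \<and>
       H2_time T lam (- s) f f1 f2 \<and> extended_solution \<Omega> lam \<phi> \<psi> s T \<gamma> g h f U \<longrightarrow>
       (\<exists>v. trace_of_time_derivative \<Omega> lam \<phi> T (- s) 3 U v \<and>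
          (\<lambda>t k. t powr (\<rho> / 2) * v t k) \<in> L2_time T lam (- s) \<and>
          L2_time_norm T lam (- s) (\<lambda>t k. t powr (\<rho> / 2) * v t k)
            \<le> C * (Hnorm lam s (eig_coeffs \<Omega> \<phi> g) + L2_norm \<Omega> h + H2_time_norm T lam (- s) f f1 f2))"
proof -
  have lp: "0 < lam k" for k using lam[of k] l0 by simp
  obtain C1 where C1: "C1 \<ge> 0" "\<And>\<mu> g h c0 c1 F2. \<mu> \<ge> 0 \<Longrightarrow> F2 \<in> borel_measurable borel \<Longrightarrow>
    (\<integral>\<^sup>+t. ennreal (indicator {0<..<T} t * (t powr \<rho> * (mode_deriv \<gamma> \<mu> T g h c0 c1 F2 3 t)\<^sup>2)) \<partial>lborel) \<le>
      ennreal C1 * (ennreal (\<mu>\<^sup>2 * g\<^sup>2 + \<mu> * h\<^sup>2 + c0\<^sup>2 + c1\<^sup>2) + (\<integral>\<^sup>+t. ennreal ((F2 t)\<^sup>2) \<partial>lborel))"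
    using mode_deriv3_bound[OF g T \<rho>] by blast
  obtain C0 where C0: "C0 \<ge> 0" "\<And>\<mu> g h c0 c1 F2. \<mu> \<ge> 0 \<Longrightarrow> F2 \<in> borel_measurable borel \<Longrightarrow>
    (\<integral>\<^sup>+t. ennreal (indicator {0<..<T} t * (mode_deriv \<gamma> \<mu> T g h c0 c1 F2 0 t)\<^sup>2) \<partial>lborel) \<le>
      ennreal C0 * (ennreal (g\<^sup>2 + h\<^sup>2 + c0\<^sup>2 + c1\<^sup>2) + (\<integral>\<^sup>+t. ennreal ((F2 t)\<^sup>2) \<partial>lborel))"
    using mode_deriv0_bound[OF g T] by blast
  define m0 where "m0 = l0 powr s"
  have m0: "m0 > 0" using l0 by (simp add: m0_def)
  define C2 where "C2 = 1 + 2 * T + 2 / T"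
  have C2: "C2 \<ge> 1" using T by (simp add: C2_def)
  define C3 where "C3 = 1 / m0\<^sup>2 + 1 / m0 + C2"
  have C3: "C3 \<ge> 0" using m0 C2 by (simp add: C3_def)
  have \<rho>0: "\<rho> \<ge> 0" using \<rho> g by simp
  have \<gamma>0: "\<gamma> > 0" using g by simp
  show ?thesis
  proof (intro exI[of _ "sqrt (C1 * C2)"] conjI allI impI)
    show "0 \<le> sqrt (C1 * C2)" using C1(1) C2 by simp
    fix gg h :: "real^'n \<Rightarrow> real" and f f1 f2 U
    assume asm: "gg \<in> L2 \<Omega> \<and> eig_coeffs \<Omega> \<phi> gg \<in> Hspace lam s \<and> h \<in> L2 \<Omega> \<and>
       H2_time T lam (- s) f f1 f2 \<and> extended_solution \<Omega> lam \<phi> \<psi> s T \<gamma> gg h f U"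
    define a where "a = eig_coeffs \<Omega> \<phi> gg"
    define b where "b = eig_coeffs \<Omega> \<phi> h"
    define \<mu> where "\<mu> = (\<lambda>k. lam k powr s)"
    define n0 where "n0 = energy T f"
    define n1 where "n1 = energy T f1"
    define n2 where "n2 = energy T f2"
    have nn: "n0 k \<ge> 0" "n1 k \<ge> 0" "n2 k \<ge> 0" for k by (simp_all add: n0_def n1_def n2_def energy_nonneg)
    have \<mu>: "\<mu> k \<ge> m0" "\<mu> k > 0" "\<mu> k \<ge> 0" for k
      using lam[of k] l0 s lp[of k] by (auto simp: \<mu>_def m0_def intro: powr_mono2)
    have om: "lam k powr (- s) = 1 / \<mu> k" for k by (simp add: \<mu>_def powr_minus_divide)
    have fL: "f \<in> L2_time T lam (- s)" "f1 \<in> L2_time T lam (- s)" "f2 \<in> L2_time T lam (- s)"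
      using asm by (auto simp: H2_time_def)
    have H2: "H2_time T lam (- s) f f1 f2" using asm by blast
    obtain c0 c1 F2 where fd: "\<And>k. forcing_data T f f1 f2 k (c0 k) (c1 k) (F2 k)"
      using mode_forcing[OF T lp H2] by metis
    have P: "F2 k \<in> borel_measurable borel" "integrable lborel (F2 k)" "x \<le> 0 \<Longrightarrow> F2 k x = 0"
      "(\<integral>\<^sup>+x. ennreal ((F2 k x)\<^sup>2) \<partial>lborel) = ennreal (n2 k)"
      "(c0 k)\<^sup>2 \<le> 2 / T * n0 k + 2 * T * n1 k" "(c1 k)\<^sup>2 \<le> 2 / T * n1 k + 2 * T * n2 k" for k x
      using fd[of k] by (simp_all add: forcing_data_def n0_def n1_def n2_def)
    have duhamel: "(\<integral>r. (t - r) powr (\<gamma> - 1) * mittag_leffler \<gamma> \<gamma> (- (\<mu> k * (t - r) powr \<gamma>)) * f r k \<partial>lebesgue_on {0<..<t})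
       = c0 k * ml_fun \<gamma> (\<mu> k) (\<gamma> + 1) t + c1 k * ml_fun \<gamma> (\<mu> k) (\<gamma> + 2) t + convolution (cut_ml \<gamma> (\<mu> k) T (\<gamma> + 2)) (F2 k) t"
      if "0 < t" "t < T" for k t
      using fd[of k] g \<mu>(3)[of k] that by (simp add: forcing_data_def)
    define L where "L = (\<lambda>n k. mode_deriv \<gamma> (\<mu> k) T (a k) (b k) (c0 k) (c1 k) (F2 k) n)"
    have Lm[measurable]: "L n k \<in> borel_measurable borel" for n k
      unfolding L_def by (rule mode_deriv_measurable[OF \<gamma>0 P(1)])
    have mode: "mode_solution s \<gamma> (lam k) (a k) (b k) (\<lambda>r. f r k) t = L 0 k t" if t: "0 < t" "t < T" for k t
      using duhamel[OF t, of k] t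
      by (simp add: mode_solution_def L_def mode_deriv_def ml_fun_def \<mu>_def)
    have coef: "eig_coeffs \<Omega> \<phi> (\<lambda>x. U x y t) k = L 0 k t * \<psi> k y" if t: "0 < t" "t < T" and y: "y > 0" for k t y
    proof -
      have ex: "(\<lambda>x. U x y t) \<in> L2 \<Omega>" "(\<lambda>N. L2_norm \<Omega> (\<lambda>x. U x y t -
           (\<Sum>k<N. mode_solution s \<gamma> (lam k) (a k) (b k) (\<lambda>r. f r k) t * \<phi> k x * \<psi> k y))) \<longlonglongrightarrow> 0"
        using asm t y unfolding extended_solution_def a_def b_def by auto
      have "(\<lambda>N. L2_norm \<Omega> (\<lambda>x. U x y t - (\<Sum>k<N. (L 0 k t * \<psi> k y) * \<phi> k x))) \<longlonglongrightarrow> 0"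
        using ex(2) unfolding mode[OF t] by (simp add: mult_ac)
      from expansion_coefficient[OF basis ex(1) this] show ?thesis by (simp add: eig_coeffs_def)
    qed
    \<comment> \<open>The contribution of mode \<open>k\<close> to the squared norms of the data.\<close>
    define D where "D = (\<lambda>k. \<mu> k * (a k)\<^sup>2 + (b k)\<^sup>2 + (1 / \<mu> k * n0 k + 1 / \<mu> k * n1 k + 1 / \<mu> k * n2 k))"
    have D0: "D k \<ge> 0" for k using nn[of k] \<mu>[of k] by (simp add: D_def)
    define A2 where "A2 = (Hnorm lam s a)\<^sup>2"
    define B2 where "B2 = (L2_norm \<Omega> h)\<^sup>2"
    define E2 where "E2 = (H2_time_norm T lam (- s) f f1 f2)\<^sup>2"
    have aH: "a \<in> Hspace lam s" using asm by (simp add: a_def)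
    have s1: "(\<lambda>k. \<mu> k * (a k)\<^sup>2) sums A2"
      using aH unfolding A2_def Hnorm_sq[OF aH] by (simp add: Hspace_def \<mu>_def summable_sums)
    have bess: "(\<Sum>k<N. (b k)\<^sup>2) \<le> B2" for N
      using bessel[OF basis, of h N] asm by (simp add: b_def eig_coeffs_def B2_def)
    have s2: "summable (\<lambda>k. (b k)\<^sup>2)" by (rule summableI_nonneg_bounded[OF _ bess]) simp
    have s2': "(\<Sum>k. (b k)\<^sup>2) \<le> B2" by (rule suminf_le_const[OF s2 bess])
    have s3: "(\<lambda>k. 1 / \<mu> k * n0 k + 1 / \<mu> k * n1 k + 1 / \<mu> k * n2 k) sums E2"
    proof -
      have "E2 = (L2_time_norm T lam (- s) f)\<^sup>2 + (L2_time_norm T lam (- s) f1)\<^sup>2 + (L2_time_norm T lam (- s) f2)\<^sup>2"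
        by (simp add: E2_def H2_time_norm_def)
      then show ?thesis
        using L2_time_energy(2)[OF lp fL(1)] L2_time_energy(2)[OF lp fL(2)] L2_time_energy(2)[OF lp fL(3)]
        unfolding om n0_def n1_def n2_def by (auto intro!: sums_add)
    qed
    have Dsum: "summable D" "suminf D \<le> A2 + B2 + E2"
    proof -
      have "D sums (A2 + (\<Sum>k. (b k)\<^sup>2) + E2)" unfolding D_def by (intro sums_add s1 s3 summable_sums[OF s2])
      then show "summable D" "suminf D \<le> A2 + B2 + E2" using s2' by (auto simp: sums_iff)
    qed
    have cc: "(c0 k)\<^sup>2 + (c1 k)\<^sup>2 + n2 k \<le> C2 * (n0 k + n1 k + n2 k)" for k
    proof -
      have "(c0 k)\<^sup>2 + (c1 k)\<^sup>2 + n2 k \<le> (2 / T * n0 k + 2 * T * n1 k) + (2 / T * n1 k + 2 * T * n2 k) + n2 k"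
        using P(5)[of k] P(6)[of k] by simp
      also have "\<dots> \<le> C2 * (n0 k + n1 k + n2 k)"
      proof -
        have "C2 * (n0 k + n1 k + n2 k) - ((2 / T * n0 k + 2 * T * n1 k) + (2 / T * n1 k + 2 * T * n2 k) + n2 k) =
          (1 + 2 * T) * n0 k + n1 k + 2 / T * n2 k"
          by (simp add: C2_def algebra_simps add_divide_distrib)
        also have "\<dots> \<ge> 0" using nn[of k] T by simp
        finally show ?thesis by simp
      qed
      finally show ?thesis .
    qed
    have b3: "(\<integral>\<^sup>+t. ennreal (lam k powr (- s) * (t powr (\<rho> / 2) * L 3 k t)\<^sup>2) \<partial>lebesgue_on {0<..<T}) \<le> ennreal (C1 * C2 * D k)" for k
    proof -
      let ?Q = "(\<mu> k)\<^sup>2 * (a k)\<^sup>2 + \<mu> k * (b k)\<^sup>2 + (c0 k)\<^sup>2 + (c1 k)\<^sup>2"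
      have Q0: "?Q \<ge> 0" using \<mu>[of k] by (intro add_nonneg_nonneg) auto
      have "(\<integral>\<^sup>+t. ennreal (indicator {0<..<T} t * (t powr \<rho> * (L 3 k t)\<^sup>2)) \<partial>lborel) \<le> ennreal C1 * (ennreal ?Q + ennreal (n2 k))"
        using C1(2)[OF \<mu>(3) P(1), of k "a k" "b k" "c0 k" "c1 k" k] P(4)[of k] by (simp add: L_def)
      also have "\<dots> = ennreal (C1 * (?Q + n2 k))" by (simp only: ennreal_plus[OF Q0 nn(3)[of k], symmetric] ennreal_mult[OF C1(1) add_nonneg_nonneg[OF Q0 nn(3)[of k]], symmetric])
      finally have i: "(\<integral>\<^sup>+t. ennreal (indicator {0<..<T} t * (t powr \<rho> * (L 3 k t)\<^sup>2)) \<partial>lborel) \<le> ennreal (C1 * (?Q + n2 k))" .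
      have "(\<integral>\<^sup>+t. ennreal (lam k powr (- s) * (t powr (\<rho> / 2) * L 3 k t)\<^sup>2) \<partial>lebesgue_on {0<..<T}) \<le> ennreal (lam k powr (- s) * (C1 * (?Q + n2 k)))"
        by (rule weighted_mode_bound[OF Lm _ _ i]) (use C1(1) Q0 nn[of k] in auto)
      also have "lam k powr (- s) * (C1 * (?Q + n2 k)) \<le> C1 * C2 * D k"
      proof -
        have "1 / \<mu> k * (?Q + n2 k) = \<mu> k * (a k)\<^sup>2 + (b k)\<^sup>2 + 1 / \<mu> k * ((c0 k)\<^sup>2 + (c1 k)\<^sup>2 + n2 k)"
          using \<mu>(2)[of k] by (simp add: field_simps power2_eq_square)
        also have "\<dots> \<le> C2 * (\<mu> k * (a k)\<^sup>2) + C2 * (b k)\<^sup>2 + 1 / \<mu> k * (C2 * (n0 k + n1 k + n2 k))"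
          using C2 cc[of k] \<mu>(2,3)[of k] mult_right_mono[OF C2, of "\<mu> k * (a k)\<^sup>2"] mult_right_mono[OF C2, of "(b k)\<^sup>2"]
          by (intro add_mono mult_left_mono) auto
        also have "\<dots> = C2 * D k" by (simp add: D_def algebra_simps)
        finally have "C1 * (1 / \<mu> k * (?Q + n2 k)) \<le> C1 * (C2 * D k)" using C1(1) by (rule mult_left_mono)
        then show ?thesis unfolding om by (simp add: mult_ac)
      qed
      finally show ?thesis by (simp add: ennreal_leI)
    qed
    have b0: "(\<integral>\<^sup>+t. ennreal (lam k powr (- s) * (t powr (0 / 2) * L 0 k t)\<^sup>2) \<partial>lebesgue_on {0<..<T}) \<le> ennreal (C0 * C3 * D k)" for k
    proof -
      let ?Q = "(a k)\<^sup>2 + (b k)\<^sup>2 + (c0 k)\<^sup>2 + (c1 k)\<^sup>2"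
      have Q0: "?Q \<ge> 0" by (intro add_nonneg_nonneg) auto
      have "(\<integral>\<^sup>+t. ennreal (indicator {0<..<T} t * (t powr 0 * (L 0 k t)\<^sup>2)) \<partial>lborel) = (\<integral>\<^sup>+t. ennreal (indicator {0<..<T} t * (L 0 k t)\<^sup>2) \<partial>lborel)"
        by (intro nn_integral_cong) (simp add: indicator_def)
      also have "\<dots> \<le> ennreal C0 * (ennreal ?Q + ennreal (n2 k))"
        using C0(2)[OF \<mu>(3) P(1), of k "a k" "b k" "c0 k" "c1 k" k] P(4)[of k] by (simp add: L_def)
      also have "\<dots> = ennreal (C0 * (?Q + n2 k))" by (simp only: ennreal_plus[OF Q0 nn(3)[of k], symmetric] ennreal_mult[OF C0(1) add_nonneg_nonneg[OF Q0 nn(3)[of k]], symmetric])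
      finally have i: "(\<integral>\<^sup>+t. ennreal (indicator {0<..<T} t * (t powr 0 * (L 0 k t)\<^sup>2)) \<partial>lborel) \<le> ennreal (C0 * (?Q + n2 k))" .
      have "(\<integral>\<^sup>+t. ennreal (lam k powr (- s) * (t powr (0 / 2) * L 0 k t)\<^sup>2) \<partial>lebesgue_on {0<..<T}) \<le> ennreal (lam k powr (- s) * (C0 * (?Q + n2 k)))"
        by (rule weighted_mode_bound[OF Lm _ _ i]) (use C0(1) Q0 nn[of k] in auto)
      also have "lam k powr (- s) * (C0 * (?Q + n2 k)) \<le> C0 * C3 * D k"
      proof -
        have m2: "m0\<^sup>2 \<le> (\<mu> k)\<^sup>2" using \<mu>(1)[of k] m0 by (intro power_mono) auto
        have "1 / \<mu> k = \<mu> k / (\<mu> k)\<^sup>2" using \<mu>(2)[of k] by (simp add: power2_eq_square)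
        also have "\<dots> \<le> \<mu> k / m0\<^sup>2" using m2 m0 \<mu>(2)[of k] by (intro divide_left_mono) auto
        finally have i1: "1 / \<mu> k \<le> 1 / m0\<^sup>2 * \<mu> k" by simp
        have i2: "1 / \<mu> k \<le> 1 / m0" using \<mu>(1,2)[of k] m0 by (intro divide_left_mono) auto
        have "1 / \<mu> k * (?Q + n2 k) = 1 / \<mu> k * (a k)\<^sup>2 + 1 / \<mu> k * (b k)\<^sup>2 + 1 / \<mu> k * ((c0 k)\<^sup>2 + (c1 k)\<^sup>2 + n2 k)"
          by (simp add: add_divide_distrib)
        also have "\<dots> \<le> (1 / m0\<^sup>2 * \<mu> k) * (a k)\<^sup>2 + 1 / m0 * (b k)\<^sup>2 + 1 / \<mu> k * (C2 * (n0 k + n1 k + n2 k))"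
          using i1 i2 cc[of k] \<mu>(2)[of k] by (intro add_mono mult_right_mono mult_left_mono) auto
        also have "\<dots> \<le> C3 * (\<mu> k * (a k)\<^sup>2) + C3 * (b k)\<^sup>2 + C3 * (1 / \<mu> k * (n0 k + n1 k + n2 k))"
        proof -
          have c3: "1 / m0\<^sup>2 \<le> C3" "1 / m0 \<le> C3" "C2 \<le> C3" using m0 C2 by (auto simp: C3_def)
          have x0: "0 \<le> \<mu> k * (a k)\<^sup>2" "0 \<le> 1 / \<mu> k * (n0 k + n1 k + n2 k)" using \<mu>(2)[of k] nn[of k] by auto
          show ?thesis
            using mult_right_mono[OF c3(1) x0(1)] mult_right_mono[OF c3(2), of "(b k)\<^sup>2"] mult_right_mono[OF c3(3) x0(2)]
            by (simp add: mult_ac)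
        qed
        also have "\<dots> = C3 * D k" by (simp add: D_def algebra_simps)
        finally have "C0 * (1 / \<mu> k * (?Q + n2 k)) \<le> C0 * (C3 * D k)" using C0(1) by (rule mult_left_mono)
        then show ?thesis unfolding om by (simp add: mult_ac)
      qed
      finally show ?thesis by (simp add: ennreal_leI)
    qed
    have Dens: "(\<Sum>k. ennreal (c * D k)) \<le> ennreal (c * (A2 + B2 + E2))" if c: "c \<ge> 0" for c
    proof -
      have "(\<Sum>k. ennreal (c * D k)) = ennreal (\<Sum>k. c * D k)"
        using c D0 Dsum(1) by (intro suminf_ennreal2 summable_mult) auto
      also have "(\<Sum>k. c * D k) = c * suminf D" by (rule suminf_mult[OF Dsum(1)])
      also have "ennreal (c * suminf D) \<le> ennreal (c * (A2 + B2 + E2))" using c Dsum(2) by (intro ennreal_leI mult_left_mono)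
      finally show ?thesis .
    qed
    have sum0: "0 \<le> A2 + B2 + E2" by (simp add: A2_def B2_def E2_def)
    have psi: "\<bar>\<psi> k y\<bar> \<le> 1" if "y > 0" for k y
      using extension_profile_range[OF prof lp that, of k] by simp
    have Llm: "(\<lambda>t. L n k t) \<in> borel_measurable (lebesgue_on {0<..<T})" for n k
      using Lm[of n k] by (intro measurable_restrict_space1 measurable_completion) simp
    define v where "v = (\<lambda>t k. L 3 k t)"
    define W where "W = (\<lambda>y t k. L 3 k t * \<psi> k y)"
    have total3: "(\<Sum>k. \<integral>\<^sup>+t. ennreal (lam k powr (- s) * (t powr (\<rho> / 2) * v t k)\<^sup>2) \<partial>lebesgue_on {0<..<T}) \<le> ennreal (C1 * C2 * (A2 + B2 + E2))"
    proof -
      have "(\<Sum>k. \<integral>\<^sup>+t. ennreal (lam k powr (- s) * (t powr (\<rho> / 2) * v t k)\<^sup>2) \<partial>lebesgue_on {0<..<T}) \<le> (\<Sum>k. ennreal (C1 * C2 * D k))"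
        unfolding v_def by (intro suminf_le b3) auto
      also have "\<dots> \<le> ennreal (C1 * C2 * (A2 + B2 + E2))" using C1(1) C2 by (intro Dens) auto
      finally show ?thesis .
    qed
    have total3': "(\<Sum>k. \<integral>\<^sup>+t. ennreal (lam k powr (- s) * (t powr (\<rho> / 2) * W y t k)\<^sup>2) \<partial>lebesgue_on {0<..<T}) \<le> ennreal (C1 * C2 * (A2 + B2 + E2))"
      if y: "y > 0" for y
    proof (rule order_trans[OF suminf_le total3])
      fix k
      show "(\<integral>\<^sup>+t. ennreal (lam k powr (- s) * (t powr (\<rho> / 2) * W y t k)\<^sup>2) \<partial>lebesgue_on {0<..<T}) \<le>
        (\<integral>\<^sup>+t. ennreal (lam k powr (- s) * (t powr (\<rho> / 2) * v t k)\<^sup>2) \<partial>lebesgue_on {0<..<T})"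
      proof (intro nn_integral_mono ennreal_leI mult_left_mono)
        fix t
        have "\<bar>L 3 k t * \<psi> k y\<bar> \<le> \<bar>L 3 k t\<bar>" using psi[OF y, of k] by (simp add: abs_mult mult_left_le)
        then have "\<bar>t powr (\<rho> / 2) * W y t k\<bar> \<le> \<bar>t powr (\<rho> / 2) * v t k\<bar>"
          unfolding W_def v_def abs_mult[of "t powr (\<rho> / 2)"] by (intro mult_left_mono) auto
        then show "(t powr (\<rho> / 2) * W y t k)\<^sup>2 \<le> (t powr (\<rho> / 2) * v t k)\<^sup>2" by (simp add: abs_le_square_iff)
      qed simp
    qed auto
    have KB: "0 \<le> C1 * C2 * (A2 + B2 + E2)" using C1(1) C2 sum0 by auto
    have KB0: "0 \<le> C0 * C3 * (A2 + B2 + E2)" using C0(1) C3 sum0 by auto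
    have vm: "(\<lambda>t. v t k) \<in> borel_measurable (lebesgue_on {0<..<T})" for k unfolding v_def by (rule Llm)
    have Wm: "(\<lambda>t. W y t k) \<in> borel_measurable (lebesgue_on {0<..<T})" for y k
      unfolding W_def using Llm[of 3 k] by measurable
    have vL1: "v \<in> L1loc_time T lam (- s)" by (rule L1loc_timeI[OF lp vm \<rho>0 total3 KB])
    have WL1: "W y \<in> L1loc_time T lam (- s)" if "y > 0" for y by (rule L1loc_timeI[OF lp Wm \<rho>0 total3'[OF that] KB])
    have UL1: "(\<lambda>t. eig_coeffs \<Omega> \<phi> (\<lambda>x. U x y t)) \<in> L1loc_time T lam (- s)" if y: "y > 0" for y
    proof (rule L1loc_timeI[OF lp _ order_refl _ KB0])
      show "(\<lambda>t. eig_coeffs \<Omega> \<phi> (\<lambda>x. U x y t) k) \<in> borel_measurable (lebesgue_on {0<..<T})" for k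
      proof -
        have "(\<lambda>t. L 0 k t * \<psi> k y) \<in> borel_measurable (lebesgue_on {0<..<T})" using Llm[of 0 k] by measurable
        then show ?thesis by (subst measurable_lebesgue_cong[OF coef[OF _ _ y]]) auto
      qed
      have "(\<integral>\<^sup>+t. ennreal (lam k powr (- s) * (t powr (0 / 2) * eig_coeffs \<Omega> \<phi> (\<lambda>x. U x y t) k)\<^sup>2) \<partial>lebesgue_on {0<..<T}) \<le> ennreal (C0 * C3 * D k)" for k
      proof (rule order_trans[OF nn_integral_mono b0])
        fix t assume "t \<in> space (lebesgue_on {0<..<T})"
        then have "eig_coeffs \<Omega> \<phi> (\<lambda>x. U x y t) k = L 0 k t * \<psi> k y" by (intro coef y) auto
        moreover have "\<bar>L 0 k t * \<psi> k y\<bar> \<le> \<bar>L 0 k t\<bar>" using psi[OF y, of k] by (simp add: abs_mult mult_left_le)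
        ultimately have "\<bar>t powr (0 / 2) * eig_coeffs \<Omega> \<phi> (\<lambda>x. U x y t) k\<bar> \<le> \<bar>t powr (0 / 2) * L 0 k t\<bar>"
          unfolding abs_mult[of "t powr (0 / 2)"] by (intro mult_left_mono) auto
        then have "(t powr (0 / 2) * eig_coeffs \<Omega> \<phi> (\<lambda>x. U x y t) k)\<^sup>2 \<le> (t powr (0 / 2) * L 0 k t)\<^sup>2" by (simp only: abs_le_square_iff)
        then show "ennreal (lam k powr (- s) * (t powr (0 / 2) * eig_coeffs \<Omega> \<phi> (\<lambda>x. U x y t) k)\<^sup>2) \<le> ennreal (lam k powr (- s) * (t powr (0 / 2) * L 0 k t)\<^sup>2)"
          by (intro ennreal_leI mult_left_mono) auto
      qed
      then have "(\<Sum>k. \<integral>\<^sup>+t. ennreal (lam k powr (- s) * (t powr (0 / 2) * eig_coeffs \<Omega> \<phi> (\<lambda>x. U x y t) k)\<^sup>2) \<partial>lebesgue_on {0<..<T}) \<le> (\<Sum>k. ennreal (C0 * C3 * D k))"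
        by (intro suminf_le) auto
      also have "\<dots> \<le> ennreal (C0 * C3 * (A2 + B2 + E2))" using C0(1) C3 by (intro Dens) auto
      finally show "(\<Sum>k. \<integral>\<^sup>+t. ennreal (lam k powr (- s) * (t powr (0 / 2) * eig_coeffs \<Omega> \<phi> (\<lambda>x. U x y t) k)\<^sup>2) \<partial>lebesgue_on {0<..<T}) \<le> ennreal (C0 * C3 * (A2 + B2 + E2))" .
    qed
    have weak: "(\<integral>t. (deriv ^^ 3) \<eta> t * eig_coeffs \<Omega> \<phi> (\<lambda>x. U x y t) k \<partial>lebesgue_on {0<..<T})
          = (- 1) ^ 3 * (\<integral>t. \<eta> t * W y t k \<partial>lebesgue_on {0<..<T})" if \<eta>: "\<eta> \<in> test_functions {0<..<T}" and y: "y > 0" for \<eta> y k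
    proof -
      have d3: "(deriv ^^ 3) \<eta> \<in> test_functions {0<..<T}"
        using test_function_deriv(1)[OF test_function_deriv(1)[OF test_function_deriv(1)[OF \<eta> T] T] T] by (simp add: numeral_3_eq_3)
      have "(\<integral>t. (deriv ^^ 3) \<eta> t * eig_coeffs \<Omega> \<phi> (\<lambda>x. U x y t) k \<partial>lebesgue_on {0<..<T}) = (\<integral>t. (deriv ^^ 3) \<eta> t * (L 0 k t * \<psi> k y) \<partial>lborel)"
        by (rule test_integral_transfer[OF T d3]) (use coef[OF _ _ y, of _ k] in auto)
      also have "\<dots> = (\<integral>t. (deriv ^^ 3) \<eta> t * L 0 k t \<partial>lborel) * \<psi> k y" by (simp add: mult.assoc[symmetric])
      also have "(\<integral>t. (deriv ^^ 3) \<eta> t * L 0 k t \<partial>lborel) = - (\<integral>t. \<eta> t * L 3 k t \<partial>lborel)"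
        unfolding L_def by (rule mode_deriv_weak_derivative[OF g T \<mu>(3) P(2) P(3) \<eta>])
      also have "- (\<integral>t. \<eta> t * L 3 k t \<partial>lborel) * \<psi> k y = - (\<integral>t. \<eta> t * (L 3 k t * \<psi> k y) \<partial>lborel)" by (simp add: mult.assoc[symmetric])
      also have "(\<integral>t. \<eta> t * (L 3 k t * \<psi> k y) \<partial>lborel) = (\<integral>t. \<eta> t * W y t k \<partial>lebesgue_on {0<..<T})"
        by (rule test_integral_transfer[OF T \<eta>, symmetric]) (auto simp: W_def)
      finally show ?thesis by simp
    qed
    have psi0: "((\<lambda>y. \<psi> k y) \<longlongrightarrow> 1) (at_right 0)" for k
      using prof[of k] by (auto simp: extension_profile_def)
    have trace: "trace_of_time_derivative \<Omega> lam \<phi> T (- s) 3 U v"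
      unfolding trace_of_time_derivative_def
    proof (intro exI[of _ W] conjI allI impI)
      fix y :: real assume "y > 0"
      then show "has_time_derivative T lam (- s) 3 (\<lambda>t. eig_coeffs \<Omega> \<phi> (\<lambda>x. U x y t)) (W y)"
        unfolding has_time_derivative_def using UL1 WL1 weak by blast
    next
      have "AE t in lebesgue_on {0<..<T}. v t \<in> Hspace lam (- s)"
        using vL1 by (simp add: L1loc_time_def bochner_measurable_def)
      then show "AE t in lebesgue_on {0<..<T}. v t \<in> Hspace lam (- s) \<and>
           (\<forall>\<^sub>F y in at_right 0. W y t \<in> Hspace lam (- s)) \<and>
           ((\<lambda>y. Hnorm lam (- s) (\<lambda>k. W y t k - v t k)) \<longlongrightarrow> 0) (at_right 0)"
      proof eventually_elim
        case (elim t)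
        have "W y t \<in> Hspace lam (- s)" if "y > 0" for y
        proof (rule Hspace_dominated[OF elim])
          show "\<bar>W y t k\<bar> \<le> \<bar>v t k\<bar>" for k using psi[OF that, of k] by (simp add: W_def v_def abs_mult mult_left_le)
        qed
        then have ev: "\<forall>\<^sub>F y in at_right 0. W y t \<in> Hspace lam (- s)"
          by (auto simp: eventually_at_filter intro!: always_eventually)
        \<comment> \<open>Truncated for \<open>y \<le> 0\<close>, where the profile is not controlled.\<close>
        define x where "x = (\<lambda>y k. if y > 0 then W y t k - v t k else 0)"
        have "((\<lambda>y. Hnorm lam (- s) (x y)) \<longlongrightarrow> 0) (at_right 0)"
        proof (rule Hnorm_null[OF elim])
          fix y :: real and k
          have "\<bar>\<psi> k y - 1\<bar> \<le> 1" if "y > 0" using extension_profile_range[OF prof lp that, of k] by simp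
          moreover have "W y t k - v t k = v t k * (\<psi> k y - 1)" by (simp add: W_def v_def algebra_simps)
          ultimately show "\<bar>x y k\<bar> \<le> \<bar>v t k\<bar>" by (simp add: x_def abs_mult mult_left_le)
        next
          fix k
          have "((\<lambda>y. v t k * (\<psi> k y - 1)) \<longlongrightarrow> v t k * (1 - 1)) (at_right 0)" by (intro tendsto_intros psi0)
          then have "((\<lambda>y. v t k * (\<psi> k y - 1)) \<longlongrightarrow> 0) (at_right 0)" by simp
          then show "((\<lambda>y. x y k) \<longlongrightarrow> 0) (at_right 0)"
            by (rule Lim_transform_eventually) (auto simp: eventually_at_filter x_def W_def v_def algebra_simps intro!: always_eventually)
        qed simp
        then have "((\<lambda>y. Hnorm lam (- s) (\<lambda>k. W y t k - v t k)) \<longlongrightarrow> 0) (at_right 0)"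
          by (rule Lim_transform_eventually) (auto simp: eventually_at_filter x_def intro!: always_eventually)
        then show ?case using elim ev by blast
      qed
    qed
    have pm: "(\<lambda>t. t powr (\<rho> / 2)) \<in> borel_measurable (lebesgue_on {0<..<T})"
      by (intro measurable_restrict_space1 measurable_completion) measurable
    have wm: "(\<lambda>t. t powr (\<rho> / 2) * v t k) \<in> borel_measurable (lebesgue_on {0<..<T})" for k using pm vm[of k] by measurable
    note wL = L2_timeI[of lam "\<lambda>t k. t powr (\<rho> / 2) * v t k", OF lp wm total3 KB]
    let ?A = "Hnorm lam s a" let ?B = "L2_norm \<Omega> h" let ?E = "H2_time_norm T lam (- s) f f1 f2"
    have nnn: "?A \<ge> 0" "?B \<ge> 0" "?E \<ge> 0" using Hnorm_nonneg[OF aH] by (auto simp: L2_norm_def H2_time_norm_def)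
    have "(L2_time_norm T lam (- s) (\<lambda>t k. t powr (\<rho> / 2) * v t k))\<^sup>2 \<le> C1 * C2 * (A2 + B2 + E2)" by (rule wL(2))
    also have "\<dots> \<le> C1 * C2 * (?A + ?B + ?E)\<^sup>2"
    proof (rule mult_left_mono)
      have "(?A + ?B + ?E)\<^sup>2 = A2 + B2 + E2 + 2 * (?A * ?B + ?A * ?E + ?B * ?E)"
        by (simp add: A2_def B2_def E2_def power2_eq_square algebra_simps)
      then show "A2 + B2 + E2 \<le> (?A + ?B + ?E)\<^sup>2" using nnn by simp
    qed (use C1(1) C2 in auto)
    also have "\<dots> = (sqrt (C1 * C2) * (?A + ?B + ?E))\<^sup>2" using C1(1) C2 by (simp add: power_mult_distrib)
    finally have "L2_time_norm T lam (- s) (\<lambda>t k. t powr (\<rho> / 2) * v t k) \<le> sqrt (C1 * C2) * (?A + ?B + ?E)"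
      using nnn C1(1) C2 by (intro power2_le_imp_le[of "L2_time_norm T lam (- s) (\<lambda>t k. t powr (\<rho> / 2) * v t k)"]) auto
    then show "\<exists>v. trace_of_time_derivative \<Omega> lam \<phi> T (- s) 3 U v \<and>
          (\<lambda>t k. t powr (\<rho> / 2) * v t k) \<in> L2_time T lam (- s) \<and>
          L2_time_norm T lam (- s) (\<lambda>t k. t powr (\<rho> / 2) * v t k)
            \<le> sqrt (C1 * C2) * (Hnorm lam s (eig_coeffs \<Omega> \<phi> gg) + L2_norm \<Omega> h + H2_time_norm T lam (- s) f f1 f2)"
      using trace wL(1) unfolding a_def by blast
  qed
qed

theorem corollary4p3:
  fixes \<Omega> :: "(real^'n) set"
    and A :: "real^'n \<Rightarrow> real^'n^'n"
    and c :: "real^'n \<Rightarrow> real"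
    and lam :: "nat \<Rightarrow> real"
    and \<phi> :: "nat \<Rightarrow> real^'n \<Rightarrow> real"
    and \<psi> :: "nat \<Rightarrow> real \<Rightarrow> real"
    and s T :: real
  assumes "open \<Omega>" "bounded \<Omega>" "convex \<Omega>"
    and "admissible_coefficients \<Omega> A c"
    and "dirichlet_eigenbasis \<Omega> A c lam \<phi>"
    and "0 < s" "s < 1" "0 < T"
    and "\<And>k. extension_profile (1 - 2 * s) (lam k) (\<psi> k)"
  shows "\<exists>C :: real \<Rightarrow> real \<Rightarrow> real.
    (\<forall>\<rho>. filterlim (\<lambda>\<gamma>. C \<gamma> \<rho>) at_top (at_right 1)) \<and>
    (\<forall>\<gamma> \<rho> g h f f1 f2 U.
       1 < \<gamma> \<and> \<gamma> < 2 \<and> 5 - 2 * \<gamma> < \<rho> \<and>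
       g \<in> L2 \<Omega> \<and> eig_coeffs \<Omega> \<phi> g \<in> Hspace lam s \<and>
       h \<in> L2 \<Omega> \<and>
       H2_time T lam (- s) f f1 f2 \<and>
       extended_solution \<Omega> lam \<phi> \<psi> s T \<gamma> g h f U \<longrightarrow>
       (\<exists>v. trace_of_time_derivative \<Omega> lam \<phi> T (- s) 3 U v \<and>
          (\<lambda>t k. t powr (\<rho> / 2) * v t k) \<in> L2_time T lam (- s) \<and>
          L2_time_norm T lam (- s) (\<lambda>t k. t powr (\<rho> / 2) * v t k)
            \<le> C \<gamma> \<rho> * (Hnorm lam s (eig_coeffs \<Omega> \<phi> g) + L2_norm \<Omega> h
                        + H2_time_norm T lam (- s) f f1 f2)))"
proof -
  have basis: "L2_orthonormal_basis \<Omega> \<phi>" and pos: "\<And>k. 0 < lam k" and ep: "\<And>k. dirichlet_eigenpair \<Omega> A c (lam k) (\<phi> k)"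
    using assms(5) by (auto simp: dirichlet_eigenbasis_def)
  have "L2_inner \<Omega> (\<phi> k) (\<phi> k) = 1" for k using basis by (simp add: L2_orthonormal_basis_def)
  then obtain l0 where l0: "l0 > 0" "\<And>k. l0 \<le> lam k"
    using eigenvalue_lower_bound[OF assms(1,2,4)] pos ep by blast
  define Q where "Q = (\<lambda>\<gamma> \<rho> C. \<forall>g h f f1 f2 U. g \<in> L2 \<Omega> \<and> eig_coeffs \<Omega> \<phi> g \<in> Hspace lam s \<and> h \<in> L2 \<Omega> \<and>
       H2_time T lam (- s) f f1 f2 \<and> extended_solution \<Omega> lam \<phi> \<psi> s T \<gamma> g h f U \<longrightarrow>
       (\<exists>v. trace_of_time_derivative \<Omega> lam \<phi> T (- s) 3 U v \<and>
          (\<lambda>t k. t powr (\<rho> / 2) * v t k) \<in> L2_time T lam (- s) \<and>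
          L2_time_norm T lam (- s) (\<lambda>t k. t powr (\<rho> / 2) * v t k)
            \<le> C * (Hnorm lam s (eig_coeffs \<Omega> \<phi> g) + L2_norm \<Omega> h + H2_time_norm T lam (- s) f f1 f2)))"
  have "\<exists>C\<ge>0. Q \<gamma> \<rho> C" if "1 < \<gamma>" "\<gamma> < 2" "5 - 2 * \<gamma> < \<rho>" for \<gamma> \<rho>
    unfolding Q_def by (rule third_derivative_estimate[OF basis l0(2,1) assms(6,8,9) that])
  then have "\<forall>\<gamma> \<rho>. \<exists>C\<ge>0. 1 < \<gamma> \<and> \<gamma> < 2 \<and> 5 - 2 * \<gamma> < \<rho> \<longrightarrow> Q \<gamma> \<rho> C" by (metis order_refl)
  then obtain C where C: "\<And>\<gamma> \<rho>. C \<gamma> \<rho> \<ge> 0" "\<And>\<gamma> \<rho>. 1 < \<gamma> \<Longrightarrow> \<gamma> < 2 \<Longrightarrow> 5 - 2 * \<gamma> < \<rho> \<Longrightarrow> Q \<gamma> \<rho> (C \<gamma> \<rho>)" by metis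
  show ?thesis
  proof (intro exI[of _ "\<lambda>\<gamma> \<rho>. C \<gamma> \<rho> + 1 / (\<gamma> - 1)"] conjI allI impI)
    fix \<rho>
    \<comment> \<open>Enlarging an admissible constant keeps it admissible; the summand \<open>1 / (\<gamma> - 1)\<close> makes it blow up.\<close>
    have "filterlim (\<lambda>\<gamma>::real. 1 / (\<gamma> - 1)) at_top (at_right 1)" by real_asymp
    then show "filterlim (\<lambda>\<gamma>. C \<gamma> \<rho> + 1 / (\<gamma> - 1)) at_top (at_right 1)"
      by (rule filterlim_at_top_mono) (use C(1) in auto)
  next
    fix \<gamma> \<rho> g h f f1 f2 U
    assume a: "1 < \<gamma> \<and> \<gamma> < 2 \<and> 5 - 2 * \<gamma> < \<rho> \<and>
       g \<in> L2 \<Omega> \<and> eig_coeffs \<Omega> \<phi> g \<in> Hspace lam s \<and>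
       h \<in> L2 \<Omega> \<and>
       H2_time T lam (- s) f f1 f2 \<and>
       extended_solution \<Omega> lam \<phi> \<psi> s T \<gamma> g h f U"
    let ?S = "Hnorm lam s (eig_coeffs \<Omega> \<phi> g) + L2_norm \<Omega> h + H2_time_norm T lam (- s) f f1 f2"
    have "Q \<gamma> \<rho> (C \<gamma> \<rho>)" using C(2) a by blast
    then obtain v where v: "trace_of_time_derivative \<Omega> lam \<phi> T (- s) 3 U v"
       "(\<lambda>t k. t powr (\<rho> / 2) * v t k) \<in> L2_time T lam (- s)"
       "L2_time_norm T lam (- s) (\<lambda>t k. t powr (\<rho> / 2) * v t k) \<le> C \<gamma> \<rho> * ?S"
      using a unfolding Q_def by blast
    have "?S \<ge> 0" using a Hnorm_nonneg[of "eig_coeffs \<Omega> \<phi> g" lam s] by (auto simp: L2_norm_def H2_time_norm_def)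
    then have "C \<gamma> \<rho> * ?S \<le> (C \<gamma> \<rho> + 1 / (\<gamma> - 1)) * ?S" using a by (intro mult_right_mono) auto
    with v show "\<exists>v. trace_of_time_derivative \<Omega> lam \<phi> T (- s) 3 U v \<and>
          (\<lambda>t k. t powr (\<rho> / 2) * v t k) \<in> L2_time T lam (- s) \<and>
          L2_time_norm T lam (- s) (\<lambda>t k. t powr (\<rho> / 2) * v t k) \<le> (C \<gamma> \<rho> + 1 / (\<gamma> - 1)) * ?S"
      by (intro exI[of _ v]) auto
  qed
qed

end
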